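(* Let $0<b<1$ with $b^2\in\mathbb{R}\setminus\mathbb{Q}$ and $q=e^{\pi i b^2}$. Let the positive quantum group $GL_q^+(N,\mathbb{R})$ be represented through its Gauss–Lusztig decomposition by the $N^2$ variables $\{b_{m,n},U_k,a_{m,n}\}$, $1\le n\le m\le N-1$, $1\le k\le N$. (1) There is an embedding of $GL_q^+(N,\mathbb{R})$ into the algebra of $\lfloor N^2/2\rfloor$ $q$-tori generated by $\{u_i,v_i\}$ satisfying $u_iv_i=q^2v_iu_i$, which are realized by $$u_i=e^{2\pi b x_i},\qquad v_i=e^{2\pi b p_i}.$$ (2) The quantum cluster variables $x_{ij}$, defined by the quantum determinants of the initial minors, can be represented as products of the variables $\{b_{m,n},U_k,a_{m,n}\}$, and hence they quasi-commute with each other.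
   Context: **Gauss–Lusztig decomposition.** Write $E_{i,j}$ for matrix units and $I$ for the $N\times N$ identity. Put $U^+=A_1A_2\cdots A_{N-1}$ with $A_s=I+\sum_{m=s}^{N-1}a_{m,s}E_{m,m+1}$; $U^-=B_1B_2\cdots B_{N-1}$ with $B_s=I+\sum_{m=N-s}^{N-1}b_{m,\,m-(N-1)+s}E_{m+1,m}$; $T=T^-T^+=\mathrm{diag}(U_1,\dots,U_N)$ with $T^-=\mathrm{diag}(\mathsf u_1,\dots,\mathsf u_{N-1},1)$ and $T^+=\mathrm{diag}(1,\mathsf v_1,\dots,\mathsf v_{N-1})$, so $U_k=\mathsf u_k\mathsf v_{k-1}$ with $\mathsf v_0=\mathsf u_N=1$. The decomposition is $Z=(z_{ij})=U^-TU^+$, where $z_{ij}$ are the generators of the quantum group. The variables satisfy: $a_{m,n}\mathsf v_m=q^2\mathsf v_ma_{m,n}$ for all $n$; $a_{m,n}a_{m,n'}=q^2a_{m,n'}a_{m,n}$ for $n>n'$; $a_{m,n}a_{m-1,n'}=q^2a_{m-1,n'}a_{m,n}$ for $n\le n'$; all other pairs among $\{a_{m,n},\mathsf v_m\}$ commute. The variables $\{b_{m,n},\mathsf u_m^{-1}\}$ satisfy exactly the same relations as $\{a_{m,n},\mathsf v_m\}$, and $\{b_{m,n},\mathsf u_m\}$ commute with $\{a_{m,n},\mathsf v_m\}$. **$GL_q^+(N,\mathbb{R})$** is the algebra generated by positive self-adjoint operators $\{a_{m,n},\mathsf u_m,\mathsf v_m,b_{m,n}\}$ satisfying these relations, where for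 positive self-adjoint operators $xy=q^2yx$ means $x^{is}y^{it}=q^{-2st}y^{it}x^{is}$ for all $s,t\in\mathbb{R}$. **$q$-tori.** The algebra of one $q$-torus is $\mathbb{C}\langle u,v\rangle/(uv=q^2vu)$; the algebra of $r$ $q$-tori is the tensor product of $r$ copies (different pairs commute). Here $x_i$ is multiplication by the $i$-th coordinate and $p_i=\frac{1}{2\pi i}\frac{\partial}{\partial x_i}$, acting on $L^2(\mathbb{R}^{\lfloor N^2/2\rfloor})$. **Quantum cluster variables.** The quantum determinant of a $k\times k$ matrix $(w_{ij})$ is $\sum_{\sigma\in S_k}(-1)^\sigma w_{1,\sigma(1)}\cdots w_{k,\sigma(k)}$. The initial minors are the square submatrices of consecutive rows and columns of $Z$ that start from the top row or the leftmost column; $x_{ij}$ is the quantum determinant of the initial minor with lower right corner at the entry $(i,j)$. Two variables quasi-commute if they commute up to a power of $q^2$.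
   Formalization: Relations among the b's are taken with q^{-2} instead of q^2 (as printed, x_{32} for N=3 is not a product); for odd N the map is injective only modulo one relation equating a central quotient of two products to a scalar, since full injectivity is impossible there; N≥2 is assumed. *)

theory Defs
  imports "HOL-Analysis.Analysis" "HOL-Library.Poly_Mapping"
begin

section \<open>Algebras given by generators and relations\<close>

text \<open>
  The free algebra \<open>\<complex>\<langle>'g\<rangle>\<close> is the monoid algebra over \<open>complex\<close> of the free monoid on \<open>'g\<close>.
  The type class of the ring structure on \<open>\<Rightarrow>\<^sub>0\<close> wants the monoid written additively, so \<open>+\<close> on
  words is (non-commutative) concatenation.
\<close>

datatype 'g word = Word (letters: "'g list")

instantiation word :: (type) monoid_add
begin

definition "0 = Word []"

definition "v + w = Word (letters v @ letters w)"

instance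
  by standard (simp_all add: zero_word_def plus_word_def)

end

type_synonym 'g free_algebra = "'g word \<Rightarrow>\<^sub>0 complex"

definition gen :: "'g \<Rightarrow> 'g free_algebra" where
  "gen g = Poly_Mapping.single (Word [g]) 1"

definition const :: "complex \<Rightarrow> 'g free_algebra" where
  "const c = Poly_Mapping.single 0 c"

text \<open>The unital algebra homomorphism with prescribed values on the generators.\<close>

definition lift :: "('g \<Rightarrow> 'h free_algebra) \<Rightarrow> 'g free_algebra \<Rightarrow> 'h free_algebra" where
  "lift \<phi> x =
     (\<Sum>w\<in>Poly_Mapping.keys x. const (Poly_Mapping.lookup x w) * prod_list (map \<phi> (letters w)))"

inductive_set two_sided_ideal :: "'g free_algebra set \<Rightarrow> 'g free_algebra set"
  for S :: "'g free_algebra set" where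
  zero: "0 \<in> two_sided_ideal S"
| base: "x \<in> S \<Longrightarrow> x \<in> two_sided_ideal S"
| add: "x \<in> two_sided_ideal S \<Longrightarrow> y \<in> two_sided_ideal S \<Longrightarrow> x + y \<in> two_sided_ideal S"
| mult: "x \<in> two_sided_ideal S \<Longrightarrow> l * x * r \<in> two_sided_ideal S"

text \<open>Equality in the algebra presented by the relations \<open>l = r\<close> for \<open>(l, r) \<in> R\<close>.\<close>

definition alg_eq ::
  "('g free_algebra \<times> 'g free_algebra) set \<Rightarrow> 'g free_algebra \<Rightarrow> 'g free_algebra \<Rightarrow> bool" where
  "alg_eq R x y \<longleftrightarrow> x - y \<in> two_sided_ideal {l - r | l r. (l, r) \<in> R}"

inductive_set generated_subalgebra :: "'g free_algebra set \<Rightarrow> 'g free_algebra set"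
  for S :: "'g free_algebra set" where
  const: "const c \<in> generated_subalgebra S"
| base: "x \<in> S \<Longrightarrow> x \<in> generated_subalgebra S"
| add: "x \<in> generated_subalgebra S \<Longrightarrow> y \<in> generated_subalgebra S
    \<Longrightarrow> x + y \<in> generated_subalgebra S"
| mult: "x \<in> generated_subalgebra S \<Longrightarrow> y \<in> generated_subalgebra S
    \<Longrightarrow> x * y \<in> generated_subalgebra S"


section \<open>The Gauss--Lusztig variables and their relations\<close>

text \<open>\<open>Ga m n\<close>, \<open>Gb m n\<close>, \<open>Gu m\<close>, \<open>Gv m\<close> stand for \<open>a\<^bsub>m,n\<^esub>\<close>, \<open>b\<^bsub>m,n\<^esub>\<close>, \<open>\<u>\<^sub>m\<close>, \<open>\<v>\<^sub>m\<close>.\<close>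

datatype gl_gen = Ga nat nat | Gb nat nat | Gu nat | Gv nat

definition gl_gens :: "nat \<Rightarrow> gl_gen set" where
  "gl_gens N =
     {Ga m n | m n. 1 \<le> n \<and> n \<le> m \<and> m \<le> N - 1} \<union> {Gb m n | m n. 1 \<le> n \<and> n \<le> m \<and> m \<le> N - 1} \<union>
     {Gu m | m. 1 \<le> m \<and> m \<le> N - 1} \<union> {Gv m | m. 1 \<le> m \<and> m \<le> N - 1}"

text \<open>
  \<open>q2_rel x y\<close> says that \<open>x y = q\<^sup>2 y x\<close> is one of the defining relations; two generators related in
  neither direction commute.

  The relation \<open>b\<^bsub>m,n\<^esub> \<u>\<^sub>m\<inverse> = q\<^sup>2 \<u>\<^sub>m\<inverse> b\<^bsub>m,n\<^esub>\<close> is written as \<open>\<u>\<^sub>m b\<^bsub>m,n\<^esub> = q\<^sup>2 b\<^bsub>m,n\<^esub> \<u>\<^sub>m\<close>,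
  so no inverses are needed among the generators.

  The relations among the \<open>b\<^bsub>m,n\<^esub>\<close> are those among the \<open>a\<^bsub>m,n\<^esub>\<close> with \<open>q\<^sup>2\<close> replaced by \<open>q\<^sup>-\<^sup>2\<close>, so that
  \<open>b\<^bsub>m,n\<^esub>, \<u>\<^sub>m\<close> satisfy the \<open>q\<inverse>\<close>-version of the relations of \<open>a\<^bsub>m,n\<^esub>, \<v>\<^sub>m\<close>. Keeping \<open>q\<^sup>2\<close> among the
  \<open>b\<^bsub>m,n\<^esub>\<close> is inconsistent with \<open>Z = U\<^sup>- T U\<^sup>+\<close> below as soon as \<open>N \<ge> 3\<close>: entries in one row of \<open>Z\<close>
  would no longer commute, and for \<open>N = 3\<close> the initial minor with lower right corner \<open>(3, 2)\<close> would be
  \<open>(b\<^sub>1\<^sub>1 b\<^sub>2\<^sub>2 + (1 - q\<^sup>4) b\<^sub>1\<^sub>1 b\<^sub>2\<^sub>1) U\<^sub>1 U\<^sub>2\<close>, not a product of the variables.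
\<close>

fun q2_rel :: "gl_gen \<Rightarrow> gl_gen \<Rightarrow> bool" where
  "q2_rel (Ga m n) (Gv k) \<longleftrightarrow> k = m"
| "q2_rel (Ga m n) (Ga k n') \<longleftrightarrow> k = m \<and> n > n' \<or> m = k + 1 \<and> n \<le> n'"
| "q2_rel (Gu k) (Gb m n) \<longleftrightarrow> k = m"
| "q2_rel (Gb k n') (Gb m n) \<longleftrightarrow> k = m \<and> n > n' \<or> m = k + 1 \<and> n \<le> n'"
| "q2_rel _ _ \<longleftrightarrow> False"

definition gl_rels :: "complex \<Rightarrow> nat \<Rightarrow> (gl_gen free_algebra \<times> gl_gen free_algebra) set" where
  "gl_rels q N =
     {(gen x * gen y, const (q\<^sup>2) * gen y * gen x) | x y.
        x \<in> gl_gens N \<and> y \<in> gl_gens N \<and> q2_rel x y} \<union>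
     {(gen x * gen y, gen y * gen x) | x y.
        x \<in> gl_gens N \<and> y \<in> gl_gens N \<and> \<not> q2_rel x y \<and> \<not> q2_rel y x}"

definition u_var :: "nat \<Rightarrow> nat \<Rightarrow> gl_gen free_algebra" where
  "u_var N k = (if k = N then 1 else gen (Gu k))"

definition v_var :: "nat \<Rightarrow> gl_gen free_algebra" where
  "v_var k = (if k = 0 then 1 else gen (Gv k))"

definition U_var :: "nat \<Rightarrow> nat \<Rightarrow> gl_gen free_algebra" where
  "U_var N k = u_var N k * v_var (k - 1)"

text \<open>The \<open>N\<^sup>2\<close> variables \<open>b\<^bsub>m,n\<^esub>\<close>, \<open>U\<^sub>k\<close>, \<open>a\<^bsub>m,n\<^esub>\<close>.\<close>

definition gauss_vars :: "nat \<Rightarrow> gl_gen free_algebra set" where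
  "gauss_vars N =
     {gen (Gb m n) | m n. 1 \<le> n \<and> n \<le> m \<and> m \<le> N - 1} \<union> {U_var N k | k. 1 \<le> k \<and> k \<le> N} \<union>
     {gen (Ga m n) | m n. 1 \<le> n \<and> n \<le> m \<and> m \<le> N - 1}"


section \<open>The decomposition \<open>Z = U\<^sup>- T U\<^sup>+\<close> and the quantum cluster variables\<close>

text \<open>\<open>N \<times> N\<close> matrices are functions of row and column indices in \<open>{1..N}\<close>.\<close>

type_synonym 'a matrix = "nat \<Rightarrow> nat \<Rightarrow> 'a"

definition mat_mult :: "nat \<Rightarrow> 'a::semiring_1 matrix \<Rightarrow> 'a matrix \<Rightarrow> 'a matrix" where
  "mat_mult N X Y = (\<lambda>i j. \<Sum>k=1..N. X i k * Y k j)"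

definition mat_one :: "'a::semiring_1 matrix" where
  "mat_one = (\<lambda>i j. if i = j then 1 else 0)"

definition mat_unit :: "nat \<Rightarrow> nat \<Rightarrow> 'a::semiring_1 matrix" where
  "mat_unit m n = (\<lambda>i j. if i = m \<and> j = n then 1 else 0)"

definition mat_prod :: "nat \<Rightarrow> 'a::semiring_1 matrix list \<Rightarrow> 'a matrix" where
  "mat_prod N Xs = foldr (mat_mult N) Xs mat_one"

definition A_mat :: "nat \<Rightarrow> nat \<Rightarrow> gl_gen free_algebra matrix" where
  "A_mat N s = (\<lambda>i j. mat_one i j + (\<Sum>m=s..N - 1. gen (Ga m s) * mat_unit m (m + 1) i j))"

definition B_mat :: "nat \<Rightarrow> nat \<Rightarrow> gl_gen free_algebra matrix" where
  "B_mat N s =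
     (\<lambda>i j. mat_one i j + (\<Sum>m=N - s..N - 1. gen (Gb m (m + s - (N - 1))) * mat_unit (m + 1) m i j))"

definition T_minus :: "nat \<Rightarrow> gl_gen free_algebra matrix" where
  "T_minus N = (\<lambda>i j. if i = j then u_var N i else 0)"

definition T_plus :: "gl_gen free_algebra matrix" where
  "T_plus = (\<lambda>i j. if i = j then v_var (i - 1) else 0)"

definition Z_mat :: "nat \<Rightarrow> gl_gen free_algebra matrix" where
  "Z_mat N =
     mat_prod N (map (B_mat N) [1..<N] @ [T_minus N, T_plus] @ map (A_mat N) [1..<N])"

definition quantum_det :: "nat \<Rightarrow> 'a::ring_1 matrix \<Rightarrow> 'a" where
  "quantum_det k w =
     (\<Sum>\<sigma> | \<sigma> permutes {1..k}. of_int (sign \<sigma>) * prod_list (map (\<lambda>r. w r (\<sigma> r)) [1..<k + 1]))"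

definition cluster_var :: "nat \<Rightarrow> nat \<Rightarrow> nat \<Rightarrow> gl_gen free_algebra" where
  "cluster_var N i j =
     (let k = min i j in quantum_det k (\<lambda>r s. Z_mat N (i - k + r) (j - k + s)))"


section \<open>The algebra of \<open>q\<close>-tori\<close>

text \<open>One pair of generators \<open>u\<^sub>i = Tu i\<close>, \<open>v\<^sub>i = Tv i\<close> for each \<open>i :: 'n\<close>.\<close>

datatype 'n torus_gen = Tu 'n | Tv 'n

definition torus_rels :: "complex \<Rightarrow> ('n torus_gen free_algebra \<times> 'n torus_gen free_algebra) set" where
  "torus_rels q =
     {(gen (Tu i) * gen (Tv i), const (q\<^sup>2) * gen (Tv i) * gen (Tu i)) | i. True} \<union>
     {(gen x * gen y, gen y * gen x) | x y i j. i \<noteq> j \<and> x \<in> {Tu i, Tv i} \<and> y \<in> {Tu j, Tv j}}"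


section \<open>Unbounded operators on \<open>L\<^sup>2\<close>\<close>

text \<open>
  Elements of \<open>L\<^sup>2\<close> are represented by Borel functions, so equality of vectors is equality almost
  everywhere. An unbounded operator is given by its graph, a set of pairs of such functions that is
  closed under a.e. equality.
\<close>

definition L2 :: "('a::euclidean_space \<Rightarrow> complex) set" where
  "L2 = {f \<in> borel_measurable lborel. integrable lborel (\<lambda>x. (cmod (f x))\<^sup>2)}"

definition ae_eq :: "('a::euclidean_space \<Rightarrow> complex) \<Rightarrow> ('a \<Rightarrow> complex) \<Rightarrow> bool" where
  "ae_eq f g \<longleftrightarrow> (AE x in lborel. f x = g x)"

definition l2_inner :: "('a::euclidean_space \<Rightarrow> complex) \<Rightarrow> ('a \<Rightarrow> complex) \<Rightarrow> complex" where
  "l2_inner f g = (LINT x|lborel. cnj (f x) * g x)"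

definition l2_dist :: "('a::euclidean_space \<Rightarrow> complex) \<Rightarrow> ('a \<Rightarrow> complex) \<Rightarrow> real" where
  "l2_dist f g = sqrt (LINT x|lborel. (cmod (f x - g x))\<^sup>2)"

type_synonym 'a operator = "(('a \<Rightarrow> complex) \<times> ('a \<Rightarrow> complex)) set"

definition densely_defined :: "'a::euclidean_space operator \<Rightarrow> bool" where
  "densely_defined X \<longleftrightarrow> (\<forall>f\<in>L2. \<forall>\<epsilon>>0. \<exists>(h, k)\<in>X. l2_dist h f < \<epsilon>)"

definition adjoint_op :: "'a::euclidean_space operator \<Rightarrow> 'a operator" where
  "adjoint_op X = {(f, g). f \<in> L2 \<and> g \<in> L2 \<and> (\<forall>(h, k)\<in>X. l2_inner f k = l2_inner g h)}"

definition closure_op :: "'a::euclidean_space operator \<Rightarrow> 'a operator" where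
  "closure_op X =
     {(f, g). f \<in> L2 \<and> g \<in> L2 \<and> (\<forall>\<epsilon>>0. \<exists>(h, k)\<in>X. l2_dist h f < \<epsilon> \<and> l2_dist k g < \<epsilon>)}"

text \<open>Positive means \<open>X \<ge> 0\<close> with trivial kernel, so that the powers \<open>X\<^sup>i\<^sup>s\<close> are unitary.\<close>

definition positive_selfadjoint :: "'a::euclidean_space operator \<Rightarrow> bool" where
  "positive_selfadjoint X \<longleftrightarrow>
     densely_defined X \<and> adjoint_op X = X \<and>
     (\<forall>(f, g)\<in>X. l2_inner f g \<in> \<real> \<and> 0 \<le> Re (l2_inner f g) \<and>
        (ae_eq g (\<lambda>_. 0) \<longrightarrow> ae_eq f (\<lambda>_. 0)))"

text \<open>Linearity and compatibility with \<open>ae_eq\<close> follow from the preservation of inner products.\<close>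

definition unitary_group :: "(real \<Rightarrow> ('a::euclidean_space \<Rightarrow> complex) \<Rightarrow> ('a \<Rightarrow> complex)) \<Rightarrow> bool" where
  "unitary_group W \<longleftrightarrow>
     (\<forall>s. \<forall>f\<in>L2. W s f \<in> L2) \<and>
     (\<forall>s. \<forall>f\<in>L2. \<forall>g\<in>L2. l2_inner (W s f) (W s g) = l2_inner f g) \<and>
     (\<forall>f\<in>L2. ae_eq (W 0 f) f) \<and>
     (\<forall>s t. \<forall>f\<in>L2. ae_eq (W (s + t) f) (W s (W t f))) \<and>
     (\<forall>f\<in>L2. ((\<lambda>s. l2_dist (W s f) f) \<longlongrightarrow> 0) (at 0))"

text \<open>
  If \<open>W s = e\<^bsup>isA\<^esup>\<close> with \<open>A\<close> self-adjoint, then \<open>analytic_generator W = W (-i)\<close> is the operator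
  \<open>e\<^sup>A\<close>: \<open>f\<close> is in its domain iff \<open>s \<mapsto> W s f\<close> continues (here: weakly) to the strip
  \<open>-1 \<le> Im z \<le> 0\<close>, and \<open>e\<^sup>A f\<close> is the value at \<open>-i\<close>.
\<close>

definition analytic_generator ::
  "(real \<Rightarrow> ('a::euclidean_space \<Rightarrow> complex) \<Rightarrow> ('a \<Rightarrow> complex)) \<Rightarrow> 'a operator" where
  "analytic_generator W =
     {(f, g). f \<in> L2 \<and> g \<in> L2 \<and>
        (\<forall>h\<in>L2. \<exists>F. continuous_on {z. -1 \<le> Im z \<and> Im z \<le> 0} F \<and>
           F holomorphic_on {z. -1 < Im z \<and> Im z < 0} \<and>
           bounded (F ` {z. -1 \<le> Im z \<and> Im z \<le> 0}) \<and>
           (\<forall>s. F (complex_of_real s) = l2_inner h (W s f)) \<and> F (- \<i>) = l2_inner h g)}"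

text \<open>
  By Stone's theorem a positive self-adjoint \<open>X = e\<^bsup>log X\<^esup>\<close> has exactly one such group \<open>W\<close>, namely
  \<open>W s = e\<^bsup>is log X\<^esup> = X\<^sup>i\<^sup>s\<close>.
\<close>

definition imaginary_powers ::
  "'a::euclidean_space operator \<Rightarrow> (real \<Rightarrow> ('a \<Rightarrow> complex) \<Rightarrow> ('a \<Rightarrow> complex)) \<Rightarrow> bool" where
  "imaginary_powers X W \<longleftrightarrow> unitary_group W \<and> analytic_generator W = X"

text \<open>
  The relation \<open>X Y = q\<^sup>k Y X\<close> for positive self-adjoint operators:
  \<open>X\<^sup>i\<^sup>s Y\<^sup>i\<^sup>t = q\<^bsup>-kst\<^esup> Y\<^sup>i\<^sup>t X\<^sup>i\<^sup>s\<close> for all real \<open>s\<close>, \<open>t\<close>. In this form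
  \<open>Y X\<inverse> = q\<^sup>k X\<inverse> Y\<close> and \<open>X Y = q\<^sup>k Y X\<close> are the same condition.
\<close>

definition q_exchange :: "complex \<Rightarrow> real \<Rightarrow> 'a::euclidean_space operator \<Rightarrow> 'a operator \<Rightarrow> bool" where
  "q_exchange q k X Y \<longleftrightarrow>
     (\<exists>V W. imaginary_powers X V \<and> imaginary_powers Y W \<and>
        (\<forall>s t. \<forall>f\<in>L2.
           ae_eq (V s (W t f)) (\<lambda>x. q powr complex_of_real (- (k * s * t)) * W t (V s f) x)))"


section \<open>The operators \<open>u\<^sub>i = e\<^bsup>2 \<pi> b x\<^sub>i\<^esup>\<close> and \<open>v\<^sub>i = e\<^bsup>2 \<pi> b p\<^sub>i\<^esup>\<close>\<close>

definition exp_position :: "real \<Rightarrow> 'n::finite \<Rightarrow> (real ^ 'n) operator" where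
  "exp_position b i =
     {(f, g). f \<in> L2 \<and> g \<in> L2 \<and> ae_eq g (\<lambda>x. complex_of_real (exp (2 * pi * b * x $ i)) * f x)}"

text \<open>
  As \<open>p\<^sub>i = (1 / 2 \<pi> i) \<partial>/\<partial>x\<^sub>i\<close>, the group \<open>e\<^bsup>is (2 \<pi> b p\<^sub>i)\<^esup> = e\<^bsup>b s \<partial>/\<partial>x\<^sub>i\<^esup>\<close> is translation by \<open>b s\<close>
  in the \<open>i\<close>-th coordinate.
\<close>

definition exp_momentum :: "real \<Rightarrow> 'n::finite \<Rightarrow> (real ^ 'n) operator" where
  "exp_momentum b i = analytic_generator (\<lambda>s f x. f (x + axis i (b * s)))"

fun torus_op :: "real \<Rightarrow> 'n::finite torus_gen \<Rightarrow> (real ^ 'n) operator" where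
  "torus_op b (Tu i) = exp_position b i"
| "torus_op b (Tv i) = exp_momentum b i"

text \<open>
  A word acts by composition of unbounded operators on the natural domain, the rightmost letter
  first; relation composition \<open>O\<close> applies its left argument first.
\<close>

fun word_op :: "real \<Rightarrow> 'n::finite torus_gen list \<Rightarrow> (real ^ 'n) operator" where
  "word_op b [] = {(f, g). f \<in> L2 \<and> g \<in> L2 \<and> ae_eq g f}"
| "word_op b (x # xs) = word_op b xs O torus_op b x"

definition poly_op :: "real \<Rightarrow> 'n::finite torus_gen free_algebra \<Rightarrow> (real ^ 'n) operator" where
  "poly_op b p =
     {(f, g). f \<in> L2 \<and> g \<in> L2 \<and>
        (\<exists>h. (\<forall>w\<in>Poly_Mapping.keys p. (f, h w) \<in> word_op b (letters w)) \<and>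
           ae_eq g (\<lambda>x. \<Sum>w\<in>Poly_Mapping.keys p. Poly_Mapping.lookup p w * h w x))}"

definition realized :: "real \<Rightarrow> 'n::finite torus_gen free_algebra \<Rightarrow> (real ^ 'n) operator" where
  "realized b p = closure_op (poly_op b p)"

end

theory Submission
  imports Defs "HOL-Complex_Analysis.Complex_Analysis" "HOL-Combinatorics.Permutations"
begin

text \<open>
  The relations say that any two generators exchange up to a power of \<open>q\<close>, and the exponents define a
  skew-symmetric integral form on the free abelian group on the generators. Everything in the first
  part rests on this form. It splits into \<open>\<lfloor>N\<^sup>2/2\<rfloor>\<close> hyperbolic planes with nonnegative integral
  coordinates (\<open>symplectic_coordinates\<close>), and a generator with coordinates \<open>(p, q)\<close> is sent to the
  Weyl ordered monomial in \<open>u\<^sub>i\<close>, \<open>v\<^sub>i\<close> with these exponents. Monomials with different exponents are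
  independent in the algebra of the tori; so the kernel on the algebra of the Gauss variables is
  governed by the vectors of the lattice of Gauss monomials on which all coordinates vanish. Those are
  the vectors in the radical of the form, which is trivial for even \<open>N\<close> (\<open>radical_even\<close>) and of rank
  one for odd \<open>N\<close> (\<open>radical_odd\<close>). The generator of the radical is what the additional relation between
  \<open>ms\<close> and \<open>ns\<close> divides out.

  On the analytic side, a Weyl ordered monomial is realized by \<open>e\<^sup>A\<close> with \<open>A\<close> a linear combination of the
  \<open>2 \<pi> b x\<^sub>i\<close> and \<open>2 \<pi> b p\<^sub>i\<close>. The unitary group \<open>e\<^bsup>isA\<^esup>\<close> is an explicit translation times a phase, and \<open>e\<^sup>A\<close> is
  its analytic generator. Gaussians are entire vectors for these groups, their span is dense and
  invariant, and this makes the span a core (\<open>AG_eq_adjoint_core\<close>, \<open>AG_eq_closure_core\<close>): a three lines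
  argument shows that the adjoint of the restriction is already the analytic generator, and there is no
  room left for a larger graph. Self-adjointness and positivity follow. The core also identifies the
  closure of a word in the \<open>u\<^sub>i\<close>, \<open>v\<^sub>i\<close> with the exponential of the sum (\<open>realized_word\<close>), and the relation
  between the imaginary powers is the canonical commutation relation in Weyl form
  (\<open>q_exchange_weyl_op\<close>).

  For the cluster variables, entries in one row of \<open>Z\<close> commute. Hence a minor does not change if a row
  is altered by a multiple, from the left and with uniform exchange behaviour, of the row above
  (\<open>quantum_det_peel\<close>). This removes the factors \<open>B\<^sub>s\<close> that do not move the top row of the minor. What is
  left is triangular for a minor at the left edge (\<open>det_lower\<close>), while for a minor at the top edge the
  factors \<open>A\<^sub>s\<close> are removed in the same way (\<open>det_upper\<close>). The determinant becomes the product of the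
  diagonal, which consists of Gauss variables; and products of generators quasi-commute.
\<close>

lemma L2_measurable: "f \<in> L2 \<Longrightarrow> f \<in> borel_measurable borel"
  by (simp add: L2_def)

lemma L2_square_integrable: "f \<in> L2 \<Longrightarrow> integrable lborel (\<lambda>x. (cmod (f x))\<^sup>2)"
  by (simp add: L2_def)

lemma L2_mult_integrable:
  assumes "f \<in> L2" "g \<in> L2"
  shows "integrable lborel (\<lambda>x. f x * g x)"
proof (rule Bochner_Integration.integrable_bound)
  show "integrable lborel (\<lambda>x. (cmod (f x))\<^sup>2 + (cmod (g x))\<^sup>2)"
    using assms by (intro Bochner_Integration.integrable_add) (auto simp: L2_def)
  show "(\<lambda>x. f x * g x) \<in> borel_measurable lborel"
    using assms by (auto simp: L2_def)
  have "cmod (f x * g x) \<le> norm ((cmod (f x))\<^sup>2 + (cmod (g x))\<^sup>2)" for x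
  proof -
    have "cmod (f x) * cmod (g x) \<le> 2 * cmod (f x) * cmod (g x)" by simp
    also have "\<dots> \<le> (cmod (f x))\<^sup>2 + (cmod (g x))\<^sup>2" by (rule sum_squares_bound)
    finally show ?thesis by (simp add: norm_mult)
  qed
  then show "AE x in lborel. norm (f x * g x) \<le> norm ((cmod (f x))\<^sup>2 + (cmod (g x))\<^sup>2)"
    by simp
qed

lemma cnj_measurable [measurable]: "cnj \<in> borel_measurable borel"
  by (intro borel_measurable_continuous_onI continuous_intros)

lemma cnj_L2: "f \<in> L2 \<Longrightarrow> (\<lambda>x. cnj (f x)) \<in> L2"
  by (auto simp: L2_def intro: measurable_compose[OF _ cnj_measurable])

lemma L2_inner_integrable:
  "f \<in> L2 \<Longrightarrow> g \<in> L2 \<Longrightarrow> integrable lborel (\<lambda>x. cnj (f x) * g x)"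
  by (intro L2_mult_integrable cnj_L2)

lemma L2_bound:
  assumes "g \<in> L2" "f \<in> borel_measurable borel" "\<And>x. cmod (f x) \<le> cmod (g x)"
  shows "f \<in> L2"
proof -
  have "integrable lborel (\<lambda>x. (cmod (f x))\<^sup>2)"
    by (rule Bochner_Integration.integrable_bound[OF L2_square_integrable[OF assms(1)]])
       (use assms in \<open>auto intro!: power_mono\<close>)
  with assms show ?thesis by (simp add: L2_def)
qed

lemma L2_cmult: "f \<in> L2 \<Longrightarrow> (\<lambda>x. c * f x) \<in> L2"
  by (auto simp: L2_def norm_mult power_mult_distrib)

lemma L2_add:
  assumes "f \<in> L2" "g \<in> L2"
  shows "(\<lambda>x. f x + g x) \<in> L2"
proof -
  have "integrable lborel (\<lambda>x. (cmod (f x + g x))\<^sup>2)"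
  proof (rule Bochner_Integration.integrable_bound)
    show "integrable lborel (\<lambda>x. 2 * (cmod (f x))\<^sup>2 + 2 * (cmod (g x))\<^sup>2)"
      using assms by (auto simp: L2_def)
    show "(\<lambda>x. (cmod (f x + g x))\<^sup>2) \<in> borel_measurable lborel"
      using assms by (auto simp: L2_def)
    have "(cmod (f x + g x))\<^sup>2 \<le> 2 * (cmod (f x))\<^sup>2 + 2 * (cmod (g x))\<^sup>2" for x
    proof -
      have "(cmod (f x + g x))\<^sup>2 \<le> (cmod (f x) + cmod (g x))\<^sup>2"
        by (intro power_mono norm_triangle_ineq) auto
      also have "\<dots> \<le> 2 * (cmod (f x))\<^sup>2 + 2 * (cmod (g x))\<^sup>2"
        using sum_squares_bound[of "cmod (f x)" "cmod (g x)"] by (simp add: power2_sum)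
      finally show ?thesis .
    qed
    then show "AE x in lborel. norm ((cmod (f x + g x))\<^sup>2) \<le> norm (2 * (cmod (f x))\<^sup>2 + 2 * (cmod (g x))\<^sup>2)"
      by (simp add: )
  qed
  with assms show ?thesis by (auto simp: L2_def intro: borel_measurable_add)
qed

lemma L2_zero: "(\<lambda>x. 0) \<in> L2" by (simp add: L2_def)

lemma L2_diff: "f \<in> L2 \<Longrightarrow> g \<in> L2 \<Longrightarrow> (\<lambda>x. f x - g x) \<in> L2"
  using L2_add[of f "\<lambda>x. (-1) * g x"] L2_cmult[of g "-1"] by simp

lemma ae_eq_refl: "ae_eq f f" by (simp add: ae_eq_def)
lemma ae_eq_sym: "ae_eq f g \<Longrightarrow> ae_eq g f" by (auto simp: ae_eq_def)
lemma ae_eq_trans: "ae_eq f g \<Longrightarrow> ae_eq g h \<Longrightarrow> ae_eq f h"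
  by (auto simp: ae_eq_def elim: AE_mp)

lemma l2_inner_cong:
  assumes "ae_eq f f'" "ae_eq g g'" "f \<in> L2" "g \<in> L2" "f' \<in> L2" "g' \<in> L2"
  shows "l2_inner f g = l2_inner f' g'"
  unfolding l2_inner_def
proof (rule integral_cong_AE)
  show "AE x in lborel. cnj (f x) * g x = cnj (f' x) * g' x"
    using assms(1,2) unfolding ae_eq_def by eventually_elim simp
qed (use assms in \<open>auto simp: L2_def intro!: borel_measurable_times measurable_compose[OF _ cnj_measurable]\<close>)

section \<open>The Hilbert space\<close>

quotient_type (overloaded) 'a l2 = "'a::euclidean_space \<Rightarrow> complex" / partial:
  "\<lambda>f g. f \<in> L2 \<and> g \<in> L2 \<and> ae_eq f g"
proof (rule part_equivpI)
  show "\<exists>x. x \<in> L2 \<and> x \<in> L2 \<and> ae_eq x x" using L2_zero ae_eq_refl by blast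
  show "symp (\<lambda>f g :: 'a \<Rightarrow> complex. f \<in> L2 \<and> g \<in> L2 \<and> ae_eq f g)"
    by (rule sympI) (simp add: ae_eq_sym)
  show "transp (\<lambda>f g :: 'a \<Rightarrow> complex. f \<in> L2 \<and> g \<in> L2 \<and> ae_eq f g)"
    by (rule transpI) (use ae_eq_trans in blast)
qed

instantiation l2 :: (euclidean_space) ab_group_add
begin
lift_definition zero_l2 :: "'a l2" is "\<lambda>x. 0" by (simp add: L2_zero ae_eq_refl)
lift_definition plus_l2 :: "'a l2 \<Rightarrow> 'a l2 \<Rightarrow> 'a l2" is "\<lambda>f g x. f x + g x"
  by (auto intro: L2_add simp: ae_eq_def)
lift_definition uminus_l2 :: "'a l2 \<Rightarrow> 'a l2" is "\<lambda>f x. - f x"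
  using L2_cmult[of _ "-1"] by (auto simp: ae_eq_def)
lift_definition minus_l2 :: "'a l2 \<Rightarrow> 'a l2 \<Rightarrow> 'a l2" is "\<lambda>f g x. f x - g x"
  by (auto intro: L2_diff simp: ae_eq_def)
instance
  by standard (transfer; (auto simp: ae_eq_def algebra_simps intro: L2_add L2_diff L2_cmult[of _ "-1", simplified] L2_zero; fail))+
end

lift_definition cscale :: "complex \<Rightarrow> 'a::euclidean_space l2 \<Rightarrow> 'a l2" (infixr "*\<^sub>C" 75) is "\<lambda>c f x. c * f x"
  by (auto intro: L2_cmult simp: ae_eq_def)

lift_definition cinner :: "'a::euclidean_space l2 \<Rightarrow> 'a l2 \<Rightarrow> complex" is l2_inner
  by (blast intro: l2_inner_cong)

lemma l2_inner_add: "f \<in> L2 \<Longrightarrow> g \<in> L2 \<Longrightarrow> h \<in> L2 \<Longrightarrow> l2_inner h (\<lambda>x. f x + g x) = l2_inner h f + l2_inner h g"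
  unfolding l2_inner_def by (subst Bochner_Integration.integral_add[symmetric])
    (auto intro: L2_inner_integrable simp: distrib_left)

lemma l2_inner_cnj: "l2_inner f g = cnj (l2_inner g f)"
  unfolding l2_inner_def by (subst Bochner_Integration.integral_cnj[symmetric]) (simp add: mult.commute)

lemma l2_inner_scale: "l2_inner h (\<lambda>x. c * f x) = c * l2_inner h f"
  unfolding l2_inner_def by (simp add: mult.left_commute)

lemma l2_inner_self: "l2_inner f f = complex_of_real (LINT x|lborel. (cmod (f x))\<^sup>2)"
  unfolding l2_inner_def
  by (subst integral_complex_of_real[symmetric], intro Bochner_Integration.integral_cong)
     (simp_all add: complex_norm_square mult.commute del: of_real_power)

lemma l2_inner_self_eq_0:
  assumes "f \<in> L2" shows "l2_inner f f = 0 \<longleftrightarrow> ae_eq f (\<lambda>x. 0)"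
proof -
  have "(LINT x|lborel. (cmod (f x))\<^sup>2) = 0 \<longleftrightarrow> (AE x in lborel. (cmod (f x))\<^sup>2 = 0)"
    by (rule integral_nonneg_eq_0_iff_AE) (use assms in \<open>auto simp: L2_def\<close>)
  then show ?thesis by (simp add: l2_inner_self ae_eq_def)
qed

lemma cinner_add_right: "cinner h (f + g) = cinner h f + cinner h g"
  by transfer (simp add: l2_inner_add)
lemma cinner_commute: "cinner f g = cnj (cinner g f)"
  by transfer (rule l2_inner_cnj)
lemma cinner_scale_right: "cinner h (c *\<^sub>C f) = c * cinner h f"
  by transfer (simp add: l2_inner_scale)
lemma cinner_add_left: "cinner (f + g) h = cinner f h + cinner g h"
  using cinner_commute cinner_add_right by (metis complex_cnj_add)
lemma cinner_scale_left: "cinner (c *\<^sub>C f) h = cnj c * cinner f h"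
  using cinner_commute cinner_scale_right by (metis complex_cnj_mult)

lemma cscale_add_right: "c *\<^sub>C (f + g) = c *\<^sub>C f + c *\<^sub>C g"
  by transfer (auto intro!: L2_add L2_cmult ae_eq_refl simp: distrib_left)
lemma cscale_add_left: "(c + d) *\<^sub>C f = c *\<^sub>C f + d *\<^sub>C f"
  by transfer (auto intro!: L2_add L2_cmult ae_eq_refl simp: distrib_right)
lemma cscale_cscale: "c *\<^sub>C d *\<^sub>C f = (c * d) *\<^sub>C f"
  by transfer (auto intro!: L2_cmult ae_eq_refl simp: mult.assoc)
lemma cscale_one: "1 *\<^sub>C f = f"
  by transfer (auto intro!: L2_cmult ae_eq_refl)
lemma cscale_zero: "0 *\<^sub>C f = 0"
  by transfer (auto simp: ae_eq_refl L2_zero)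
instantiation l2 :: (euclidean_space) real_vector
begin
definition scaleR_l2 :: "real \<Rightarrow> 'a l2 \<Rightarrow> 'a l2" where "scaleR_l2 r f = complex_of_real r *\<^sub>C f"
instance
  by standard (simp_all add: scaleR_l2_def cscale_add_right cscale_add_left cscale_cscale cscale_one)
end

instantiation l2 :: (euclidean_space) real_inner
begin
definition inner_l2 :: "'a l2 \<Rightarrow> 'a l2 \<Rightarrow> real" where "inner_l2 f g = Re (cinner f g)"
definition norm_l2 :: "'a l2 \<Rightarrow> real" where "norm_l2 f = sqrt (inner f f)"
definition sgn_l2 :: "'a l2 \<Rightarrow> 'a l2" where "sgn_l2 f = f /\<^sub>R norm f"
definition dist_l2 :: "'a l2 \<Rightarrow> 'a l2 \<Rightarrow> real" where "dist_l2 f g = norm (f - g)"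
definition uniformity_l2 :: "('a l2 \<times> 'a l2) filter" where
  "uniformity_l2 = (INF e\<in>{0<..}. principal {(x, y). dist x y < e})"
definition open_l2 :: "'a l2 set \<Rightarrow> bool" where
  "open_l2 U = (\<forall>x\<in>U. eventually (\<lambda>(x', y). x' = x \<longrightarrow> y \<in> U) uniformity)"
instance
proof
  fix x y z :: "'a l2" and r :: real and U :: "'a l2 set"
  show "dist x y = norm (x - y)" by (rule dist_l2_def)
  show "sgn x = x /\<^sub>R norm x" by (rule sgn_l2_def)
  show "(uniformity :: ('a l2 \<times> 'a l2) filter) = (INF e\<in>{0<..}. principal {(x, y). dist x y < e})"
    by (rule uniformity_l2_def)
  show "open U = (\<forall>x\<in>U. eventually (\<lambda>(x', y). x' = x \<longrightarrow> y \<in> U) uniformity)"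
    by (rule open_l2_def)
  show "inner x y = inner y x" unfolding inner_l2_def by (subst cinner_commute) simp
  show "inner (x + y) z = inner x z + inner y z" by (simp add: inner_l2_def cinner_add_left)
  show "inner (r *\<^sub>R x) y = r * inner x y" by (simp add: inner_l2_def scaleR_l2_def cinner_scale_left)
  show "0 \<le> inner x x" unfolding inner_l2_def by transfer (simp add: l2_inner_self)
  show "inner x x = 0 \<longleftrightarrow> x = 0" unfolding inner_l2_def
  proof transfer
    fix x :: "'a \<Rightarrow> complex" assume "x \<in> L2 \<and> x \<in> L2 \<and> ae_eq x x"
    then show "(Re (l2_inner x x) = 0) = (x \<in> L2 \<and> (\<lambda>x. 0) \<in> (L2 :: ('a \<Rightarrow> complex) set) \<and> ae_eq x (\<lambda>x. 0))"
      using l2_inner_self_eq_0[of x] by (simp add: l2_inner_self L2_zero)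
  qed
  show "norm x = sqrt (inner x x)" by (rule norm_l2_def)
qed
end

abbreviation cls :: "('a::euclidean_space \<Rightarrow> complex) \<Rightarrow> 'a l2" where "cls \<equiv> abs_l2"

lemma cls_eq_iff: "f \<in> L2 \<Longrightarrow> g \<in> L2 \<Longrightarrow> cls f = cls g \<longleftrightarrow> ae_eq f g"
  using Quotient3_rel[OF Quotient3_l2, of f g] by (simp add: ae_eq_refl)

lemma cls_exhaust: obtains f where "f \<in> L2" "F = cls f"
  by (metis (mono_tags, lifting) Quotient3_abs_rep Quotient3_l2 Quotient3_rep_reflp)

lemma cls_surj: "\<exists>f. f \<in> L2 \<and> F = cls f"
  by (rule cls_exhaust) (intro exI conjI)

lemma cinner_cls: "f \<in> L2 \<Longrightarrow> g \<in> L2 \<Longrightarrow> cinner (cls f) (cls g) = l2_inner f g"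
  by (rule cinner.abs_eq) (simp_all add: ae_eq_refl)
lemma cls_diff: "f \<in> L2 \<Longrightarrow> g \<in> L2 \<Longrightarrow> cls (\<lambda>x. f x - g x) = cls f - cls g"
  by (rule minus_l2.abs_eq[symmetric]) (simp_all add: ae_eq_refl)
lemma cls_add: "f \<in> L2 \<Longrightarrow> g \<in> L2 \<Longrightarrow> cls (\<lambda>x. f x + g x) = cls f + cls g"
  by (rule plus_l2.abs_eq[symmetric]) (simp_all add: ae_eq_refl)
lemma cls_scale: "f \<in> L2 \<Longrightarrow> cls (\<lambda>x. c * f x) = c *\<^sub>C cls f"
  by (rule cscale.abs_eq[symmetric]) (simp_all add: ae_eq_refl)
lemma cls_zero: "cls (\<lambda>x. 0) = 0"
  by (simp add: zero_l2_def)

lemma norm_cls_sq: "f \<in> L2 \<Longrightarrow> (norm (cls f))\<^sup>2 = (LINT x|lborel. (cmod (f x))\<^sup>2)"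
  by (simp add: power2_norm_eq_inner inner_l2_def cinner_cls l2_inner_self)

lemma norm_cls: "f \<in> L2 \<Longrightarrow> norm (cls f) = sqrt (LINT x|lborel. (cmod (f x))\<^sup>2)"
  by (metis norm_cls_sq norm_ge_zero real_sqrt_unique)

lemma l2_dist_cls: "f \<in> L2 \<Longrightarrow> g \<in> L2 \<Longrightarrow> l2_dist f g = dist (cls f) (cls g)"
  by (simp add: l2_dist_def dist_norm cls_diff[symmetric] norm_cls L2_diff)

lemma cinner_self: "cinner x x = complex_of_real ((norm x)\<^sup>2)"
proof -
  obtain f where "f \<in> L2" "x = cls f" by (rule cls_exhaust)
  then show ?thesis by (simp add: cinner_cls norm_cls_sq l2_inner_self del: of_real_power)
qed

lemma norm_cscale: "norm (c *\<^sub>C x) = cmod c * norm x"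
proof -
  have "complex_of_real ((norm (c *\<^sub>C x))\<^sup>2) = cnj c * (c * complex_of_real ((norm x)\<^sup>2))"
    by (simp only: cinner_self[symmetric] cinner_scale_left cinner_scale_right mult.left_commute)
  also have "\<dots> = complex_of_real ((cmod c)\<^sup>2) * complex_of_real ((norm x)\<^sup>2)"
    by (simp only: complex_norm_square mult.assoc mult.left_commute)
  also have "\<dots> = complex_of_real ((cmod c * norm x)\<^sup>2)"
    by (simp only: of_real_mult[symmetric] power_mult_distrib)
  finally have "complex_of_real ((norm (c *\<^sub>C x))\<^sup>2) = complex_of_real ((cmod c * norm x)\<^sup>2)" .
  then show ?thesis by (simp only: of_real_eq_iff power2_eq_iff_nonneg norm_ge_zero mult_nonneg_nonneg)
qed

lemma cinner_Cauchy_Schwarz: "cmod (cinner x y) \<le> norm x * norm y"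
proof (cases "cinner x y = 0")
  case False
  define c where "c = cnj (sgn (cinner x y))"
  have "complex_of_real (cmod (cinner x y)) = cinner x (c *\<^sub>C y)"
  proof -
    have "cnj (sgn z) * z = complex_of_real (cmod z)" for z
      by (cases "z = 0") (simp_all add: sgn_eq complex_norm_square[symmetric] mult.commute power2_eq_square)
    then show ?thesis by (simp add: c_def cinner_scale_right)
  qed
  then have "cmod (cinner x y) = inner x (c *\<^sub>C y)"
    by (simp add: inner_l2_def complex_eq_iff)
  also have "\<dots> \<le> norm x * norm (c *\<^sub>C y)" by (rule norm_cauchy_schwarz)
  also have "norm (c *\<^sub>C y) = norm y" using False by (simp add: norm_cscale c_def norm_sgn)
  finally show ?thesis .
qed simp

lemma cinner_diff_right: "cinner h (f - g) = cinner h f - cinner h g"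
  by (metis add_diff_cancel diff_add_cancel cinner_add_right)
lemma cinner_diff_left: "cinner (f - g) h = cinner f h - cinner g h"
  by (metis add_diff_cancel diff_add_cancel cinner_add_left)
lemma cinner_zero_right [simp]: "cinner h 0 = 0" 
  using cinner_diff_right[of h 0 0] by simp
lemma cinner_zero_left [simp]: "cinner 0 h = 0" 
  using cinner_diff_left[of 0 0 h] by simp

lemma cinner_minus_right [simp]: "cinner h (- f) = - cinner h f"
  using cinner_diff_right[of h 0 f] by simp
lemma cinner_minus_left [simp]: "cinner (- f) h = - cinner f h"
  using cinner_diff_left[of 0 f h] by simp

lemma cinner_eqI: "(\<And>h. cinner h f = cinner h g) \<Longrightarrow> f = g"
proof -
  assume "\<And>h. cinner h f = cinner h g"
  then have "cinner (f - g) (f - g) = 0" by (simp add: cinner_diff_right)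
  then show ?thesis by (simp add: cinner_self)
qed

lemma tendsto_cinner:
  assumes "(f \<longlongrightarrow> a) F" "(g \<longlongrightarrow> c) F"
  shows "((\<lambda>x. cinner (f x) (g x)) \<longlongrightarrow> cinner a c) F"
proof -
  have *: "((\<lambda>x. inner (f x) (g x)) \<longlongrightarrow> inner a c) F" by (intro tendsto_intros assms)
  have "bounded_linear (\<lambda>x :: 'b l2. \<i> *\<^sub>C x)"
    by (rule bounded_linear_intro[where K = 1])
       (simp_all add: cscale_add_right scaleR_l2_def cscale_cscale norm_cscale mult.commute)
  from bounded_linear.tendsto[OF this assms(2)]
  have **: "((\<lambda>x. inner (f x) (\<i> *\<^sub>C g x)) \<longlongrightarrow> inner a (\<i> *\<^sub>C c)) F" by (intro tendsto_intros assms)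
  have eq: "cinner u v = Complex (inner u v) (- inner u (\<i> *\<^sub>C v))" for u v :: "'b l2"
    by (simp add: complex_eq_iff inner_l2_def cinner_scale_right)
  show ?thesis unfolding eq by (intro tendsto_Complex tendsto_minus * **)
qed

section \<open>Completeness\<close>

lemma norm_cls_nn_integral:
  assumes "f \<in> L2"
  shows "(\<integral>\<^sup>+x. ennreal ((cmod (f x))\<^sup>2) \<partial>lborel) = ennreal ((norm (cls f))\<^sup>2)"
  by (simp add: norm_cls_sq[OF assms] nn_integral_eq_integral[OF L2_square_integrable[OF assms]])

lemma L2_nn_integral_iff:
  "f \<in> L2 \<longleftrightarrow> f \<in> borel_measurable borel \<and> (\<integral>\<^sup>+x. ennreal ((cmod (f x))\<^sup>2) \<partial>lborel) < \<infinity>"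
  by (auto simp: L2_def integrable_iff_bounded)

lemma norm_cls_abs:
  assumes "f \<in> L2"
  shows "(\<lambda>x. complex_of_real (cmod (f x))) \<in> L2" "norm (cls (\<lambda>x. complex_of_real (cmod (f x)))) = norm (cls f)"
proof -
  show 1: "(\<lambda>x. complex_of_real (cmod (f x))) \<in> L2" using assms by (auto simp: L2_def)
  show "norm (cls (\<lambda>x. complex_of_real (cmod (f x)))) = norm (cls f)"
    by (simp add: norm_cls 1 assms)
qed

lemma L2_sum: "(\<And>i. i \<in> A \<Longrightarrow> f i \<in> L2) \<Longrightarrow> (\<lambda>x. \<Sum>i\<in>A. f i x) \<in> L2"
  by (induction A rule: infinite_finite_induct) (auto intro: L2_zero L2_add)

lemma cls_sum: "(\<And>i. i \<in> A \<Longrightarrow> f i \<in> L2) \<Longrightarrow> cls (\<lambda>x. \<Sum>i\<in>A. f i x) = (\<Sum>i\<in>A. cls (f i))"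
  by (induction A rule: infinite_finite_induct) (auto simp: cls_zero cls_add L2_sum)

text \<open>A sequence whose consecutive distances are summable converges almost everywhere.\<close>

lemma l2_fast_Cauchy_convergent:
  fixes X :: "nat \<Rightarrow> 'a::euclidean_space l2"
  assumes fast: "\<And>n. norm (X (Suc n) - X n) \<le> (1/2)^n"
  shows "\<exists>L. X \<longlonglongrightarrow> L"
proof -
  define f where "f n = (SOME g. g \<in> L2 \<and> X n = cls g)" for n
  have "f n \<in> L2 \<and> X n = cls (f n)" for n
    unfolding f_def by (rule someI_ex[OF cls_surj])
  then have f: "\<And>n. f n \<in> L2" "\<And>n. X n = cls (f n)" by simp_all
  have fm [measurable]: "f n \<in> borel_measurable borel" for n by (rule L2_measurable[OF f(1)])
  define d where "d n x = cmod (f (Suc n) x - f n x)" for n x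
  have dm [measurable]: "d n \<in> borel_measurable borel" for n unfolding d_def[abs_def] by measurable
  have d: "(\<lambda>x. complex_of_real (d n x)) \<in> L2" "norm (cls (\<lambda>x. complex_of_real (d n x))) \<le> (1/2)^n" for n
    using norm_cls_abs[OF L2_diff[OF f(1)[of "Suc n"] f(1)[of n]]] fast[of n]
    by (simp_all add: d_def[abs_def] cls_diff f)
  define S where "S n x = (\<Sum>i<n. d i x)" for n x
  have Sm [measurable]: "S n \<in> borel_measurable borel" for n unfolding S_def[abs_def] by measurable
  have S0: "S n x \<ge> 0" for n x by (auto simp: S_def d_def intro: sum_nonneg)
  have SL: "(\<lambda>x. complex_of_real (S n x)) \<in> L2" for n
    unfolding S_def of_real_sum by (intro L2_sum d)
  have SN: "norm (cls (\<lambda>x. complex_of_real (S n x))) \<le> 2" for n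
  proof -
    have "norm (cls (\<lambda>x. complex_of_real (S n x))) \<le> (\<Sum>i<n. norm (cls (\<lambda>x. complex_of_real (d i x))))"
      unfolding S_def of_real_sum by (simp add: cls_sum d norm_sum)
    also have "\<dots> \<le> (\<Sum>i<n. (1/2)^i)" by (intro sum_mono d)
    also have "\<dots> \<le> suminf (\<lambda>i. (1/2::real)^i)" by (intro sum_le_suminf) auto
    also have "\<dots> = 2" by (subst suminf_geometric) auto
    finally show ?thesis .
  qed
  have "(\<integral>\<^sup>+x. (SUP n. ennreal ((S n x)\<^sup>2)) \<partial>lborel) = (SUP n. (\<integral>\<^sup>+x. ennreal ((S n x)\<^sup>2) \<partial>lborel))"
  proof (rule nn_integral_monotone_convergence_SUP)
    show "incseq (\<lambda>n x. ennreal ((S n x)\<^sup>2))"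
    proof (intro incseq_SucI le_funI ennreal_leI power_mono S0)
      show "S n x \<le> S (Suc n) x" for n x by (simp add: S_def d_def)
    qed
  qed measurable
  also have "\<dots> \<le> 4"
  proof (rule SUP_least)
    fix n
    have "(\<integral>\<^sup>+x. ennreal ((S n x)\<^sup>2) \<partial>lborel) = ennreal ((norm (cls (\<lambda>x. complex_of_real (S n x))))\<^sup>2)"
      using norm_cls_nn_integral[OF SL[of n]] by simp
    also have "\<dots> \<le> ennreal (2\<^sup>2)" by (intro ennreal_leI power_mono SN) auto
    finally show "(\<integral>\<^sup>+x. ennreal ((S n x)\<^sup>2) \<partial>lborel) \<le> 4" by simp
  qed
  finally have "(\<integral>\<^sup>+x. (SUP n. ennreal ((S n x)\<^sup>2)) \<partial>lborel) < \<infinity>"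
    by (rule le_less_trans) simp
  then have "(\<integral>\<^sup>+x. (SUP n. ennreal ((S n x)\<^sup>2)) \<partial>lborel) \<noteq> \<infinity>" by simp
  then have "AE x in lborel. (SUP n. ennreal ((S n x)\<^sup>2)) \<noteq> \<infinity>"
    by (intro nn_integral_PInf_AE) measurable
  then have conv: "AE x in lborel. convergent (\<lambda>n. f n x)"
  proof eventually_elim
    case (elim x)
    then obtain B where B: "(SUP n. ennreal ((S n x)\<^sup>2)) = ennreal B" "B \<ge> 0"
      by (cases "SUP n. ennreal ((S n x)\<^sup>2)" rule: ennreal_cases) auto
    have "(S n x)\<^sup>2 \<le> B" for n
      using SUP_upper[of n UNIV "\<lambda>n. ennreal ((S n x)\<^sup>2)"] B by simp
    then have S_le: "S n x \<le> sqrt B" for n by (rule real_le_rsqrt)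
    have *: "(\<Sum>i\<le>n. d i x) \<le> sqrt B" for n
      using S_le[of "Suc n"] unfolding S_def lessThan_Suc_atMost .
    have "summable (\<lambda>i. d i x)"
      by (rule bounded_imp_summable[OF _ *]) (simp add: d_def)
    then have "summable (\<lambda>i. f (Suc i) x - f i x)" unfolding d_def by (rule summable_norm_cancel)
    then obtain s where "(\<lambda>i. f (Suc i) x - f i x) sums s" by (auto simp: summable_def)
    then have "(\<lambda>n. f n x - f 0 x) \<longlonglongrightarrow> s" by (simp add: sums_def sum_lessThan_telescope[of "\<lambda>i. f i x"])
    from tendsto_add[OF this tendsto_const[of "f 0 x"]] show ?case by (auto simp: convergent_def)
  qed
  define F where "F x = lim (\<lambda>n. f n x)" for x
  have Fm [measurable]: "F \<in> borel_measurable borel"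
    unfolding F_def[abs_def] by (rule borel_measurable_lim_metric) measurable
  have bound: "(\<integral>\<^sup>+x. ennreal ((cmod (F x - f n x))\<^sup>2) \<partial>lborel) \<le> ennreal ((2 * (1/2)^n)\<^sup>2)" for n
  proof -
    have "(\<integral>\<^sup>+x. ennreal ((cmod (F x - f n x))\<^sup>2) \<partial>lborel)
        = (\<integral>\<^sup>+x. liminf (\<lambda>m. ennreal ((cmod (f m x - f n x))\<^sup>2)) \<partial>lborel)"
    proof (rule nn_integral_cong_AE, use conv in eventually_elim)
      case (elim x)
      then have "(\<lambda>m. f m x) \<longlonglongrightarrow> F x" unfolding F_def by (simp add: convergent_LIMSEQ_iff)
      then have "(\<lambda>m. ennreal ((cmod (f m x - f n x))\<^sup>2)) \<longlonglongrightarrow> ennreal ((cmod (F x - f n x))\<^sup>2)"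
        by (intro tendsto_intros)
      then show ?case by (intro lim_imp_Liminf[symmetric]) simp_all
    qed
    also have "\<dots> \<le> liminf (\<lambda>m. \<integral>\<^sup>+x. ennreal ((cmod (f m x - f n x))\<^sup>2) \<partial>lborel)"
      by (rule nn_integral_liminf) measurable
    also have "\<dots> \<le> ennreal ((2 * (1/2)^n)\<^sup>2)"
    proof (rule Liminf_le)
      have "\<forall>\<^sub>F m in sequentially. m \<ge> n" by (rule eventually_ge_at_top)
      then show "\<forall>\<^sub>F m in sequentially. (\<integral>\<^sup>+x. ennreal ((cmod (f m x - f n x))\<^sup>2) \<partial>lborel) \<le> ennreal ((2 * (1/2)^n)\<^sup>2)"
      proof eventually_elim
        case (elim m)
        have "norm (X m - X n) \<le> (\<Sum>i=n..<m. (1/2)^i)" using elim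
        proof (induction m rule: dec_induct)
          case (step m)
          have "norm (X (Suc m) - X n) \<le> norm (X (Suc m) - X m) + norm (X m - X n)"
            using norm_triangle_ineq[of "X (Suc m) - X m" "X m - X n"] by simp
          moreover have "(\<Sum>i=n..<Suc m. (1/2::real)^i) = (\<Sum>i=n..<m. (1/2)^i) + (1/2)^m"
            using step(1) by simp
          ultimately show ?case using step.IH fast[of m] by linarith
        qed simp
        also have "(\<Sum>i=n..<m. (1/2::real)^i) = 2 * (1/2)^n - 2 * (1/2)^m" using elim
          by (induction m rule: dec_induct) simp_all
        also have "\<dots> \<le> 2 * (1/2)^n" by simp
        finally have "norm (cls (\<lambda>x. f m x - f n x)) \<le> 2 * (1/2)^n" by (simp add: cls_diff f)
        then show ?case
          unfolding norm_cls_nn_integral[OF L2_diff[OF f(1) f(1)]]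
          by (intro ennreal_leI power_mono norm_ge_zero)
      qed
    qed simp
    finally show ?thesis .
  qed
  have FL: "(\<lambda>x. F x - f n x) \<in> L2" for n
    unfolding L2_nn_integral_iff
  proof
    show "(\<integral>\<^sup>+x. ennreal ((cmod (F x - f n x))\<^sup>2) \<partial>lborel) < \<infinity>"
      by (rule le_less_trans[OF bound]) simp
  qed measurable
  from L2_add[OF this[of 0] f(1)[of 0]] have F: "F \<in> L2" by simp
  have "norm (cls F - X n) \<le> 2 * (1/2)^n" for n
  proof -
    have "ennreal ((norm (cls F - X n))\<^sup>2) \<le> ennreal ((2 * (1/2)^n)\<^sup>2)"
      using bound[of n] norm_cls_nn_integral[OF FL[of n]] by (simp add: cls_diff F f)
    then have "(norm (cls F - X n))\<^sup>2 \<le> (2 * (1/2)^n)\<^sup>2" by simp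
    then show ?thesis by (rule power2_le_imp_le) simp
  qed
  then have "\<forall>\<^sub>F n in sequentially. norm (X n - cls F) \<le> 2 * (1/2)^n" by (simp add: norm_minus_commute)
  moreover have "(\<lambda>n. 2 * (1/2::real)^n) \<longlonglongrightarrow> 0"
    using tendsto_mult_left[OF LIMSEQ_realpow_zero[of "1/2::real"], of 2] by simp
  ultimately have "(\<lambda>n. X n - cls F) \<longlonglongrightarrow> 0" by (rule Lim_null_comparison)
  then have "X \<longlonglongrightarrow> cls F" by (rule LIM_zero_cancel)
  then show ?thesis ..
qed

instance l2 :: (euclidean_space) complete_space
proof
  fix X :: "nat \<Rightarrow> 'a l2" assume C: "Cauchy X"
  have "\<exists>r. strict_mono r \<and> (\<forall>n. \<forall>m\<ge>r n. norm (X m - X (r n)) \<le> (1/2)^n)"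
  proof -
    have "\<forall>n. \<exists>M. \<forall>m\<ge>M. \<forall>k\<ge>M. norm (X m - X k) < (1/2)^n"
      by (intro allI CauchyD[OF C]) simp
    from choice[OF this] obtain M where
      "\<forall>n. \<forall>m\<ge>M n. \<forall>k\<ge>M n. norm (X m - X k) < (1/2)^n" ..
    then have M: "norm (X m - X k) < (1/2)^n" if "m \<ge> M n" "k \<ge> M n" for n m k
      using that by simp
    define r where "r = rec_nat (M 0) (\<lambda>n y. max (Suc y) (M (Suc n)))"
    have "r n < r (Suc n)" for n by (simp add: r_def)
    then have "strict_mono r" by (simp add: strict_mono_Suc_iff)
    moreover have Mr: "M n \<le> r n" for n by (cases n) (auto simp: r_def)
    have "norm (X m - X (r n)) \<le> (1/2)^n" if "m \<ge> r n" for n m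
      using M[of n m "r n"] Mr[of n] that by simp
    ultimately show ?thesis by (intro exI[of _ r] conjI allI impI) 
  qed
  then obtain r where r: "strict_mono r" "\<And>n m. m \<ge> r n \<Longrightarrow> norm (X m - X (r n)) \<le> (1/2)^n" by blast
  have "\<exists>L. (\<lambda>n. X (r n)) \<longlonglongrightarrow> L"
    by (rule l2_fast_Cauchy_convergent) (use r in \<open>simp add: strict_mono_less_eq\<close>)
  then obtain L where "(X \<circ> r) \<longlonglongrightarrow> L" unfolding comp_def ..
  with C r(1) have "X \<longlonglongrightarrow> L" by (rule Cauchy_converges_subseq)
  then show "convergent X" by (rule convergentI)
qed

section \<open>Orthogonal projection\<close>

text \<open>A minimizing sequence for the distance is Cauchy by the parallelogram identity, so completeness supplies the nearest point.\<close>

lemma subspace_projection: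
  fixes S :: "'v::{real_inner,complete_space} set"
  assumes S: "subspace S"
  shows "\<exists>y\<in>closure S. \<forall>s\<in>S. inner (x - y) s = 0"
proof -
  define d where "d = infdist x S"
  have ne: "S \<noteq> {}" using S subspace_0 by auto
  have d0: "d \<ge> 0" by (simp add: d_def infdist_nonneg)
  have dle: "d \<le> norm (x - s)" if "s \<in> S" for s
    using infdist_le[OF that, of x] by (simp add: d_def dist_norm)
  have "\<exists>s\<in>S. norm (x - s) < d + 1 / Suc n" for n
  proof -
    have "infdist x S < d + 1 / Suc n" by (simp add: d_def)
    then have "Inf (dist x ` S) < d + 1 / Suc n" using ne by (simp add: infdist_notempty)
    from cInf_lessD[OF _ this] ne show ?thesis by (auto simp: dist_norm)
  qed
  then obtain s where s: "\<And>n. s n \<in> S" "\<And>n. norm (x - s n) < d + 1 / Suc n" by metis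
  have lim: "(\<lambda>n. norm (x - s n)) \<longlonglongrightarrow> d"
  proof (rule tendsto_sandwich)
    show "(\<lambda>n. d) \<longlonglongrightarrow> d" by simp
    show "(\<lambda>n. d + 1 / Suc n) \<longlonglongrightarrow> d"
      using tendsto_add[OF tendsto_const[of d] LIMSEQ_Suc[OF lim_1_over_n]] by simp
  qed (use dle[OF s(1)] less_imp_le[OF s(2)] in \<open>auto intro!: always_eventually\<close>)
  have par: "(norm (s n - s m))\<^sup>2 \<le> 2 * (norm (x - s n))\<^sup>2 + 2 * (norm (x - s m))\<^sup>2 - 4 * d\<^sup>2" for n m
  proof -
    have mid: "(1/2) *\<^sub>R (s n + s m) \<in> S" by (intro subspace_scale subspace_add S s)
    have "d\<^sup>2 \<le> (norm (x - (1/2) *\<^sub>R (s n + s m)))\<^sup>2" by (intro power_mono dle mid d0)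
    moreover have "4 * (norm (x - (1/2) *\<^sub>R (s n + s m)))\<^sup>2 + (norm (s n - s m))\<^sup>2
        = 2 * (norm (x - s n))\<^sup>2 + 2 * (norm (x - s m))\<^sup>2"
      by (simp add: power2_norm_eq_inner inner_diff_left inner_diff_right inner_add_left inner_add_right inner_commute algebra_simps)
    ultimately show ?thesis by linarith
  qed
  have "Cauchy s"
  proof (rule CauchyI)
    fix e :: real assume "e > 0"
    have "(\<lambda>n. (norm (x - s n))\<^sup>2) \<longlonglongrightarrow> d\<^sup>2" by (intro tendsto_intros lim)
    then have "\<forall>\<^sub>F n in sequentially. (norm (x - s n))\<^sup>2 < d\<^sup>2 + e\<^sup>2 / 4"
      by (rule order_tendstoD(2)) (use \<open>e > 0\<close> in simp)
    then obtain M where M: "\<And>n. n \<ge> M \<Longrightarrow> (norm (x - s n))\<^sup>2 < d\<^sup>2 + e\<^sup>2 / 4"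
      unfolding eventually_sequentially by blast
    have "norm (s m - s n) < e" if "m \<ge> M" "n \<ge> M" for m n
    proof -
      have "(norm (s m - s n))\<^sup>2 < e\<^sup>2" using par[of m n] M[OF that(1)] M[OF that(2)] by linarith
      then show ?thesis using \<open>e > 0\<close> by (simp add: power_less_imp_less_base)
    qed
    then show "\<exists>M. \<forall>m\<ge>M. \<forall>n\<ge>M. norm (s m - s n) < e" by blast
  qed
  then obtain y where y: "s \<longlonglongrightarrow> y" unfolding Cauchy_convergent_iff convergent_def ..
  have yc: "y \<in> closure S" unfolding closure_sequential using y s(1) by (intro exI[of _ s]) simp
  have "(\<lambda>n. norm (x - s n)) \<longlonglongrightarrow> norm (x - y)" by (intro tendsto_intros y)
  with lim have dy: "norm (x - y) = d" by (rule LIMSEQ_unique[symmetric])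
  have low: "d \<le> norm (x - (y + t *\<^sub>R v))" if v: "v \<in> S" for t v
  proof (rule LIMSEQ_le_const)
    show "(\<lambda>n. norm (x - (s n + t *\<^sub>R v))) \<longlonglongrightarrow> norm (x - (y + t *\<^sub>R v))" by (intro tendsto_intros y)
    show "\<exists>N. \<forall>n\<ge>N. d \<le> norm (x - (s n + t *\<^sub>R v))"
      by (intro exI[of _ 0] allI impI dle subspace_add subspace_scale S s v)
  qed
  have "inner (x - y) v = 0" if v: "v \<in> S" for v
  proof (cases "v = 0")
    case False
    define t where "t = inner (x - y) v / (norm v)\<^sup>2"
    have "d\<^sup>2 \<le> (norm (x - (y + t *\<^sub>R v)))\<^sup>2" by (intro power_mono low v d0)
    also have "\<dots> = (norm ((x - y) - t *\<^sub>R v))\<^sup>2" by (simp add: diff_diff_eq)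
    also have "\<dots> = (norm (x - y))\<^sup>2 - 2 * t * inner (x - y) v + t\<^sup>2 * (norm v)\<^sup>2"
      unfolding power2_norm_eq_inner inner_diff_left[of "x - y"] inner_diff_right[of _ "x - y"]
      by (simp add: inner_commute power2_eq_square algebra_simps)
    also have "\<dots> = d\<^sup>2 - (inner (x - y) v)\<^sup>2 / (norm v)\<^sup>2"
      using False by (simp add: dy t_def power2_eq_square field_simps)
    finally have "(inner (x - y) v)\<^sup>2 / (norm v)\<^sup>2 \<le> 0" by simp
    then show ?thesis using False by (simp add: divide_le_0_iff)
  qed simp
  with yc show ?thesis by blast
qed

section \<open>Bounded holomorphic functions on a strip\<close>

text \<open>The functions on the strip that occur in \<open>analytic_generator\<close>.\<close>

definition strip_fun :: "(complex \<Rightarrow> complex) \<Rightarrow> bool" where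
  "strip_fun F \<longleftrightarrow> continuous_on {z. -1 \<le> Im z \<and> Im z \<le> 0} F \<and>
     F holomorphic_on {z. -1 < Im z \<and> Im z < 0} \<and>
     bounded (F ` {z. -1 \<le> Im z \<and> Im z \<le> 0})"

text \<open>The factor that decays at infinity makes the maximum principle on large rectangles applicable to a function that is merely bounded; afterwards the factor is sent to \<open>1\<close>.\<close>

lemma strip_maximum_principle:
  assumes F: "strip_fun F"
    and top: "\<And>s :: real. cmod (F (of_real s)) \<le> B"
    and bot: "\<And>s :: real. cmod (F (of_real s - \<i>)) \<le> B"
    and z: "-1 \<le> Im z" "Im z \<le> 0"
  shows "cmod (F z) \<le> B"
proof -
  obtain M where M: "\<And>z. -1 \<le> Im z \<Longrightarrow> Im z \<le> 0 \<Longrightarrow> cmod (F z) \<le> M"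
    using F unfolding strip_fun_def bounded_iff by blast
  have B0: "B \<ge> 0" using top[of 0] norm_ge_zero order_trans by blast
  have M0: "M \<ge> 0" using order_trans[OF norm_ge_zero M[of 0]] by simp
  have main: "cmod (F z) \<le> (B + e) * exp e * cmod (exp (of_real e * z\<^sup>2))" if e: "e > 0" for e :: real
  proof -
    define G where "G = (\<lambda>z. F z * exp (- of_real e * z\<^sup>2))"
    have expb: "cmod (exp (- of_real e * w\<^sup>2)) = exp (e * ((Im w)\<^sup>2 - (Re w)\<^sup>2))" for w
      by (simp add: norm_exp_eq_Re Re_power2 algebra_simps)
    define R where "R = max (\<bar>Re z\<bar>) (sqrt (M / (B + e) / e))"
    have R0: "R \<ge> 0" by (simp add: R_def)
    have R: "M * exp (- e * R\<^sup>2) \<le> B + e"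
    proof -
      have "M / (B + e) / e \<le> R\<^sup>2"
      proof -
        have "M / (B + e) / e = (sqrt (M / (B + e) / e))\<^sup>2" using B0 M0 e by simp
        also have "\<dots> \<le> R\<^sup>2" by (intro power_mono) (use B0 M0 e in \<open>auto simp: R_def\<close>)
        finally show ?thesis .
      qed
      from mult_right_mono[OF this, of e] have "M / (B + e) \<le> e * R\<^sup>2" using e by (simp add: mult.commute)
      also have "\<dots> \<le> exp (e * R\<^sup>2)" using exp_ge_add_one_self[of "e * R\<^sup>2"] by linarith
      finally have "M / (B + e) * (B + e) \<le> exp (e * R\<^sup>2) * (B + e)"
        using B0 e by (intro mult_right_mono) auto
      then have "M \<le> (B + e) * exp (e * R\<^sup>2)" using B0 e by (simp add: mult.commute)
      then have "M * exp (- e * R\<^sup>2) \<le> (B + e) * exp (e * R\<^sup>2) * exp (- e * R\<^sup>2)"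
        by (intro mult_right_mono) auto
      also have "\<dots> = B + e" by (simp add: exp_minus)
      finally show ?thesis .
    qed
    let ?S = "cbox (Complex (-R) (-1)) (Complex R 0)"
    have zS: "z \<in> ?S" using z by (auto simp: in_cbox_complex_iff R_def)
    have "cmod (G z) \<le> (B + e) * exp e"
    proof (rule maximum_modulus_frontier[OF _ _ _ _ zS])
      have "F holomorphic_on {z. -1 < Im z \<and> Im z < 0}" using F by (simp add: strip_fun_def)
      then have "F holomorphic_on interior ?S"
        by (rule holomorphic_on_subset) (auto simp: in_box_complex_iff interior_cbox)
      then show "G holomorphic_on interior ?S"
        unfolding G_def by (intro holomorphic_intros)
      have "continuous_on {z. -1 \<le> Im z \<and> Im z \<le> 0} F" using F by (simp add: strip_fun_def)
      then have "continuous_on (closure ?S) F"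
        by (rule continuous_on_subset) (auto simp: in_cbox_complex_iff)
      then show "continuous_on (closure ?S) G"
        unfolding G_def by (intro continuous_intros)
      show "bounded ?S" by simp
      fix w assume "w \<in> frontier ?S"
      then have w: "w \<in> ?S" "w \<notin> box (Complex (-R) (-1)) (Complex R 0)"
        by (auto simp: frontier_def)
      have Gw: "cmod (G w) = cmod (F w) * exp (e * ((Im w)\<^sup>2 - (Re w)\<^sup>2))" unfolding G_def norm_mult expb ..
      have im1: "(Im w)\<^sup>2 \<le> 1" using w(1) by (auto simp: in_cbox_complex_iff abs_square_le_1)
      have "(Im w)\<^sup>2 - (Re w)\<^sup>2 \<le> 1" using im1 zero_le_power2[of "Re w"] by linarith
      then have exp_le: "exp (e * ((Im w)\<^sup>2 - (Re w)\<^sup>2)) \<le> exp e" using e by (simp add: mult_left_le)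
      consider "Im w = 0" | "Im w = -1" | "\<bar>Re w\<bar> = R"
        using w by (force simp: in_cbox_complex_iff in_box_complex_iff)
      then show "cmod (G w) \<le> (B + e) * exp e"
      proof cases
        case 1
        then have "w = of_real (Re w)" by (simp add: complex_eq_iff)
        then have "cmod (F w) \<le> B + e" using top[of "Re w"] e by simp
        with exp_le show ?thesis unfolding Gw using B0 e by (intro mult_mono) auto
      next
        case 2
        then have "w = of_real (Re w) - \<i>" by (simp add: complex_eq_iff)
        then have "cmod (F w) \<le> B + e" using bot[of "Re w"] e by simp
        with exp_le show ?thesis unfolding Gw using B0 e by (intro mult_mono) auto
      next
        case 3
        have "cmod (F w) \<le> M" using w(1) by (intro M) (auto simp: in_cbox_complex_iff)
        moreover have "(Re w)\<^sup>2 = R\<^sup>2" using 3 power2_abs[of "Re w"] by simp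
        then have "e * ((Im w)\<^sup>2 - (Re w)\<^sup>2) \<le> e + - e * R\<^sup>2"
          using mult_left_mono[OF im1, of e] e by (simp add: right_diff_distrib)
        then have "exp (e * ((Im w)\<^sup>2 - (Re w)\<^sup>2)) \<le> exp e * exp (- e * R\<^sup>2)" by (simp add: exp_add[symmetric])
        ultimately have "cmod (G w) \<le> M * (exp e * exp (- e * R\<^sup>2))" unfolding Gw using M0 by (intro mult_mono) auto
        also have "\<dots> = (M * exp (- e * R\<^sup>2)) * exp e" by simp
        also have "\<dots> \<le> (B + e) * exp e" using R by (intro mult_right_mono) auto
        finally show ?thesis .
      qed
    qed
    moreover have "F z = G z * exp (of_real e * z\<^sup>2)" by (simp add: G_def exp_minus)
    ultimately show ?thesis by (simp add: norm_mult mult_right_mono)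
  qed
  have "((\<lambda>e. (B + e) * exp e * cmod (exp (of_real e * z\<^sup>2))) \<longlongrightarrow> (B + 0) * exp 0 * cmod (exp (of_real 0 * z\<^sup>2))) (at_right 0)"
    by (intro tendsto_intros)
  then have lim: "((\<lambda>e. (B + e) * exp e * cmod (exp (of_real e * z\<^sup>2))) \<longlongrightarrow> B) (at_right 0)" by simp
  have ev: "\<forall>\<^sub>F e in at_right 0. cmod (F z) \<le> (B + e) * exp e * cmod (exp (of_real e * z\<^sup>2))"
    unfolding eventually_at_right_field by (intro exI[of _ 1] conjI allI impI main) simp_all
  show ?thesis
    by (rule tendsto_lowerbound[OF lim ev]) simp
qed

lemma strip_fun_cmult: "strip_fun F \<Longrightarrow> strip_fun (\<lambda>z. c * F z)"
  unfolding strip_fun_def by (auto intro!: continuous_intros holomorphic_intros simp: bounded_iff norm_mult)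
    (meson mult_left_mono norm_ge_zero)

lemma strip_fun_add: "strip_fun F \<Longrightarrow> strip_fun G \<Longrightarrow> strip_fun (\<lambda>z. F z + G z)"
  unfolding strip_fun_def by (auto intro!: continuous_intros holomorphic_intros bounded_plus_comp)

lemma strip_fun_diff: "strip_fun F \<Longrightarrow> strip_fun G \<Longrightarrow> strip_fun (\<lambda>z. F z - G z)"
  unfolding strip_fun_def by (auto intro!: continuous_intros holomorphic_intros bounded_minus_comp)

lemma strip_fun_shift:
  assumes "strip_fun F" shows "strip_fun (\<lambda>z. F (z + of_real s))"
  unfolding strip_fun_def
proof (intro conjI)
  show "continuous_on {z. -1 \<le> Im z \<and> Im z \<le> 0} (\<lambda>z. F (z + of_real s))"
    by (rule continuous_on_compose2[of "{z. -1 \<le> Im z \<and> Im z \<le> 0}" F])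
       (use assms in \<open>auto simp: strip_fun_def intro!: continuous_intros\<close>)
  have "(F \<circ> (\<lambda>z. z + of_real s)) holomorphic_on {z. -1 < Im z \<and> Im z < 0}"
    by (rule holomorphic_on_compose_gen[of _ _ F "{z. -1 < Im z \<and> Im z < 0}"])
       (use assms in \<open>auto simp: strip_fun_def intro!: holomorphic_intros\<close>)
  then show "(\<lambda>z. F (z + of_real s)) holomorphic_on {z. -1 < Im z \<and> Im z < 0}" by (simp add: o_def)
  show "bounded ((\<lambda>z. F (z + of_real s)) ` {z. -1 \<le> Im z \<and> Im z \<le> 0})"
    by (rule bounded_subset[of "F ` {z. -1 \<le> Im z \<and> Im z \<le> 0}"]) (use assms in \<open>auto simp: strip_fun_def\<close>)
qed

text \<open>The reflections in the imaginary axis and in the line \<open>Im z = -1/2\<close>.\<close>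

lemma holomorphic_cnj_cnj:
  assumes "open S" "f holomorphic_on cnj ` S"
  shows "(\<lambda>z. cnj (f (cnj z))) holomorphic_on S"
proof -
  have "(cnj \<circ> f \<circ> cnj) holomorphic_on S"
    by (rule holomorphic_on_compose_cnj_cnj[OF assms(2,1)])
  then show ?thesis by (simp add: o_def)
qed

lemma strip_fun_reflect:
  assumes F: "strip_fun F" shows "strip_fun (\<lambda>z. cnj (F (- cnj z)))"
  unfolding strip_fun_def
proof (intro conjI)
  have "continuous_on {z. -1 \<le> Im z \<and> Im z \<le> 0} (\<lambda>z. F (- cnj z))"
    by (rule continuous_on_compose2[of "{z. -1 \<le> Im z \<and> Im z \<le> 0}" F])
       (use F in \<open>auto simp: strip_fun_def intro!: continuous_intros\<close>)
  then show "continuous_on {z. -1 \<le> Im z \<and> Im z \<le> 0} (\<lambda>z. cnj (F (- cnj z)))"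
    by (rule continuous_on_cnj)
  have "(\<lambda>z. F (- z)) holomorphic_on cnj ` {z. -1 < Im z \<and> Im z < 0}"
  proof -
    have "(F \<circ> uminus) holomorphic_on cnj ` {z. -1 < Im z \<and> Im z < 0}"
      by (rule holomorphic_on_compose_gen[of _ _ F "{z. -1 < Im z \<and> Im z < 0}"])
         (use F in \<open>auto simp: strip_fun_def intro!: holomorphic_intros\<close>)
    then show ?thesis by (simp add: o_def)
  qed
  then show "(\<lambda>z. cnj (F (- cnj z))) holomorphic_on {z. -1 < Im z \<and> Im z < 0}"
    by (intro holomorphic_cnj_cnj) (auto intro!: open_Collect_conj open_Collect_less continuous_intros)
  have "(\<lambda>z. cnj (F (- cnj z))) ` {z. -1 \<le> Im z \<and> Im z \<le> 0} \<subseteq> cnj ` F ` {z. -1 \<le> Im z \<and> Im z \<le> 0}"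
    by auto
  moreover have "bounded (cnj ` F ` {z. -1 \<le> Im z \<and> Im z \<le> 0})"
    using F by (auto simp: strip_fun_def bounded_iff)
  ultimately show "bounded ((\<lambda>z. cnj (F (- cnj z))) ` {z. -1 \<le> Im z \<and> Im z \<le> 0})"
    by (rule bounded_subset[rotated])
qed

lemma strip_fun_flip:
  assumes F: "strip_fun F" shows "strip_fun (\<lambda>z. cnj (F (cnj z - \<i>)))"
  unfolding strip_fun_def
proof (intro conjI)
  have "continuous_on {z. -1 \<le> Im z \<and> Im z \<le> 0} (\<lambda>z. F (cnj z - \<i>))"
    by (rule continuous_on_compose2[of "{z. -1 \<le> Im z \<and> Im z \<le> 0}" F])
       (use F in \<open>auto simp: strip_fun_def intro!: continuous_intros\<close>)
  then show "continuous_on {z. -1 \<le> Im z \<and> Im z \<le> 0} (\<lambda>z. cnj (F (cnj z - \<i>)))"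
    by (rule continuous_on_cnj)
  have "(\<lambda>z. F (z - \<i>)) holomorphic_on cnj ` {z. -1 < Im z \<and> Im z < 0}"
  proof -
    have "(F \<circ> (\<lambda>z. z - \<i>)) holomorphic_on cnj ` {z. -1 < Im z \<and> Im z < 0}"
      by (rule holomorphic_on_compose_gen[of _ _ F "{z. -1 < Im z \<and> Im z < 0}"])
         (use F in \<open>auto simp: strip_fun_def intro!: holomorphic_intros\<close>)
    then show ?thesis by (simp add: o_def)
  qed
  then show "(\<lambda>z. cnj (F (cnj z - \<i>))) holomorphic_on {z. -1 < Im z \<and> Im z < 0}"
    by (intro holomorphic_cnj_cnj) (auto intro!: open_Collect_conj open_Collect_less continuous_intros)
  have "(\<lambda>z. cnj (F (cnj z - \<i>))) ` {z. -1 \<le> Im z \<and> Im z \<le> 0} \<subseteq> cnj ` F ` {z. -1 \<le> Im z \<and> Im z \<le> 0}"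
    by auto
  moreover have "bounded (cnj ` F ` {z. -1 \<le> Im z \<and> Im z \<le> 0})"
    using F by (auto simp: strip_fun_def bounded_iff)
  ultimately show "bounded ((\<lambda>z. cnj (F (cnj z - \<i>))) ` {z. -1 \<le> Im z \<and> Im z \<le> 0})"
    by (rule bounded_subset[rotated])
qed

lemma strip_fun_zero:
  assumes F: "strip_fun F" and top: "\<And>s :: real. F (of_real s) = 0"
    and z: "-1 \<le> Im z" "Im z \<le> 0"
  shows "F z = 0"
proof -
  obtain M where M: "\<And>z. -1 \<le> Im z \<Longrightarrow> Im z \<le> 0 \<Longrightarrow> cmod (F z) \<le> M"
    using F unfolding strip_fun_def bounded_iff by blast
  have M0: "M \<ge> 0" using order_trans[OF norm_ge_zero M[of 0]] by simp
  have open_zero: "F z = 0" if z: "-1 < Im z" "Im z \<le> 0" for z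
  proof -
    have b: "cmod (F z) \<le> M * exp (- real n * (1 + Im z))" for n :: nat
    proof -
      define G where "G = (\<lambda>z. exp (- \<i> * of_real (real n) * z) * F z)"
      have G: "cmod (G z) = exp (real n * Im z) * cmod (F z)" for z
        by (simp add: G_def norm_mult norm_exp_eq_Re)
      have "bounded (G ` {z. -1 \<le> Im z \<and> Im z \<le> 0})"
        unfolding bounded_iff
      proof (intro exI ballI)
        fix y assume "y \<in> G ` {z. -1 \<le> Im z \<and> Im z \<le> 0}"
        then obtain z where z: "y = G z" "-1 \<le> Im z" "Im z \<le> 0" by auto
        have "exp (real n * Im z) \<le> 1" using z by (simp add: mult_nonneg_nonpos)
        then have "exp (real n * Im z) * cmod (F z) \<le> 1 * M"
          using M[OF z(2,3)] by (intro mult_mono) auto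
        then show "norm y \<le> M" by (simp add: z(1) G)
      qed
      then have "strip_fun G" using F unfolding strip_fun_def G_def
        by (auto intro!: continuous_intros holomorphic_intros)
      then have "cmod (G z) \<le> M * exp (- real n)"
      proof (rule strip_maximum_principle)
        fix s :: real
        show "cmod (G (of_real s)) \<le> M * exp (- real n)"
          using M0 by (simp add: G top)
        have "cmod (F (of_real s - \<i>)) \<le> M" by (rule M) auto
        then show "cmod (G (of_real s - \<i>)) \<le> M * exp (- real n)"
          by (simp add: G mult.commute mult_right_mono)
      qed (use z in auto)
      then have "exp (- (real n * Im z)) * (exp (real n * Im z) * cmod (F z)) \<le> exp (- (real n * Im z)) * (M * exp (- real n))"
        unfolding G by (intro mult_left_mono) auto
      moreover have "exp (- (real n * Im z)) * (exp (real n * Im z) * cmod (F z)) = cmod (F z)"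
        by (simp add: mult.assoc[symmetric] exp_minus)
      moreover have "exp (- (real n * Im z)) * (M * exp (- real n)) = M * (exp (- (real n * Im z)) * exp (- real n))"
        by simp
      moreover have "exp (- (real n * Im z)) * exp (- real n) = exp (- real n * (1 + Im z))"
        unfolding exp_add[symmetric] by (simp add: algebra_simps)
      ultimately show ?thesis by simp
    qed
    have "(\<lambda>n. M * (exp (- (1 + Im z)))^n) \<longlonglongrightarrow> M * 0"
      using z by (intro tendsto_mult tendsto_const LIMSEQ_realpow_zero) auto
    moreover have "(exp (- (1 + Im z)))^n = exp (- real n * (1 + Im z))" for n
      unfolding exp_of_nat_mult[symmetric] by (simp add: algebra_simps)
    ultimately have "(\<lambda>n. M * exp (- real n * (1 + Im z))) \<longlonglongrightarrow> 0" by simp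
    then have "cmod (F z) \<le> 0" by (rule LIMSEQ_le_const) (use b in auto)
    then show ?thesis by simp
  qed
  show ?thesis
  proof (cases "Im z = -1")
    case True
    have "((\<lambda>t. F (z + \<i> * of_real t)) \<longlongrightarrow> F (z + \<i> * of_real 0)) (at 0 within {0..1})"
    proof -
      have "continuous_on {0..1::real} (\<lambda>t. F (z + \<i> * of_real t))"
        by (rule continuous_on_compose2[of "{z. -1 \<le> Im z \<and> Im z \<le> 0}" F])
           (use F True in \<open>auto simp: strip_fun_def intro!: continuous_intros\<close>)
      then have "\<forall>t\<in>{0..1}. ((\<lambda>t. F (z + \<i> * of_real t)) \<longlongrightarrow> F (z + \<i> * of_real t)) (at t within {0..1})"
        by (simp only: continuous_on_def)
      then show ?thesis by (rule bspec) simp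
    qed
    moreover have "\<forall>\<^sub>F t in at 0 within {0..1::real}. F (z + \<i> * of_real t) = 0"
      unfolding eventually_at by (intro exI[of _ 1]) (auto intro!: open_zero simp: True)
    ultimately have "((\<lambda>t :: real. 0 :: complex) \<longlongrightarrow> F (z + \<i> * of_real 0)) (at 0 within {0..1})"
      by (rule Lim_transform_eventually)
    moreover have "at (0::real) within {0..1} \<noteq> bot" by (simp add: trivial_limit_within islimpt_Icc)
    ultimately show ?thesis by (simp add: tendsto_const_iff)
  qed (use open_zero z in auto)
qed

lemma strip_fun_unique:
  assumes "strip_fun F" "strip_fun G" "\<And>s :: real. F (of_real s) = G (of_real s)" "-1 \<le> Im z" "Im z \<le> 0"
  shows "F z = G z"
  using strip_fun_zero[OF strip_fun_diff[OF assms(1,2)], of z] assms(3-) by simp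

text \<open>Uniform closeness on the two boundary lines spreads to the strip by the maximum principle, so limits of boundary values stay boundary values of strip functions.\<close>

lemma strip_fun_limit:
  fixes h :: "nat \<Rightarrow> 'b::real_normed_vector"
  assumes F: "\<And>n. strip_fun (F n)" and h: "h \<longlonglongrightarrow> h0"
    and b: "\<And>n m z. -1 \<le> Im z \<Longrightarrow> Im z \<le> 0 \<Longrightarrow> cmod (F n z - F m z) \<le> C * norm (h n - h m)"
  shows "\<exists>G. strip_fun G \<and> (\<forall>z. -1 \<le> Im z \<longrightarrow> Im z \<le> 0 \<longrightarrow> (\<lambda>n. F n z) \<longlonglongrightarrow> G z)"
proof -
  let ?S = "{z. -1 \<le> Im z \<and> Im z \<le> 0}" and ?T = "{z. -1 < Im z \<and> Im z < 0}"
  have uc: "uniformly_Cauchy_on ?S F"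
    unfolding uniformly_Cauchy_on_def
  proof (intro allI impI)
    fix e :: real assume e: "e > 0"
    have "Cauchy h" using h by (rule LIMSEQ_imp_Cauchy)
    moreover have "e / (\<bar>C\<bar> + 1) > 0" using e by simp
    ultimately obtain M where M: "\<And>m n. m \<ge> M \<Longrightarrow> n \<ge> M \<Longrightarrow> norm (h m - h n) < e / (\<bar>C\<bar> + 1)"
      by (meson CauchyD)
    have "dist (F m z) (F n z) < e" if "m \<ge> M" "n \<ge> M" "z \<in> ?S" for m n z
    proof -
      have "dist (F m z) (F n z) \<le> C * norm (h m - h n)" using b that by (simp add: dist_norm)
      also have "\<dots> \<le> (\<bar>C\<bar> + 1) * norm (h m - h n)" by (intro mult_right_mono) auto
      also have "\<dots> < (\<bar>C\<bar> + 1) * (e / (\<bar>C\<bar> + 1))" using M[OF that(1,2)] by (intro mult_strict_left_mono) auto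
      finally show ?thesis by simp
    qed
    then show "\<exists>M. \<forall>x\<in>?S. \<forall>m\<ge>M. \<forall>n\<ge>M. dist (F m x) (F n x) < e" by blast
  qed
  then obtain G where G: "uniform_limit ?S F G sequentially"
    using uniformly_convergent_eq_Cauchy uniformly_convergent_on_def by blast
  have cG: "continuous_on ?S G"
    by (rule uniform_limit_theorem[OF _ G]) (use F in \<open>auto simp: strip_fun_def\<close>)
  have hG: "G holomorphic_on ?T"
  proof (rule holomorphic_uniform_sequence[where f = F])
    show "open ?T" by (auto intro!: open_Collect_conj open_Collect_less continuous_intros)
    show "F n holomorphic_on ?T" for n using F by (simp add: strip_fun_def)
    fix z assume "z \<in> ?T"
    then obtain d where d: "d > 0" "cball z d \<subseteq> ?T"
      using open_contains_cball \<open>open ?T\<close> by blast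
    have "uniform_limit (cball z d) F G sequentially"
      by (rule uniform_limit_on_subset[OF G]) (use d in auto)
    with d show "\<exists>d>0. cball z d \<subseteq> ?T \<and> uniform_limit (cball z d) F G sequentially" by blast
  qed
  have bG: "bounded (G ` ?S)"
    by (rule uniform_limit_bounded[OF G]) (use F in \<open>auto simp: strip_fun_def\<close>)
  have "(\<lambda>n. F n z) \<longlonglongrightarrow> G z" if "z \<in> ?S" for z using tendsto_uniform_limitI[OF G that] .
  with cG hG bG show ?thesis unfolding strip_fun_def by blast
qed

section \<open>Analytic generators\<close>

locale ugroup =
  fixes U :: "real \<Rightarrow> 'a::euclidean_space l2 \<Rightarrow> 'a l2"
  assumes U_cinner: "cinner (U s f) (U s g) = cinner f g"
    and U_zero: "U 0 f = f"
    and U_add: "U (s + t) f = U s (U t f)"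
begin

definition AG :: "('a l2 \<times> 'a l2) set" where
  "AG = {(f, g). \<forall>h. \<exists>F. strip_fun F \<and> (\<forall>s::real. F (of_real s) = cinner h (U s f)) \<and> F (-\<i>) = cinner h g}"

lemma U_adj: "cinner h (U s f) = cinner (U (-s) h) f"
  using U_cinner[of s "U (-s) h" f] U_add[of s "-s" h] by (simp add: U_zero)

lemma U_linear: "U s (f + g) = U s f + U s g" "U s (c *\<^sub>C f) = c *\<^sub>C U s f"
  by (rule cinner_eqI, simp add: U_adj cinner_add_right cinner_scale_right)+

lemma U_norm: "norm (U s f) = norm f"
proof -
  have "(norm (U s f))\<^sup>2 = (norm f)\<^sup>2"
    using U_cinner[of s f f] unfolding cinner_self of_real_eq_iff .
  then show ?thesis by simp
qed

lemma U_bound: "cmod (cinner h (U s f)) \<le> norm h * norm f"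
  using cinner_Cauchy_Schwarz[of h "U s f"] by (simp add: U_norm)

lemma AG_D:
  assumes "(f, g) \<in> AG"
  shows "\<exists>F. strip_fun F \<and> (\<forall>s::real. F (of_real s) = cinner h (U s f)) \<and> F (-\<i>) = cinner h g"
  using assms unfolding AG_def by simp

lemma AG_strip:
  assumes "(f, g) \<in> AG"
  shows "\<exists>F. strip_fun F \<and> (\<forall>s::real. F (of_real s) = cinner h (U s f)) \<and>
    (\<forall>s::real. F (of_real s - \<i>) = cinner h (U s g))"
proof -
  obtain F where F: "strip_fun F" "\<And>s::real. F (of_real s) = cinner h (U s f)" "F (-\<i>) = cinner h g"
    using AG_D[OF assms, where h = h] by blast
  have "F (of_real s - \<i>) = cinner h (U s g)" for s :: real
  proof -
    obtain G where G: "strip_fun G" "\<And>t::real. G (of_real t) = cinner (U (-s) h) (U t f)" "G (-\<i>) = cinner (U (-s) h) g"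
      using AG_D[OF assms, where h = "U (-s) h"] by blast
    have "F (-\<i> + of_real s) = G (-\<i>)"
    proof (rule strip_fun_unique[OF strip_fun_shift[OF F(1)] G(1)])
      fix t :: real
      have "F (of_real t + of_real s) = cinner h (U (s + t) f)"
        using F(2)[of "s + t"] by (simp add: add.commute)
      then show "F (of_real t + of_real s) = G (of_real t)" by (simp add: G(2) U_add U_adj[of h])
    qed simp_all
    then show ?thesis by (simp add: G(3) U_adj[of h] add.commute)
  qed
  with F show ?thesis by blast
qed

lemma AG_add: "(f, g) \<in> AG \<Longrightarrow> (f', g') \<in> AG \<Longrightarrow> (f + f', g + g') \<in> AG"
  unfolding AG_def
proof (clarsimp, goal_cases)
  case (1 h)
  from 1(1)[rule_format, of h] 1(2)[rule_format, of h] obtain F G where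
    "strip_fun F" "\<forall>s::real. F (of_real s) = cinner h (U s f)" "F (-\<i>) = cinner h g"
    "strip_fun G" "\<forall>s::real. G (of_real s) = cinner h (U s f')" "G (-\<i>) = cinner h g'" by blast
  then show ?case
    by (intro exI[of _ "\<lambda>z. F z + G z"]) (simp add: strip_fun_add U_linear cinner_add_right)
qed

lemma AG_scale: "(f, g) \<in> AG \<Longrightarrow> (c *\<^sub>C f, c *\<^sub>C g) \<in> AG"
  unfolding AG_def
proof (clarsimp, goal_cases)
  case (1 h)
  from 1[rule_format, of h] obtain F where
    "strip_fun F" "\<forall>s::real. F (of_real s) = cinner h (U s f)" "F (-\<i>) = cinner h g" by blast
  then show ?case
    by (intro exI[of _ "\<lambda>z. c * F z"]) (simp add: strip_fun_cmult U_linear cinner_scale_right)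
qed

lemma AG_subspace: "subspace AG"
proof (rule subspaceI)
  show "0 \<in> AG"
  proof -
    have "strip_fun (\<lambda>z. 0)" by (auto simp: strip_fun_def image_constant_conv)
    moreover have "U s 0 = 0" for s using U_norm[of s 0] by simp
    ultimately show ?thesis unfolding AG_def zero_prod_def by auto
  qed
  show "x + y \<in> AG" if "x \<in> AG" "y \<in> AG" for x y
    using AG_add[of "fst x" "snd x" "fst y" "snd y"] that by (simp add: plus_prod_def)
  show "c *\<^sub>R x \<in> AG" if "x \<in> AG" for x c
    using AG_scale[of "fst x" "snd x" "of_real c"] that by (simp add: scaleR_prod_def scaleR_l2_def)
qed

lemma AG_invariant: "(f, g) \<in> AG \<Longrightarrow> (U s f, U s g) \<in> AG"
proof -
  assume A: "(f, g) \<in> AG"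
  have "\<exists>F. strip_fun F \<and> (\<forall>t::real. F (of_real t) = cinner h (U t (U s f))) \<and> F (-\<i>) = cinner h (U s g)" for h
  proof -
    obtain F where F: "strip_fun F" "\<And>t::real. F (of_real t) = cinner (U (-s) h) (U t f)" "F (-\<i>) = cinner (U (-s) h) g"
      using AG_D[OF A, where h = "U (-s) h"] by blast
    have "F (of_real t) = cinner h (U t (U s f))" for t
      by (simp add: F(2) U_adj[symmetric] U_add[symmetric] add.commute)
    with F show ?thesis by (intro exI[of _ F]) (simp add: U_adj[symmetric])
  qed
  then show ?thesis by (simp add: AG_def)
qed

text \<open>Moving one factor of the group to the other side of the inner product turns the continuation of one orbit into that of the other, read along the strip in the opposite direction.\<close>

lemma AG_symmetric:
  assumes "(f, g) \<in> AG" "(f', g') \<in> AG"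
  shows "cinner f' g = cinner g' f"
proof -
  obtain F where F: "strip_fun F" "\<And>s::real. F (of_real s) = cinner f' (U s f)" "F (-\<i>) = cinner f' g"
    using AG_D[OF assms(1), where h = f'] by blast
  obtain G where G: "strip_fun G" "\<And>s::real. G (of_real s) = cinner f (U s f')" "G (-\<i>) = cinner f g'"
    using AG_D[OF assms(2), where h = f] by blast
  have "F (-\<i>) = cnj (G (- cnj (-\<i>)))"
  proof (rule strip_fun_unique[OF F(1) strip_fun_reflect[OF G(1)]])
    fix s :: real
    have "cnj (G (- cnj (of_real s))) = cnj (cinner f (U (-s) f'))" using G(2)[of "-s"] by simp
    also have "\<dots> = cinner (U (-s) f') f" by (rule cinner_commute[symmetric])
    finally show "F (of_real s) = cnj (G (- cnj (of_real s)))" by (simp add: F(2) U_adj[of f'])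
  qed simp_all
  then show ?thesis by (simp add: F(3) G(3) cinner_commute[of g' f])
qed

text \<open>Symmetry applied twice gives \<open>\<parallel>p\<parallel>\<^sup>2 = - \<parallel>r\<parallel>\<^sup>2\<close>: the eigenvalues \<open>\<plusminus>i\<close> cannot occur for a symmetric operator.\<close>

lemma AG_kernel:
  assumes "(f, 0) \<in> AG" shows "f = 0"
proof -
  obtain F where F: "strip_fun F" "\<And>s::real. F (of_real s) = cinner f (U s f)"
    "\<And>s::real. F (of_real s - \<i>) = cinner f (U s 0)" using AG_strip[OF assms, where h = f] by blast
  have U0: "U s 0 = 0" for s using U_norm[of s 0] by simp
  have "cnj (F (cnj (-\<i>) - \<i>)) = 0"
    by (rule strip_fun_zero[OF strip_fun_flip[OF F(1)]]) (simp_all add: F(3) U0)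
  then have "F 0 = 0" by simp
  with F(2)[of 0] have "cinner f f = 0" by (simp add: U_zero)
  then show ?thesis by (simp add: cinner_self)
qed

text \<open>The restriction to a dense invariant domain already determines the analytic generator.\<close>

lemma adjoint_core_subset_AG:
  assumes K: "K \<subseteq> AG"
    and inv: "\<And>h k s. (h, k) \<in> K \<Longrightarrow> (U s h, U s k) \<in> K"
    and dense: "closure (fst ` K) = UNIV"
    and adj: "\<And>h k. (h, k) \<in> K \<Longrightarrow> cinner f k = cinner g h"
  shows "(f, g) \<in> AG"
proof -
  define P where "P = (\<lambda>h F. strip_fun F \<and> (\<forall>s::real. F (of_real s) = cinner h (U s f)) \<and>
    (\<forall>s::real. F (of_real s - \<i>) = cinner h (U s g)))"
  have core: "\<exists>F. P h F" if hk: "(h, k) \<in> K" for h k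
  proof -
    obtain E where E: "strip_fun E" "\<And>s::real. E (of_real s) = cinner f (U s h)"
      "\<And>s::real. E (of_real s - \<i>) = cinner f (U s k)" using AG_strip[OF subsetD[OF K hk], where h = f] by blast
    have E3: "E (of_real s - \<i>) = cinner g (U s h)" for s :: real
      using adj[OF inv[OF hk]] by (simp add: E(3))
    have "cnj (E (- cnj (of_real s))) = cinner h (U s f)" for s :: real
      using E(2)[of "-s"] by (simp add: U_adj[of h] cinner_commute[of _ f])
    moreover have "cnj (E (- cnj (of_real s - \<i>))) = cinner h (U s g)" for s :: real
      using E3[of "-s"] by (simp add: U_adj[of h] cinner_commute[of _ g])
    ultimately have "P h (\<lambda>z. cnj (E (- cnj z)))" unfolding P_def using strip_fun_reflect[OF E(1)] by blast
    then show ?thesis by blast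
  qed
  have "\<exists>F. strip_fun F \<and> (\<forall>s::real. F (of_real s) = cinner h (U s f)) \<and> F (-\<i>) = cinner h g" for h
  proof -
    have "h \<in> closure (fst ` K)" using dense by simp
    then obtain hn where hn: "\<And>n. hn n \<in> fst ` K" "hn \<longlonglongrightarrow> h" unfolding closure_sequential by blast
    have "\<forall>n. \<exists>F. P (hn n) F"
    proof
      fix n obtain k where "(hn n, k) \<in> K" using hn(1)[of n] by force
      then show "\<exists>F. P (hn n) F" by (rule core)
    qed
    from choice[OF this] obtain F where F: "\<forall>n. P (hn n) (F n)" ..
    have F1: "strip_fun (F n)" for n using F by (simp add: P_def)
    have F2: "F n (of_real s) = cinner (hn n) (U s f)" "F n (of_real s - \<i>) = cinner (hn n) (U s g)"
      for n and s :: real using F by (simp_all add: P_def)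
    have b: "cmod (F n z - F m z) \<le> max (norm f) (norm g) * norm (hn n - hn m)"
      if z: "-1 \<le> Im z" "Im z \<le> 0" for n m z
    proof (rule strip_maximum_principle[OF strip_fun_diff[OF F1 F1] _ _ z])
      fix s :: real
      have "cmod (cinner (hn n - hn m) (U s u)) \<le> max (norm f) (norm g) * norm (hn n - hn m)"
        if "norm u \<le> max (norm f) (norm g)" for u
        using U_bound[of "hn n - hn m" s u] mult_left_mono[OF that norm_ge_zero[of "hn n - hn m"]]
        by (simp add: mult.commute)
      then show "cmod (F n (of_real s) - F m (of_real s)) \<le> max (norm f) (norm g) * norm (hn n - hn m)"
        "cmod (F n (of_real s - \<i>) - F m (of_real s - \<i>)) \<le> max (norm f) (norm g) * norm (hn n - hn m)"
        unfolding F2 cinner_diff_left[symmetric] by simp_all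
    qed
    from strip_fun_limit[OF F1 hn(2) b] obtain G where
      G: "strip_fun G" "\<And>z. -1 \<le> Im z \<Longrightarrow> Im z \<le> 0 \<Longrightarrow> (\<lambda>n. F n z) \<longlonglongrightarrow> G z" by blast
    have "G (of_real s) = cinner h (U s f)" for s :: real
    proof (rule LIMSEQ_unique[OF G(2)])
      show "(\<lambda>n. F n (of_real s)) \<longlonglongrightarrow> cinner h (U s f)" unfolding F2 by (intro tendsto_cinner hn tendsto_const)
    qed auto
    moreover have "G (-\<i>) = cinner h g"
    proof (rule LIMSEQ_unique[OF G(2)])
      have "(\<lambda>n. F n (of_real 0 - \<i>)) \<longlonglongrightarrow> cinner h (U 0 g)" unfolding F2 by (intro tendsto_cinner hn tendsto_const)
      then show "(\<lambda>n. F n (-\<i>)) \<longlonglongrightarrow> cinner h g" by (simp add: U_zero)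
    qed auto
    ultimately show ?thesis using G(1) by blast
  qed
  then show ?thesis by (simp add: AG_def)
qed

lemma AG_eq_adjoint_core:
  assumes K: "K \<subseteq> AG"
    and inv: "\<And>h k s. (h, k) \<in> K \<Longrightarrow> (U s h, U s k) \<in> K"
    and dense: "closure (fst ` K) = UNIV"
  shows "(f, g) \<in> AG \<longleftrightarrow> (\<forall>(h, k)\<in>K. cinner f k = cinner g h)"
proof
  assume fg: "(f, g) \<in> AG"
  show "\<forall>(h, k)\<in>K. cinner f k = cinner g h"
    using AG_symmetric[OF _ fg] K by blast
next
  assume "\<forall>(h, k)\<in>K. cinner f k = cinner g h"
  then show "(f, g) \<in> AG" by (intro adjoint_core_subset_AG[OF K inv dense]) auto
qed

lemma AG_closed:
  assumes K: "K \<subseteq> AG"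
    and inv: "\<And>h k s. (h, k) \<in> K \<Longrightarrow> (U s h, U s k) \<in> K"
    and dense: "closure (fst ` K) = UNIV"
  shows "closed AG"
  unfolding closed_sequential_limits
proof (intro allI impI, elim conjE)
  fix x l assume x: "\<forall>n. x n \<in> AG" "x \<longlonglongrightarrow> l"
  have "\<forall>(h, k)\<in>K. cinner (fst l) k = cinner (snd l) h"
  proof clarify
    fix h k assume hk: "(h, k) \<in> K"
    have "(\<lambda>n. cinner (fst (x n)) k) \<longlonglongrightarrow> cinner (fst l) k"
      "(\<lambda>n. cinner (snd (x n)) h) \<longlonglongrightarrow> cinner (snd l) h"
      by (intro tendsto_cinner tendsto_fst tendsto_snd x tendsto_const)+
    moreover have "cinner (fst (x n)) k = cinner (snd (x n)) h" for n
      using x(1)[rule_format, of n] AG_eq_adjoint_core[OF K inv dense, of "fst (x n)" "snd (x n)"] hk by auto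
    ultimately show "cinner (fst l) k = cinner (snd l) h" by (simp add: LIMSEQ_unique)
  qed
  then show "l \<in> AG" using AG_eq_adjoint_core[OF K inv dense, of "fst l" "snd l"] by simp
qed

text \<open>The graph is the orthogonal sum of the closure of the core and its complement inside the graph. A pair in the complement yields an eigenvector for \<open>\<plusminus>i\<close>, which does not exist.\<close>

lemma AG_eq_closure_core:
  assumes K: "K \<subseteq> AG"
    and inv: "\<And>h k s. (h, k) \<in> K \<Longrightarrow> (U s h, U s k) \<in> K"
    and dense: "closure (fst ` K) = UNIV"
    and sub: "subspace K" and scale: "\<And>h k. (h, k) \<in> K \<Longrightarrow> (\<i> *\<^sub>C h, \<i> *\<^sub>C k) \<in> K"
  shows "AG = closure K"
proof
  show "closure K \<subseteq> AG" by (rule closure_minimal[OF K AG_closed[OF K inv dense]])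
  show "AG \<subseteq> closure K"
  proof
    fix x assume x: "x \<in> AG"
    obtain y where y: "y \<in> closure K" "\<forall>s\<in>K. inner (x - y) s = 0" using subspace_projection[OF sub, of x] by blast
    define p r where "p = fst (x - y)" and "r = snd (x - y)"
    have pr: "(p, r) \<in> AG"
      unfolding p_def r_def prod.collapse
      using subspace_diff[OF AG_subspace x] y(1) \<open>closure K \<subseteq> AG\<close> by blast
    have orth: "cinner p h + cinner r k = 0" if hk: "(h, k) \<in> K" for h k
    proof -
      have "inner p h + inner r k = 0" using y(2)[rule_format, OF hk] by (simp add: p_def r_def inner_prod_def)
      moreover have "inner p (\<i> *\<^sub>C h) + inner r (\<i> *\<^sub>C k) = 0"
        using y(2)[rule_format, OF scale[OF hk]] by (simp add: p_def r_def inner_prod_def)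
      ultimately show ?thesis by (simp add: inner_l2_def cinner_scale_right complex_eq_iff)
    qed
    have "(r, - p) \<in> AG"
    proof (rule adjoint_core_subset_AG[OF K inv dense])
      fix h k assume "(h, k) \<in> K"
      from orth[OF this] show "cinner r k = cinner (- p) h"
        by (simp add: add_eq_0_iff)
    qed
    from AG_symmetric[OF this pr] have "cinner p (- p) = cinner r r" .
    then have "- cinner p p = cinner r r" by simp
    then have "cinner p p + cinner r r = 0" by (metis add.right_inverse)
    then have "complex_of_real ((norm p)\<^sup>2 + (norm r)\<^sup>2) = 0" by (simp only: cinner_self of_real_add)
    then have "(norm p)\<^sup>2 + (norm r)\<^sup>2 = 0" by (simp only: of_real_eq_0_iff)
    then have "p = 0" "r = 0" by (simp_all add: add_nonneg_eq_0_iff)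
    then have "x - y = 0" unfolding p_def r_def by (simp add: prod_eq_iff)
    then show "x \<in> closure K" using y(1) by simp
  qed
qed

end

section \<open>Gaussian functions\<close>

lemma integrable_exp_abs: "integrable lborel (\<lambda>t::real. exp (- \<bar>t\<bar>))"
proof (rule integrableI_bounded)
  have half: "(\<integral>\<^sup>+t. ennreal (exp (- t)) * indicator {0..} t \<partial>lborel) = ennreal (0 - (- exp (- 0 :: real)))"
  proof (rule nn_integral_FTC_atLeast)
    show "((\<lambda>a :: real. - exp (- a)) \<longlongrightarrow> 0) at_top"
      using tendsto_minus[OF filterlim_compose[OF exp_at_bot filterlim_uminus_at_bot_at_top]] by simp
  qed (auto intro!: derivative_eq_intros)
  have half': "(\<integral>\<^sup>+t. ennreal (exp t) * indicator {..0} t \<partial>lborel) = 1"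
  proof -
    have "(\<integral>\<^sup>+t. ennreal (exp t) * indicator {..0::real} t \<partial>lborel)
        = ennreal \<bar>-1\<bar> * (\<integral>\<^sup>+t. ennreal (exp (0 + (-1) * t)) * indicator {..0::real} (0 + (-1) * t) \<partial>lborel)"
      by (rule nn_integral_real_affine) auto
    also have "\<dots> = (\<integral>\<^sup>+t. ennreal (exp (- t)) * indicator {0..} t \<partial>lborel)"
      by (simp add: indicator_def)
    finally show ?thesis using half by simp
  qed
  have "(\<integral>\<^sup>+t. ennreal (norm (exp (- \<bar>t :: real\<bar>))) \<partial>lborel)
      \<le> (\<integral>\<^sup>+t. ennreal (exp (- t)) * indicator {0..} t + ennreal (exp t) * indicator {..0} t \<partial>lborel)"
    by (intro nn_integral_mono) (auto simp: indicator_def)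
  also have "\<dots> = 1 + 1" using half half' by (subst nn_integral_add) auto
  also have "\<dots> < \<infinity>" by simp
  finally show "(\<integral>\<^sup>+t. ennreal (norm (exp (- \<bar>t :: real\<bar>))) \<partial>lborel) < \<infinity>" .
qed simp

lemma integrable_gauss_1d:
  assumes "g > 0"
  shows "integrable lborel (\<lambda>t::real. exp (- g * t\<^sup>2 + R * \<bar>t\<bar>))"
proof (rule Bochner_Integration.integrable_bound)
  let ?C = "(R + 1)\<^sup>2 / (4 * g)"
  show "integrable lborel (\<lambda>t::real. exp ?C * exp (- \<bar>t\<bar>))"
    by (intro integrable_mult_right integrable_exp_abs)
  have "- g * t\<^sup>2 + R * \<bar>t\<bar> \<le> ?C + - \<bar>t\<bar>" for t :: real
  proof -
    have "0 \<le> (2 * g * \<bar>t\<bar> - (R + 1))\<^sup>2 / (4 * g)" using assms by simp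
    also have "\<dots> = ?C - (R + 1) * \<bar>t\<bar> + g * \<bar>t\<bar>\<^sup>2"
      using assms by (simp add: power2_diff power_mult_distrib field_simps) (simp add: power2_eq_square)
    finally show ?thesis by (simp add: algebra_simps)
  qed
  then show "AE t in lborel. norm (exp (- g * t\<^sup>2 + R * \<bar>t\<bar>)) \<le> norm (exp ?C * exp (- \<bar>t\<bar>))"
    unfolding exp_add[symmetric] by simp
qed simp

definition l1 :: "'a::euclidean_space \<Rightarrow> real" where "l1 x = (\<Sum>b\<in>Basis. \<bar>x \<bullet> b\<bar>)"

lemma l1_measurable [measurable]: "l1 \<in> borel_measurable borel"
  unfolding l1_def[abs_def] by measurable

lemma l1_nonneg: "l1 x \<ge> 0" by (simp add: l1_def sum_nonneg)

lemma integrable_gauss: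
  assumes g: "g > 0"
  shows "integrable lborel (\<lambda>x::'a::euclidean_space. exp (- g * (x \<bullet> x) + R * l1 x))"
proof (rule integrableI_bounded)
  show "(\<lambda>x::'a. exp (- g * (x \<bullet> x) + R * l1 x)) \<in> borel_measurable lborel" by measurable
  have e: "exp (- g * (x \<bullet> x) + R * l1 x) = (\<Prod>b\<in>Basis. exp (- g * (x \<bullet> b)\<^sup>2 + R * \<bar>x \<bullet> b\<bar>))" for x :: 'a
    by (simp add: exp_sum[symmetric] l1_def sum.distrib sum_distrib_left sum_subtractf sum_negf euclidean_inner[of x x] power2_eq_square)
  have "(\<integral>\<^sup>+x. ennreal (norm (exp (- g * (x \<bullet> x) + R * l1 x))) \<partial>(lborel :: 'a measure))
      = (\<integral>\<^sup>+x. (\<Prod>b\<in>Basis. ennreal (exp (- g * (x \<bullet> b)\<^sup>2 + R * \<bar>x \<bullet> b\<bar>))) \<partial>(lborel :: 'a measure))"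
    by (intro nn_integral_cong) (simp only: real_norm_def abs_prod abs_exp_cancel e prod_ennreal[OF exp_ge_zero])
  also have "\<dots> = (\<Prod>b\<in>(Basis :: 'a set). (\<integral>\<^sup>+t. ennreal (exp (- g * t\<^sup>2 + R * \<bar>t\<bar>)) \<partial>lborel))"
    by (rule nn_integral_lborel_prod) auto
  also have "\<dots> < \<infinity>"
    using integrable_gauss_1d[OF g, of R] by (auto simp: integrable_iff_bounded power_eq_top_ennreal less_top[symmetric])
  finally show "(\<integral>\<^sup>+x. ennreal (norm (exp (- g * (x \<bullet> x) + R * l1 x))) \<partial>(lborel :: 'a measure)) < \<infinity>" .
qed

definition cdot :: "complex ^ 'n::finite \<Rightarrow> complex ^ 'n \<Rightarrow> complex" where
  "cdot w v = (\<Sum>i\<in>UNIV. w $ i * v $ i)"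

definition cvec :: "real ^ 'n::finite \<Rightarrow> complex ^ 'n" where
  "cvec x = (\<chi> i. complex_of_real (x $ i))"

lemma cdot_simps:
  "cdot (w + w') v = cdot w v + cdot w' v" "cdot w (v + v') = cdot w v + cdot w v'"
  "cdot (w - w') v = cdot w v - cdot w' v" "cdot w (v - v') = cdot w v - cdot w v'"
  "cdot (c *s w) v = c * cdot w v" "cdot w (c *s v) = c * cdot w v"
  by (simp_all add: cdot_def sum.distrib sum_subtractf algebra_simps sum_distrib_left)

lemma cdot_commute: "cdot w v = cdot v w"
  by (simp add: cdot_def mult.commute)

lemma cvec_simps: "cvec (x + y) = cvec x + cvec y" "cvec (r *\<^sub>R x) = complex_of_real r *s cvec x"
  "cdot (cvec x) (cvec y) = complex_of_real (x \<bullet> y)"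
  by (simp_all add: cvec_def vec_eq_iff cdot_def inner_vec_def)

lemma cvec_zero [simp]: "cvec 0 = 0" and cdot_zero [simp]: "cdot 0 v = 0" "cdot w 0 = 0"
  by (simp_all add: cvec_def vec_eq_iff cdot_def)

lemma cdot_minus [simp]: "cdot (- w) v = - cdot w v"
  by (simp add: cdot_def sum_negf)

lemma cdot_cvec_measurable [measurable]: "(\<lambda>x. cdot w (cvec x)) \<in> borel_measurable borel"
  unfolding cdot_def cvec_def by (intro borel_measurable_continuous_onI continuous_intros)

definition cn :: "complex ^ 'n::finite \<Rightarrow> real" where "cn w = (\<Sum>i\<in>UNIV. cmod (w $ i))"

lemma cdot_cvec_bound: "cmod (cdot w (cvec x)) \<le> cn w * l1 x"
proof -
  have "\<bar>x $ i\<bar> \<le> l1 x" for i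
  proof -
    have "\<bar>x \<bullet> axis i 1\<bar> \<le> l1 x" unfolding l1_def
      by (rule member_le_sum[of "axis i 1" Basis "\<lambda>b. \<bar>x \<bullet> b\<bar>"]) (auto simp: axis_in_Basis_iff)
    then show ?thesis by (simp add: inner_axis)
  qed
  then have "(\<Sum>i\<in>UNIV. cmod (w $ i * complex_of_real (x $ i))) \<le> (\<Sum>i\<in>UNIV. cmod (w $ i) * l1 x)"
    by (intro sum_mono) (simp add: norm_mult mult_left_mono)
  then show ?thesis unfolding cdot_def cvec_def cn_def sum_distrib_right
    using sum_norm_le[of UNIV "\<lambda>i. w $ i * complex_of_real (x $ i)"] by (simp add: order_trans[OF norm_sum])
qed

definition gs :: "real \<Rightarrow> complex ^ 'n::finite \<Rightarrow> real ^ 'n \<Rightarrow> complex" where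
  "gs \<gamma> w x = exp (cdot w (cvec x) - of_real \<gamma> * cdot (cvec x) (cvec x))"

lemma gs_measurable [measurable]: "gs \<gamma> w \<in> borel_measurable borel"
  unfolding gs_def[abs_def] cvec_simps by measurable

lemma gs_bound: "cmod (gs \<gamma> w x) \<le> exp (- \<gamma> * (x \<bullet> x) + cn w * l1 x)"
proof -
  have "Re (cdot w (cvec x)) \<le> cn w * l1 x"
    using cdot_cvec_bound[of w x] abs_Re_le_cmod[of "cdot w (cvec x)"] by linarith
  then show ?thesis by (simp add: gs_def norm_exp_eq_Re cvec_simps)
qed

lemma gauss_L2:
  assumes "g > 0"
  shows "(\<lambda>x::'a::euclidean_space. complex_of_real (exp (- g * (x \<bullet> x) + R * l1 x))) \<in> L2"
proof -
  have "(cmod (complex_of_real (exp (- g * (x \<bullet> x) + R * l1 x))))\<^sup>2 = exp (- (2 * g) * (x \<bullet> x) + (2 * R) * l1 x)" for x :: 'a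
    by (simp add: exp_double[symmetric] algebra_simps)
  then show ?thesis unfolding L2_def using integrable_gauss[of "2 * g" "2 * R"] assms by simp
qed

lemma gs_L2: "\<gamma> > 0 \<Longrightarrow> gs \<gamma> w \<in> L2"
  by (rule L2_bound[OF gauss_L2[of \<gamma> "cn w"]]) (use gs_bound in auto)

text \<open>Expanding the exponential turns the integral into an everywhere convergent power series.\<close>

lemma entire_exp_integral:
  fixes \<phi> l :: "'a::euclidean_space \<Rightarrow> complex"
  assumes [measurable]: "\<phi> \<in> borel_measurable borel" "l \<in> borel_measurable borel"
    and int: "\<And>R. R \<ge> 0 \<Longrightarrow> integrable lborel (\<lambda>x. cmod (\<phi> x) * exp (R * cmod (l x)))"
  shows "(\<lambda>z. LINT x|lborel. \<phi> x * exp (z * l x)) holomorphic_on UNIV"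
proof -
  define a where "a n = (LINT x|lborel. \<phi> x * (l x ^ n /\<^sub>R fact n))" for n
  have s: "(\<lambda>n. a n * z ^ n) sums (LINT x|lborel. \<phi> x * exp (z * l x))" for z
  proof -
    define f where "f n x = \<phi> x * ((z * l x) ^ n /\<^sub>R fact n)" for n x
    have fb: "(\<Sum>i\<le>n. norm (f i x)) \<le> cmod (\<phi> x) * exp (cmod z * cmod (l x))" for n x
    proof -
      have "(\<Sum>i\<le>n. norm (f i x)) = cmod (\<phi> x) * (\<Sum>i\<le>n. (cmod z * cmod (l x)) ^ i /\<^sub>R fact i)"
        by (simp add: f_def norm_mult norm_power sum_distrib_left norm_divide mult_ac)
      also have "(\<Sum>i\<le>n. (cmod z * cmod (l x)) ^ i /\<^sub>R fact i) \<le> exp (cmod z * cmod (l x))"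
        unfolding exp_def by (rule sum_le_suminf) (auto intro: summable_exp)
      finally show ?thesis by (simp add: mult_left_mono)
    qed
    have fi: "integrable lborel (f n)" for n
    proof (rule Bochner_Integration.integrable_bound[OF int[of "cmod z"]])
      show "AE x in lborel. norm (f n x) \<le> norm (cmod (\<phi> x) * exp (cmod z * cmod (l x)))"
        using order_trans[OF member_le_sum[of n "{..n}" "\<lambda>i. norm (f i x)" for x] fb] by simp
      show "f n \<in> borel_measurable lborel" unfolding f_def[abs_def] by measurable
    qed simp
    have "(\<lambda>n. integral\<^sup>L lborel (f n)) sums (LINT x|lborel. (suminf (\<lambda>n. f n x)))"
    proof (rule sums_integral[OF fi])
      show "AE x in lborel. summable (\<lambda>i. norm (f i x))"
        using bounded_imp_summable[OF _ fb] by simp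
      show "summable (\<lambda>i. LINT x|lborel. norm (f i x))"
      proof (rule bounded_imp_summable)
        fix n
        have "(\<Sum>i\<le>n. LINT x|lborel. norm (f i x)) = (LINT x|lborel. (\<Sum>i\<le>n. norm (f i x)))"
          by (subst Bochner_Integration.integral_sum) (auto intro: fi)
        also have "\<dots> \<le> (LINT x|lborel. cmod (\<phi> x) * exp (cmod z * cmod (l x)))"
          by (intro integral_mono fb int Bochner_Integration.integrable_sum integrable_norm fi) simp
        finally show "(\<Sum>i\<le>n. LINT x|lborel. norm (f i x)) \<le> (LINT x|lborel. cmod (\<phi> x) * exp (cmod z * cmod (l x)))" .
      qed simp
    qed
    moreover have "suminf (\<lambda>n. f n x) = \<phi> x * exp (z * l x)" for x
      unfolding f_def exp_def by (rule suminf_mult) (rule summable_exp_generic)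
    moreover have "integral\<^sup>L lborel (f n) = a n * z ^ n" for n
    proof -
      have "integral\<^sup>L lborel (f n) = (LINT x|lborel. (\<phi> x * (l x ^ n /\<^sub>R fact n)) * z ^ n)"
        by (intro Bochner_Integration.integral_cong) (simp_all add: f_def power_mult_distrib mult.commute)
      then show ?thesis by (simp add: a_def)
    qed
    ultimately show ?thesis by simp
  qed
  have "(\<lambda>z. LINT x|lborel. \<phi> x * exp (z * l x)) holomorphic_on ball 0 r" for r
    by (rule power_series_holomorphic[where a = a]) (use s in simp)
  then have "(\<lambda>z. LINT x|lborel. \<phi> x * exp (z * l x)) field_differentiable at z" for z
    using holomorphic_on_imp_differentiable_at[of _ "ball 0 (norm z + 1)" z] by simp
  then show ?thesis by (simp add: holomorphic_on_def field_differentiable_at_within)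
qed

section \<open>The Weyl operators\<close>

definition Wf :: "real \<Rightarrow> real ^ 'n::finite \<Rightarrow> real ^ 'n \<Rightarrow> real \<Rightarrow> (real ^ 'n \<Rightarrow> complex) \<Rightarrow> (real ^ 'n \<Rightarrow> complex)" where
  "Wf b \<alpha> \<beta> s f x =
     exp (\<i> * complex_of_real (2 * pi * b * s * (\<alpha> \<bullet> x) + pi * b\<^sup>2 * s\<^sup>2 * (\<alpha> \<bullet> \<beta>))) * f (x + (b * s) *\<^sub>R \<beta>)"

lemma exp_i_norm: "cmod (exp (\<i> * complex_of_real r)) = 1"
  by (simp add: norm_exp_eq_Re)

lemma integral_translate:
  fixes f :: "'a::euclidean_space \<Rightarrow> 'b::{banach,second_countable_topology}"
  assumes [measurable]: "f \<in> borel_measurable borel"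
  shows "(LINT x|lborel. f (x + t)) = (LINT x|lborel. f x)" "integrable lborel (\<lambda>x. f (x + t)) \<longleftrightarrow> integrable lborel f"
proof -
  have d: "lborel = distr lborel borel (\<lambda>x. x + t)"
    using lborel_affine[of 1 t] by (simp add: add.commute density_1)
  show "(LINT x|lborel. f (x + t)) = (LINT x|lborel. f x)"
    by (subst (2) d) (simp add: integral_distr)
  show "integrable lborel (\<lambda>x. f (x + t)) \<longleftrightarrow> integrable lborel f"
    by (subst (2) d) (simp add: integrable_distr_eq)
qed

lemma Wf_measurable:
  assumes [measurable]: "f \<in> borel_measurable borel"
  shows "Wf b \<alpha> \<beta> s f \<in> borel_measurable borel"
  unfolding Wf_def[abs_def] by measurable

lemma Wf_L2:
  assumes f: "f \<in> L2" shows "Wf b \<alpha> \<beta> s f \<in> L2"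
proof -
  have [measurable]: "f \<in> borel_measurable borel" using f by (rule L2_measurable)
  have "integrable lborel (\<lambda>x. (cmod (f (x + (b * s) *\<^sub>R \<beta>)))\<^sup>2)"
    by (subst integral_translate(2)[of "\<lambda>x. (cmod (f x))\<^sup>2"]) (measurable, rule L2_square_integrable[OF f])
  then show ?thesis using Wf_measurable[of f] by (simp add: L2_def Wf_def norm_mult exp_i_norm)
qed

lemma Wf_inner: "f \<in> L2 \<Longrightarrow> g \<in> L2 \<Longrightarrow> l2_inner (Wf b \<alpha> \<beta> s f) (Wf b \<alpha> \<beta> s g) = l2_inner f g"
proof -
  assume f: "f \<in> L2" and g: "g \<in> L2"
  have e: "cnj (exp (\<i> * complex_of_real r)) * exp (\<i> * complex_of_real r) = 1" for r
    by (simp add: exp_cnj exp_add[symmetric])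
  have e2: "cnj (exp (\<i> * complex_of_real r) * u) * (exp (\<i> * complex_of_real r) * v) = cnj u * v" for r u v
  proof -
    have "cnj (exp (\<i> * complex_of_real r) * u) * (exp (\<i> * complex_of_real r) * v)
        = (cnj (exp (\<i> * complex_of_real r)) * exp (\<i> * complex_of_real r)) * (cnj u * v)"
      unfolding complex_cnj_mult by (simp only: mult_ac)
    then show ?thesis unfolding e by simp
  qed
  show ?thesis unfolding l2_inner_def Wf_def e2
    by (rule integral_translate(1)) (use f g in \<open>auto simp: L2_def intro!: borel_measurable_times measurable_compose[OF _ cnj_measurable]\<close>)
qed

lemma Wf_add: "Wf b \<alpha> \<beta> (s + t) f = Wf b \<alpha> \<beta> s (Wf b \<alpha> \<beta> t f)"
  by (rule ext) (simp add: Wf_def exp_add[symmetric] algebra_simps inner_add_right inner_scaleR_right power2_eq_square)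

lemma Wf_zero: "Wf b \<alpha> \<beta> 0 f = f"
  by (rule ext) (simp add: Wf_def)

lemma Wf_diff: "Wf b \<alpha> \<beta> s (\<lambda>x. f x - g x) x = Wf b \<alpha> \<beta> s f x - Wf b \<alpha> \<beta> s g x"
  by (simp add: Wf_def algebra_simps)

lemma ae_eq_iff_inner: "f \<in> L2 \<Longrightarrow> g \<in> L2 \<Longrightarrow> ae_eq f g \<longleftrightarrow> l2_inner (\<lambda>x. f x - g x) (\<lambda>x. f x - g x) = 0"
  using l2_inner_self_eq_0[OF L2_diff, of f g] by (simp add: ae_eq_def)

lemma Wf_ae_cong:
  assumes A: "f \<in> L2" "g \<in> L2" "ae_eq f g"
  shows "ae_eq (Wf b \<alpha> \<beta> s f) (Wf b \<alpha> \<beta> s g)"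
proof -
  have "l2_inner (Wf b \<alpha> \<beta> s (\<lambda>x. f x - g x)) (Wf b \<alpha> \<beta> s (\<lambda>x. f x - g x)) = 0"
    using A by (simp add: Wf_inner L2_diff ae_eq_iff_inner)
  then show ?thesis
    unfolding ae_eq_iff_inner[OF Wf_L2[OF A(1)] Wf_L2[OF A(2)]] Wf_diff[abs_def] .
qed

lift_definition Wl :: "real \<Rightarrow> real ^ 'n::finite \<Rightarrow> real ^ 'n \<Rightarrow> real \<Rightarrow> (real ^ 'n) l2 \<Rightarrow> (real ^ 'n) l2" is Wf
  by (simp add: Wf_L2 Wf_ae_cong)

lemma Wl_cls: "f \<in> L2 \<Longrightarrow> Wl b \<alpha> \<beta> s (cls f) = cls (Wf b \<alpha> \<beta> s f)"
  by (rule Wl.abs_eq) (simp add: ae_eq_refl)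

lemma ugroup_Wl:
  fixes \<alpha> \<beta> :: "real ^ 'n::finite"
  shows "ugroup (Wl b \<alpha> \<beta>)"
proof
  fix s t :: real and f g :: "(real ^ 'n) l2"
  show "cinner (Wl b \<alpha> \<beta> s f) (Wl b \<alpha> \<beta> s g) = cinner f g" by transfer (simp add: Wf_inner)
  show "Wl b \<alpha> \<beta> 0 f = f" by transfer (simp add: Wf_zero ae_eq_refl)
  show "Wl b \<alpha> \<beta> (s + t) f = Wl b \<alpha> \<beta> s (Wl b \<alpha> \<beta> t f)" by transfer (simp add: Wf_add ae_eq_refl Wf_L2)
qed

definition kap :: "real \<Rightarrow> real ^ 'n::finite \<Rightarrow> real ^ 'n \<Rightarrow> real \<Rightarrow> complex ^ 'n" where
  "kap b \<alpha> \<beta> \<gamma> = (2 * of_real pi * \<i> * of_real b) *s cvec \<alpha> - (2 * of_real \<gamma> * of_real b) *s cvec \<beta>"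

definition cf :: "real \<Rightarrow> real ^ 'n::finite \<Rightarrow> real ^ 'n \<Rightarrow> real \<Rightarrow> complex ^ 'n \<Rightarrow> complex \<Rightarrow> complex" where
  "cf b \<alpha> \<beta> \<gamma> w z = exp ((\<i> * of_real pi * of_real b ^ 2 * cdot (cvec \<alpha>) (cvec \<beta>)
      - of_real \<gamma> * of_real b ^ 2 * cdot (cvec \<beta>) (cvec \<beta>)) * z ^ 2 + of_real b * z * cdot w (cvec \<beta>))"

text \<open>A Weyl operator multiplies a Gaussian by a scalar and shifts its linear exponent. Both depend on the parameter in an entire way, which is why Gaussians are analytic vectors.\<close>

lemma Wf_gs: "Wf b \<alpha> \<beta> s (gs \<gamma> w) x = cf b \<alpha> \<beta> \<gamma> w (of_real s) * gs \<gamma> (w + of_real s *s kap b \<alpha> \<beta> \<gamma>) x"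
proof -
  have e: "complex_of_real (2 * pi * b * s * (\<alpha> \<bullet> x) + pi * b\<^sup>2 * s\<^sup>2 * (\<alpha> \<bullet> \<beta>))
    = 2 * of_real pi * of_real b * of_real s * cdot (cvec \<alpha>) (cvec x) + of_real pi * of_real b ^ 2 * of_real s ^ 2 * cdot (cvec \<alpha>) (cvec \<beta>)"
    by (simp add: cvec_simps(3))
  show ?thesis
    unfolding Wf_def gs_def cf_def exp_add[symmetric] e
    by (simp add: cvec_simps(1,2) cdot_simps kap_def cdot_commute[of "cvec \<beta>" "cvec x"] algebra_simps power2_eq_square)
qed

lemma cf_cocycle:
  "cf b \<alpha> \<beta> \<gamma> w (z + z') = cf b \<alpha> \<beta> \<gamma> w z * cf b \<alpha> \<beta> \<gamma> (w + z *s kap b \<alpha> \<beta> \<gamma>) z'"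
  unfolding cf_def exp_add[symmetric]
  by (simp add: cdot_simps kap_def algebra_simps power2_eq_square)

lemma gs_pairing_entire:
  assumes h: "h \<in> L2" and \<gamma>: "\<gamma> > 0"
  shows "(\<lambda>z. l2_inner h (gs \<gamma> (w + z *s k))) holomorphic_on UNIV"
proof -
  have "(\<lambda>z. LINT x|lborel. (cnj (h x) * gs \<gamma> w x) * exp (z * cdot k (cvec x))) holomorphic_on UNIV"
  proof (rule entire_exp_integral)
    show "(\<lambda>x. cnj (h x) * gs \<gamma> w x) \<in> borel_measurable borel"
      using L2_measurable[OF cnj_L2[OF h]] by measurable
    fix R :: real assume R: "R \<ge> 0"
    define g where "g x = complex_of_real (cmod (gs \<gamma> w x) * exp (R * cmod (cdot k (cvec x))))" for x
    have "g \<in> L2"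
    proof (rule L2_bound[OF gauss_L2[OF \<gamma>, of "cn w + R * cn k"]])
      fix x
      have "exp (R * cmod (cdot k (cvec x))) \<le> exp (R * (cn k * l1 x))"
        using R cdot_cvec_bound[of k x] by (simp add: mult_left_mono)
      then have "cmod (gs \<gamma> w x) * exp (R * cmod (cdot k (cvec x))) \<le> exp (- \<gamma> * (x \<bullet> x) + cn w * l1 x) * exp (R * (cn k * l1 x))"
        by (intro mult_mono gs_bound) auto
      then show "cmod (g x) \<le> cmod (complex_of_real (exp (- \<gamma> * (x \<bullet> x) + (cn w + R * cn k) * l1 x)))"
        by (simp add: g_def exp_add[symmetric] norm_mult algebra_simps)
    qed (unfold g_def[abs_def], measurable)
    from integrable_norm[OF L2_mult_integrable[OF h this]]
    show "integrable lborel (\<lambda>x. cmod (cnj (h x) * gs \<gamma> w x) * exp (R * cmod (cdot k (cvec x))))"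
      by (simp add: g_def norm_mult mult.assoc)
  qed measurable
  moreover have "(LINT x|lborel. (cnj (h x) * gs \<gamma> w x) * exp (z * cdot k (cvec x))) = l2_inner h (gs \<gamma> (w + z *s k))" for z
    unfolding l2_inner_def
    by (intro Bochner_Integration.integral_cong) (simp_all add: gs_def exp_add[symmetric] cdot_simps algebra_simps)
  ultimately show ?thesis by simp
qed

lemma norm_gs_bound:
  fixes w :: "complex ^ 'n::finite"
  assumes \<gamma>: "\<gamma> > 0" and R: "cn w \<le> R"
  shows "norm (cls (gs \<gamma> w)) \<le> norm (cls (\<lambda>x :: real ^ 'n. complex_of_real (exp (- \<gamma> * (x \<bullet> x) + R * l1 x))))"
proof -
  have le: "(cmod (gs \<gamma> w x))\<^sup>2 \<le> (cmod (complex_of_real (exp (- \<gamma> * (x \<bullet> x) + R * l1 x))))\<^sup>2" for x :: "real ^ 'n"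
  proof (intro power_mono norm_ge_zero)
    have "- \<gamma> * (x \<bullet> x) + cn w * l1 x \<le> - \<gamma> * (x \<bullet> x) + R * l1 x"
      using R l1_nonneg[of x] by (simp add: mult_right_mono)
    then show "cmod (gs \<gamma> w x) \<le> cmod (complex_of_real (exp (- \<gamma> * (x \<bullet> x) + R * l1 x)))"
      using gs_bound[of \<gamma> w x] by (simp add: order_trans)
  qed
  show ?thesis
    unfolding norm_cls[OF gs_L2[OF \<gamma>]] norm_cls[OF gauss_L2[OF \<gamma>]]
    unfolding real_sqrt_le_iff
    by (rule integral_mono[OF L2_square_integrable[OF gs_L2[OF \<gamma>]] L2_square_integrable[OF gauss_L2[OF \<gamma>]] le])
qed

text \<open>The image of a Gaussian under the analytic generator.\<close>

definition TG :: "real \<Rightarrow> real ^ 'n::finite \<Rightarrow> real ^ 'n \<Rightarrow> real \<Rightarrow> complex ^ 'n \<Rightarrow> (real ^ 'n) l2" where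
  "TG b \<alpha> \<beta> \<gamma> w = cf b \<alpha> \<beta> \<gamma> w (-\<i>) *\<^sub>C cls (gs \<gamma> (w + (-\<i>) *s kap b \<alpha> \<beta> \<gamma>))"

text \<open>The entire continuation of the orbit of a Gaussian is evaluated at \<open>-i\<close>.\<close>

lemma gs_in_AG:
  fixes w :: "complex ^ 'n::finite"
  assumes \<gamma>: "\<gamma> > 0"
  shows "(cls (gs \<gamma> w), TG b \<alpha> \<beta> \<gamma> w) \<in> ugroup.AG (Wl b \<alpha> \<beta>)"
proof -
  interpret ugroup "Wl b \<alpha> \<beta>" by (rule ugroup_Wl)
  let ?k = "kap b \<alpha> \<beta> \<gamma>"
  have "\<exists>F. strip_fun F \<and> (\<forall>s::real. F (of_real s) = cinner h (Wl b \<alpha> \<beta> s (cls (gs \<gamma> w)))) \<and> F (-\<i>) = cinner h (TG b \<alpha> \<beta> \<gamma> w)"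
    for h :: "(real ^ 'n) l2"
  proof -
    obtain h' where h': "h' \<in> L2" "h = cls h'" by (rule cls_exhaust)
    define F where "F z = cf b \<alpha> \<beta> \<gamma> w z * l2_inner h' (gs \<gamma> (w + z *s ?k))" for z
    have Fc: "F z = cinner h (cf b \<alpha> \<beta> \<gamma> w z *\<^sub>C cls (gs \<gamma> (w + z *s ?k)))" for z
      by (simp add: F_def h' cinner_scale_right cinner_cls gs_L2 \<gamma>)
    have shift: "Wl b \<alpha> \<beta> s (cls (gs \<gamma> v)) = cf b \<alpha> \<beta> \<gamma> v (of_real s) *\<^sub>C cls (gs \<gamma> (v + of_real s *s ?k))" for s v
      by (simp add: Wl_cls gs_L2 \<gamma> cls_scale[symmetric] Wf_gs[abs_def])
    have hol: "F holomorphic_on UNIV"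
      unfolding F_def cf_def by (intro holomorphic_intros gs_pairing_entire h' \<gamma>)
    have "bounded (F ` {z. -1 \<le> Im z \<and> Im z \<le> 0})"
    proof -
      define D where "D = norm (cls (\<lambda>x. complex_of_real (exp (- \<gamma> * (x \<bullet> x) + (cn w + cn ?k) * l1 (x :: real ^ 'n)))))"
      have "compact ((\<lambda>y. cf b \<alpha> \<beta> \<gamma> w (\<i> * of_real y)) ` {-1..0})"
        unfolding cf_def by (intro compact_continuous_image continuous_intros) auto
      from compact_imp_bounded[OF this] obtain M
        where "\<forall>v\<in>(\<lambda>y. cf b \<alpha> \<beta> \<gamma> w (\<i> * of_real y)) ` {-1..0}. norm v \<le> M"
        unfolding bounded_iff ..
      then have M: "cmod (cf b \<alpha> \<beta> \<gamma> w (\<i> * of_real y)) \<le> M" if "y \<in> {-1..0}" for y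
        using that by blast
      have "cmod (F z) \<le> norm h * (M * D)" if z: "-1 \<le> Im z" "Im z \<le> 0" for z
      proof -
        let ?v = "w + (\<i> * of_real (Im z)) *s ?k"
        have zz: "z = \<i> * of_real (Im z) + of_real (Re z)" by (simp add: complex_eq_iff)
        have "cf b \<alpha> \<beta> \<gamma> w z *\<^sub>C cls (gs \<gamma> (w + z *s ?k)) = Wl b \<alpha> \<beta> (Re z) (cf b \<alpha> \<beta> \<gamma> w (\<i> * of_real (Im z)) *\<^sub>C cls (gs \<gamma> ?v))"
        proof -
          have "w + z *s ?k = ?v + of_real (Re z) *s ?k"
            by (subst zz) (simp add: vector_sadd_rdistrib add.assoc)
          moreover have "cf b \<alpha> \<beta> \<gamma> w z = cf b \<alpha> \<beta> \<gamma> w (\<i> * of_real (Im z)) * cf b \<alpha> \<beta> \<gamma> ?v (of_real (Re z))"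
            by (subst zz) (rule cf_cocycle)
          ultimately show ?thesis by (simp only: U_linear shift cscale_cscale)
        qed
        then have "cmod (F z) \<le> norm h * norm (cf b \<alpha> \<beta> \<gamma> w (\<i> * of_real (Im z)) *\<^sub>C cls (gs \<gamma> ?v))"
          unfolding Fc by (simp add: U_bound)
        also have "\<dots> \<le> norm h * (M * D)"
        proof (rule mult_left_mono)
          have "cn ?v \<le> cn w + cn ?k"
          proof -
            have "cmod (?v $ i) \<le> cmod (w $ i) + cmod (?k $ i)" for i
            proof -
              have "cmod (\<i> * of_real (Im z) * ?k $ i) \<le> 1 * cmod (?k $ i)"
                unfolding norm_mult using z by (intro mult_right_mono) auto
              then show ?thesis using norm_triangle_ineq[of "w $ i" "\<i> * of_real (Im z) * ?k $ i"] by simp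
            qed
            then show ?thesis unfolding cn_def sum.distrib[symmetric] by (intro sum_mono)
          qed
          then have "norm (cls (gs \<gamma> ?v)) \<le> D" unfolding D_def by (rule norm_gs_bound[OF \<gamma>])
          moreover have "cmod (cf b \<alpha> \<beta> \<gamma> w (\<i> * of_real (Im z))) \<le> M" using z by (intro M) auto
          ultimately show "norm (cf b \<alpha> \<beta> \<gamma> w (\<i> * of_real (Im z)) *\<^sub>C cls (gs \<gamma> ?v)) \<le> M * D"
            unfolding norm_cscale by (intro mult_mono) (auto intro: order_trans[OF norm_ge_zero])
        qed simp
        finally show ?thesis .
      qed
      then show ?thesis unfolding bounded_iff by (intro exI[of _ "norm h * (M * D)"]) auto
    qed
    then have "strip_fun F" unfolding strip_fun_def
      using hol by (auto intro: holomorphic_on_subset holomorphic_on_imp_continuous_on continuous_on_subset)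
    then show ?thesis
      by (intro exI[of _ F] conjI allI) (simp_all add: Fc shift TG_def)
  qed
  then show ?thesis by (simp add: AG_def)
qed

section \<open>Density of the Gaussians\<close>

lemma AE_zero_if_box_integrals_zero:
  fixes r :: "'a::euclidean_space \<Rightarrow> real"
  assumes [measurable]: "r \<in> borel_measurable borel"
    and int: "\<And>a c. integrable lborel (\<lambda>x. indicator (box a c) x * r x)"
    and zero: "\<And>a c. (LINT x|lborel. indicator (box a c) x * r x) = 0"
  shows "AE x in lborel. r x = 0"
proof -
  define D where "D s = density lborel (\<lambda>x. ennreal (s * r x))" for s
  have em: "emeasure (D s) (box a c) = ennreal (LINT x|lborel. indicator (box a c) x * max 0 (s * r x))" for s a c
  proof -
    have "integrable lborel (\<lambda>x. indicator (box a c) x * max 0 (s * r x))"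
    proof (rule Bochner_Integration.integrable_bound[OF integrable_mult_right[OF int[of a c], of s]])
      show "AE x in lborel. norm (indicator (box a c) x * max 0 (s * r x)) \<le> norm (s * (indicator (box a c) x * r x))"
        by (auto simp: indicator_def max_def)
    qed measurable
    then have "ennreal (LINT x|lborel. indicator (box a c) x * max 0 (s * r x))
        = (\<integral>\<^sup>+x. ennreal (indicator (box a c) x * max 0 (s * r x)) \<partial>lborel)"
      by (intro nn_integral_eq_integral[symmetric]) auto
    also have "\<dots> = (\<integral>\<^sup>+x. ennreal (s * r x) * indicator (box a c) x \<partial>lborel)"
      by (intro nn_integral_cong) (auto simp: indicator_def max_def ennreal_neg)
    also have "\<dots> = emeasure (D s) (box a c)" unfolding D_def
      by (subst emeasure_density) auto
    finally show ?thesis by simp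
  qed
  have eq: "emeasure (D 1) (box a c) = emeasure (D (-1)) (box a c)" for a c
  proof -
    have i: "integrable lborel (\<lambda>x. indicator (box a c) x * max 0 (s * r x))" for s
    proof (rule Bochner_Integration.integrable_bound[OF integrable_mult_right[OF int[of a c], of s]])
      show "AE x in lborel. norm (indicator (box a c) x * max 0 (s * r x)) \<le> norm (s * (indicator (box a c) x * r x))"
        by (auto simp: indicator_def max_def)
    qed measurable
    have "(LINT x|lborel. indicator (box a c) x * r x) = (LINT x|lborel. indicator (box a c) x * max 0 (1 * r x) - indicator (box a c) x * max 0 (-1 * r x))"
      by (intro Bochner_Integration.integral_cong) (auto simp: max_def)
    also have "\<dots> = (LINT x|lborel. indicator (box a c) x * max 0 (1 * r x)) - (LINT x|lborel. indicator (box a c) x * max 0 (-1 * r x))"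
      by (rule Bochner_Integration.integral_diff[OF i i])
    finally show ?thesis by (simp add: em zero)
  qed
  have "D 1 = D (-1)"
  proof (rule measure_eqI_generator_eq[where E = "range (\<lambda>(a, c). box a c)" and \<Omega> = UNIV
        and A = "\<lambda>i::nat. box (- (real i *\<^sub>R One)) (real i *\<^sub>R One)"])
    show "Int_stable (range (\<lambda>(a, c). box a c :: 'a set))" by (auto simp: Int_stable_def box_Int_box)
    show "sets (D 1) = sigma_sets UNIV (range (\<lambda>(a, c). box a c))"
      "sets (D (-1)) = sigma_sets UNIV (range (\<lambda>(a, c). box a c))"
      by (simp_all add: D_def borel_eq_box)
    show "emeasure (D 1) X = emeasure (D (-1)) X" if "X \<in> range (\<lambda>(a, c). box a c)" for X
      using that eq by auto
    show "emeasure (D 1) (box (- (real i *\<^sub>R One)) (real i *\<^sub>R One)) \<noteq> \<infinity>" for i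
      by (simp add: em)
  qed (auto simp: UN_box_eq_UNIV)
  then have "AE x in lborel. ennreal (1 * r x) = ennreal (-1 * r x)"
    unfolding D_def by (subst (asm) sigma_finite_measure.density_unique_iff[OF sigma_finite_lborel]) auto
  then show ?thesis
  proof eventually_elim
    case (elim x)
    have e: "ennreal (r x) = ennreal (- r x)" using elim by simp
    show ?case
    proof (cases "r x \<ge> 0")
      case True
      have "ennreal (- r x) = 0" by (rule ennreal_neg) (use True in simp)
      then have "r x \<le> 0" unfolding e[symmetric] by (simp only: ennreal_eq_0_iff)
      with True show ?thesis by simp
    next
      case False
      have "ennreal (r x) = 0" by (rule ennreal_neg) (use False in simp)
      then have "- r x \<le> 0" unfolding e by (simp only: ennreal_eq_0_iff)
      with False show ?thesis by simp
    qed
  qed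
qed

text \<open>Averaging over a Gaussian of small width recovers the indicator function of a box.\<close>

lemma orthogonal_to_gs_imp_zero:
  fixes k :: "real ^ 'n::finite \<Rightarrow> complex"
  assumes k: "k \<in> L2" and orth: "\<And>\<gamma> w. \<gamma> > 0 \<Longrightarrow> l2_inner k (gs \<gamma> w) = 0"
  shows "AE x in lborel. k x = 0"
proof -
  have [measurable]: "k \<in> borel_measurable borel" using k by (rule L2_measurable)
  have [measurable]: "(\<lambda>x. cnj (k x)) \<in> borel_measurable borel" using cnj_L2[OF k] by (rule L2_measurable)
  have box0: "integrable lborel (\<lambda>x. cnj (k x) * of_real (indicator (box a c) x))
     \<and> (LINT x|lborel. cnj (k x) * of_real (indicator (box a c) x)) = 0" for a c
  proof -
    let ?B = "box a c"
    obtain R where R: "\<And>x. x \<in> ?B \<Longrightarrow> norm x \<le> R" using bounded_box[of a c] unfolding bounded_iff by blast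
    define \<Phi> where "\<Phi> e x = (LINT t|lborel. indicator ?B (x + e *\<^sub>R t) * exp (- (t \<bullet> t)))" for e and x :: "real ^ 'n"
    have gi: "integrable lborel (\<lambda>t :: real ^ 'n. exp (- g * (t \<bullet> t)))" if "g > 0" for g
      using integrable_gauss[OF that, of 0] by simp
    define c0 where "c0 = (LINT t|lborel. exp (- ((t :: real ^ 'n) \<bullet> t)))"
    define c1 where "c1 = (LINT t|lborel. exp (- (1/2) * ((t :: real ^ 'n) \<bullet> t)))"
    have \<Phi>_int: "integrable lborel (\<lambda>t. indicator ?B (x + e *\<^sub>R t) * exp (- (t \<bullet> t)))" for e x
      by (rule Bochner_Integration.integrable_bound[OF gi[of 1]]) (auto simp: indicator_def)
    have \<Phi>_nonneg: "\<Phi> e x \<ge> 0" for e x unfolding \<Phi>_def by (intro integral_nonneg_AE) auto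
    have \<Phi>_bound: "\<Phi> e x \<le> exp (R\<^sup>2 / 2) * c1 * exp (- (1/4) * (x \<bullet> x))" if e: "0 < e" "e \<le> 1" for e x
    proof -
      have dom: "integrable lborel (\<lambda>t. exp (R\<^sup>2 / 2 - (1/4) * (x \<bullet> x)) * exp (- (1/2) * ((t :: real ^ 'n) \<bullet> t)))"
        using gi[of "1/2"] by simp
      have "\<Phi> e x \<le> (LINT t|lborel. exp (R\<^sup>2 / 2 - (1/4) * (x \<bullet> x)) * exp (- (1/2) * ((t :: real ^ 'n) \<bullet> t)))"
        unfolding \<Phi>_def
      proof (rule integral_mono[OF \<Phi>_int dom])
        fix t :: "real ^ 'n"
        show "indicator ?B (x + e *\<^sub>R t) * exp (- (t \<bullet> t)) \<le> exp (R\<^sup>2 / 2 - (1/4) * (x \<bullet> x)) * exp (- (1/2) * (t \<bullet> t))"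
        proof (cases "x + e *\<^sub>R t \<in> ?B")
          case True
          have "norm x \<le> norm (x + e *\<^sub>R t) + norm (e *\<^sub>R t)"
            using norm_triangle_ineq4[of "x + e *\<^sub>R t" "e *\<^sub>R t"] by simp
          also have "\<dots> \<le> R + norm t" using R[OF True] e mult_right_mono[of e 1 "norm t"] by simp
          finally have "(norm x)\<^sup>2 \<le> (R + norm t)\<^sup>2" by (intro power_mono) auto
          also have "\<dots> \<le> 2 * R\<^sup>2 + 2 * (norm t)\<^sup>2" using sum_squares_bound[of R "norm t"] by (simp add: power2_sum)
          finally have "x \<bullet> x \<le> 2 * R\<^sup>2 + 2 * (t \<bullet> t)" by (simp add: power2_norm_eq_inner)
          then show ?thesis using True unfolding exp_add[symmetric] by simp
        qed simp
      qed
      also have "\<dots> = exp (R\<^sup>2 / 2 - (1/4) * (x \<bullet> x)) * c1" by (simp add: c1_def)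
      also have "\<dots> = exp (R\<^sup>2 / 2) * c1 * exp (- (1/4) * (x \<bullet> x))" 
      proof -
        have "exp (R\<^sup>2 / 2 - (1/4) * (x \<bullet> x)) = exp (R\<^sup>2 / 2) * exp (- (1/4) * (x \<bullet> x))"
          unfolding exp_add[symmetric] by simp
        then show ?thesis by simp
      qed
      finally show ?thesis .
    qed
    have \<Phi>_meas [measurable]: "\<Phi> e \<in> borel_measurable borel" for e
      unfolding \<Phi>_def[abs_def] by measurable
    define d where "d x = complex_of_real (exp (R\<^sup>2 / 2) * c1 * exp (- (1/4) * (x \<bullet> x)))" for x :: "real ^ 'n"
    have dL2: "d \<in> L2"
      using L2_cmult[OF gauss_L2[of "1/4" 0], of "of_real (exp (R\<^sup>2 / 2) * c1)"] by (simp add: d_def[abs_def])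
    have kd: "integrable lborel (\<lambda>x. cmod (k x) * cmod (d x))"
      using integrable_norm[OF L2_mult_integrable[OF k dL2]] by (simp add: norm_mult)
    have \<Phi>_d: "\<Phi> e x \<le> cmod (d x)" if e: "0 < e" "e \<le> 1" for e x
    proof -
      have "cmod (d x) = \<bar>exp (R\<^sup>2 / 2) * c1 * exp (- (1/4) * (x \<bullet> x))\<bar>"
        unfolding d_def by (rule norm_of_real)
      then show ?thesis using \<Phi>_bound[OF e, of x] abs_ge_self[of "exp (R\<^sup>2 / 2) * c1 * exp (- (1/4) * (x \<bullet> x))"] by linarith
    qed
    have zero: "(LINT x|lborel. cnj (k x) * of_real (\<Phi> e x)) = 0" if e: "0 < e" "e \<le> 1" for e
    proof -
      define \<gamma> where "\<gamma> = 1 / e\<^sup>2"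
      have \<gamma>: "\<gamma> > 0" using e by (simp add: \<gamma>_def)
      define G where "G x y = indicator ?B y * exp (- \<gamma> * ((y - x) \<bullet> (y - x)))" for x y :: "real ^ 'n"
      have sub: "(LINT y|lborel. G x y) = e ^ DIM(real ^ 'n) * \<Phi> e x" "integrable lborel (G x)" for x
      proof -
        have [measurable]: "G x \<in> borel_measurable borel" unfolding G_def[abs_def] by measurable
        have Gt: "G x (x + e *\<^sub>R t) = indicator ?B (x + e *\<^sub>R t) * exp (- (t \<bullet> t))" for t
          using e by (simp add: G_def \<gamma>_def power2_eq_square)
        have lb: "(lborel :: (real ^ 'n) measure) = density (distr lborel borel (\<lambda>t. x + e *\<^sub>R t)) (\<lambda>_. ennreal (e ^ DIM(real ^ 'n)))"
          using lborel_affine[of e x] e by simp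
        show "(LINT y|lborel. G x y) = e ^ DIM(real ^ 'n) * \<Phi> e x"
          using e by (subst lb) (simp add: integral_density integral_distr Gt \<Phi>_def)
        show "integrable lborel (G x)"
          using e \<Phi>_int[of x e] by (subst lb) (simp add: integrable_density integrable_distr_eq Gt)
      qed
      have GL: "G x y = indicator ?B y * exp (- \<gamma> * (y \<bullet> y)) * Re (gs \<gamma> (cvec ((2 * \<gamma>) *\<^sub>R y)) x)" 
        "complex_of_real (G x y) = complex_of_real (indicator ?B y * exp (- \<gamma> * (y \<bullet> y))) * gs \<gamma> (cvec ((2 * \<gamma>) *\<^sub>R y)) x" for x y
      proof -
        have g: "gs \<gamma> (cvec ((2 * \<gamma>) *\<^sub>R y)) x = complex_of_real (exp (2 * \<gamma> * (y \<bullet> x) - \<gamma> * (x \<bullet> x)))"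
          unfolding gs_def cvec_simps(3) by (simp add: exp_of_real[symmetric])
        have x: "exp (- \<gamma> * ((y - x) \<bullet> (y - x))) = exp (- \<gamma> * (y \<bullet> y)) * exp (2 * \<gamma> * (y \<bullet> x) - \<gamma> * (x \<bullet> x))"
          unfolding exp_add[symmetric] by (simp add: inner_diff_left inner_diff_right inner_commute algebra_simps)
        show "G x y = indicator ?B y * exp (- \<gamma> * (y \<bullet> y)) * Re (gs \<gamma> (cvec ((2 * \<gamma>) *\<^sub>R y)) x)"
          unfolding G_def x g Re_complex_of_real by simp
        show "complex_of_real (G x y) = complex_of_real (indicator ?B y * exp (- \<gamma> * (y \<bullet> y))) * gs \<gamma> (cvec ((2 * \<gamma>) *\<^sub>R y)) x"
          unfolding G_def x g by simp
      qed
      define H where "H x y = cnj (k x) * of_real (G x y)" for x y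
      have Hint: "integrable (lborel \<Otimes>\<^sub>M lborel) (case_prod H)"
      proof (rule lborel_pair.Fubini_integrable)
        have [measurable]: "(\<lambda>(x, y). G x y) \<in> borel_measurable (borel \<Otimes>\<^sub>M borel)"
          unfolding G_def by measurable
        show "case_prod H \<in> borel_measurable (lborel \<Otimes>\<^sub>M lborel)" unfolding H_def by measurable
        have "(LINT y|lborel. norm (case_prod H (x, y))) = e ^ DIM(real ^ 'n) * (cmod (k x) * \<Phi> e x)" for x
        proof -
          have "(LINT y|lborel. norm (case_prod H (x, y))) = (LINT y|lborel. cmod (k x) * G x y)"
            by (intro Bochner_Integration.integral_cong) (simp_all add: H_def norm_mult G_def)
          then show ?thesis by (simp add: sub)
        qed
        moreover have "integrable lborel (\<lambda>x. cmod (k x) * \<Phi> e x)"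
          by (rule Bochner_Integration.integrable_bound[OF kd])
             (use \<Phi>_d[OF e] \<Phi>_nonneg[of e] in \<open>auto intro!: mult_left_mono\<close>)
        ultimately show "integrable lborel (\<lambda>x. LINT y|lborel. norm (case_prod H (x, y)))" by simp
        show "AE x in lborel. integrable lborel (\<lambda>y. case_prod H (x, y))"
          by (simp add: H_def sub)
      qed
      have "(LINT x|lborel. LINT y|lborel. H x y) = (LINT y|lborel. LINT x|lborel. H x y)"
        by (rule lborel_pair.Fubini_integral[OF Hint, symmetric])
      also have "\<dots> = (LINT y|(lborel :: (real ^ 'n) measure). 0)"
      proof (intro Bochner_Integration.integral_cong refl)
        fix y :: "real ^ 'n"
        have "H x y = complex_of_real (indicator ?B y * exp (- \<gamma> * (y \<bullet> y))) * (cnj (k x) * gs \<gamma> (cvec ((2 * \<gamma>) *\<^sub>R y)) x)" for x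
          unfolding H_def GL(2) by simp
        then have "(LINT x|lborel. H x y) = complex_of_real (indicator ?B y * exp (- \<gamma> * (y \<bullet> y))) * l2_inner k (gs \<gamma> (cvec ((2 * \<gamma>) *\<^sub>R y)))"
          by (simp add: l2_inner_def)
        then show "(LINT x|lborel. H x y) = 0" by (simp add: orth[OF \<gamma>])
      qed
      also have "(LINT x|lborel. LINT y|lborel. H x y) = of_real (e ^ DIM(real ^ 'n)) * (LINT x|lborel. cnj (k x) * of_real (\<Phi> e x))"
      proof -
        have "(LINT y|lborel. H x y) = of_real (e ^ DIM(real ^ 'n)) * (cnj (k x) * of_real (\<Phi> e x))" for x
          unfolding H_def by (simp add: sub)
        then show ?thesis by simp
      qed
      finally show ?thesis using e by simp
    qed
    define e where "e m = 1 / (real m + 1)" for m :: nat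
    have e: "0 < e m" "e m \<le> 1" for m by (simp_all add: e_def)
    have e0: "e \<longlonglongrightarrow> 0" unfolding e_def[abs_def] using LIMSEQ_inverse_real_of_nat by (simp add: inverse_eq_divide add.commute)
    have \<Phi>_lim: "(\<lambda>m. \<Phi> (e m) x) \<longlonglongrightarrow> c0 * indicator ?B x" if x: "x \<notin> cbox a c - box a c" for x
    proof -
      have "(\<lambda>m. \<Phi> (e m) x) \<longlonglongrightarrow> (LINT t|lborel. indicator ?B x * exp (- ((t :: real ^ 'n) \<bullet> t)))"
        unfolding \<Phi>_def
      proof (rule integral_dominated_convergence[OF _ _ gi[of 1]])
        show "AE t in lborel. (\<lambda>m. indicator ?B (x + e m *\<^sub>R t) * exp (- (t \<bullet> t))) \<longlonglongrightarrow> indicator ?B x * exp (- (t \<bullet> t))"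
        proof (intro AE_I2 tendsto_mult tendsto_const)
          fix t :: "real ^ 'n"
          have lim: "(\<lambda>m. x + e m *\<^sub>R t) \<longlonglongrightarrow> x" using tendsto_add[OF tendsto_const tendsto_scaleR[OF e0 tendsto_const]] by simp
          have "\<forall>\<^sub>F m in sequentially. indicator ?B (x + e m *\<^sub>R t) = (indicator ?B x :: real)"
          proof (cases "x \<in> ?B")
            case True
            then show ?thesis using topological_tendstoD[OF lim open_box True] by (auto elim: eventually_mono)
          next
            case False
            then have "x \<in> - cbox a c" using x False by auto
            moreover have "open (- cbox a c)" by (intro open_Compl closed_cbox)
            ultimately have "\<forall>\<^sub>F m in sequentially. x + e m *\<^sub>R t \<in> - cbox a c"
              by (intro topological_tendstoD[OF lim])
            then show ?thesis
            proof eventually_elim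
              case (elim m)
              then have "x + e m *\<^sub>R t \<notin> ?B" using box_subset_cbox by blast
              then show ?case using False by simp
            qed
          qed
          then show "(\<lambda>m. indicator ?B (x + e m *\<^sub>R t) :: real) \<longlonglongrightarrow> indicator ?B x"
            by (rule tendsto_eventually)
        qed
      qed (auto simp: indicator_def)
      then show ?thesis by (simp add: c0_def mult.commute)
    qed
    have bd: "AE x in lborel. x \<notin> cbox a c - box a c"
    proof -
      have "cbox a c - box a c \<in> null_sets lebesgue"
        using negligible_frontier_interval[of a c] by (simp add: negligible_iff_null_sets)
      then have "cbox a c - box a c \<in> null_sets lborel"
        by (simp add: null_sets_def emeasure_lborel_box_eq)
      then show ?thesis by (rule AE_not_in)
    qed
    have "(\<lambda>m. LINT x|lborel. cnj (k x) * of_real (\<Phi> (e m) x)) \<longlonglongrightarrow> (LINT x|lborel. cnj (k x) * of_real (c0 * indicator ?B x))"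
    proof (rule integral_dominated_convergence[OF _ _ kd])
      show "AE x in lborel. (\<lambda>m. cnj (k x) * of_real (\<Phi> (e m) x)) \<longlonglongrightarrow> cnj (k x) * of_real (c0 * indicator ?B x)"
        using bd by eventually_elim (intro tendsto_intros \<Phi>_lim)
      show "AE x in lborel. norm (cnj (k x) * of_real (\<Phi> (e m) x)) \<le> cmod (k x) * cmod (d x)" for m
        using \<Phi>_d[OF e] \<Phi>_nonneg by (auto simp: norm_mult intro!: mult_left_mono)
    qed measurable
    then have "(LINT x|lborel. cnj (k x) * of_real (c0 * indicator ?B x)) = 0"
      using zero[OF e] by (simp add: LIMSEQ_const_iff)
    then have z: "of_real c0 * (LINT x|lborel. cnj (k x) * of_real (indicator ?B x)) = 0"
      by (simp add: mult.left_commute)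
    have "c0 > 0"
    proof -
      have "c0 \<ge> 0" unfolding c0_def by (intro integral_nonneg_AE) auto
      moreover have "c0 \<noteq> 0"
      proof
        assume "c0 = 0"
        then have "AE t in lborel. exp (- ((t :: real ^ 'n) \<bullet> t)) = 0"
          unfolding c0_def using gi[of 1] by (subst (asm) integral_nonneg_eq_0_iff_AE) auto
        then show False by (simp add: eventually_False ae_filter_eq_bot_iff)
      qed
      ultimately show ?thesis by simp
    qed
    moreover have "integrable lborel (\<lambda>x. cnj (k x) * of_real (indicator ?B x))"
    proof (rule L2_mult_integrable[OF cnj_L2[OF k]])
      have "integrable lborel (\<lambda>x. indicator ?B x :: real)"
        by (rule integrable_real_indicator) (auto intro: emeasure_bounded_finite[unfolded infinity_ennreal_def])
      moreover have "(cmod (complex_of_real (indicator ?B x)))\<^sup>2 = indicator ?B x" for x by (simp add: indicator_def)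
      ultimately show "(\<lambda>x. complex_of_real (indicator ?B x)) \<in> L2" by (simp add: L2_def)
    qed
    ultimately show ?thesis using z by simp
  qed
  have "AE x in lborel. Re (cnj (k x)) = 0"
  proof (rule AE_zero_if_box_integrals_zero)
    show "integrable lborel (\<lambda>x. indicator (box a c) x * Re (cnj (k x)))" for a c
      using integrable_Re[OF conjunct1[OF box0[of a c]]] by (simp add: mult.commute)
    show "(LINT x|lborel. indicator (box a c) x * Re (cnj (k x))) = 0" for a c
      using integral_Re[OF conjunct1[OF box0[of a c]]] conjunct2[OF box0[of a c]] by (simp add: mult.commute)
  qed measurable
  moreover have "AE x in lborel. Im (cnj (k x)) = 0"
  proof (rule AE_zero_if_box_integrals_zero)
    show "integrable lborel (\<lambda>x. indicator (box a c) x * Im (cnj (k x)))" for a c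
      using integrable_Im[OF conjunct1[OF box0[of a c]]] by (simp add: mult.commute)
    show "(LINT x|lborel. indicator (box a c) x * Im (cnj (k x))) = 0" for a c
      using integral_Im[OF conjunct1[OF box0[of a c]]] conjunct2[OF box0[of a c]] by (simp add: mult.commute)
  qed measurable
  ultimately show ?thesis by eventually_elim (simp add: complex_eq_iff)
qed

section \<open>The Gaussian core\<close>

definition gens :: "real \<Rightarrow> real ^ 'n::finite \<Rightarrow> real ^ 'n \<Rightarrow> ((real ^ 'n) l2 \<times> (real ^ 'n) l2) set" where
  "gens b \<alpha> \<beta> = {(c *\<^sub>C cls (gs \<gamma> w), c *\<^sub>C TG b \<alpha> \<beta> \<gamma> w) | c \<gamma> w. \<gamma> > 0}"

text \<open>The restriction of the analytic generator to the span of the Gaussians.\<close>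

definition core :: "real \<Rightarrow> real ^ 'n::finite \<Rightarrow> real ^ 'n \<Rightarrow> ((real ^ 'n) l2 \<times> (real ^ 'n) l2) set" where
  "core b \<alpha> \<beta> = span (gens b \<alpha> \<beta>)"

lemma orthogonal_gs_cls:
  assumes "\<And>\<gamma> w. \<gamma> > 0 \<Longrightarrow> cinner F (cls (gs \<gamma> w)) = 0"
  shows "F = 0"
proof -
  obtain k where k: "k \<in> L2" "F = cls k" by (rule cls_exhaust)
  have "AE x in lborel. k x = 0"
    by (rule orthogonal_to_gs_imp_zero[OF k(1)]) (use assms in \<open>simp add: k cinner_cls gs_L2\<close>)
  then have "cls k = cls (\<lambda>x. 0)" by (simp add: cls_eq_iff k L2_zero ae_eq_def)
  then show ?thesis by (simp add: k cls_zero)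
qed

lemma linear_fst: "linear fst" and linear_snd: "linear snd"
  by (auto intro!: linearI simp: plus_prod_def scaleR_prod_def)

lemma core_dense: "closure (fst ` core b \<alpha> \<beta>) = UNIV"
proof -
  let ?S = "fst ` core b \<alpha> \<beta>"
  have sub: "subspace ?S" unfolding core_def by (rule linear_subspace_image[OF linear_fst subspace_span])
  have mem: "c *\<^sub>C cls (gs \<gamma> w) \<in> ?S" if "\<gamma> > 0" for c \<gamma> w
  proof -
    have "(c *\<^sub>C cls (gs \<gamma> w), c *\<^sub>C TG b \<alpha> \<beta> \<gamma> w) \<in> core b \<alpha> \<beta>"
      unfolding core_def by (rule span_base) (use that in \<open>auto simp: gens_def\<close>)
    then show ?thesis by (metis fst_conv image_eqI)
  qed
  have "x \<in> closure ?S" for x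
  proof -
    obtain y where y: "y \<in> closure ?S" "\<forall>s\<in>?S. inner (x - y) s = 0" using subspace_projection[OF sub, of x] by blast
    have "x - y = 0"
    proof (rule orthogonal_gs_cls)
      fix \<gamma> :: real and w :: "complex ^ 'a" assume g: "\<gamma> > 0"
      have "inner (x - y) (1 *\<^sub>C cls (gs \<gamma> w)) = 0" "inner (x - y) (\<i> *\<^sub>C cls (gs \<gamma> w)) = 0"
        using y(2) mem[OF g] by blast+
      then show "cinner (x - y) (cls (gs \<gamma> w)) = 0"
        by (simp add: inner_l2_def cinner_scale_right complex_eq_iff)
    qed
    then show ?thesis using y(1) by simp
  qed
  then show ?thesis by blast
qed

lemma core_subset_AG: "core b \<alpha> \<beta> \<subseteq> ugroup.AG (Wl b \<alpha> \<beta>)"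
proof -
  interpret ugroup "Wl b \<alpha> \<beta>" by (rule ugroup_Wl)
  show ?thesis unfolding core_def
    by (rule span_minimal[OF _ AG_subspace]) (auto simp: gens_def intro!: AG_scale gs_in_AG)
qed

lemma span_map_mem:
  assumes "linear f" "\<And>x. x \<in> G \<Longrightarrow> f x \<in> span G'" "x \<in> span G"
  shows "f x \<in> span G'"
proof -
  have "span G \<subseteq> f -` span G'"
  proof (rule span_minimal)
    show "subspace (f -` span G')" by (rule linear_subspace_vimage[OF assms(1) subspace_span])
    show "G \<subseteq> f -` span G'" using assms(2) by blast
  qed
  with assms(3) show ?thesis by blast
qed

lemma core_scale: "(h, k) \<in> core b \<alpha> \<beta> \<Longrightarrow> (c *\<^sub>C h, c *\<^sub>C k) \<in> core b \<alpha> \<beta>"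
proof -
  assume hk: "(h, k) \<in> core b \<alpha> \<beta>"
  have "(\<lambda>x. (c *\<^sub>C fst x, c *\<^sub>C snd x)) (h, k) \<in> span (gens b \<alpha> \<beta>)"
  proof (rule span_map_mem[of "\<lambda>x. (c *\<^sub>C fst x, c *\<^sub>C snd x)" "gens b \<alpha> \<beta>" _ "(h, k)"])
    show "linear (\<lambda>x :: (real ^ 'a) l2 \<times> (real ^ 'a) l2. (c *\<^sub>C fst x, c *\<^sub>C snd x))"
      by (rule linearI) (simp_all add: cscale_add_right scaleR_l2_def cscale_cscale mult.commute)
    show "(h, k) \<in> span (gens b \<alpha> \<beta>)" using hk by (simp add: core_def)
    fix x assume "x \<in> gens b \<alpha> \<beta>"
    then obtain c' \<gamma> w where "x = (c' *\<^sub>C cls (gs \<gamma> w), c' *\<^sub>C TG b \<alpha> \<beta> \<gamma> w)" "\<gamma> > 0" by (auto simp: gens_def)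
    then show "(c *\<^sub>C fst x, c *\<^sub>C snd x) \<in> span (gens b \<alpha> \<beta>)"
      by (intro span_base) (auto simp: gens_def cscale_cscale)
  qed
  then show ?thesis by (simp add: core_def)
qed

lemma Wl_gs: "\<gamma> > 0 \<Longrightarrow> Wl b \<alpha> \<beta> s (cls (gs \<gamma> v)) = cf b \<alpha> \<beta> \<gamma> v (of_real s) *\<^sub>C cls (gs \<gamma> (v + of_real s *s kap b \<alpha> \<beta> \<gamma>))"
  by (simp add: Wl_cls gs_L2 cls_scale[symmetric] Wf_gs[abs_def])

text \<open>The orbit of a Gaussian consists of multiples of Gaussians, so the span of the Gaussians is preserved by the group.\<close>

lemma core_invariant: "(h, k) \<in> core b \<alpha> \<beta> \<Longrightarrow> (Wl b \<alpha> \<beta> s h, Wl b \<alpha> \<beta> s k) \<in> core b \<alpha> \<beta>"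
proof -
  assume hk: "(h, k) \<in> core b \<alpha> \<beta>"
  interpret ugroup "Wl b \<alpha> \<beta>" by (rule ugroup_Wl)
  have "(\<lambda>x. (Wl b \<alpha> \<beta> s (fst x), Wl b \<alpha> \<beta> s (snd x))) (h, k) \<in> span (gens b \<alpha> \<beta>)"
  proof (rule span_map_mem[of "\<lambda>x. (Wl b \<alpha> \<beta> s (fst x), Wl b \<alpha> \<beta> s (snd x))" "gens b \<alpha> \<beta>" _ "(h, k)"])
    show "linear (\<lambda>x. (Wl b \<alpha> \<beta> s (fst x), Wl b \<alpha> \<beta> s (snd x)))"
      by (rule linearI) (simp_all add: scaleR_l2_def U_linear)
    show "(h, k) \<in> span (gens b \<alpha> \<beta>)" using hk by (simp add: core_def)
    fix x assume "x \<in> gens b \<alpha> \<beta>"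
    then obtain c \<gamma> w where x: "x = (c *\<^sub>C cls (gs \<gamma> w), c *\<^sub>C TG b \<alpha> \<beta> \<gamma> w)" and g: "\<gamma> > 0" by (auto simp: gens_def)
    let ?k = "kap b \<alpha> \<beta> \<gamma>" and ?s = "complex_of_real s"
    have "w + (-\<i>) *s ?k + ?s *s ?k = w + ?s *s ?k + (-\<i>) *s ?k" by (simp add: add_ac)
    moreover have "cf b \<alpha> \<beta> \<gamma> w (-\<i>) * cf b \<alpha> \<beta> \<gamma> (w + (-\<i>) *s ?k) ?s = cf b \<alpha> \<beta> \<gamma> w ?s * cf b \<alpha> \<beta> \<gamma> (w + ?s *s ?k) (-\<i>)"
      unfolding cf_cocycle[symmetric] by (simp add: add.commute)
    ultimately have "Wl b \<alpha> \<beta> s (TG b \<alpha> \<beta> \<gamma> w) = cf b \<alpha> \<beta> \<gamma> w ?s *\<^sub>C TG b \<alpha> \<beta> \<gamma> (w + ?s *s ?k)"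
      unfolding TG_def U_linear Wl_gs[OF g] cscale_cscale by (simp only:)
    then have "(Wl b \<alpha> \<beta> s (fst x), Wl b \<alpha> \<beta> s (snd x))
        = ((c * cf b \<alpha> \<beta> \<gamma> w ?s) *\<^sub>C cls (gs \<gamma> (w + ?s *s ?k)), (c * cf b \<alpha> \<beta> \<gamma> w ?s) *\<^sub>C TG b \<alpha> \<beta> \<gamma> (w + ?s *s ?k))"
      by (simp add: x U_linear Wl_gs[OF g] cscale_cscale)
    then show "(Wl b \<alpha> \<beta> s (fst x), Wl b \<alpha> \<beta> s (snd x)) \<in> span (gens b \<alpha> \<beta>)"
      using g by (intro span_base) (auto simp: gens_def)
  qed
  then show ?thesis by (simp add: core_def)
qed

lemma core_subspace: "subspace (core b \<alpha> \<beta>)" by (simp add: core_def subspace_span)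

lemma TG_half:
  "TG b \<alpha> \<beta> \<gamma> w = cf (b/2) \<alpha> \<beta> \<gamma> w (-\<i>) *\<^sub>C TG (b/2) \<alpha> \<beta> \<gamma> (w + (-\<i>) *s kap (b/2) \<alpha> \<beta> \<gamma>)"
proof -
  have "(-\<i>) *s kap b \<alpha> \<beta> \<gamma> = (-\<i>) *s kap (b/2) \<alpha> \<beta> \<gamma> + (-\<i>) *s kap (b/2) \<alpha> \<beta> \<gamma>"
    by (simp add: kap_def vec_eq_iff algebra_simps)
  moreover have "cf b \<alpha> \<beta> \<gamma> w (-\<i>) = cf (b/2) \<alpha> \<beta> \<gamma> w (-\<i> + -\<i>)"
    by (simp add: cf_def power2_eq_square)
  ultimately show ?thesis unfolding TG_def cscale_cscale cf_cocycle[symmetric] by (simp add: add.assoc)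
qed

text \<open>On Gaussians, \<open>e\<^sup>A\<close> is the square of the symmetric operator \<open>e\<^bsup>A/2\<^esup>\<close>.\<close>

lemma core_positive:
  assumes "(h, k) \<in> core b \<alpha> \<beta>" shows "\<exists>r\<ge>0. cinner h k = complex_of_real r"
proof -
  define T3 where "T3 = span {(c *\<^sub>C cls (gs \<gamma> w), c *\<^sub>C TG (b/2) \<alpha> \<beta> \<gamma> w, c *\<^sub>C TG b \<alpha> \<beta> \<gamma> w) | c \<gamma> w. \<gamma> > 0}"
  interpret h: ugroup "Wl (b/2) \<alpha> \<beta>" by (rule ugroup_Wl)
  have base: "cinner (c' *\<^sub>C cls (gs \<gamma>' w')) (c *\<^sub>C TG b \<alpha> \<beta> \<gamma> w) = cinner (c' *\<^sub>C TG (b/2) \<alpha> \<beta> \<gamma>' w') (c *\<^sub>C TG (b/2) \<alpha> \<beta> \<gamma> w)"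
    if g: "\<gamma> > 0" "\<gamma>' > 0" for c c' \<gamma> \<gamma>' w w'
  proof -
    have "(TG (b/2) \<alpha> \<beta> \<gamma> w, TG b \<alpha> \<beta> \<gamma> w) \<in> h.AG"
      unfolding TG_half[of b] by (subst TG_def) (intro h.AG_scale gs_in_AG g)
    from h.AG_symmetric[OF this gs_in_AG[OF g(2)]] show ?thesis
      by (simp add: cinner_scale_left cinner_scale_right)
  qed
  have step: "cinner (fst y) (snd (snd x)) = cinner (fst (snd y)) (fst (snd x))" if "x \<in> T3" "y \<in> T3" for x y
  proof -
    have "T3 \<subseteq> {x. \<forall>y\<in>T3. cinner (fst y) (snd (snd x)) = cinner (fst (snd y)) (fst (snd x))}"
    proof (subst (1) T3_def, rule span_minimal)
      show "subspace {x. \<forall>y\<in>T3. cinner (fst y) (snd (snd x)) = cinner (fst (snd y)) (fst (snd x))}"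
        by (rule subspaceI) (auto simp: cinner_add_right scaleR_l2_def cinner_scale_right)
      show "{(c *\<^sub>C cls (gs \<gamma> w), c *\<^sub>C TG (b/2) \<alpha> \<beta> \<gamma> w, c *\<^sub>C TG b \<alpha> \<beta> \<gamma> w) | c \<gamma> w. \<gamma> > 0}
          \<subseteq> {x. \<forall>y\<in>T3. cinner (fst y) (snd (snd x)) = cinner (fst (snd y)) (fst (snd x))}"
      proof (clarify, goal_cases)
        case (1 a1 a2 a3 y1 y2 y3 c \<gamma> w)
        have "T3 \<subseteq> {y. cinner (fst y) (c *\<^sub>C TG b \<alpha> \<beta> \<gamma> w) = cinner (fst (snd y)) (c *\<^sub>C TG (b/2) \<alpha> \<beta> \<gamma> w)}"
        proof (subst T3_def, rule span_minimal)
          show "subspace {y. cinner (fst y) (c *\<^sub>C TG b \<alpha> \<beta> \<gamma> w) = cinner (fst (snd y)) (c *\<^sub>C TG (b/2) \<alpha> \<beta> \<gamma> w)}"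
            by (rule subspaceI) (auto simp: cinner_add_left scaleR_l2_def cinner_scale_left)
        qed (use 1 base in auto)
        with 1 show ?case by auto
      qed
    qed
    with that show ?thesis by blast
  qed
  have "core b \<alpha> \<beta> \<subseteq> (\<lambda>x. (fst x, snd (snd x))) ` T3"
    unfolding core_def
  proof (rule span_minimal)
    have "linear (\<lambda>x :: (real ^ 'a) l2 \<times> (real ^ 'a) l2 \<times> (real ^ 'a) l2. (fst x, snd (snd x)))"
      by (rule linearI) auto
    then show "subspace ((\<lambda>x. (fst x, snd (snd x))) ` T3)"
      unfolding T3_def by (rule linear_subspace_image[OF _ subspace_span])
    show "gens b \<alpha> \<beta> \<subseteq> (\<lambda>x. (fst x, snd (snd x))) ` T3"
    proof
      fix x assume "x \<in> gens b \<alpha> \<beta>"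
      then obtain c \<gamma> w where x: "x = (c *\<^sub>C cls (gs \<gamma> w), c *\<^sub>C TG b \<alpha> \<beta> \<gamma> w)" "\<gamma> > 0" by (auto simp: gens_def)
      then have "(c *\<^sub>C cls (gs \<gamma> w), c *\<^sub>C TG (b/2) \<alpha> \<beta> \<gamma> w, c *\<^sub>C TG b \<alpha> \<beta> \<gamma> w) \<in> T3"
        unfolding T3_def by (intro span_base) blast
      from imageI[OF this, of "\<lambda>x. (fst x, snd (snd x))"] show "x \<in> (\<lambda>x. (fst x, snd (snd x))) ` T3"
        by (simp add: x)
    qed
  qed
  from subsetD[OF this assms] obtain l where "(h, l, k) \<in> T3" by (auto simp: image_iff)
  from step[OF this this] have "cinner h k = complex_of_real ((norm l)\<^sup>2)" by (simp add: cinner_self)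
  then show ?thesis by (intro exI[of _ "(norm l)\<^sup>2"]) simp
qed

section \<open>The operators \<open>e\<^bsup>2 \<pi> b (\<alpha> x + \<beta> p)\<^esup>\<close>\<close>

definition AGW :: "real \<Rightarrow> real ^ 'n::finite \<Rightarrow> real ^ 'n \<Rightarrow> ((real ^ 'n) l2 \<times> (real ^ 'n) l2) set" where
  "AGW b \<alpha> \<beta> = ugroup.AG (Wl b \<alpha> \<beta>)"

definition weyl_op :: "real \<Rightarrow> real ^ 'n::finite \<Rightarrow> real ^ 'n \<Rightarrow> (real ^ 'n) operator" where
  "weyl_op b \<alpha> \<beta> = analytic_generator (Wf b \<alpha> \<beta>)"

lemma weyl_op_iff: "(f, g) \<in> weyl_op b \<alpha> \<beta> \<longleftrightarrow> f \<in> L2 \<and> g \<in> L2 \<and> (cls f, cls g) \<in> AGW b \<alpha> \<beta>"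
proof -
  interpret ugroup "Wl b \<alpha> \<beta>" by (rule ugroup_Wl)
  have "(\<forall>h\<in>L2. \<exists>F. continuous_on {z. -1 \<le> Im z \<and> Im z \<le> 0} F \<and>
           F holomorphic_on {z. -1 < Im z \<and> Im z < 0} \<and>
           bounded (F ` {z. -1 \<le> Im z \<and> Im z \<le> 0}) \<and>
           (\<forall>s. F (complex_of_real s) = l2_inner h (Wf b \<alpha> \<beta> s f)) \<and> F (- \<i>) = l2_inner h g) \<longleftrightarrow> (cls f, cls g) \<in> AG"
    (is "?L \<longleftrightarrow> _") if fg: "f \<in> L2" "g \<in> L2"
  proof -
    have e: "cinner (cls h) (Wl b \<alpha> \<beta> s (cls f)) = l2_inner h (Wf b \<alpha> \<beta> s f)" "cinner (cls h) (cls g) = l2_inner h g" if "h \<in> L2" for h s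
      using that fg by (simp_all add: Wl_cls cinner_cls Wf_L2)
    have "?L \<longleftrightarrow> (\<forall>h\<in>L2. \<exists>F. strip_fun F \<and> (\<forall>s::real. F (of_real s) = cinner (cls h) (Wl b \<alpha> \<beta> s (cls f))) \<and> F (-\<i>) = cinner (cls h) (cls g))"
      by (intro ball_cong refl) (simp add: e strip_fun_def conj_assoc)
    also have "\<dots> \<longleftrightarrow> (cls f, cls g) \<in> AG"
      unfolding AG_def mem_Collect_eq prod.case
    proof
      assume *: "\<forall>h\<in>L2. \<exists>F. strip_fun F \<and> (\<forall>s::real. F (of_real s) = cinner (cls h) (Wl b \<alpha> \<beta> s (cls f))) \<and> F (-\<i>) = cinner (cls h) (cls g)"
      show "\<forall>h. \<exists>F. strip_fun F \<and> (\<forall>s::real. F (of_real s) = cinner h (Wl b \<alpha> \<beta> s (cls f))) \<and> F (-\<i>) = cinner h (cls g)"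
      proof
        fix h :: "(real ^ 'a) l2"
        obtain h' where h': "h' \<in> L2" "h = cls h'" by (rule cls_exhaust)
        from bspec[OF * h'(1)] show "\<exists>F. strip_fun F \<and> (\<forall>s::real. F (of_real s) = cinner h (Wl b \<alpha> \<beta> s (cls f))) \<and> F (-\<i>) = cinner h (cls g)"
          unfolding h'(2) .
      qed
    qed simp
    finally show ?thesis .
  qed
  then show ?thesis unfolding weyl_op_def analytic_generator_def AGW_def by auto
qed

lemma AGW_adjoint: "(f, g) \<in> AGW b \<alpha> \<beta> \<longleftrightarrow> (\<forall>(h, k)\<in>core b \<alpha> \<beta>. cinner f k = cinner g h)"
  unfolding AGW_def by (rule ugroup.AG_eq_adjoint_core[OF ugroup_Wl core_subset_AG core_invariant core_dense])

lemma AGW_closure: "AGW b \<alpha> \<beta> = closure (core b \<alpha> \<beta>)"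
  unfolding AGW_def
  by (rule ugroup.AG_eq_closure_core[OF ugroup_Wl core_subset_AG core_invariant core_dense core_subspace core_scale])

lemma AGW_dense: "closure (fst ` AGW b \<alpha> \<beta>) = UNIV"
proof -
  have "fst ` core b \<alpha> \<beta> \<subseteq> fst ` AGW b \<alpha> \<beta>" unfolding AGW_closure by (intro image_mono closure_subset)
  from closure_mono[OF this] show ?thesis using core_dense[of b \<alpha> \<beta>] by auto
qed

lemma AGW_self_adjoint: "(f, g) \<in> AGW b \<alpha> \<beta> \<longleftrightarrow> (\<forall>(h, k)\<in>AGW b \<alpha> \<beta>. cinner f k = cinner g h)"
proof -
  interpret ugroup "Wl b \<alpha> \<beta>" by (rule ugroup_Wl)
  show ?thesis unfolding AGW_def
    by (rule AG_eq_adjoint_core[OF order_refl AG_invariant]) (auto simp: AGW_dense[unfolded AGW_def])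
qed

text \<open>Positivity holds on the core, and the graph is the closure of the core.\<close>

lemma AGW_positive:
  assumes "(f, g) \<in> AGW b \<alpha> \<beta>" shows "\<exists>r\<ge>0. cinner f g = complex_of_real r"
proof -
  obtain x where x: "\<And>n. x n \<in> core b \<alpha> \<beta>" "x \<longlonglongrightarrow> (f, g)"
    using assms unfolding AGW_closure closure_sequential by blast
  have lim: "(\<lambda>n. cinner (fst (x n)) (snd (x n))) \<longlonglongrightarrow> cinner f g"
    using tendsto_cinner[OF tendsto_fst[OF x(2)] tendsto_snd[OF x(2)]] by simp
  have p: "cinner (fst (x n)) (snd (x n)) \<in> {z. Im z = 0 \<and> 0 \<le> Re z}" for n
    using core_positive[of "fst (x n)" "snd (x n)" b \<alpha> \<beta>] x(1)[of n] by auto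
  have "closed {z. Im z = 0 \<and> 0 \<le> Re z}"
    by (intro closed_Collect_conj closed_Collect_eq closed_Collect_le continuous_intros)
  from closed_sequentially[OF this p lim] show ?thesis
    by (intro exI[of _ "Re (cinner f g)"]) (simp add: complex_eq_iff)
qed

lemma positive_selfadjoint_weyl_op: "positive_selfadjoint (weyl_op b \<alpha> \<beta>)"
  unfolding positive_selfadjoint_def
proof (intro conjI)
  show "densely_defined (weyl_op b \<alpha> \<beta>)"
    unfolding densely_defined_def
  proof (intro ballI allI impI)
    fix f :: "real ^ 'a \<Rightarrow> complex" and e :: real assume f: "f \<in> L2" and e: "e > 0"
    have "cls f \<in> closure (fst ` AGW b \<alpha> \<beta>)" by (simp add: AGW_dense)
    then obtain H K where HK: "(H, K) \<in> AGW b \<alpha> \<beta>" "dist H (cls f) < e"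
      unfolding closure_approachable using e by fastforce
    obtain h where h: "h \<in> L2" "H = cls h" by (rule cls_exhaust)
    obtain k where k: "k \<in> L2" "K = cls k" by (rule cls_exhaust)
    have "(h, k) \<in> weyl_op b \<alpha> \<beta>" using HK h k by (simp add: weyl_op_iff)
    moreover have "l2_dist h f < e" using HK h f by (simp add: l2_dist_cls)
    ultimately show "\<exists>(h, k)\<in>weyl_op b \<alpha> \<beta>. l2_dist h f < e" by blast
  qed
  show "adjoint_op (weyl_op b \<alpha> \<beta>) = weyl_op b \<alpha> \<beta>"
  proof (intro set_eqI, clarify)
    fix f g :: "real ^ 'a \<Rightarrow> complex"
    show "(f, g) \<in> adjoint_op (weyl_op b \<alpha> \<beta>) \<longleftrightarrow> (f, g) \<in> weyl_op b \<alpha> \<beta>"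
    proof (cases "f \<in> L2 \<and> g \<in> L2")
      case True
      have "(\<forall>(h, k)\<in>weyl_op b \<alpha> \<beta>. l2_inner f k = l2_inner g h) \<longleftrightarrow> (\<forall>(H, K)\<in>AGW b \<alpha> \<beta>. cinner (cls f) K = cinner (cls g) H)"
      proof safe
        fix H K assume A: "\<forall>(h, k)\<in>weyl_op b \<alpha> \<beta>. l2_inner f k = l2_inner g h" "(H, K) \<in> AGW b \<alpha> \<beta>"
        obtain h where h: "h \<in> L2" "H = cls h" by (rule cls_exhaust)
        obtain k where k: "k \<in> L2" "K = cls k" by (rule cls_exhaust)
        have "(h, k) \<in> weyl_op b \<alpha> \<beta>" using A h k by (simp add: weyl_op_iff)
        with A(1) have "l2_inner f k = l2_inner g h" by blast
        then show "cinner (cls f) K = cinner (cls g) H" using True h k by (simp add: cinner_cls)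
      next
        fix h k assume A: "\<forall>(H, K)\<in>AGW b \<alpha> \<beta>. cinner (cls f) K = cinner (cls g) H" "(h, k) \<in> weyl_op b \<alpha> \<beta>"
        then have "cinner (cls f) (cls k) = cinner (cls g) (cls h)" "h \<in> L2" "k \<in> L2" by (auto simp: weyl_op_iff)
        then show "l2_inner f k = l2_inner g h" using True by (simp add: cinner_cls)
      qed
      then show ?thesis using True AGW_self_adjoint[of "cls f" "cls g" b \<alpha> \<beta>]
        by (simp add: adjoint_op_def weyl_op_iff[of f g])
    qed (auto simp: adjoint_op_def weyl_op_iff[of f g])
  qed
  show "\<forall>(f, g)\<in>weyl_op b \<alpha> \<beta>. l2_inner f g \<in> \<real> \<and> 0 \<le> Re (l2_inner f g) \<and> (ae_eq g (\<lambda>_. 0) \<longrightarrow> ae_eq f (\<lambda>_. 0))"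
  proof (clarify, intro conjI impI)
    fix f g assume "(f, g) \<in> weyl_op b \<alpha> \<beta>"
    then have fg: "f \<in> L2" "g \<in> L2" "(cls f, cls g) \<in> AGW b \<alpha> \<beta>" by (simp_all add: weyl_op_iff)
    from AGW_positive[OF fg(3)] obtain r where "r \<ge> 0" "l2_inner f g = complex_of_real r"
      using fg by (auto simp: cinner_cls)
    then show "l2_inner f g \<in> \<real>" "0 \<le> Re (l2_inner f g)" by simp_all
    assume "ae_eq g (\<lambda>_. 0)"
    then have "cls g = 0" using cls_eq_iff[OF fg(2) L2_zero] by (simp add: cls_zero)
    then have "cls f = 0" using fg(3) ugroup.AG_kernel[OF ugroup_Wl] by (simp add: AGW_def)
    then show "ae_eq f (\<lambda>_. 0)" using cls_eq_iff[OF fg(1) L2_zero] by (simp add: cls_zero)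
  qed
qed

lemma Wl_continuous: "((\<lambda>s. Wl b \<alpha> \<beta> s f) \<longlongrightarrow> f) (at 0)"
proof (rule tendstoI)
  interpret ugroup "Wl b \<alpha> \<beta>" by (rule ugroup_Wl)
  fix e :: real assume e: "e > 0"
  have "f \<in> closure (fst ` AGW b \<alpha> \<beta>)" by (simp add: AGW_dense)
  then obtain H K where HK: "(H, K) \<in> AG" "dist H f < e / 4"
    unfolding closure_approachable AGW_def using e by (metis (no_types, lifting) divide_pos_pos imageE prod.collapse zero_less_numeral)
  obtain F where F: "strip_fun F" "\<And>s::real. F (of_real s) = cinner H (Wl b \<alpha> \<beta> s H)" using AG_D[OF HK(1), of H] by blast
  have "continuous_on UNIV (\<lambda>s::real. F (of_real s))"
    by (rule continuous_on_compose2[of "{z. -1 \<le> Im z \<and> Im z \<le> 0}" F])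
       (use F(1) in \<open>auto simp: strip_fun_def intro!: continuous_intros\<close>)
  then have "isCont (\<lambda>s::real. F (of_real s)) 0"
    by (simp add: continuous_on_eq_continuous_at)
  then have "((\<lambda>s::real. F (of_real s)) \<longlongrightarrow> F (of_real 0)) (at 0)"
    by (simp only: isCont_def)
  then have "((\<lambda>s. 2 * (norm H)\<^sup>2 - 2 * Re (cinner H (Wl b \<alpha> \<beta> s H))) \<longlongrightarrow> 2 * (norm H)\<^sup>2 - 2 * Re (cinner H H)) (at 0)"
    unfolding F(2) U_zero by (intro tendsto_intros)
  then have "((\<lambda>s. 2 * (norm H)\<^sup>2 - 2 * Re (cinner H (Wl b \<alpha> \<beta> s H))) \<longlongrightarrow> 0) (at 0)"
    by (simp add: cinner_self flip: of_real_power)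
  then have "\<forall>\<^sub>F s in at 0. 2 * (norm H)\<^sup>2 - 2 * Re (cinner H (Wl b \<alpha> \<beta> s H)) < (e / 4)\<^sup>2"
    by (rule order_tendstoD) (use e in simp)
  then show "\<forall>\<^sub>F s in at 0. dist (Wl b \<alpha> \<beta> s f) f < e"
  proof eventually_elim
    case (elim s)
    have "(norm (Wl b \<alpha> \<beta> s H - H))\<^sup>2 = 2 * (norm H)\<^sup>2 - 2 * Re (cinner H (Wl b \<alpha> \<beta> s H))"
    proof -
      have "(norm (Wl b \<alpha> \<beta> s H - H))\<^sup>2 = (norm (Wl b \<alpha> \<beta> s H))\<^sup>2 + (norm H)\<^sup>2 - 2 * inner H (Wl b \<alpha> \<beta> s H)"
        unfolding power2_norm_eq_inner by (simp add: inner_diff_left inner_diff_right inner_commute)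
      then show ?thesis by (simp add: U_norm inner_l2_def)
    qed
    with elim have "(norm (Wl b \<alpha> \<beta> s H - H))\<^sup>2 < (e / 4)\<^sup>2" by simp
    then have n1: "norm (Wl b \<alpha> \<beta> s H - H) < e / 4" by (rule power2_less_imp_less) (use e in simp)
    have "Wl b \<alpha> \<beta> s f - Wl b \<alpha> \<beta> s H = Wl b \<alpha> \<beta> s (f - H)"
      using U_linear(1)[of s "f - H" H] by simp
    then have "norm (Wl b \<alpha> \<beta> s f - Wl b \<alpha> \<beta> s H) < e / 4" using HK(2) by (simp add: U_norm dist_norm norm_minus_commute)
    moreover have tri: "norm (A + B + C) \<le> norm A + norm B + norm C" for A B C :: "(real ^ 'a) l2"
      using norm_triangle_ineq[of "A + B" C] norm_triangle_ineq[of A B] by linarith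
    have "Wl b \<alpha> \<beta> s f - f = (Wl b \<alpha> \<beta> s f - Wl b \<alpha> \<beta> s H) + (Wl b \<alpha> \<beta> s H - H) + (H - f)" by simp
    then have "norm (Wl b \<alpha> \<beta> s f - f) \<le> norm (Wl b \<alpha> \<beta> s f - Wl b \<alpha> \<beta> s H) + norm (Wl b \<alpha> \<beta> s H - H) + norm (H - f)"
      using tri by metis
    with calculation show ?case using n1 HK(2) e by (simp add: dist_norm)
  qed
qed

lemma imaginary_powers_weyl_op: "imaginary_powers (weyl_op b \<alpha> \<beta>) (Wf b \<alpha> \<beta>)"
  unfolding imaginary_powers_def unitary_group_def
proof (intro conjI allI ballI)
  fix f :: "real ^ 'a \<Rightarrow> complex" assume f: "f \<in> L2"
  have "((\<lambda>s. dist (Wl b \<alpha> \<beta> s (cls f)) (cls f)) \<longlongrightarrow> 0) (at 0)"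
    using tendsto_dist[OF Wl_continuous[of b \<alpha> \<beta> "cls f"] tendsto_const[of "cls f"]] by simp
  then show "((\<lambda>s. l2_dist (Wf b \<alpha> \<beta> s f) f) \<longlongrightarrow> 0) (at 0)"
    using f by (simp add: l2_dist_cls Wf_L2 Wl_cls)
qed (simp_all add: Wf_L2 Wf_inner Wf_zero ae_eq_refl Wf_add weyl_op_def)

text \<open>The canonical commutation relation in Weyl form: both orders of composition are the same translation, and the two phases differ by the symplectic form of the directions.\<close>

lemma Wf_exchange:
  "Wf b \<alpha> \<beta> s (Wf b \<alpha>' \<beta>' t f) x =
    exp (- (2 * of_real pi * \<i> * of_real (b\<^sup>2 * s * t * (\<alpha> \<bullet> \<beta>' - \<alpha>' \<bullet> \<beta>)))) * Wf b \<alpha>' \<beta>' t (Wf b \<alpha> \<beta> s f) x"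
proof -
  have e: "x + (b * s) *\<^sub>R \<beta> + (b * t) *\<^sub>R \<beta>' = x + (b * t) *\<^sub>R \<beta>' + (b * s) *\<^sub>R \<beta>" by simp
  show ?thesis unfolding Wf_def e mult.assoc[symmetric] exp_add[symmetric]
    by (simp add: inner_add_right algebra_simps power2_eq_square)
qed

lemma q_exchange_weyl_op:
  assumes b: "0 < b" "b < 1" and q: "q = exp (complex_of_real pi * \<i> * complex_of_real (b\<^sup>2))"
    and k: "k = 2 * (\<alpha> \<bullet> \<beta>' - \<alpha>' \<bullet> \<beta>)"
  shows "q_exchange q k (weyl_op b \<alpha> \<beta>) (weyl_op b \<alpha>' \<beta>')"
  unfolding q_exchange_def
proof (rule exI[of _ "Wf b \<alpha> \<beta>"], rule exI[of _ "Wf b \<alpha>' \<beta>'"], intro conjI allI ballI)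
  fix s t :: real and f :: "real ^ 'a \<Rightarrow> complex"
  have b1: "b\<^sup>2 < 1" using b by (simp add: power_less_one_iff)
  have "Ln q = of_real pi * \<i> * of_real (b\<^sup>2)"
    unfolding q
  proof (rule Ln_exp)
    have "pi * b\<^sup>2 \<le> pi * 1" using b1 by (intro mult_left_mono) auto
    then show "Im (of_real pi * \<i> * of_real (b\<^sup>2)) \<le> pi" by simp
    have "- pi < 0" by simp
    also have "0 \<le> pi * b\<^sup>2" by simp
    finally show "- pi < Im (of_real pi * \<i> * of_real (b\<^sup>2))" by simp
  qed
  then have "q powr complex_of_real (- (k * s * t)) = exp (- (2 * of_real pi * \<i> * of_real (b\<^sup>2 * s * t * (\<alpha> \<bullet> \<beta>' - \<alpha>' \<bullet> \<beta>))))"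
    by (simp add: powr_def q k algebra_simps)
  then show "ae_eq (Wf b \<alpha> \<beta> s (Wf b \<alpha>' \<beta>' t f)) (\<lambda>x. q powr complex_of_real (- (k * s * t)) * Wf b \<alpha>' \<beta>' t (Wf b \<alpha> \<beta> s f) x)"
    unfolding ae_eq_def Wf_exchange[of b \<alpha> \<beta> s \<alpha>' \<beta>' t f] by simp
qed (rule imaginary_powers_weyl_op)+

section \<open>Words in the generators of the tori\<close>

fun lal lbe :: "'n::finite torus_gen \<Rightarrow> real ^ 'n" where
  "lal (Tu i) = axis i 1" | "lal (Tv i) = 0"
| "lbe (Tu i) = 0" | "lbe (Tv i) = axis i 1"

lemma exp_position_eq: "exp_position b i = weyl_op b (axis i 1) 0"
proof -
  define E where "E x = complex_of_real (exp (2 * pi * b * x $ i))" for x :: "real ^ 'a"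
  have [measurable]: "E \<in> borel_measurable borel"
    unfolding E_def[abs_def] by (intro borel_measurable_continuous_onI continuous_intros)
  have Egs: "gs \<gamma> (w + (-\<i>) *s kap b (axis i 1) 0 \<gamma>) = (\<lambda>x. E x * gs \<gamma> w x)" for \<gamma> w
  proof
    fix x :: "real ^ 'a"
    have ax: "cdot (cvec (axis i 1)) (cvec x) = complex_of_real (x $ i)"
      by (simp add: cvec_simps(3) inner_axis')
    have "cdot ((-\<i>) *s kap b (axis i 1) 0 \<gamma>) (cvec x) = -\<i> * (2 * of_real pi * \<i> * of_real b * complex_of_real (x $ i))"
      unfolding kap_def cdot_simps ax by simp
    also have "\<dots> = complex_of_real (2 * pi * b * x $ i)" by (simp add: complex_eq_iff)
    finally have c: "cdot ((-\<i>) *s kap b (axis i 1) 0 \<gamma>) (cvec x) = complex_of_real (2 * pi * b * x $ i)" .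
    show "gs \<gamma> (w + (-\<i>) *s kap b (axis i 1) 0 \<gamma>) x = E x * gs \<gamma> w x"
      unfolding gs_def E_def exp_of_real[symmetric] exp_add[symmetric] cdot_simps(1) c
      by (rule arg_cong[of _ _ exp]) simp
  qed
  have cf1: "cf b (axis i 1) 0 \<gamma> w (-\<i>) = 1" for \<gamma> w
    by (simp add: cf_def)
  have TG: "TG b (axis i 1) 0 \<gamma> w = cls (\<lambda>x. E x * gs \<gamma> w x)" for \<gamma> w
    by (simp only: TG_def cf1 cscale_one Egs)
  have EL2: "(\<lambda>x. E x * gs \<gamma> w x) \<in> L2" if "\<gamma> > 0" for \<gamma> w
    using gs_L2[OF that, of "w + (-\<i>) *s kap b (axis i 1) 0 \<gamma>"] by (simp only: Egs)
  have Ecnj: "cnj (E x) = E x" for x by (simp add: E_def)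
  have sym: "l2_inner f (\<lambda>x. E x * h x) = l2_inner (\<lambda>x. E x * f x) h" for f h
    unfolding l2_inner_def by (simp add: Ecnj mult_ac)
  have adj: "(f, g) \<in> weyl_op b (axis i 1) 0 \<longleftrightarrow> (\<forall>\<gamma>>0. \<forall>w. l2_inner f (\<lambda>x. E x * gs \<gamma> w x) = l2_inner g (gs \<gamma> w))"
    if fg: "f \<in> L2" "g \<in> L2" for f g
  proof
    assume "(f, g) \<in> weyl_op b (axis i 1) 0"
    then have A: "(cls f, cls g) \<in> AGW b (axis i 1) 0" by (simp add: weyl_op_iff)
    show "\<forall>\<gamma>>0. \<forall>w. l2_inner f (\<lambda>x. E x * gs \<gamma> w x) = l2_inner g (gs \<gamma> w)"
    proof (intro allI impI)
      fix \<gamma> :: real and w assume \<gamma>: "\<gamma> > 0"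
      from ugroup.AG_symmetric[OF ugroup_Wl gs_in_AG[OF \<gamma>] A[unfolded AGW_def]]
      show "l2_inner f (\<lambda>x. E x * gs \<gamma> w x) = l2_inner g (gs \<gamma> w)"
        unfolding TG using \<gamma> fg by (simp add: cinner_cls EL2 gs_L2)
    qed
  next
    assume A: "\<forall>\<gamma>>0. \<forall>w. l2_inner f (\<lambda>x. E x * gs \<gamma> w x) = l2_inner g (gs \<gamma> w)"
    have "core b (axis i 1) 0 \<subseteq> {x. cinner (cls f) (snd x) = cinner (cls g) (fst x)}"
      unfolding core_def
    proof (rule span_minimal)
      show "subspace {x. cinner (cls f) (snd x) = cinner (cls g) (fst x)}"
        by (rule subspaceI) (auto simp: cinner_add_right scaleR_l2_def cinner_scale_right)
      show "gens b (axis i 1) 0 \<subseteq> {x. cinner (cls f) (snd x) = cinner (cls g) (fst x)}"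
        using A fg by (auto simp: gens_def cinner_scale_right TG cinner_cls EL2 gs_L2)
    qed
    then have "(cls f, cls g) \<in> AGW b (axis i 1) 0" unfolding AGW_adjoint by auto
    then show "(f, g) \<in> weyl_op b (axis i 1) 0" using fg by (simp add: weyl_op_iff)
  qed
  show ?thesis
  proof (intro set_eqI, clarify)
    fix f g :: "real ^ 'a \<Rightarrow> complex"
    show "(f, g) \<in> exp_position b i \<longleftrightarrow> (f, g) \<in> weyl_op b (axis i 1) 0"
    proof (cases "f \<in> L2 \<and> g \<in> L2")
      case True
      then have fg: "f \<in> L2" "g \<in> L2" by auto
      note [measurable] = L2_measurable[OF fg(1)] L2_measurable[OF fg(2)]
      have "ae_eq g (\<lambda>x. E x * f x) \<longleftrightarrow> (\<forall>\<gamma>>0. \<forall>w. l2_inner f (\<lambda>x. E x * gs \<gamma> w x) = l2_inner g (gs \<gamma> w))"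
      proof
        assume "ae_eq g (\<lambda>x. E x * f x)"
        then have a: "AE x in lborel. g x = E x * f x" by (simp add: ae_eq_def)
        show "\<forall>\<gamma>>0. \<forall>w. l2_inner f (\<lambda>x. E x * gs \<gamma> w x) = l2_inner g (gs \<gamma> w)"
          unfolding sym l2_inner_def
        proof (intro allI impI integral_cong_AE)
          fix \<gamma> :: real and w :: "complex ^ 'a"
          show "AE x in lborel. cnj (E x * f x) * gs \<gamma> w x = cnj (g x) * gs \<gamma> w x"
            using a by eventually_elim simp
        qed measurable
      next
        assume A: "\<forall>\<gamma>>0. \<forall>w. l2_inner f (\<lambda>x. E x * gs \<gamma> w x) = l2_inner g (gs \<gamma> w)"
        define m where "m x = (E x * f x - g x) * gs 1 0 x" for x
        have g0: "gs 1 0 x = complex_of_real (exp (- (x \<bullet> x)))" for x :: "real ^ 'a"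
          by (simp add: gs_def cvec_simps(3) exp_of_real[symmetric])
        have b1: "(\<lambda>x. E x * gs 1 0 x * f x) \<in> L2"
        proof (rule L2_bound[OF L2_cmult[OF fg(1), of "of_real (exp ((pi * b)\<^sup>2))"]])
          fix x :: "real ^ 'a"
          have "\<bar>x $ i\<bar> \<le> norm x" by (rule component_le_norm_cart)
          then have "(x $ i)\<^sup>2 \<le> (norm x)\<^sup>2" by (metis abs_ge_zero power2_abs power_mono)
          then have "2 * pi * b * x $ i + - (x \<bullet> x) \<le> (pi * b)\<^sup>2"
            using sum_squares_bound[of "pi * b" "x $ i"] by (simp add: power2_norm_eq_inner)
          then have "exp (2 * pi * b * x $ i) * exp (- (x \<bullet> x)) \<le> exp ((pi * b)\<^sup>2)"
            unfolding exp_add[symmetric] by simp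
          then show "cmod (E x * gs 1 0 x * f x) \<le> cmod (of_real (exp ((pi * b)\<^sup>2)) * f x)"
            by (simp add: g0 E_def norm_mult mult_right_mono)
        qed measurable
        have b2: "(\<lambda>x. gs 1 0 x * g x) \<in> L2"
          by (rule L2_bound[OF fg(2)]) (measurable, simp add: g0 norm_mult mult_left_le_one_le)
        have mL2: "m \<in> L2" using L2_diff[OF b1 b2] by (simp add: m_def[abs_def] algebra_simps)
        have "AE x in lborel. m x = 0"
        proof (rule orthogonal_to_gs_imp_zero[OF mL2])
          fix \<gamma> :: real and w :: "complex ^ 'a" assume \<gamma>: "\<gamma> > 0"
          have gg: "gs (1 + \<gamma>) w x = gs 1 0 x * gs \<gamma> w x" for x
            unfolding gs_def exp_add[symmetric] by (simp add: algebra_simps)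
          have c0: "cnj (gs 1 0 x) = gs 1 0 x" for x :: "real ^ 'a" by (simp add: g0)
          have "l2_inner m (gs \<gamma> w) = (LINT x|lborel. cnj (f x) * (E x * gs (1 + \<gamma>) w x) - cnj (g x) * gs (1 + \<gamma>) w x)"
            unfolding l2_inner_def
            by (intro Bochner_Integration.integral_cong refl) (simp add: m_def gg c0 Ecnj algebra_simps)
          also have "\<dots> = l2_inner f (\<lambda>x. E x * gs (1 + \<gamma>) w x) - l2_inner g (gs (1 + \<gamma>) w)"
            unfolding l2_inner_def using \<gamma>
            by (intro Bochner_Integration.integral_diff L2_inner_integrable fg EL2 gs_L2) auto
          also have "\<dots> = 0" using A \<gamma> by simp
          finally show "l2_inner m (gs \<gamma> w) = 0" .
        qed
        then show "ae_eq g (\<lambda>x. E x * f x)" unfolding ae_eq_def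
          by eventually_elim (auto simp: m_def g0)
      qed
      then show ?thesis using adj[OF fg] fg by (simp add: exp_position_def E_def)
    qed (auto simp: exp_position_def weyl_op_iff)
  qed
qed

lemma exp_momentum_eq: "exp_momentum b i = weyl_op b 0 (axis i 1)"
proof -
  have "(b * s) *\<^sub>R axis i 1 = axis i (b * s)" for s :: real by (simp add: vec_eq_iff axis_def)
  then show ?thesis by (simp add: exp_momentum_def weyl_op_def Wf_def[abs_def])
qed

lemma torus_op_eq: "torus_op b x = weyl_op b (lal x) (lbe x)"
  by (cases x) (simp_all add: exp_position_eq exp_momentum_eq)

definition wal :: "'n::finite torus_gen list \<Rightarrow> real ^ 'n" where "wal xs = sum_list (map lal xs)"
definition wbe :: "'n::finite torus_gen list \<Rightarrow> real ^ 'n" where "wbe xs = sum_list (map lbe xs)"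

fun phr :: "'n::finite torus_gen list \<Rightarrow> real" where
  "phr [] = 0"
| "phr (x # xs) = (lal x \<bullet> wbe xs - wal xs \<bullet> lbe x) + phr xs"

definition eph :: "real \<Rightarrow> real \<Rightarrow> complex" where
  "eph b r = exp (of_real pi * \<i> * of_real (b\<^sup>2) * of_real r)"

lemma eph_add: "eph b (r + s) = eph b r * eph b s"
  by (simp add: eph_def exp_add[symmetric] algebra_simps)

lemma cnj_eph: "cnj (eph b r) = eph b (- r)"
  by (simp add: eph_def exp_cnj)

lemma eph_minus: "eph b (- r) * eph b r = 1" "eph b r * eph b (- r) = 1"
  by (simp_all add: eph_add[symmetric], simp_all add: eph_def)

lemma TG_compose:
  "cf b \<alpha>' \<beta>' \<gamma> w (-\<i>) *\<^sub>C TG b \<alpha> \<beta> \<gamma> (w + (-\<i>) *s kap b \<alpha>' \<beta>' \<gamma>)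
    = eph b (\<alpha> \<bullet> \<beta>' - \<alpha>' \<bullet> \<beta>) *\<^sub>C TG b (\<alpha> + \<alpha>') (\<beta> + \<beta>') \<gamma> w"
proof -
  have k: "w + (-\<i>) *s kap b \<alpha>' \<beta>' \<gamma> + (-\<i>) *s kap b \<alpha> \<beta> \<gamma> = w + (-\<i>) *s kap b (\<alpha> + \<alpha>') (\<beta> + \<beta>') \<gamma>"
    by (simp add: kap_def cvec_simps(1) vec_eq_iff algebra_simps)
  have e: "complex_of_real (\<alpha> \<bullet> \<beta>' - \<alpha>' \<bullet> \<beta>) = cdot (cvec \<alpha>) (cvec \<beta>') - cdot (cvec \<alpha>') (cvec \<beta>)"
    by (simp add: cvec_simps(3))
  have "cf b \<alpha>' \<beta>' \<gamma> w (-\<i>) * cf b \<alpha> \<beta> \<gamma> (w + (-\<i>) *s kap b \<alpha>' \<beta>' \<gamma>) (-\<i>)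
      = eph b (\<alpha> \<bullet> \<beta>' - \<alpha>' \<bullet> \<beta>) * cf b (\<alpha> + \<alpha>') (\<beta> + \<beta>') \<gamma> w (-\<i>)"
    unfolding cf_def eph_def e exp_add[symmetric] kap_def cdot_simps cvec_simps(1)
    by (rule arg_cong[of _ _ exp]) (simp add: cdot_commute[of "cvec \<beta>'" "cvec \<beta>"] algebra_simps power2_eq_square)
  then show ?thesis unfolding TG_def cscale_cscale k by simp
qed

fun WL :: "real \<Rightarrow> 'n::finite torus_gen list \<Rightarrow> ((real ^ 'n) l2 \<times> (real ^ 'n) l2) set" where
  "WL b [] = {(F, F) | F. True}"
| "WL b (x # xs) = WL b xs O AGW b (lal x) (lbe x)"

lemma word_op_iff: "(f, g) \<in> word_op b xs \<longleftrightarrow> f \<in> L2 \<and> g \<in> L2 \<and> (cls f, cls g) \<in> WL b xs"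
proof (induction xs arbitrary: g)
  case Nil
  have "ae_eq g f \<longleftrightarrow> ae_eq f g" by (auto intro: ae_eq_sym)
  then show ?case using cls_eq_iff[of f g] by auto
next
  case (Cons x xs)
  show ?case
  proof
    assume "(f, g) \<in> word_op b (x # xs)"
    then obtain h where "(f, h) \<in> word_op b xs" "(h, g) \<in> torus_op b x" by auto
    then show "f \<in> L2 \<and> g \<in> L2 \<and> (cls f, cls g) \<in> WL b (x # xs)"
      unfolding Cons.IH torus_op_eq weyl_op_iff by auto
  next
    assume A: "f \<in> L2 \<and> g \<in> L2 \<and> (cls f, cls g) \<in> WL b (x # xs)"
    then obtain H where H: "(cls f, H) \<in> WL b xs" "(H, cls g) \<in> AGW b (lal x) (lbe x)" by auto
    obtain h where h: "h \<in> L2" "H = cls h" by (rule cls_exhaust)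
    have "(f, h) \<in> word_op b xs" "(h, g) \<in> torus_op b x"
      unfolding Cons.IH torus_op_eq weyl_op_iff using A H h by auto
    then show "(f, g) \<in> word_op b (x # xs)" by auto
  qed
qed

lemma AGW_scale: "(f, g) \<in> AGW b \<alpha> \<beta> \<Longrightarrow> (c *\<^sub>C f, c *\<^sub>C g) \<in> AGW b \<alpha> \<beta>"
  unfolding AGW_def by (rule ugroup.AG_scale[OF ugroup_Wl])
lemma AGW_add: "(f, g) \<in> AGW b \<alpha> \<beta> \<Longrightarrow> (f', g') \<in> AGW b \<alpha> \<beta> \<Longrightarrow> (f + f', g + g') \<in> AGW b \<alpha> \<beta>"
  unfolding AGW_def by (rule ugroup.AG_add[OF ugroup_Wl])

lemma WL_scale: "(F, G) \<in> WL b xs \<Longrightarrow> (c *\<^sub>C F, c *\<^sub>C G) \<in> WL b xs"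
  by (induction xs arbitrary: G) (auto intro: AGW_scale)

lemma WL_add: "(F, G) \<in> WL b xs \<Longrightarrow> (F', G') \<in> WL b xs \<Longrightarrow> (F + F', G + G') \<in> WL b xs"
proof (induction xs arbitrary: G G')
  case (Cons x xs)
  from Cons.prems obtain H H' where "(F, H) \<in> WL b xs" "(H, G) \<in> AGW b (lal x) (lbe x)"
    "(F', H') \<in> WL b xs" "(H', G') \<in> AGW b (lal x) (lbe x)" by auto
  then have "(F + F', H + H') \<in> WL b xs" "(H + H', G + G') \<in> AGW b (lal x) (lbe x)"
    by (auto intro: Cons.IH AGW_add)
  then show ?case by auto
qed simp

lemma WL_gs:
  assumes g: "\<gamma> > 0"
  shows "(cls (gs \<gamma> w), eph b (phr xs) *\<^sub>C TG b (wal xs) (wbe xs) \<gamma> w) \<in> WL b xs"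
proof (induction xs)
  case Nil
  have "TG b 0 0 \<gamma> w = cls (gs \<gamma> w)"
    by (simp add: TG_def cf_def kap_def cscale_one)
  then show ?case by (simp add: wal_def wbe_def eph_def cscale_one)
next
  case (Cons x xs)
  define w' where "w' = w + (-\<i>) *s kap b (wal xs) (wbe xs) \<gamma>"
  define c where "c = eph b (phr xs) * cf b (wal xs) (wbe xs) \<gamma> w (-\<i>)"
  have "(cls (gs \<gamma> w), c *\<^sub>C cls (gs \<gamma> w')) \<in> WL b xs"
    using Cons by (simp add: c_def w'_def TG_def cscale_cscale)
  moreover have "(c *\<^sub>C cls (gs \<gamma> w'), c *\<^sub>C TG b (lal x) (lbe x) \<gamma> w') \<in> AGW b (lal x) (lbe x)"
    unfolding AGW_def by (intro ugroup.AG_scale[OF ugroup_Wl] gs_in_AG g)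
  moreover have "c *\<^sub>C TG b (lal x) (lbe x) \<gamma> w' = eph b (phr (x # xs)) *\<^sub>C TG b (wal (x # xs)) (wbe (x # xs)) \<gamma> w"
  proof -
    have "c *\<^sub>C TG b (lal x) (lbe x) \<gamma> w' = eph b (phr xs) *\<^sub>C (cf b (wal xs) (wbe xs) \<gamma> w (-\<i>) *\<^sub>C TG b (lal x) (lbe x) \<gamma> w')"
      by (simp add: c_def cscale_cscale)
    also have "\<dots> = (eph b (phr xs) * eph b (lal x \<bullet> wbe xs - wal xs \<bullet> lbe x)) *\<^sub>C TG b (lal x + wal xs) (lbe x + wbe xs) \<gamma> w"
      unfolding w'_def TG_compose cscale_cscale ..
    finally show ?thesis by (simp add: eph_add wal_def wbe_def mult.commute)
  qed
  ultimately show ?case by auto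
qed

text \<open>The letters are symmetric, so a word has the reversed word as formal adjoint.\<close>

lemma WL_adj:
  assumes g: "\<gamma> > 0" and FG: "(F, G) \<in> WL b xs"
  shows "cinner G (cls (gs \<gamma> w)) = cinner F (eph b (- phr xs) *\<^sub>C TG b (wal xs) (wbe xs) \<gamma> w)"
  using FG
proof (induction xs arbitrary: G w)
  case Nil
  have "TG b 0 0 \<gamma> w = cls (gs \<gamma> w)"
    by (simp add: TG_def cf_def kap_def cscale_one)
  then show ?case using Nil by (simp add: wal_def wbe_def eph_def cscale_one)
next
  case (Cons x xs)
  define w' where "w' = w + (-\<i>) *s kap b (lal x) (lbe x) \<gamma>"
  define c where "c = cf b (lal x) (lbe x) \<gamma> w (-\<i>)"
  from Cons.prems obtain G1 where G1: "(F, G1) \<in> WL b xs" "(G1, G) \<in> AGW b (lal x) (lbe x)" by auto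
  from ugroup.AG_symmetric[OF ugroup_Wl gs_in_AG[OF g] G1(2)[unfolded AGW_def]]
  have "cinner G (cls (gs \<gamma> w)) = cinner G1 (TG b (lal x) (lbe x) \<gamma> w)" by simp
  also have "\<dots> = c * cinner G1 (cls (gs \<gamma> w'))" by (simp add: TG_def c_def w'_def cinner_scale_right)
  also have "\<dots> = cinner F (eph b (- phr xs) *\<^sub>C (c *\<^sub>C TG b (wal xs) (wbe xs) \<gamma> w'))"
    by (simp add: Cons.IH[OF G1(1)] cinner_scale_right)
  also have "\<dots> = cinner F ((eph b (- phr xs) * eph b (wal xs \<bullet> lbe x - lal x \<bullet> wbe xs)) *\<^sub>C TG b (wal xs + lal x) (wbe xs + lbe x) \<gamma> w)"
    unfolding w'_def c_def TG_compose cscale_cscale ..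
  also have "eph b (- phr xs) * eph b (wal xs \<bullet> lbe x - lal x \<bullet> wbe xs) = eph b (- phr (x # xs))"
    by (simp add: eph_add[symmetric] algebra_simps)
  finally show ?case by (simp add: wal_def wbe_def add.commute)
qed

lemma closure_op_cls:
  assumes X: "\<And>f g. (f, g) \<in> X \<longleftrightarrow> f \<in> L2 \<and> g \<in> L2 \<and> (cls f, cls g) \<in> Y"
  shows "(f, g) \<in> closure_op X \<longleftrightarrow> f \<in> L2 \<and> g \<in> L2 \<and> (cls f, cls g) \<in> closure Y"
proof (cases "f \<in> L2 \<and> g \<in> L2")
  case True
  have "(\<forall>\<epsilon>>0. \<exists>(h, k)\<in>X. l2_dist h f < \<epsilon> \<and> l2_dist k g < \<epsilon>) \<longleftrightarrow> (cls f, cls g) \<in> closure Y"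
  proof
    assume A: "\<forall>\<epsilon>>0. \<exists>(h, k)\<in>X. l2_dist h f < \<epsilon> \<and> l2_dist k g < \<epsilon>"
    show "(cls f, cls g) \<in> closure Y" unfolding closure_approachable
    proof (intro allI impI)
      fix e :: real assume "e > 0"
      then obtain h k where hk: "(h, k) \<in> X" "l2_dist h f < e/2" "l2_dist k g < e/2"
        using A[rule_format, of "e/2"] by auto
      then have Y: "h \<in> L2" "k \<in> L2" "(cls h, cls k) \<in> Y" by (simp_all add: X)
      have "dist (cls h, cls k) (cls f, cls g) \<le> dist (cls h) (cls f) + dist (cls k) (cls g)"
        unfolding dist_Pair_Pair by (rule sqrt_sum_squares_le_sum) auto
      also have "\<dots> < e" using hk True Y by (simp add: l2_dist_cls)
      finally show "\<exists>y\<in>Y. dist y (cls f, cls g) < e" using Y by blast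
    qed
  next
    assume A: "(cls f, cls g) \<in> closure Y"
    show "\<forall>\<epsilon>>0. \<exists>(h, k)\<in>X. l2_dist h f < \<epsilon> \<and> l2_dist k g < \<epsilon>"
    proof (intro allI impI)
      fix e :: real assume "e > 0"
      then obtain y where y: "y \<in> Y" "dist y (cls f, cls g) < e" using A unfolding closure_approachable by blast
      obtain h where h: "h \<in> L2" "fst y = cls h" by (rule cls_exhaust)
      obtain k where k: "k \<in> L2" "snd y = cls k" by (rule cls_exhaust)
      have "y = (cls h, cls k)" using h k by (simp add: prod_eq_iff)
      then have "(h, k) \<in> X" using y h k by (simp add: X)
      moreover have "l2_dist h f < e" "l2_dist k g < e"
        using dist_fst_le[of y "(cls f, cls g)"] dist_snd_le[of y "(cls f, cls g)"] y(2) h k True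
        by (simp_all add: l2_dist_cls)
      ultimately show "\<exists>(h, k)\<in>X. l2_dist h f < e \<and> l2_dist k g < e" by blast
    qed
  qed
  then show ?thesis using True by (simp add: closure_op_def)
qed (auto simp: closure_op_def)

text \<open>A word in the \<open>u\<^sub>i\<close>, \<open>v\<^sub>i\<close>, divided by its phase, is essentially self-adjoint.\<close>

theorem realized_word: "realized b (Poly_Mapping.single (Word xs) (eph b (- phr xs))) = weyl_op b (wal xs) (wbe xs)"
proof -
  define c where "c = eph b (- phr xs)"
  have c0: "c \<noteq> 0" by (simp add: c_def eph_def)
  let ?p = "Poly_Mapping.single (Word xs) c" and ?\<alpha> = "wal xs" and ?\<beta> = "wbe xs"
  define Y where "Y = {(F, c *\<^sub>C H) | F H. (F, H) \<in> WL b xs}"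
  have poly: "(f, g) \<in> poly_op b ?p \<longleftrightarrow> f \<in> L2 \<and> g \<in> L2 \<and> (cls f, cls g) \<in> Y" for f g
  proof
    assume "(f, g) \<in> poly_op b ?p"
    then obtain h where h: "f \<in> L2" "g \<in> L2" "(f, h) \<in> word_op b xs" "ae_eq g (\<lambda>x. c * h x)"
      using c0 by (auto simp: poly_op_def)
    then have "h \<in> L2" "(cls f, cls h) \<in> WL b xs" by (simp_all add: word_op_iff)
    moreover have "cls g = c *\<^sub>C cls h" using h \<open>h \<in> L2\<close> by (simp add: cls_scale[symmetric] cls_eq_iff L2_cmult)
    ultimately show "f \<in> L2 \<and> g \<in> L2 \<and> (cls f, cls g) \<in> Y" using h by (auto simp: Y_def)
  next
    assume A: "f \<in> L2 \<and> g \<in> L2 \<and> (cls f, cls g) \<in> Y"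
    then obtain H where H: "(cls f, H) \<in> WL b xs" "cls g = c *\<^sub>C H" by (auto simp: Y_def)
    obtain h where h: "h \<in> L2" "H = cls h" by (rule cls_exhaust)
    have "(f, h) \<in> word_op b xs" using A H h by (simp add: word_op_iff)
    moreover have "ae_eq g (\<lambda>x. c * h x)" using A H h by (simp add: cls_scale[symmetric] cls_eq_iff L2_cmult)
    ultimately show "(f, g) \<in> poly_op b ?p" using A c0 by (auto simp: poly_op_def intro!: exI[of _ "\<lambda>_. h"])
  qed
  have "Y \<subseteq> AGW b ?\<alpha> ?\<beta>"
  proof (clarsimp simp: Y_def)
    fix F H assume FH: "(F, H) \<in> WL b xs"
    have "core b ?\<alpha> ?\<beta> \<subseteq> {x. cinner F (snd x) = cinner (c *\<^sub>C H) (fst x)}"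
      unfolding core_def
    proof (rule span_minimal)
      show "subspace {x. cinner F (snd x) = cinner (c *\<^sub>C H) (fst x)}"
        by (rule subspaceI) (auto simp: cinner_add_right scaleR_l2_def cinner_scale_right)
      have "cinner F (TG b ?\<alpha> ?\<beta> \<gamma> w) = cinner (c *\<^sub>C H) (cls (gs \<gamma> w))" if "\<gamma> > 0" for \<gamma> w
        using WL_adj[OF that FH, of w] by (simp add: cinner_scale_left cinner_scale_right c_def cnj_eph mult.assoc[symmetric] eph_minus)
      then show "gens b ?\<alpha> ?\<beta> \<subseteq> {x. cinner F (snd x) = cinner (c *\<^sub>C H) (fst x)}"
        by (auto simp: gens_def cinner_scale_right)
    qed
    then show "(F, c *\<^sub>C H) \<in> AGW b ?\<alpha> ?\<beta>" unfolding AGW_adjoint by auto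
  qed
  moreover have "closed (AGW b ?\<alpha> ?\<beta>)" unfolding AGW_closure by (rule closed_closure)
  ultimately have "closure Y \<subseteq> AGW b ?\<alpha> ?\<beta>" by (rule closure_minimal)
  moreover have "core b ?\<alpha> ?\<beta> \<subseteq> Y"
    unfolding core_def
  proof (rule span_minimal)
    show "subspace Y"
    proof (rule subspaceI)
      have "(0, 0) \<in> WL b xs"
        using WL_scale[OF WL_gs[of 1 0 b xs], of 0] by (simp add: cscale_zero)
      then show "0 \<in> Y" unfolding Y_def zero_prod_def
        using cscale_cscale[of c 0 0] by (auto intro!: exI[of _ 0] simp: cscale_zero)
      show "x + y \<in> Y" if xy: "x \<in> Y" "y \<in> Y" for x y
      proof -
        obtain F H F' H' where e: "x = (F, c *\<^sub>C H)" "y = (F', c *\<^sub>C H')" "(F, H) \<in> WL b xs" "(F', H') \<in> WL b xs"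
          using xy unfolding Y_def by blast
        have "x + y = (F + F', c *\<^sub>C (H + H'))" by (simp add: e cscale_add_right)
        with WL_add[OF e(3,4)] show ?thesis unfolding Y_def by blast
      qed
      show "r *\<^sub>R x \<in> Y" if x: "x \<in> Y" for x r
      proof -
        obtain F H where e: "x = (F, c *\<^sub>C H)" "(F, H) \<in> WL b xs" using x unfolding Y_def by blast
        have "r *\<^sub>R x = (of_real r *\<^sub>C F, c *\<^sub>C (of_real r *\<^sub>C H))"
          by (simp add: e scaleR_l2_def cscale_cscale mult.commute)
        with WL_scale[OF e(2)] show ?thesis unfolding Y_def by blast
      qed
    qed
    show "gens b ?\<alpha> ?\<beta> \<subseteq> Y"
    proof
      fix x assume "x \<in> gens b ?\<alpha> ?\<beta>"
      then obtain d \<gamma> w where x: "x = (d *\<^sub>C cls (gs \<gamma> w), d *\<^sub>C TG b ?\<alpha> ?\<beta> \<gamma> w)" and g: "\<gamma> > 0" by (auto simp: gens_def)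
      have "(d *\<^sub>C cls (gs \<gamma> w), d *\<^sub>C eph b (phr xs) *\<^sub>C TG b ?\<alpha> ?\<beta> \<gamma> w) \<in> WL b xs"
        by (rule WL_scale[OF WL_gs[OF g]])
      moreover have "d *\<^sub>C TG b ?\<alpha> ?\<beta> \<gamma> w = c *\<^sub>C (d *\<^sub>C eph b (phr xs) *\<^sub>C TG b ?\<alpha> ?\<beta> \<gamma> w)"
      proof -
        have "c * (d * eph b (phr xs)) = d" using eph_minus(1)[of b "phr xs"] by (simp add: c_def mult.left_commute)
        then show ?thesis by (simp only: cscale_cscale mult.assoc)
      qed
      ultimately show "x \<in> Y" unfolding Y_def x by blast
    qed
  qed
  then have "AGW b ?\<alpha> ?\<beta> \<subseteq> closure Y" unfolding AGW_closure by (rule closure_mono)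
  ultimately have "closure Y = AGW b ?\<alpha> ?\<beta>" by blast
  then show ?thesis
    unfolding realized_def c_def[symmetric]
    by (intro set_eqI) (clarsimp simp: closure_op_cls[OF poly] weyl_op_iff)
qed

section \<open>Calculation in presented algebras\<close>

definition monom :: "'g list \<Rightarrow> 'g free_algebra" where
  "monom w = Poly_Mapping.single (Word w) 1"

lemma plus_Word: "Word v + Word w = Word (v @ w)" by (simp add: plus_word_def)

lemma single_mult_single:
  "Poly_Mapping.single (Word v) c * Poly_Mapping.single (Word w) d = Poly_Mapping.single (Word (v @ w)) (c * d :: complex)"
  by (simp add: mult_single plus_Word)

lemma const_mult_single: "const c * Poly_Mapping.single w d = Poly_Mapping.single w (c * d)"
  by (simp add: const_def mult_single)

lemma single_eq_const_monom: "Poly_Mapping.single w c = const c * monom (letters w)"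
  by (simp add: monom_def const_mult_single)

lemma monom_Nil: "monom [] = 1" by (simp add: monom_def zero_word_def[symmetric])
lemma monom_append: "monom (v @ w) = monom v * monom w" by (simp add: monom_def single_mult_single)
lemma monom_single: "monom [g] = gen g" by (simp add: monom_def gen_def)

lemma const_add: "const (c + d) = const c + const d" by (simp add: const_def single_add)
lemma const_zero: "const 0 = 0" by (simp add: const_def)
lemma const_one: "const 1 = 1" by (simp add: const_def)
lemma const_mult: "const (c * d) = const c * const d" by (simp add: const_def mult_single)
lemma const_sum: "const (\<Sum>x\<in>A. f x) = (\<Sum>x\<in>A. const (f x))"
  by (induction A rule: infinite_finite_induct) (simp_all add: const_zero const_add)

lemma poly_expand:
  fixes x :: "'w \<Rightarrow>\<^sub>0 complex"
  shows "x = (\<Sum>w\<in>Poly_Mapping.keys x. Poly_Mapping.single w (Poly_Mapping.lookup x w))"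
  by (rule poly_mapping_eqI) (simp add: lookup_sum lookup_single when_def in_keys_iff)

lemma poly_single_induct [case_names single sum]:
  fixes x :: "'w \<Rightarrow>\<^sub>0 complex"
  assumes "\<And>k v. P (Poly_Mapping.single k v)" "\<And>f g. P f \<Longrightarrow> P g \<Longrightarrow> P (f + g)"
  shows "P x"
proof -
  have "P (\<Sum>w\<in>A. Poly_Mapping.single w (Poly_Mapping.lookup x w))" if "finite A" for A
    using that by induction (use assms assms(1)[of undefined 0] in simp_all)
  from this[of "Poly_Mapping.keys x"] show ?thesis by (simp add: poly_expand[symmetric])
qed

lemma const_commute: "const c * x = x * const c"
proof (induction x rule: poly_single_induct)
  case (single k v) then show ?case by (simp add: const_def mult_single mult.commute)
next
  case (sum f g) then show ?case by (simp add: distrib_left distrib_right)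
qed

lemma sum_keys_superset:
  assumes "finite A" "Poly_Mapping.keys x \<subseteq> A" "\<And>w. f w 0 = (0 :: 'a::comm_monoid_add)"
  shows "(\<Sum>w\<in>Poly_Mapping.keys x. f w (Poly_Mapping.lookup x w)) = (\<Sum>w\<in>A. f w (Poly_Mapping.lookup x w))"
  by (rule sum.mono_neutral_left) (use assms in \<open>auto simp: in_keys_iff\<close>)

lemma sum_keys_add:
  fixes f :: "'b \<Rightarrow> complex \<Rightarrow> 'a::comm_monoid_add"
  assumes z: "\<And>w. f w 0 = 0" and a: "\<And>w c d. f w (c + d) = f w c + f w d"
  shows "(\<Sum>w\<in>Poly_Mapping.keys (x + y). f w (Poly_Mapping.lookup (x + y) w))
    = (\<Sum>w\<in>Poly_Mapping.keys x. f w (Poly_Mapping.lookup x w)) + (\<Sum>w\<in>Poly_Mapping.keys y. f w (Poly_Mapping.lookup y w))"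
proof -
  let ?A = "Poly_Mapping.keys x \<union> Poly_Mapping.keys y"
  have f: "finite ?A" by simp
  have s: "Poly_Mapping.keys (x + y) \<subseteq> ?A" by (rule Poly_Mapping.keys_add)
  have "(\<Sum>w\<in>Poly_Mapping.keys (x + y). f w (Poly_Mapping.lookup (x + y) w)) = (\<Sum>w\<in>?A. f w (Poly_Mapping.lookup (x + y) w))"
    by (rule sum_keys_superset[of ?A "x + y" f]) (simp_all only: f s z)
  also have "\<dots> = (\<Sum>w\<in>?A. f w (Poly_Mapping.lookup x w)) + (\<Sum>w\<in>?A. f w (Poly_Mapping.lookup y w))"
    by (simp add: lookup_add a sum.distrib)
  also have "(\<Sum>w\<in>?A. f w (Poly_Mapping.lookup x w)) = (\<Sum>w\<in>Poly_Mapping.keys x. f w (Poly_Mapping.lookup x w))"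
    by (rule sum_keys_superset[of ?A x f, symmetric]) (simp_all add: z)
  also have "(\<Sum>w\<in>?A. f w (Poly_Mapping.lookup y w)) = (\<Sum>w\<in>Poly_Mapping.keys y. f w (Poly_Mapping.lookup y w))"
    by (rule sum_keys_superset[of ?A y f, symmetric]) (simp_all add: z)
  finally show ?thesis .
qed

subsection \<open>The homomorphism \<open>lift\<close>\<close>

lemma lift_single: "lift \<phi> (Poly_Mapping.single w c) = const c * prod_list (map \<phi> (letters w))"
  by (simp add: lift_def const_zero)

lemma lift_add: "lift \<phi> (x + y) = lift \<phi> x + lift \<phi> y"
  unfolding lift_def
  by (rule sum_keys_add[of "\<lambda>w c. const c * prod_list (map \<phi> (letters w))"]) (simp_all add: const_zero const_add distrib_right)

lemma lift_zero: "lift \<phi> 0 = 0" by (simp add: lift_def)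

lemma lift_minus: "lift \<phi> (- x) = - lift \<phi> x"
  using lift_add[of \<phi> x "- x"] by (simp add: lift_zero minus_unique)

lemma lift_diff: "lift \<phi> (x - y) = lift \<phi> x - lift \<phi> y"
  using lift_add[of \<phi> x "- y"] by (simp add: lift_minus)

lemma const_left_commute: "x * (const c * y) = const c * (x * y)"
  by (simp only: mult.assoc[symmetric] const_commute[of c x])

lemma const_mult_swap: "const (c * d) * (A * B) = (const c * A) * (const d * B)"
proof -
  have "const (c * d) * (A * B) = const c * (const d * (A * B))" by (simp only: const_mult mult.assoc)
  also have "const d * (A * B) = A * (const d * B)" by (rule const_left_commute[symmetric])
  finally show ?thesis by (simp only: mult.assoc)
qed

lemma lift_mult: "lift \<phi> (x * y) = lift \<phi> x * lift \<phi> y"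
proof (induction x rule: poly_single_induct)
  case (single v c)
  show ?case
  proof (induction y rule: poly_single_induct)
    case (single w d)
    have "lift \<phi> (Poly_Mapping.single v c * Poly_Mapping.single w d) = lift \<phi> (Poly_Mapping.single (Word (letters v @ letters w)) (c * d))"
      by (simp only: mult_single plus_word_def)
    also have "\<dots> = const (c * d) * (prod_list (map \<phi> (letters v)) * prod_list (map \<phi> (letters w)))"
      by (simp only: lift_single word.sel map_append prod_list.append)
    also have "\<dots> = lift \<phi> (Poly_Mapping.single v c) * lift \<phi> (Poly_Mapping.single w d)"
      unfolding lift_single by (rule const_mult_swap)
    finally show ?case .
  next
    case (sum f g)
    show ?case by (simp only: distrib_left lift_add sum)
  qed
next
  case (sum f g)
  show ?case by (simp only: distrib_right lift_add sum)
qed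

lemma lift_const: "lift \<phi> (const c) = const c"
proof -
  have "lift \<phi> (Poly_Mapping.single (Word []) c) = const c * 1"
    by (simp only: lift_single word.sel list.map prod_list.Nil)
  then show ?thesis by (simp only: const_def zero_word_def mult_1_right)
qed

subsection \<open>Congruence\<close>

lemma alg_eq_refl: "alg_eq R x x"
  by (simp add: alg_eq_def two_sided_ideal.zero)

lemma ideal_uminus: "x \<in> two_sided_ideal S \<Longrightarrow> - x \<in> two_sided_ideal S"
  using two_sided_ideal.mult[of x S "-1" 1] by simp

lemma alg_eq_sym: "alg_eq R x y \<Longrightarrow> alg_eq R y x"
  unfolding alg_eq_def using ideal_uminus by fastforce

lemma alg_eq_trans [trans]: "alg_eq R x y \<Longrightarrow> alg_eq R y z \<Longrightarrow> alg_eq R x z"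
  unfolding alg_eq_def using two_sided_ideal.add[of "x - y" _ "y - z"] by simp

lemma alg_eq_add: "alg_eq R x y \<Longrightarrow> alg_eq R x' y' \<Longrightarrow> alg_eq R (x + x') (y + y')"
  unfolding alg_eq_def using two_sided_ideal.add[of "x - y" _ "x' - y'"] by (simp add: algebra_simps)

lemma alg_eq_mult:
  assumes "alg_eq R x y" "alg_eq R x' y'" shows "alg_eq R (x * x') (y * y')"
proof -
  have "1 * (x - y) * x' + y * (x' - y') * 1 \<in> two_sided_ideal {l - r | l r. (l, r) \<in> R}"
    using assms unfolding alg_eq_def by (intro two_sided_ideal.add two_sided_ideal.mult)
  then show ?thesis by (simp add: alg_eq_def algebra_simps)
qed

lemma alg_eq_sum: "(\<And>i. i \<in> A \<Longrightarrow> alg_eq R (f i) (g i)) \<Longrightarrow> alg_eq R (\<Sum>i\<in>A. f i) (\<Sum>i\<in>A. g i)"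
  by (induction A rule: infinite_finite_induct) (auto intro: alg_eq_refl alg_eq_add)

lemma alg_eq_scale: "alg_eq R x y \<Longrightarrow> alg_eq R (const c * x) (const c * y)"
  by (intro alg_eq_mult alg_eq_refl)

lemma alg_eq_rel: "(l, r) \<in> R \<Longrightarrow> alg_eq R l r"
  unfolding alg_eq_def by (rule two_sided_ideal.base) blast

lemma alg_eq_diff_zero: "alg_eq R x y \<longleftrightarrow> alg_eq R (x - y) 0"
  by (simp add: alg_eq_def)

text \<open>A homomorphism that respects the relations maps the ideal they generate to an ideal of the target.\<close>

lemma alg_eq_lift:
  assumes "\<And>l r. (l, r) \<in> R \<Longrightarrow> alg_eq R' (lift \<phi> l) (lift \<phi> r)" and "alg_eq R x y"
  shows "alg_eq R' (lift \<phi> x) (lift \<phi> y)"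
proof -
  have "lift \<phi> z \<in> two_sided_ideal {l - r | l r. (l, r) \<in> R'}" if "z \<in> two_sided_ideal {l - r | l r. (l, r) \<in> R}" for z
    using that
  proof induction
    case zero show ?case by (simp add: lift_zero two_sided_ideal.zero)
  next
    case (base x) then show ?case using assms(1) by (auto simp: lift_diff alg_eq_def)
  next
    case (add x y) then show ?case by (simp add: lift_add two_sided_ideal.add)
  next
    case (mult x l r) then show ?case by (simp add: lift_mult two_sided_ideal.mult)
  qed
  from this[OF assms(2)[unfolded alg_eq_def]] show ?thesis by (simp add: alg_eq_def lift_diff)
qed

section \<open>Normal forms in quasi-commuting variables\<close>

text \<open>The exponent picked up when the words \<open>v\<close> and \<open>w\<close> are exchanged, up to the factor two.\<close>

definition cross :: "('g \<Rightarrow> 'g \<Rightarrow> int) \<Rightarrow> 'g list \<Rightarrow> 'g list \<Rightarrow> int" where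
  "cross om v w = (\<Sum>x\<leftarrow>v. \<Sum>y\<leftarrow>w. om x y)"

fun ph :: "('g \<Rightarrow> 'g \<Rightarrow> int) \<Rightarrow> 'g list \<Rightarrow> int" where
  "ph om [] = 0"
| "ph om (x # xs) = (\<Sum>y\<leftarrow>xs. om x y) + ph om xs"

lemma ph_append: "ph om (v @ w) = ph om v + ph om w + cross om v w"
  by (induction v) (simp_all add: cross_def)

lemma sum_list_mset_cong: "mset v = mset w \<Longrightarrow> (\<Sum>y\<leftarrow>v. f y) = (\<Sum>y\<leftarrow>w. f y :: int)"
  by (metis mset_map sum_mset_sum_list)

lemma cross_cong: "mset v = mset v' \<Longrightarrow> mset w = mset w' \<Longrightarrow> cross om v w = cross om v' w'"
  unfolding cross_def by (simp add: sum_list_mset_cong[of w w'] sum_list_mset_cong[of v v'])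

lemma cross_simps: "cross om [] w = 0" "cross om (x # v) w = (\<Sum>y\<leftarrow>w. om x y) + cross om v w"
  "cross om v [] = 0" "cross om v (y # w) = (\<Sum>x\<leftarrow>v. om x y) + cross om v w"
  "cross om (v @ v') w = cross om v w + cross om v' w" "cross om v (w @ w') = cross om v w + cross om v w'"
  by (simp_all add: cross_def sum_list_addf)

text \<open>The coefficient of the Weyl ordered monomial with exponents \<open>M\<close>.\<close>

definition nf :: "complex \<Rightarrow> ('g \<Rightarrow> 'g \<Rightarrow> int) \<Rightarrow> 'g free_algebra \<Rightarrow> 'g multiset \<Rightarrow> complex" where
  "nf q om x M = (\<Sum>w\<in>Poly_Mapping.keys x.
     if mset (letters w) = M then Poly_Mapping.lookup x w * q powi ph om (letters w) else 0)"

lemma nf_add: "nf q om (x + y) M = nf q om x M + nf q om y M"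
  unfolding nf_def
  by (rule sum_keys_add[of "\<lambda>w c. if mset (letters w) = M then c * q powi ph om (letters w) else 0"]) (simp_all add: distrib_right)

lemma nf_single: "nf q om (Poly_Mapping.single w c) M = (if mset (letters w) = M then c * q powi ph om (letters w) else 0)"
  by (simp add: nf_def)

lemma nf_zero: "nf q om 0 M = 0" by (simp add: nf_def)

lemma nf_diff: "nf q om (x - y) M = nf q om x M - nf q om y M"
  using nf_add[of q om "x - y" y M] by simp

text \<open>A linear functional vanishes on a two-sided ideal once it vanishes on all translates of the generators by monomials.\<close>

lemma nf_ideal:
  assumes base: "\<And>s v w c d M. s \<in> S \<Longrightarrow> nf q om (Poly_Mapping.single v c * s * Poly_Mapping.single w d) M = 0"
    and "x \<in> two_sided_ideal S"
  shows "nf q om (l * x * r) M = 0"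
  using assms(2)
proof (induction arbitrary: l r)
  case zero show ?case by (simp add: nf_zero)
next
  case (base x)
  show ?case
  proof (induction l rule: poly_single_induct)
    case (single v c)
    show ?case
    proof (induction r rule: poly_single_induct)
      case (single w d) show ?case by (rule assms(1)[OF base])
    next
      case (sum f g) then show ?case by (simp add: distrib_left nf_add)
    qed
  next
    case (sum f g) then show ?case by (simp add: distrib_right nf_add)
  qed
next
  case (add x y) then show ?case by (simp add: distrib_left distrib_right nf_add)
next
  case (mult x l' r')
  from mult.IH[of "l * l'" "r' * r"] show ?case by (simp add: mult.assoc)
qed

text \<open>The algebra presented by \<open>R\<close> in which the generators in \<open>G\<close> quasi-commute.\<close>

locale quasi_commuting =
  fixes q :: complex and om :: "'g \<Rightarrow> 'g \<Rightarrow> int" and G :: "'g set" and R :: "('g free_algebra \<times> 'g free_algebra) set"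
  assumes q0: "q \<noteq> 0" and skew: "om x y = - om y x"
    and swap: "x \<in> G \<Longrightarrow> y \<in> G \<Longrightarrow> alg_eq R (gen x * gen y) (const (q powi (2 * om x y)) * (gen y * gen x))"
begin

lemma move_front:
  assumes "set a \<subseteq> G" "g \<in> G"
  shows "alg_eq R (monom (a @ [g])) (const (q powi (2 * (\<Sum>x\<leftarrow>a. om x g))) * monom (g # a))"
  using assms
proof (induction a)
  case Nil then show ?case by (simp add: const_one alg_eq_refl)
next
  case (Cons x a)
  let ?s = "q powi (2 * (\<Sum>x\<leftarrow>a. om x g))"
  have "alg_eq R (gen x * monom (a @ [g])) (gen x * (const ?s * monom (g # a)))"
    using Cons by (intro alg_eq_mult alg_eq_refl) auto
  also have "gen x * (const ?s * monom (g # a)) = const ?s * ((gen x * gen g) * monom a)"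
    using monom_append[of "[g]" a] by (simp add: monom_single mult.assoc const_commute)
  also have "alg_eq R \<dots> (const ?s * ((const (q powi (2 * om x g)) * (gen g * gen x)) * monom a))"
    using Cons.prems by (intro alg_eq_scale alg_eq_mult swap alg_eq_refl) auto
  also have "const ?s * ((const (q powi (2 * om x g)) * (gen g * gen x)) * monom a) = const (?s * q powi (2 * om x g)) * monom (g # x # a)"
    using monom_append[of "[g]" "x # a"] monom_append[of "[x]" a] by (simp add: monom_single mult.assoc const_mult)
  also have "?s * q powi (2 * om x g) = q powi (2 * (\<Sum>x\<leftarrow>x # a. om x g))"
    using q0 by (simp add: power_int_add[symmetric] algebra_simps)
  finally show ?case using monom_append[of "[x]" "a @ [g]"] by (simp add: monom_single)
qed

text \<open>Each transposition of two neighbouring letters costs \<open>q\<close> to twice their form, which is the amount by which the phase \<open>ph\<close> changes.\<close>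

lemma word_reorder:
  assumes "set v \<subseteq> G" "mset v = mset w"
  shows "alg_eq R (monom v) (const (q powi (ph om v - ph om w)) * monom w)"
  using assms
proof (induction v arbitrary: w)
  case Nil then show ?case by (simp add: const_one alg_eq_refl)
next
  case (Cons g v)
  have "g \<in> set w" using Cons.prems(2) by (metis list.set_intros(1) set_mset_mset)
  then obtain a c where w: "w = a @ g # c" by (meson split_list)
  have m: "mset v = mset (a @ c)" using Cons.prems(2) w by simp
  have setw: "set w \<subseteq> G" using Cons.prems by (metis set_mset_mset)
  define s where "s = (\<Sum>x\<leftarrow>a. om x g)"
  have sg: "(\<Sum>x\<leftarrow>a. om g x) = - s" unfolding s_def
    by (induction a) (use skew[of g] in \<open>simp_all\<close>)
  have "(\<Sum>y\<leftarrow>v. om g y) = (\<Sum>y\<leftarrow>a @ c. om g y)" by (rule sum_list_mset_cong[OF m])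
  then have phs: "ph om (g # v) - ph om w = ph om v - ph om (a @ c) - 2 * s"
    by (simp add: w ph_append cross_simps sg) (simp add: s_def)
  have "alg_eq R (gen g * monom v) (gen g * (const (q powi (ph om v - ph om (a @ c))) * monom (a @ c)))"
    using Cons m by (intro alg_eq_mult alg_eq_refl Cons.IH) auto
  also have "gen g * (const (q powi (ph om v - ph om (a @ c))) * monom (a @ c)) = const (q powi (ph om v - ph om (a @ c))) * (monom (g # a) * monom c)"
    using monom_append[of "[g]" "a @ c"] monom_append[of "g # a" c]
    by (simp add: monom_single const_left_commute[of "gen g"] mult.assoc)
  also have "alg_eq R \<dots> (const (q powi (ph om v - ph om (a @ c))) * ((const (q powi (- 2 * s)) * monom (a @ [g])) * monom c))"
  proof (intro alg_eq_scale alg_eq_mult alg_eq_refl)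
    have "alg_eq R (const (q powi (- 2 * s)) * monom (a @ [g])) (const (q powi (- 2 * s)) * (const (q powi (2 * s)) * monom (g # a)))"
      unfolding s_def using setw w by (intro alg_eq_scale move_front) auto
    also have "const (q powi (- 2 * s)) * (const (q powi (2 * s)) * monom (g # a)) = monom (g # a)"
      using q0 by (simp add: mult.assoc[symmetric] const_mult[symmetric] power_int_add[symmetric] const_one)
    finally show "alg_eq R (monom (g # a)) (const (q powi (- 2 * s)) * monom (a @ [g]))" by (rule alg_eq_sym)
  qed
  also have "const (q powi (ph om v - ph om (a @ c))) * ((const (q powi (- 2 * s)) * monom (a @ [g])) * monom c) = const (q powi (ph om (g # v) - ph om w)) * monom w"
  proof -
    have "q powi (ph om (g # v) - ph om w) = q powi (ph om v - ph om (a @ c)) * q powi (- 2 * s)"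
      unfolding phs using q0 by (simp add: power_int_add[symmetric])
    then show ?thesis using monom_append[of "a @ [g]" c] by (simp add: w const_mult mult.assoc)
  qed
  finally show ?case using monom_append[of "[g]" v] by (simp add: monom_single)
qed

definition cword :: "'g multiset \<Rightarrow> 'g list" where "cword M = (SOME w. mset w = M)"

lemma mset_cword: "mset (cword M) = M"
  unfolding cword_def by (rule someI_ex) (rule ex_mset)

definition N :: "'g multiset \<Rightarrow> 'g free_algebra" where
  "N M = const (q powi (- ph om (cword M))) * monom (cword M)"

lemma monom_eq_N:
  assumes "set w \<subseteq> G" shows "alg_eq R (monom w) (const (q powi ph om w) * N (mset w))"
proof -
  have "alg_eq R (monom w) (const (q powi (ph om w - ph om (cword (mset w)))) * monom (cword (mset w)))"
    by (rule word_reorder) (simp_all add: assms mset_cword)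
  also have "\<dots> = const (q powi ph om w) * N (mset w)"
    using q0 by (simp add: N_def mult.assoc[symmetric] const_mult[symmetric] power_int_diff power_int_minus divide_inverse)
  finally show ?thesis .
qed

lemma N_add:
  assumes "set_mset M \<subseteq> G" "set_mset M' \<subseteq> G"
  shows "alg_eq R (N M * N M') (const (q powi (cross om (cword M) (cword M'))) * N (M + M'))"
proof -
  let ?v = "cword M" and ?w = "cword M'"
  have s: "set (?v @ ?w) \<subseteq> G" using assms by (metis mset_cword set_mset_mset set_append le_sup_iff)
  have "N M * N M' = const (q powi (- ph om ?v) * q powi (- ph om ?w)) * monom (?v @ ?w)"
    by (simp add: N_def monom_append const_mult mult.assoc) (metis const_commute mult.assoc)
  also have "alg_eq R \<dots> (const (q powi (- ph om ?v) * q powi (- ph om ?w)) * (const (q powi ph om (?v @ ?w)) * N (mset (?v @ ?w))))"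
    by (intro alg_eq_scale monom_eq_N s)
  also have "\<dots> = const (q powi (cross om ?v ?w)) * N (M + M')"
    using q0 by (simp add: mult.assoc[symmetric] const_mult[symmetric] power_int_add[symmetric] ph_append mset_cword)
  finally show ?thesis .
qed

text \<open>An element vanishes as soon as its coefficients cancel within classes of equal monomials.\<close>

lemma vanish_criterion:
  assumes G: "\<And>w. w \<in> Poly_Mapping.keys x \<Longrightarrow> set (letters w) \<subseteq> G"
    and eq: "\<And>v w. v \<in> Poly_Mapping.keys x \<Longrightarrow> w \<in> Poly_Mapping.keys x \<Longrightarrow> \<Phi> (mset (letters v)) = \<Phi> (mset (letters w))
      \<Longrightarrow> alg_eq R (N (mset (letters v))) (N (mset (letters w)))"
    and zero: "\<And>E. (\<Sum>w\<in>Poly_Mapping.keys x. if \<Phi> (mset (letters w)) = E then Poly_Mapping.lookup x w * q powi ph om (letters w) else 0) = 0"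
  shows "alg_eq R x 0"
proof -
  let ?K = "Poly_Mapping.keys x" and ?m = "\<lambda>w. mset (letters w)"
  define r where "r E = (SOME w. w \<in> ?K \<and> \<Phi> (?m w) = E)" for E
  have r: "r (\<Phi> (?m w)) \<in> ?K \<and> \<Phi> (?m (r (\<Phi> (?m w)))) = \<Phi> (?m w)" if "w \<in> ?K" for w
    unfolding r_def by (rule someI[of _ w]) (use that in auto)
  let ?c = "\<lambda>w. Poly_Mapping.lookup x w * q powi ph om (letters w)"
  have "x = (\<Sum>w\<in>?K. const (Poly_Mapping.lookup x w) * monom (letters w))"
    by (subst poly_expand) (simp only: single_eq_const_monom)
  also have "alg_eq R \<dots> (\<Sum>w\<in>?K. const (Poly_Mapping.lookup x w) * (const (q powi ph om (letters w)) * N (?m (r (\<Phi> (?m w))))))"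
  proof (intro alg_eq_sum alg_eq_scale)
    fix w assume w: "w \<in> ?K"
    have "alg_eq R (monom (letters w)) (const (q powi ph om (letters w)) * N (?m w))" by (rule monom_eq_N[OF G[OF w]])
    also have "alg_eq R \<dots> (const (q powi ph om (letters w)) * N (?m (r (\<Phi> (?m w)))))"
      using r[OF w] by (intro alg_eq_scale eq w) auto
    finally show "alg_eq R (monom (letters w)) (const (q powi ph om (letters w)) * N (?m (r (\<Phi> (?m w)))))" .
  qed
  also have "(\<Sum>w\<in>?K. const (Poly_Mapping.lookup x w) * (const (q powi ph om (letters w)) * N (?m (r (\<Phi> (?m w))))))
      = (\<Sum>E\<in>(\<lambda>w. \<Phi> (?m w)) ` ?K. \<Sum>w\<in>{w \<in> ?K. \<Phi> (?m w) = E}. const (?c w) * N (?m (r (\<Phi> (?m w)))))"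
    by (subst sum.group) (auto simp: const_mult mult.assoc)
  also have "\<dots> = 0"
  proof (rule sum.neutral, rule ballI)
    fix E
    have "(\<Sum>w\<in>{w \<in> ?K. \<Phi> (?m w) = E}. const (?c w) * N (?m (r (\<Phi> (?m w))))) = const (\<Sum>w\<in>{w \<in> ?K. \<Phi> (?m w) = E}. ?c w) * N (?m (r E))"
      by (simp add: const_sum sum_distrib_right)
    also have "(\<Sum>w\<in>{w \<in> ?K. \<Phi> (?m w) = E}. ?c w) = 0"
      using zero[of E] by (subst sum.inter_filter) simp_all
    finally show "(\<Sum>w\<in>{w \<in> ?K. \<Phi> (?m w) = E}. const (?c w) * N (?m (r (\<Phi> (?m w))))) = 0" by (simp add: const_zero)
  qed
  finally show ?thesis .
qed

lemma nf_zero_imp: 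
  assumes "\<And>w. w \<in> Poly_Mapping.keys x \<Longrightarrow> set (letters w) \<subseteq> G" "\<And>M. nf q om x M = 0"
  shows "alg_eq R x 0"
  by (rule vanish_criterion[where \<Phi> = "\<lambda>M. M"]) (use assms in \<open>auto simp: nf_def intro: alg_eq_refl\<close>)

end

section \<open>The form of the Gauss--Lusztig variables as a sum of \<open>\<lfloor>N\<^sup>2/2\<rfloor>\<close> symplectic planes\<close>

definition om_gl :: "gl_gen \<Rightarrow> gl_gen \<Rightarrow> int" where
  "om_gl x y = of_bool (q2_rel x y) - of_bool (q2_rel y x)"

definition dd :: "nat \<Rightarrow> nat \<Rightarrow> nat" where "dd m n = min n (m + 1 - n)"

definition pa :: "nat \<Rightarrow> nat \<Rightarrow> nat \<Rightarrow> nat \<Rightarrow> nat" where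
  "pa j k m n = of_bool (k = m \<and> j < n \<and> n + j \<le> m)"

text \<open>The first case is the pairing with the level above, the second the one inside a level, the third with the level below. A symmetric part \<open>dd m n\<close>, which does not affect the form, makes all values nonnegative, as exponents of words have to be.\<close>

definition qa :: "nat \<Rightarrow> nat \<Rightarrow> nat \<Rightarrow> nat \<Rightarrow> nat" where
  "qa j k m n =
     (if k = m + 1 then of_bool (j < n \<and> n + j \<le> k)
      else if k = m then dd m n + of_bool (n = j + 1 \<and> n + j \<le> m) - of_bool (n + j = m + 1 \<and> j < n)
      else if k + 1 = m then of_bool (j + 2 \<le> n \<and> n + j \<le> m)
      else 0)"

definition II :: "nat \<Rightarrow> (nat \<times> nat) set" where "II N = {(j, k). 2 * j < k \<and> k < N}"

lemma finite_II: "finite (II N)"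
  by (rule finite_subset[of _ "{..<N} \<times> {..<N}"]) (auto simp: II_def)

lemma card_II: "card (II N) = N\<^sup>2 div 4"
proof (induction N)
  case 0 show ?case by (simp add: II_def)
next
  case (Suc N)
  have "II (Suc N) = II N \<union> (\<lambda>j. (j, N)) ` {j. 2 * j < N}" by (auto simp: II_def)
  moreover have "II N \<inter> (\<lambda>j. (j, N)) ` {j. 2 * j < N} = {}" by (auto simp: II_def)
  moreover have f: "{j. 2 * j < N} = {..<(N + 1) div 2}" by auto
  moreover have "card ((\<lambda>j. (j, N)) ` {..<(N + 1) div 2}) = (N + 1) div 2"
    by (subst card_image) (auto simp: inj_on_def)
  ultimately have "card (II (Suc N)) = N\<^sup>2 div 4 + (N + 1) div 2"
    using Suc by (simp add: card_Un_disjoint finite_II)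
  also have "\<dots> = (Suc N)\<^sup>2 div 4"
  proof (cases "even N")
    case True
    then obtain t where "N = 2 * t" by blast
    then show ?thesis by (simp add: power2_eq_square)
  next
    case False
    then obtain t where t: "N = 2 * t + 1" by (elim oddE)
    have e: "N\<^sup>2 = 4 * (t * t + t) + 1" "(Suc N)\<^sup>2 = 4 * (t * t + 2 * t + 1)" "(N + 1) div 2 = t + 1"
      by (simp_all add: t power2_eq_square algebra_simps)
    show ?thesis unfolding e by simp
  qed
  finally show ?case .
qed

text \<open>Pairing of the \<open>p\<close>-coordinates of \<open>a\<^bsub>m,n\<^esub>\<close> with the \<open>q\<close>-coordinates of \<open>a\<^bsub>m',n'\<^esub>\<close>.\<close>

lemma sum_pa:
  assumes "1 \<le> n" "n \<le> m" "m < N"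
  shows "(\<Sum>(j, k)\<in>II N. int (pa j k m n) * f j k) = (\<Sum>j<dd m n. f j m)"
proof -
  have "(\<Sum>(j, k)\<in>II N. int (pa j k m n) * f j k) = (\<Sum>(j, k)\<in>(\<lambda>j. (j, m)) ` {..<dd m n}. int (pa j k m n) * f j k)"
    by (rule sum.mono_neutral_right[OF finite_II]) (use assms in \<open>auto simp: II_def pa_def dd_def image_iff\<close>)
  also have "\<dots> = (\<Sum>j<dd m n. int (pa j m m n) * f j m)"
    by (subst sum.reindex) (auto simp: inj_on_def)
  also have "\<dots> = (\<Sum>j<dd m n. f j m)"
    by (intro sum.cong) (auto simp: pa_def dd_def)
  finally show ?thesis .
qed

lemma sum_of_bool_less: "(\<Sum>j<a. of_bool (j < b)) = int (min a b)"
proof -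
  have "(\<Sum>j<a. of_bool (j < b)) = int (card ({..<a} \<inter> {j. j < b}))" by (simp add: sum.inter_filter[symmetric] Int_def of_bool_def)
  also have "{..<a} \<inter> {j. j < b} = {..<min a b}" by auto
  finally show ?thesis by simp
qed

lemma sum_of_bool_eq: fixes a b :: nat shows "(\<Sum>j<a. of_bool (j = b)) = (of_bool (b < a) :: int)"
  by (simp add: of_bool_def)

definition TT :: "nat \<Rightarrow> nat \<Rightarrow> nat \<Rightarrow> nat \<Rightarrow> int" where
  "TT m n m' n' = (\<Sum>j<dd m n. int (qa j m m' n'))"

lemma TT_up: "1 \<le> n \<Longrightarrow> n \<le> m' + 1 \<Longrightarrow> 1 \<le> n' \<Longrightarrow> n' \<le> m' \<Longrightarrow>
  TT (m' + 1) n m' n' = int (min (dd (m' + 1) n) (dd (m' + 1) n'))"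
proof -
  assume A: "1 \<le> n" "n \<le> m' + 1" "1 \<le> n'" "n' \<le> m'"
  have "TT (m' + 1) n m' n' = (\<Sum>j<dd (m' + 1) n. of_bool (j < dd (m' + 1) n'))"
    unfolding TT_def by (intro sum.cong) (use A in \<open>auto simp: qa_def dd_def\<close>)
  then show ?thesis by (simp only: sum_of_bool_less)
qed

lemma TT_down: "1 \<le> n \<Longrightarrow> n \<le> m \<Longrightarrow> 1 \<le> n' \<Longrightarrow> n' \<le> m + 1 \<Longrightarrow>
  TT m n (m + 1) n' = int (min (dd m n) (min (n' - 1) (m + 2 - n')))"
proof -
  assume A: "1 \<le> n" "n \<le> m" "1 \<le> n'" "n' \<le> m + 1"
  have "TT m n (m + 1) n' = (\<Sum>j<dd m n. of_bool (j < min (n' - 1) (m + 2 - n')))"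
    unfolding TT_def by (intro sum.cong) (use A in \<open>auto simp: qa_def dd_def\<close>)
  then show ?thesis by (simp only: sum_of_bool_less)
qed

lemma qa_same:
  assumes "1 \<le> n" "n \<le> m"
  shows "int (qa j m m n) = int (dd m n) + of_bool (2 * n \<le> m + 1) * of_bool (j = n - 1) - of_bool (m + 1 < 2 * n) * of_bool (j = m + 1 - n)"
proof -
  have e1: "(n = j + 1 \<and> n + j \<le> m) \<longleftrightarrow> (2 * n \<le> m + 1 \<and> j = n - 1)" using assms by auto
  have e2: "(n + j = m + 1 \<and> j < n) \<longleftrightarrow> (m + 1 < 2 * n \<and> j = m + 1 - n)" using assms by auto
  have d: "1 \<le> dd m n" using assms by (simp add: dd_def)
  have q: "qa j m m n = dd m n + of_bool (2 * n \<le> m + 1 \<and> j = n - 1) - of_bool (m + 1 < 2 * n \<and> j = m + 1 - n)"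
    by (simp only: qa_def e1 e2) simp
  show ?thesis unfolding q using d by (simp add: of_nat_diff of_bool_conj)
qed

lemma TT_same:
  assumes A: "1 \<le> n'" "n' \<le> m"
  shows "TT m n m n' = int (dd m n) * int (dd m n') + of_bool (2 * n' \<le> m + 1 \<and> n' \<le> dd m n)
     - of_bool (m + 1 < 2 * n' \<and> m + 1 < dd m n + n')"
proof -
  have "TT m n m n' = (\<Sum>j<dd m n. int (dd m n')) + of_bool (2 * n' \<le> m + 1) * (\<Sum>j<dd m n. of_bool (j = n' - 1))
      - of_bool (m + 1 < 2 * n') * (\<Sum>j<dd m n. of_bool (j = m + 1 - n'))"
    unfolding TT_def qa_same[OF A] sum_subtractf sum.distrib sum_distrib_left[symmetric] ..
  also have "\<dots> = int (dd m n) * int (dd m n') + of_bool (2 * n' \<le> m + 1) * of_bool (n' - 1 < dd m n) - of_bool (m + 1 < 2 * n') * of_bool (m + 1 - n' < dd m n)"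
    unfolding sum_of_bool_eq by simp
  also have "of_bool (2 * n' \<le> m + 1) * of_bool (n' - 1 < dd m n) = (of_bool (2 * n' \<le> m + 1 \<and> n' \<le> dd m n) :: int)"
    unfolding of_bool_conj[symmetric] by (rule arg_cong[of _ _ of_bool]) (use A in auto)
  also have "of_bool (m + 1 < 2 * n') * of_bool (m + 1 - n' < dd m n) = (of_bool (m + 1 < 2 * n' \<and> m + 1 < dd m n + n') :: int)"
    unfolding of_bool_conj[symmetric] by (rule arg_cong[of _ _ of_bool]) (use A in auto)
  finally show ?thesis .
qed

lemma TT_other: "m \<noteq> m' \<Longrightarrow> m \<noteq> m' + 1 \<Longrightarrow> m' \<noteq> m + 1 \<Longrightarrow> TT m n m' n' = 0"
  by (simp add: TT_def qa_def)

lemma int_dd: "1 \<le> n \<Longrightarrow> n \<le> m + 1 \<Longrightarrow> int (dd m n) = min (int n) (int m + 1 - int n)"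
  unfolding dd_def of_nat_min by (simp add: of_nat_diff)

lemma min_step:
  fixes n n' m :: int
  assumes "1 \<le> n" "n \<le> m + 1" "1 \<le> n'" "n' \<le> m"
  shows "min (min n (m + 2 - n)) (min n' (m + 2 - n')) = min (min n' (m + 1 - n')) (min (n - 1) (m + 2 - n)) + (if n \<le> n' then 1 else 0)"
  using assms by (cases "n \<le> n'") (simp_all add: min_def)

lemma TT_antisym:
  assumes A: "1 \<le> n" "n \<le> m" "1 \<le> n'" "n' \<le> m'"
  shows "TT m n m' n' - TT m' n' m n = om_gl (Ga m n) (Ga m' n')"
proof -
  consider "m = m'" | "m = m' + 1" | "m' = m + 1" | "m \<noteq> m'" "m \<noteq> m' + 1" "m' \<noteq> m + 1" by blast
  then show ?thesis
  proof cases
    case 1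
    have eq: "TT m n m n' - TT m n' m n =
        (of_bool (2 * n' \<le> m + 1 \<and> n' \<le> dd m n) - of_bool (m + 1 < 2 * n' \<and> m + 1 < dd m n + n')) -
        (of_bool (2 * n \<le> m + 1 \<and> n \<le> dd m n') - of_bool (m + 1 < 2 * n \<and> m + 1 < dd m n' + n))"
      using A 1 by (simp add: TT_same)
    consider "n = n'" | "n < n'" | "n' < n" by linarith
    then have "TT m n m n' - TT m n' m n = of_bool (n' < n) - of_bool (n < n')"
    proof cases
      case 1 then show ?thesis by simp
    next
      case 2
      have e: "(2 * n' \<le> m + 1 \<and> n' \<le> dd m n) = False" "(m + 1 < 2 * n \<and> m + 1 < dd m n' + n) = False"
        "(m + 1 < 2 * n' \<and> m + 1 < dd m n + n') = (m + 1 < n + n')" "(2 * n \<le> m + 1 \<and> n \<le> dd m n') = (n + n' \<le> m + 1)"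
        using 2 A \<open>m = m'\<close> by (simp_all add: dd_def) linarith+
      show ?thesis unfolding eq e using 2 by simp
    next
      case 3
      have e: "(2 * n' \<le> m + 1 \<and> n' \<le> dd m n) = (n + n' \<le> m + 1)" "(m + 1 < 2 * n \<and> m + 1 < dd m n' + n) = (m + 1 < n + n')"
        "(m + 1 < 2 * n' \<and> m + 1 < dd m n + n') = False" "(2 * n \<le> m + 1 \<and> n \<le> dd m n') = False"
        using 3 A \<open>m = m'\<close> by (simp_all add: dd_def) linarith+
      show ?thesis unfolding eq e using 3 by simp
    qed
    then show ?thesis using \<open>m = m'\<close> by (simp add: om_gl_def)
  next
    case 2
    have "TT (m' + 1) n m' n' = int (min (dd (m' + 1) n) (dd (m' + 1) n'))" by (rule TT_up) (use A 2 in auto)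
    moreover have "TT m' n' (m' + 1) n = int (min (dd m' n') (min (n - 1) (m' + 2 - n)))" by (rule TT_down) (use A 2 in auto)
    moreover have "om_gl (Ga m n) (Ga m' n') = of_bool (n \<le> n')" using 2 by (simp add: om_gl_def)
    moreover have "int (min (dd (m' + 1) n) (dd (m' + 1) n')) = min (min (int n) (int m' + 2 - int n)) (min (int n') (int m' + 2 - int n'))"
      using A 2 by (simp add: of_nat_min int_dd of_nat_diff)
    moreover have "int (min (dd m' n') (min (n - 1) (m' + 2 - n))) = min (min (int n') (int m' + 1 - int n')) (min (int n - 1) (int m' + 2 - int n))"
      using A 2 by (simp add: of_nat_min int_dd of_nat_diff)
    moreover have "min (min (int n) (int m' + 2 - int n)) (min (int n') (int m' + 2 - int n')) = min (min (int n') (int m' + 1 - int n')) (min (int n - 1) (int m' + 2 - int n)) + (if int n \<le> int n' then 1 else 0)"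
      by (rule min_step) (use A 2 in simp_all)
    ultimately show ?thesis unfolding 2 by (simp only: of_nat_le_iff of_bool_def) 
  next
    case 3
    have "TT (m + 1) n' m n = int (min (dd (m + 1) n') (dd (m + 1) n))" by (rule TT_up) (use A 3 in auto)
    moreover have "TT m n (m + 1) n' = int (min (dd m n) (min (n' - 1) (m + 2 - n')))" by (rule TT_down) (use A 3 in auto)
    moreover have "om_gl (Ga m n) (Ga m' n') = - of_bool (n' \<le> n)" using 3 by (simp add: om_gl_def)
    moreover have "int (min (dd (m + 1) n') (dd (m + 1) n)) = min (min (int n') (int m + 2 - int n')) (min (int n) (int m + 2 - int n))"
      using A 3 by (simp add: of_nat_min int_dd of_nat_diff)
    moreover have "int (min (dd m n) (min (n' - 1) (m + 2 - n'))) = min (min (int n) (int m + 1 - int n)) (min (int n' - 1) (int m + 2 - int n'))"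
      using A 3 by (simp add: of_nat_min int_dd of_nat_diff)
    moreover have "min (min (int n') (int m + 2 - int n')) (min (int n) (int m + 2 - int n)) = min (min (int n) (int m + 1 - int n)) (min (int n' - 1) (int m + 2 - int n')) + (if int n' \<le> int n then 1 else 0)"
      by (rule min_step) (use A 3 in simp_all)
    ultimately show ?thesis unfolding 3 by (simp only: of_nat_le_iff of_bool_def)
  next
    case 4
    then show ?thesis by (simp add: TT_other om_gl_def)
  qed
qed

type_synonym plane = "bool \<times> nat \<times> nat"

fun pc :: "gl_gen \<Rightarrow> plane \<Rightarrow> nat" where
  "pc (Ga m n) (s, j, k) = (if s then 0 else pa j k m n)"
| "pc (Gv m) (s, j, k) = 0"
| "pc (Gb m n) (s, j, k) = (if s then qa j k m n else 0)"
| "pc (Gu m) (s, j, k) = of_bool (s \<and> j = 0 \<and> k = m)"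

fun qc :: "gl_gen \<Rightarrow> plane \<Rightarrow> nat" where
  "qc (Ga m n) (s, j, k) = (if s then 0 else qa j k m n)"
| "qc (Gv m) (s, j, k) = of_bool (\<not> s \<and> j = 0 \<and> k = m)"
| "qc (Gb m n) (s, j, k) = (if s then pa j k m n else 0)"
| "qc (Gu m) (s, j, k) = 0"

definition planes :: "nat \<Rightarrow> plane set" where "planes N = UNIV \<times> II N"

lemma card_planes: "card (planes N) = N\<^sup>2 div 2"
proof -
  have "card (planes N) = 2 * (N\<^sup>2 div 4)" by (simp add: planes_def card_cartesian_product card_II)
  also have "\<dots> = N\<^sup>2 div 2"
  proof (cases "even N")
    case True
    then obtain t where "N = 2 * t" by blast
    then show ?thesis by (simp add: power2_eq_square)
  next
    case False
    then obtain t where t: "N = 2 * t + 1" by (elim oddE)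
    have e: "N\<^sup>2 = 4 * (t * t + t) + 1" by (simp add: t power2_eq_square algebra_simps)
    show ?thesis unfolding e by presburger
  qed
  finally show ?thesis .
qed

lemma finite_planes: "finite (planes N)" by (simp add: planes_def finite_II)

lemma sum_planes: "(\<Sum>x\<in>planes N. f x) = (\<Sum>(j, k)\<in>II N. f (False, j, k)) + (\<Sum>(j, k)\<in>II N. (f (True, j, k) :: int))"
proof -
  have "planes N = Pair False ` II N \<union> Pair True ` II N" by (auto simp: planes_def)
  then have "(\<Sum>x\<in>planes N. f x) = (\<Sum>x\<in>Pair False ` II N. f x) + (\<Sum>x\<in>Pair True ` II N. f x)"
    by (simp add: sum.union_disjoint[of "Pair False ` II N" "Pair True ` II N"] finite_II image_iff disjoint_iff)
  then show ?thesis by (simp add: sum.reindex inj_on_def case_prod_unfold)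
qed

lemma sum_single: "m < N \<Longrightarrow> 1 \<le> m \<Longrightarrow> (\<Sum>(j, k)\<in>II N. of_bool (j = 0 \<and> k = m) * f j k) = (f 0 m :: int)"
proof -
  assume m: "m < N" "1 \<le> m"
  have "(\<Sum>(j, k)\<in>II N. of_bool (j = 0 \<and> k = m) * f j k) = (\<Sum>(j, k)\<in>{(0, m)}. of_bool (j = 0 \<and> k = m) * f j k)"
    by (rule sum.mono_neutral_right[OF finite_II]) (use m in \<open>auto simp: II_def\<close>)
  then show ?thesis by simp
qed

text \<open>The \<open>p\<close>-coordinates of \<open>a\<^bsub>m,n\<^esub>\<close> are supported in level \<open>m\<close> and the \<open>q\<close>-coordinates in the levels \<open>m - 1\<close>, \<open>m\<close>, \<open>m + 1\<close>, because variables of distant levels commute. The \<open>b\<^bsub>m,n\<^esub>\<close>, whose form is the negative, use a second copy of the planes with \<open>p\<close> and \<open>q\<close> exchanged.\<close>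

theorem symplectic_coordinates:
  assumes "x \<in> gl_gens N" "y \<in> gl_gens N"
  shows "(\<Sum>i\<in>planes N. int (pc x i) * int (qc y i) - int (qc x i) * int (pc y i)) = om_gl x y"
proof -
  have aa: "(\<Sum>(j, k)\<in>II N. int (pa j k m n) * int (qa j k m' n') - int (qa j k m n) * int (pa j k m' n')) = om_gl (Ga m n) (Ga m' n')"
    if "1 \<le> n" "n \<le> m" "m < N" "1 \<le> n'" "n' \<le> m'" "m' < N" for m n m' n'
  proof -
    have "(\<Sum>(j, k)\<in>II N. int (pa j k m n) * int (qa j k m' n') - int (qa j k m n) * int (pa j k m' n'))
        = (\<Sum>(j, k)\<in>II N. int (pa j k m n) * int (qa j k m' n')) - (\<Sum>(j, k)\<in>II N. int (pa j k m' n') * int (qa j k m n))"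
      by (simp add: sum_subtractf[symmetric] case_prod_unfold mult.commute)
    also have "\<dots> = TT m n m' n' - TT m' n' m n" using that by (simp only: sum_pa TT_def)
    finally show ?thesis using that by (simp only: TT_antisym)
  qed
  have av: "(\<Sum>(j, k)\<in>II N. int (pa j k m n) * of_bool (j = 0 \<and> k = m')) = of_bool (m = m')"
    if "1 \<le> n" "n \<le> m" "1 \<le> m'" "m' < N" for m n m'
    using sum_single[OF that(4,3), of "\<lambda>j k. int (pa j k m n)"] that
    by (simp add: mult.commute) (auto simp: pa_def)
  have b: "om_gl (Gb m n) (Gb m' n') = - om_gl (Ga m n) (Ga m' n')" for m n m' n'
    by (auto simp: om_gl_def of_bool_def)
  show ?thesis
  proof (cases x)
    case (Ga m n)
    then have x: "1 \<le> n" "n \<le> m" "m < N" using assms(1) by (auto simp: gl_gens_def)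
    show ?thesis
    proof (cases y)
      case (Ga m' n')
      then have "1 \<le> n'" "n' \<le> m'" "m' < N" using assms(2) by (auto simp: gl_gens_def)
      then show ?thesis using aa x \<open>x = Ga m n\<close> Ga by (simp add: sum_planes)
    next
      case (Gv m')
      then have "1 \<le> m'" "m' < N" using assms(2) by (auto simp: gl_gens_def)
      then show ?thesis using av x \<open>x = Ga m n\<close> Gv by (simp add: sum_planes om_gl_def)
    qed (use \<open>x = Ga m n\<close> in \<open>simp_all add: sum_planes om_gl_def case_prod_unfold\<close>)
  next
    case (Gb m n)
    then have x: "1 \<le> n" "n \<le> m" "m < N" using assms(1) by (auto simp: gl_gens_def)
    show ?thesis
    proof (cases y)
      case (Gb m' n')
      then have y: "1 \<le> n'" "n' \<le> m'" "m' < N" using assms(2) by (auto simp: gl_gens_def)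
      have "(\<Sum>(j, k)\<in>II N. int (qa j k m n) * int (pa j k m' n') - int (pa j k m n) * int (qa j k m' n')) = - om_gl (Ga m n) (Ga m' n')"
        unfolding aa[OF x y, symmetric] sum_negf[symmetric] by (intro sum.cong) auto
      then show ?thesis using \<open>x = Gb m n\<close> Gb by (simp add: sum_planes b)
    next
      case (Gu m')
      then have "1 \<le> m'" "m' < N" using assms(2) by (auto simp: gl_gens_def)
      then show ?thesis using av x \<open>x = Gb m n\<close> Gu
        by (simp add: sum_planes om_gl_def case_prod_unfold sum_negf)
    qed (use \<open>x = Gb m n\<close> in \<open>simp_all add: sum_planes om_gl_def case_prod_unfold\<close>)
  next
    case (Gu m)
    then have x: "1 \<le> m" "m < N" using assms(1) by (auto simp: gl_gens_def)
    show ?thesis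
    proof (cases y)
      case (Gb m' n')
      then have "1 \<le> n'" "n' \<le> m'" "m' < N" using assms(2) by (auto simp: gl_gens_def)
      then show ?thesis using av[of n' m' m] x \<open>x = Gu m\<close> Gb
        by (simp add: sum_planes om_gl_def case_prod_unfold mult.commute)
    qed (use \<open>x = Gu m\<close> in \<open>simp_all add: sum_planes om_gl_def case_prod_unfold\<close>)
  next
    case (Gv m)
    then have x: "1 \<le> m" "m < N" using assms(1) by (auto simp: gl_gens_def)
    show ?thesis
    proof (cases y)
      case (Ga m' n')
      then have "1 \<le> n'" "n' \<le> m'" "m' < N" using assms(2) by (auto simp: gl_gens_def)
      then show ?thesis using av[of n' m' m] x \<open>x = Gv m\<close> Ga
        by (simp add: sum_planes om_gl_def case_prod_unfold mult.commute sum_negf)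
    qed (use \<open>x = Gv m\<close> in \<open>simp_all add: sum_planes om_gl_def case_prod_unfold\<close>)
  qed
qed

definition TR :: "nat \<Rightarrow> (nat \<times> nat) set" where "TR N = {(m, n). 1 \<le> n \<and> n \<le> m \<and> m < N}"

lemma finite_TR: "finite (TR N)"
  by (rule finite_subset[of _ "{..<N} \<times> {..<N}"]) (auto simp: TR_def)

lemma gl_gens_eq: "gl_gens N = (\<lambda>(m, n). Ga m n) ` TR N \<union> (\<lambda>(m, n). Gb m n) ` TR N \<union> Gu ` {1..<N} \<union> Gv ` {1..<N}"
  unfolding gl_gens_def TR_def by (auto simp: image_iff)

lemma finite_gl_gens: "finite (gl_gens N)" by (simp add: gl_gens_eq finite_TR)

lemma sum_gl_gens:
  fixes f :: "gl_gen \<Rightarrow> int"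
  shows "(\<Sum>g\<in>gl_gens N. f g) = (\<Sum>(m, n)\<in>TR N. f (Ga m n)) + (\<Sum>(m, n)\<in>TR N. f (Gb m n))
    + (\<Sum>k\<in>{1..<N}. f (Gu k)) + (\<Sum>k\<in>{1..<N}. f (Gv k))"
  unfolding gl_gens_eq
  by (subst sum.union_disjoint, (auto simp: finite_TR)[3])+
     (simp add: sum.reindex inj_on_def case_prod_unfold split_beta prod_eq_iff)

lemma sum_row:
  fixes \<alpha> f :: "nat \<Rightarrow> nat \<Rightarrow> int"
  assumes "m < N"
  shows "(\<Sum>(k, n)\<in>TR N. \<alpha> k n * (of_bool (k = m) * f k n)) = (\<Sum>n=1..m. \<alpha> m n * f m n)"
proof -
  have "(\<Sum>(k, n)\<in>TR N. \<alpha> k n * (of_bool (k = m) * f k n)) = (\<Sum>(k, n)\<in>Pair m ` {1..m}. \<alpha> k n * (of_bool (k = m) * f k n))"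
    by (rule sum.mono_neutral_right[OF finite_TR]) (use assms in \<open>auto simp: TR_def\<close>)
  also have "\<dots> = (\<Sum>n=1..m. \<alpha> m n * f m n)" by (subst sum.reindex) (auto simp: inj_on_def)
  finally show ?thesis .
qed

section \<open>The radical of the form on the Gauss lattice\<close>

definition Gam :: "(nat \<Rightarrow> int) \<Rightarrow> nat \<Rightarrow> int" where "Gam \<gamma> m = (\<Sum>i=1..m. \<gamma> i)"

text \<open>The difference of consecutive rows of \<open>S\<close> telescopes to \<open>\<Gamma> m - \<Gamma> (m - n)\<close> with \<open>\<Gamma>\<close> the partial sums of \<open>\<gamma>\<close>. The boundary condition \<open>S N n = 0\<close> then makes \<open>\<Gamma>\<close> symmetric under \<open>m \<mapsto> N - 1 - m\<close>.\<close>

lemma triangle_recursion: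
  fixes S :: "nat \<Rightarrow> nat \<Rightarrow> int" and \<gamma> :: "nat \<Rightarrow> int"
  assumes z: "\<And>m. S m 0 = 0" and d: "\<And>m. m < N \<Longrightarrow> S m m = 0" and t: "\<And>n. S N n = 0"
    and rec: "\<And>m n. 1 \<le> n \<Longrightarrow> n \<le> m \<Longrightarrow> m < N \<Longrightarrow> S (m + 1) n - S m n = S m (n - 1) - S (m - 1) (n - 1) + \<gamma> m"
  shows "\<And>m. 1 \<le> m \<Longrightarrow> m < N \<Longrightarrow> \<gamma> m = - \<gamma> (N - m)"
    and "(\<And>m. 1 \<le> m \<Longrightarrow> m < N \<Longrightarrow> \<gamma> m = 0) \<Longrightarrow> n \<le> m \<Longrightarrow> m < N \<Longrightarrow> S m n = 0"
proof -
  have D: "S (m + 1) n - S m n = Gam \<gamma> m - Gam \<gamma> (m - n)" if "n \<le> m" "m < N" for m n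
    using that
  proof (induction n arbitrary: m)
    case 0 then show ?case by (simp add: z)
  next
    case (Suc n)
    then obtain m' where m': "m = Suc m'" by (cases m) auto
    have "S (m' + 1) n - S m' n = Gam \<gamma> m' - Gam \<gamma> (m' - n)" using Suc m' by simp
    moreover have "Gam \<gamma> m = Gam \<gamma> m' + \<gamma> m" by (simp add: Gam_def m')
    ultimately show ?case using rec[of "Suc n" m] Suc.prems m' by simp
  qed
  have E: "S (n + l) n = (\<Sum>k<l. Gam \<gamma> (n + k)) - (\<Sum>k<l. Gam \<gamma> k)" if "n + l \<le> N" "n < N" for n l
    using that
  proof (induction l)
    case 0 then show ?case using d[of n] by simp
  next
    case (Suc l) then show ?case using D[of n "n + l"] by (simp add: algebra_simps)
  qed
  have F: "(\<Sum>k<N - n. Gam \<gamma> (n + k)) = (\<Sum>k<N - n. Gam \<gamma> k)" if "n < N" for n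
    using E[of n "N - n"] that t[of n] by simp
  have G: "Gam \<gamma> n = Gam \<gamma> (N - 1 - n)" if n: "n < N" for n
  proof (cases "n = N - 1")
    case True
    then show ?thesis using F[OF n] n by (cases N) simp_all
  next
    case False
    then have "n + 1 < N" using n by simp
    then obtain r where r: "N - n = Suc r" "N - (n + 1) = r" "N - 1 - n = r" by (cases "N - n") auto
    have "Gam \<gamma> n + (\<Sum>k<r. Gam \<gamma> (n + Suc k)) = (\<Sum>k<r. Gam \<gamma> k) + Gam \<gamma> r"
      using F[OF n] by (simp only: r sum.lessThan_Suc_shift[of "\<lambda>k. Gam \<gamma> (n + k)"] sum.lessThan_Suc[of "Gam \<gamma>"] add_0_right)
    moreover have "(\<Sum>k<r. Gam \<gamma> (n + Suc k)) = (\<Sum>k<r. Gam \<gamma> k)"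
      using F[OF \<open>n + 1 < N\<close>] unfolding r(2) by simp
    moreover note r(3)
    ultimately show ?thesis by simp
  qed
  have st: "\<gamma> m = Gam \<gamma> m - Gam \<gamma> (m - 1)" if "1 \<le> m" for m using that by (cases m) (simp_all add: Gam_def)
  show "\<gamma> m = - \<gamma> (N - m)" if "1 \<le> m" "m < N" for m
    using st[of m] st[of "N - m"] G[of m] G[of "m - 1"] that by (simp add: diff_diff_add add.commute)
  show "S m n = 0" if g0: "\<And>m. 1 \<le> m \<Longrightarrow> m < N \<Longrightarrow> \<gamma> m = 0" and mn: "n \<le> m" "m < N"
  proof -
    have g: "Gam \<gamma> k = 0" if "k < N" for k unfolding Gam_def by (rule sum.neutral) (use g0 that in auto)
    have "S (n + (m - n)) n = (\<Sum>k<m - n. Gam \<gamma> (n + k)) - (\<Sum>k<m - n. Gam \<gamma> k)" by (rule E) (use mn in auto)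
    also have "\<dots> = 0" using mn g by simp
    finally show ?thesis using mn by simp
  qed
qed

text \<open>The equations that the radical imposes on the coefficients \<open>\<alpha>\<close> of the \<open>a\<^bsub>m,n\<^esub>\<close> and \<open>\<gamma>\<close> of the \<open>\<v>\<^sub>m\<close>; those on the \<open>b\<^bsub>m,n\<^esub>\<close> and \<open>\<u>\<^sub>m\<close> have the same shape.\<close>

definition half_system :: "nat \<Rightarrow> (nat \<Rightarrow> nat \<Rightarrow> int) \<Rightarrow> (nat \<Rightarrow> int) \<Rightarrow> bool" where
  "half_system N \<alpha> \<gamma> \<longleftrightarrow> (\<forall>m\<in>{1..<N}. (\<Sum>n=1..m. \<alpha> m n) = 0) \<and>
     (\<forall>m n. 1 \<le> n \<and> n \<le> m \<and> m < N \<longrightarrow> (\<Sum>(k, n')\<in>TR N. \<alpha> k n' * om_gl (Ga k n') (Ga m n)) = \<gamma> m)"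

lemma of_bool_exclusive:
  "\<not> (A \<and> B) \<Longrightarrow> \<not> (A \<and> C) \<Longrightarrow> \<not> (B \<and> C) \<Longrightarrow>
    of_bool (A \<and> P \<or> B \<and> Q) - of_bool (A \<and> P' \<or> C \<and> Q') = (of_bool A * of_bool P - of_bool A * of_bool P' + of_bool B * of_bool Q - of_bool C * of_bool Q' :: int)"
  by (cases A; cases B; cases C) simp_all

text \<open>Testing a vector of the radical against \<open>a\<^bsub>m,n\<^esub>\<close> involves only the levels \<open>m - 1\<close>, \<open>m\<close>, \<open>m + 1\<close>; testing against \<open>\<v>\<^sub>m\<close> makes the row sums vanish. In terms of partial sums this is the recursion.\<close>

lemma half_system_step:
  fixes \<alpha> :: "nat \<Rightarrow> nat \<Rightarrow> int" and N :: nat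
  defines "S \<equiv> \<lambda>m n. if m < N then (\<Sum>k=1..n. \<alpha> m k) else 0"
  assumes h: "half_system N \<alpha> \<gamma>" and mn: "1 \<le> n" "n \<le> m" "m < N"
  shows "S (m + 1) n - S m n = S m (n - 1) - S (m - 1) (n - 1) + \<gamma> m"
proof -
  have tot: "(\<Sum>k=1..l. \<alpha> l k) = 0" if "l < N" for l
    using h that by (cases "l = 0") (auto simp: half_system_def)
  have part: "(\<Sum>k=1..l. \<alpha> l k * of_bool (k \<le> j)) = (\<Sum>k=1..j. \<alpha> l k)" if "j \<le> l" for l j
    by (subst sum.mono_neutral_right[of "{1..l}" "{1..j}"]) (use that in auto)
  have part': "(\<Sum>k=1..l. \<alpha> l k * of_bool (j < k)) = - (\<Sum>k=1..j. \<alpha> l k)" if "j \<le> l" "l < N" for l j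
  proof -
    have "(\<Sum>k=1..l. \<alpha> l k * of_bool (j < k)) + (\<Sum>k=1..l. \<alpha> l k * of_bool (k \<le> j)) = (\<Sum>k=1..l. \<alpha> l k)"
      unfolding sum.distrib[symmetric] by (intro sum.cong) auto
    then show ?thesis using part[OF that(1)] tot[OF that(2)] by simp
  qed
  have om: "om_gl (Ga k n') (Ga m n) = of_bool (k = m) * of_bool (n < n') - of_bool (k = m) * of_bool (n' \<le> n - 1)
      + of_bool (k = m + 1) * of_bool (n' \<le> n) - of_bool (k = m - 1) * of_bool (n - 1 < n')" if "1 \<le> k" for k n'
  proof -
    have e: "(n' \<le> n - 1) = (n' < n)" "(n - 1 < n') = (n \<le> n')" "(k = m - 1) = (m = k + 1)" using mn that by linarith+
    have "om_gl (Ga k n') (Ga m n) = of_bool (k = m \<and> n < n' \<or> k = m + 1 \<and> n' \<le> n) - of_bool (k = m \<and> n' < n \<or> m = k + 1 \<and> n \<le> n')"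
      unfolding om_gl_def q2_rel.simps by (simp only: eq_commute[of m k])
    also have "\<dots> = of_bool (k = m) * of_bool (n < n') - of_bool (k = m) * of_bool (n' < n) + of_bool (k = m + 1) * of_bool (n' \<le> n) - of_bool (m = k + 1) * of_bool (n \<le> n')"
      by (rule of_bool_exclusive) simp_all
    finally show ?thesis unfolding e .
  qed
  have "\<gamma> m = (\<Sum>(k, n')\<in>TR N. \<alpha> k n' * om_gl (Ga k n') (Ga m n))"
  proof -
    have H: "\<forall>m n. 1 \<le> n \<and> n \<le> m \<and> m < N \<longrightarrow> (\<Sum>(k, n')\<in>TR N. \<alpha> k n' * om_gl (Ga k n') (Ga m n)) = \<gamma> m"
      using h unfolding half_system_def by (rule conjunct2)
    show ?thesis by (rule H[rule_format, symmetric]) (use mn in simp)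
  qed
  also have "\<dots> = (\<Sum>(k, n')\<in>TR N. \<alpha> k n' * (of_bool (k = m) * of_bool (n < n')) - \<alpha> k n' * (of_bool (k = m) * of_bool (n' \<le> n - 1))
      + \<alpha> k n' * (of_bool (k = m + 1) * of_bool (n' \<le> n)) - \<alpha> k n' * (of_bool (k = m - 1) * of_bool (n - 1 < n')))"
  proof (intro sum.cong refl)
    fix x assume "x \<in> TR N"
    then obtain k n' where "x = (k, n')" "1 \<le> k" by (auto simp: TR_def)
    then show "(case x of (k, n') \<Rightarrow> \<alpha> k n' * om_gl (Ga k n') (Ga m n)) = (case x of (k, n') \<Rightarrow> \<alpha> k n' * (of_bool (k = m) * of_bool (n < n')) - \<alpha> k n' * (of_bool (k = m) * of_bool (n' \<le> n - 1))
      + \<alpha> k n' * (of_bool (k = m + 1) * of_bool (n' \<le> n)) - \<alpha> k n' * (of_bool (k = m - 1) * of_bool (n - 1 < n')))"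
      by (simp only: om prod.case distrib_left right_diff_distrib)
  qed
  also have "\<dots> = (\<Sum>n'=1..m. \<alpha> m n' * of_bool (n < n')) - (\<Sum>n'=1..m. \<alpha> m n' * of_bool (n' \<le> n - 1))
      + S (m + 1) n - (\<Sum>n'=1..m-1. \<alpha> (m-1) n' * of_bool (n - 1 < n'))"
  proof -
    have "(\<Sum>(k, n')\<in>TR N. \<alpha> k n' * (of_bool (k = m + 1) * of_bool (n' \<le> n))) = S (m + 1) n"
    proof (cases "m + 1 < N")
      case True
      then show ?thesis using mn part[of n "m + 1"] sum_row[OF True, of \<alpha> "\<lambda>k n'. of_bool (n' \<le> n)"] by (simp add: S_def)
    next
      case False
      then show ?thesis unfolding S_def by (subst sum.neutral) (auto simp: TR_def)
    qed
    moreover have "m - 1 < N" using mn by simp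
    ultimately show ?thesis
      using sum_row[OF mn(3), of \<alpha> "\<lambda>k n'. of_bool (n < n')"] sum_row[OF mn(3), of \<alpha> "\<lambda>k n'. of_bool (n' \<le> n - 1)"]
        sum_row[of "m - 1" N \<alpha> "\<lambda>k n'. of_bool (n - 1 < n')"]
      by (simp only: case_prod_unfold sum.distrib sum_subtractf)
  qed
  also have "\<dots> = - S m n - S m (n - 1) + S (m + 1) n + S (m - 1) (n - 1)"
    using part'[of n m] part[of "n - 1" m] part'[of "n - 1" "m - 1"] mn by (simp add: S_def)
  finally show ?thesis by simp
qed

lemma half_system_solution:
  assumes h: "half_system N \<alpha> \<gamma>"
  shows "\<And>m. 1 \<le> m \<Longrightarrow> m < N \<Longrightarrow> \<gamma> m = - \<gamma> (N - m)"
    and "(\<And>m. 1 \<le> m \<Longrightarrow> m < N \<Longrightarrow> \<gamma> m = 0) \<Longrightarrow> 1 \<le> n \<Longrightarrow> n \<le> m \<Longrightarrow> m < N \<Longrightarrow> \<alpha> m n = 0"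
proof -
  let ?S = "\<lambda>m n. if m < N then (\<Sum>k=1..n. \<alpha> m k) else 0"
  have tot: "?S l l = 0" if "l < N" for l
    using h that by (cases "l = 0") (auto simp: half_system_def)
  note tri = triangle_recursion[of ?S N \<gamma>, OF _ tot _ half_system_step[OF h]]
  show "\<gamma> m = - \<gamma> (N - m)" if "1 \<le> m" "m < N" for m by (rule tri(1)) (use that in simp_all)
  show "\<alpha> m n = 0" if g: "\<And>m. 1 \<le> m \<Longrightarrow> m < N \<Longrightarrow> \<gamma> m = 0" and mn: "1 \<le> n" "n \<le> m" "m < N"
  proof -
    have "?S m n = 0" by (rule tri(2)) (use g mn in simp_all)
    moreover have "?S m (n - 1) = 0" by (rule tri(2)) (use g mn in simp_all)
    moreover obtain n' where "n = Suc n'" using mn(1) by (cases n) auto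
    ultimately show ?thesis using mn by simp
  qed
qed

definition in_radical :: "nat \<Rightarrow> (gl_gen \<Rightarrow> int) \<Rightarrow> bool" where
  "in_radical N \<delta> \<longleftrightarrow> (\<forall>h\<in>gl_gens N. (\<Sum>g\<in>gl_gens N. \<delta> g * om_gl g h) = 0)"

definition gauss_lattice :: "nat \<Rightarrow> (gl_gen \<Rightarrow> int) \<Rightarrow> (nat \<Rightarrow> int) \<Rightarrow> bool" where
  "gauss_lattice N \<delta> c \<longleftrightarrow> (\<forall>k\<in>{1..<N}. \<delta> (Gu k) = c k \<and> \<delta> (Gv k) = c (k + 1))"

lemma sum_delta: "finite A \<Longrightarrow> m \<in> A \<Longrightarrow> (\<Sum>k\<in>A. f k * of_bool (k = m)) = (f m :: int)"
  by (subst sum.mono_neutral_right[of A "{m}"]) auto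

lemma radical_half_systems:
  assumes r: "in_radical N \<delta>" and c: "gauss_lattice N \<delta> c"
  shows "half_system N (\<lambda>m n. \<delta> (Ga m n)) (\<lambda>m. c (m + 1))" "half_system N (\<lambda>m n. \<delta> (Gb m n)) c"
proof -
  note R = r[unfolded in_radical_def sum_gl_gens, rule_format]
  have g: "Ga m n \<in> gl_gens N \<longleftrightarrow> 1 \<le> n \<and> n \<le> m \<and> m < N" "Gb m n \<in> gl_gens N \<longleftrightarrow> 1 \<le> n \<and> n \<le> m \<and> m < N"
    "Gu m \<in> gl_gens N \<longleftrightarrow> 1 \<le> m \<and> m < N" "Gv m \<in> gl_gens N \<longleftrightarrow> 1 \<le> m \<and> m < N" for m n by (auto simp: gl_gens_def)
  have oms: "om_gl (Gb m n) (Gv k) = 0" "om_gl (Gu m) (Gv k) = 0" "om_gl (Gv m) (Gv k) = 0" "om_gl (Ga m n) (Gv k) = of_bool (m = k)"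
    "om_gl (Ga m n) (Gu k) = 0" "om_gl (Gu m) (Gu k) = 0" "om_gl (Gv m) (Gu k) = 0" "om_gl (Gb m n) (Gu k) = - of_bool (m = k)"
    "om_gl (Gb m n) (Ga k l) = 0" "om_gl (Gu m) (Ga k l) = 0" "om_gl (Gv m) (Ga k l) = - of_bool (m = k)"
    "om_gl (Ga m n) (Gb k l) = 0" "om_gl (Gv m) (Gb k l) = 0" "om_gl (Gu m) (Gb k l) = of_bool (m = k)"
    "om_gl (Gb m n) (Gb k l) = - om_gl (Ga m n) (Ga k l)" for m n k l
    by (auto simp: om_gl_def of_bool_def)
  show "half_system N (\<lambda>m n. \<delta> (Ga m n)) (\<lambda>m. c (m + 1))"
    unfolding half_system_def
  proof (intro conjI ballI allI impI)
    fix m assume m: "m \<in> {1..<N}"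
    then show "(\<Sum>n=1..m. \<delta> (Ga m n)) = 0"
      using R[of "Gv m"] sum_row[of m N "\<lambda>m n. \<delta> (Ga m n)" "\<lambda>_ _. 1"] by (simp add: g oms)
  next
    fix m n assume a: "1 \<le> n \<and> n \<le> m \<and> m < N"
    then have m: "m \<in> {1..<N}" by auto
    have "(\<Sum>k\<in>{1..<N}. \<delta> (Gv k) * of_bool (k = m)) = c (m + 1)"
      using sum_delta[OF _ m, of "\<lambda>k. \<delta> (Gv k)"] c m by (simp add: gauss_lattice_def)
    then show "(\<Sum>(k, n')\<in>TR N. \<delta> (Ga k n') * om_gl (Ga k n') (Ga m n)) = c (m + 1)"
      using R[of "Ga m n"] a by (simp add: g oms sum_negf)
  qed
  show "half_system N (\<lambda>m n. \<delta> (Gb m n)) c"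
    unfolding half_system_def
  proof (intro conjI ballI allI impI)
    fix m assume m: "m \<in> {1..<N}"
    then show "(\<Sum>n=1..m. \<delta> (Gb m n)) = 0"
      using R[of "Gu m"] sum_row[of m N "\<lambda>m n. \<delta> (Gb m n)" "\<lambda>_ _. 1"] by (simp add: g oms sum_negf case_prod_unfold)
  next
    fix m n assume a: "1 \<le> n \<and> n \<le> m \<and> m < N"
    then have m: "m \<in> {1..<N}" by auto
    have "(\<Sum>k\<in>{1..<N}. \<delta> (Gu k) * of_bool (k = m)) = c m"
      using sum_delta[OF _ m, of "\<lambda>k. \<delta> (Gu k)"] c m by (simp add: gauss_lattice_def)
    then show "(\<Sum>(k, n')\<in>TR N. \<delta> (Gb k n') * om_gl (Ga k n') (Ga m n)) = c m"
      using R[of "Gb m n"] a by (simp add: g oms sum_negf case_prod_unfold)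
  qed
qed

lemma radical_trivial_if_c_trivial:
  assumes r: "in_radical N \<delta>" and c: "gauss_lattice N \<delta> c" and 0: "\<And>k. k \<in> {1..N} \<Longrightarrow> c k = 0" and x: "x \<in> gl_gens N"
  shows "\<delta> x = 0"
proof (cases x)
  case (Ga m n)
  show ?thesis unfolding Ga by (rule half_system_solution(2)[OF radical_half_systems(1)[OF r c]]) (use x Ga 0 in \<open>auto simp: gl_gens_def\<close>)
next
  case (Gb m n)
  show ?thesis unfolding Gb by (rule half_system_solution(2)[OF radical_half_systems(2)[OF r c]]) (use x Gb 0 in \<open>auto simp: gl_gens_def\<close>)
qed (use c 0 x in \<open>auto simp: gl_gens_def gauss_lattice_def\<close>)

text \<open>The coefficient of \<open>U\<^sub>k = \<u>\<^sub>k \<v>\<^bsub>k-1\<^esub>\<close> enters the system of the \<open>b\<close> through \<open>\<u>\<^sub>k\<close> and that of the \<open>a\<close>, with index shifted by one, through \<open>\<v>\<^bsub>k-1\<^esub>\<close>. The two reflection symmetries compose to a translation by two.\<close>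

lemma radical_symmetry:
  assumes r: "in_radical N \<delta>" and c: "gauss_lattice N \<delta> c"
  shows "1 \<le> m \<Longrightarrow> m < N \<Longrightarrow> c m = - c (N - m)" "1 \<le> m \<Longrightarrow> m < N \<Longrightarrow> c (m + 1) = - c (N - m + 1)"
    "1 \<le> j \<Longrightarrow> j + 2 \<le> N \<Longrightarrow> c (j + 2) = c j"
proof -
  show 1: "1 \<le> m \<Longrightarrow> m < N \<Longrightarrow> c m = - c (N - m)" for m using half_system_solution(1)[OF radical_half_systems(2)[OF r c]] .
  show 2: "1 \<le> m \<Longrightarrow> m < N \<Longrightarrow> c (m + 1) = - c (N - m + 1)" for m using half_system_solution(1)[OF radical_half_systems(1)[OF r c]] .
  show "1 \<le> j \<Longrightarrow> j + 2 \<le> N \<Longrightarrow> c (j + 2) = c j"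
    using 1[of j] 2[of "j + 1"] by (simp add: numeral_2_eq_2 Suc_diff_Suc)
qed

lemma radical_parity:
  assumes r: "in_radical N \<delta>" and c: "gauss_lattice N \<delta> c" and "1 \<le> j" "j \<le> N"
  shows "c j = (if odd j then c 1 else c 2)"
  using assms(3,4)
proof (induction j rule: less_induct)
  case (less j)
  consider "j = 1" | "j = 2" | "3 \<le> j" using less.prems by linarith
  then show ?case
  proof cases
    case 3
    define i where "i = j - 2"
    have i: "j = i + 2" "1 \<le> i" using 3 by (auto simp: i_def)
    show ?thesis using i less.IH[of i] radical_symmetry(3)[OF r c, of i] less.prems by simp
  qed simp_all
qed

text \<open>For even \<open>N\<close> the reflections \<open>k \<mapsto> N - k\<close> and \<open>k \<mapsto> N + 2 - k\<close> preserve the parity of \<open>k\<close>, so the antisymmetric coefficients vanish.\<close>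

theorem radical_even:
  assumes r: "in_radical N \<delta>" and c: "gauss_lattice N \<delta> c" and N: "even N" "2 \<le> N" and x: "x \<in> gl_gens N"
  shows "\<delta> x = 0"
proof -
  have "c 1 = - c (N - 1)" by (rule radical_symmetry(1)[OF r c]) (use N in auto)
  then have "c 1 = 0" using radical_parity[OF r c, of "N - 1"] N by simp
  moreover have "c (1 + 1) = - c (N - 1 + 1)" by (rule radical_symmetry(2)[OF r c]) (use N in auto)
  then have "c 2 = 0" using radical_parity[OF r c, of N] N by (simp add: numeral_2_eq_2)
  ultimately have "c k = 0" if "k \<in> {1..N}" for k
    using radical_parity[OF r c, of k] that by (cases "odd k") simp_all
  then show ?thesis by (rule radical_trivial_if_c_trivial[OF r c _ x])
qed

text \<open>The generator of the radical for odd \<open>N\<close>.\<close>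

fun kpa :: "gl_gen \<Rightarrow> int" where
  "kpa (Ga m n) = of_bool (even m) * (-1) ^ n"
| "kpa (Gb m n) = - of_bool (even m) * (-1) ^ n"
| "kpa (Gu k) = - ((-1) ^ k)"
| "kpa (Gv k) = (-1) ^ k"

lemma alternating_sum: "lo \<le> hi \<Longrightarrow> (\<Sum>n\<in>{lo<..hi}. (-1) ^ n) = (if even (hi - lo) then 0 else (-1) ^ (lo + 1) :: int)"
proof (induction "hi - lo" arbitrary: hi)
  case (Suc d)
  then obtain h where h: "hi = Suc h" "lo \<le> h" by (cases hi) auto
  have "{lo<..hi} = insert hi {lo<..h}" using h by auto
  then show ?case using Suc.hyps(1)[of h] h Suc.hyps(2) by (auto simp: Suc_diff_le elim!: evenE oddE)
qed simp

lemma alternating_count: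
  assumes "lo \<le> hi" "hi \<le> m"
  shows "(\<Sum>n=1..m. (-1) ^ n * of_bool (lo < n \<and> n \<le> hi)) = (if even (hi - lo) then 0 else (-1) ^ (lo + 1) :: int)"
proof -
  have "(\<Sum>n=1..m. (-1) ^ n * of_bool (lo < n \<and> n \<le> hi)) = (\<Sum>n\<in>{lo<..hi}. (-1) ^ n * (of_bool (lo < n \<and> n \<le> hi) :: int))"
    by (rule sum.mono_neutral_right) (use assms in auto)
  also have "\<dots> = (\<Sum>n\<in>{lo<..hi}. (-1) ^ n)" by (intro sum.cong) auto
  finally show ?thesis by (simp add: alternating_sum[OF assms(1)])
qed

lemma kpa_p: "(j, k) \<in> II N \<Longrightarrow> (\<Sum>(m, n)\<in>TR N. kpa (Ga m n) * int (pa j k m n)) = 0"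
proof -
  assume jk: "(j, k) \<in> II N"
  then have k: "k < N" "2 * j < k" by (auto simp: II_def)
  have "(\<Sum>(m, n)\<in>TR N. kpa (Ga m n) * int (pa j k m n)) = (\<Sum>(m, n)\<in>TR N. kpa (Ga m n) * (of_bool (m = k) * of_bool (j < n \<and> n + j \<le> m)))"
    by (intro sum.cong) (auto simp: pa_def)
  also have "\<dots> = (\<Sum>n=1..k. kpa (Ga k n) * of_bool (j < n \<and> n + j \<le> k))" by (rule sum_row[OF k(1)])
  also have "\<dots> = of_bool (even k) * (\<Sum>n=1..k. (-1) ^ n * of_bool (j < n \<and> n \<le> k - j))"
    unfolding sum_distrib_left by (intro sum.cong) (use k in auto)
  also have "\<dots> = 0" using alternating_count[of j "k - j" k] k by auto
  finally show ?thesis .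
qed

lemma kpa_dd: "even k \<Longrightarrow> (\<Sum>n=1..k. (-1) ^ n * int (dd k n)) = 0"
proof -
  assume k: "even k"
  have "(\<Sum>n=1..k. (-1) ^ n * int (dd k n)) = (\<Sum>n=1..k. (-1) ^ (k + 1 - n) * int (dd k (k + 1 - n)))"
    by (subst sum.atLeastAtMost_rev) simp
  also have "\<dots> = (\<Sum>n=1..k. - ((-1) ^ n * int (dd k n)))"
  proof (intro sum.cong refl)
    fix n assume n: "n \<in> {1..k}"
    have "dd k (k + 1 - n) = dd k n" using n by (auto simp: dd_def)
    moreover have "(-1 :: int) ^ (k + 1 - n) = - ((-1) ^ n)" using n k by (simp add: minus_one_power_iff)
    ultimately show "(-1) ^ (k + 1 - n) * int (dd k (k + 1 - n)) = - ((-1) ^ n * int (dd k n))" by simp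
  qed
  finally show ?thesis by (simp add: sum_negf)
qed

lemma kpa_q:
  assumes jk: "(j, k) \<in> II N" and N: "odd N"
  shows "(\<Sum>(m, n)\<in>TR N. kpa (Ga m n) * int (qa j k m n)) = - of_bool (j = 0) * (-1) ^ k"
proof -
  from jk have k: "k < N" "2 * j < k" by (auto simp: II_def)
  let ?f = "\<lambda>m n. of_bool (even m) * (-1) ^ n * (of_bool (m = k - 1) * of_bool (j < n \<and> n \<le> k - j))
      + of_bool (even m) * (-1) ^ n * (of_bool (m = k) * int (qa j m m n))
      + of_bool (even m) * (-1) ^ n * (of_bool (m = k + 1) * of_bool (j + 1 < n \<and> n \<le> m - j)) :: int"
  have "(\<Sum>(m, n)\<in>TR N. kpa (Ga m n) * int (qa j k m n)) = (\<Sum>(m, n)\<in>TR N. ?f m n)"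
  proof (rule sum.cong[OF refl], clarify)
    fix m n assume "(m, n) \<in> TR N"
    consider "k = m + 1" | "k = m" | "m = k + 1" | "k \<noteq> m + 1" "k \<noteq> m" "m \<noteq> k + 1" by blast
    then show "kpa (Ga m n) * int (qa j k m n) = ?f m n"
    proof cases
      case 1 then have "(n + j \<le> k) = (n \<le> k - j)" using k by auto
      then show ?thesis using 1 by (simp add: qa_def)
    next
      case 2 then show ?thesis using k by simp
    next
      case 3 then have "(j + 2 \<le> n \<and> n + j \<le> m) = (j + 1 < n \<and> n \<le> m - j)" using k by auto
      then show ?thesis using 3 by (simp add: qa_def)
    next
      case 4 then show ?thesis using k by (auto simp: qa_def)
    qed
  qed
  also have "\<dots> = (\<Sum>n=1..k-1. of_bool (even (k-1)) * (-1) ^ n * of_bool (j < n \<and> n \<le> k - j))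
      + (\<Sum>n=1..k. of_bool (even k) * (-1) ^ n * int (qa j k k n))
      + (\<Sum>(m, n)\<in>TR N. of_bool (even m) * (-1) ^ n * (of_bool (m = k + 1) * of_bool (j + 1 < n \<and> n \<le> m - j)))"
    using sum_row[of "k-1" N "\<lambda>m n. of_bool (even m) * (-1) ^ n" "\<lambda>m n. of_bool (j < n \<and> n \<le> k - j)"]
      sum_row[of k N "\<lambda>m n. of_bool (even m) * (-1) ^ n" "\<lambda>m n. int (qa j m m n)"] k
    by (simp only: case_prod_unfold sum.distrib)
  also have "\<dots> = - of_bool (j = 0) * (-1) ^ k"
  proof (cases "even k")
    case True
    have x1: "(\<Sum>(m, n)\<in>TR N. of_bool (even m) * (-1) ^ n * (of_bool (m = k + 1) * of_bool (j + 1 < n \<and> n \<le> m - j))) = (0 :: int)"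
      by (rule sum.neutral) (use True in auto)
    have y1: "(\<Sum>n=1..k-1. of_bool (even (k-1)) * (-1) ^ n * of_bool (j < n \<and> n \<le> k - j)) = (0 :: int)"
      by (rule sum.neutral) (use True k in auto)
    have y2: "(\<Sum>n=1..k. of_bool (even k) * (-1) ^ n * int (qa j k k n)) = (\<Sum>n=1..k. (-1) ^ n * int (qa j k k n))"
      using True by simp
    have x2: "(\<Sum>n=1..k. (-1) ^ n * int (qa j k k n)) = (\<Sum>n=1..k. (-1) ^ n * int (dd k n)) + (\<Sum>n=1..k. (-1) ^ n * of_bool (n = j + 1)) - (\<Sum>n=1..k. (-1) ^ n * of_bool (n = k + 1 - j))"
    proof -
      have "int (qa j k k n) = int (dd k n) + of_bool (n = j + 1) - of_bool (n = k + 1 - j)" if "n \<in> {1..k}" for n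
      proof -
        have "(2 * n \<le> k + 1 \<and> j = n - 1) = (n = j + 1)" "(k + 1 < 2 * n \<and> j = k + 1 - n) = (n = k + 1 - j)" using that k by auto
        then show ?thesis using qa_same[of n k j] that by (simp only: of_bool_conj[symmetric]) simp
      qed
      then show ?thesis unfolding sum.distrib[symmetric] sum_subtractf[symmetric] by (intro sum.cong) (simp_all only: distrib_left right_diff_distrib)
    qed
    have x3: "(\<Sum>n=1..k. (-1) ^ n * of_bool (n = j + 1)) = ((-1) ^ (j + 1) :: int)" by (rule sum_delta) (use k in auto)
    have x4: "(\<Sum>n=1..k. (-1) ^ n * of_bool (n = k + 1 - j)) = (if j = 0 then 0 else (-1) ^ (j + 1) :: int)"
    proof (cases "j = 0")
      case True then show ?thesis by (auto intro: sum.neutral)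
    next
      case False
      have e: "(\<Sum>n=1..k. (-1) ^ n * of_bool (n = k + 1 - j)) = ((-1) ^ (k + 1 - j) :: int)" by (rule sum_delta) (use k False in auto)
      have "even (k + 1 - j) = even (j + 1)" using True k by simp
      then have "(-1) ^ (k + 1 - j) = ((-1) ^ (j + 1) :: int)" by (simp only: minus_one_power_iff)
      then show ?thesis unfolding e using False by simp
    qed
    show ?thesis unfolding y1 y2 x1 x2 kpa_dd[OF True] x3 x4 using True by (cases "j = 0") simp_all
  next
    case False
    then have k1: "k + 1 < N" proof -
      have "k + 1 \<noteq> N" using False N by auto
      then show ?thesis using k by simp
    qed
    have a: "(\<Sum>(m, n)\<in>TR N. of_bool (even m) * (-1) ^ n * (of_bool (m = k + 1) * of_bool (j + 1 < n \<and> n \<le> m - j)))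
        = (\<Sum>n=1..k+1. of_bool (even (k+1)) * (-1) ^ n * (of_bool (j + 1 < n \<and> n \<le> k + 1 - j) :: int))"
      by (rule sum_row[OF k1])
    also have "\<dots> = (\<Sum>n=1..k+1. (-1) ^ n * of_bool (j + 1 < n \<and> n \<le> k + 1 - j))" using False by simp
    also have "\<dots> = (-1) ^ j" using alternating_count[of "j + 1" "k + 1 - j" "k + 1"] k False by auto
    finally have A: "(\<Sum>(m, n)\<in>TR N. of_bool (even m) * (-1) ^ n * (of_bool (m = k + 1) * of_bool (j + 1 < n \<and> n \<le> m - j))) = ((-1) ^ j :: int)" .
    have B: "(\<Sum>n=1..k-1. (-1) ^ n * of_bool (j < n \<and> n \<le> k - j)) = (if j = 0 then 0 else (-1) ^ (j + 1) :: int)"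
    proof (cases "j = 0")
      case True
      have "(\<Sum>n=1..k-1. (-1) ^ n * of_bool (j < n \<and> n \<le> k - j)) = (\<Sum>n=1..k-1. (-1) ^ n * (of_bool (0 < n \<and> n \<le> k - 1) :: int))"
        by (intro sum.cong) (use True in auto)
      then show ?thesis using alternating_count[of 0 "k - 1" "k - 1"] k False True by simp
    next
      case j: False
      then show ?thesis using alternating_count[of j "k - j" "k - 1"] k False by auto
    qed
    show ?thesis unfolding A using B False by (auto simp: minus_one_power_iff)
  qed
  finally show ?thesis .
qed

text \<open>Alternating sums over intervals cancel, up to a boundary term in the planes with \<open>j = 0\<close> that the coefficient of \<open>\<v>\<^sub>k\<close> or \<open>\<u>\<^sub>k\<close> compensates.\<close>

theorem kpa_coordinates:
  assumes N: "odd N" and i: "i \<in> planes N"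
  shows "(\<Sum>g\<in>gl_gens N. kpa g * int (pc g i)) = 0" "(\<Sum>g\<in>gl_gens N. kpa g * int (qc g i)) = 0"
proof -
  obtain s j k where ijk: "i = (s, j, k)" "(j, k) \<in> II N" using i by (cases i) (auto simp: planes_def)
  then have k: "k \<in> {1..<N}" by (auto simp: II_def)
  have sd: "(\<Sum>l\<in>{1..<N}. f l * of_bool (j = 0 \<and> k = l)) = of_bool (j = 0) * (f k :: int)" for f
  proof -
    have "(\<Sum>l\<in>{1..<N}. f l * of_bool (j = 0 \<and> k = l)) = (\<Sum>l\<in>{1..<N}. of_bool (j = 0) * (f l * of_bool (l = k)))"
      by (intro sum.cong) auto
    also have "\<dots> = of_bool (j = 0) * f k" unfolding sum_distrib_left[symmetric] by (subst sum_delta[OF _ k]) simp_all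
    finally show ?thesis .
  qed
  note s = sd[of "\<lambda>l. - ((-1) ^ l)"] sd[of "\<lambda>l. (-1) ^ l"]
  have neg: "kpa (Gb m n) = - kpa (Ga m n)" for m n by simp
  note p = kpa_p[OF ijk(2)] and q = kpa_q[OF ijk(2) N]
  show "(\<Sum>g\<in>gl_gens N. kpa g * int (pc g i)) = 0"
    using p q s by (cases s) (simp_all add: sum_gl_gens ijk(1) neg sum_negf case_prod_unfold del: kpa.simps(1,2))
  show "(\<Sum>g\<in>gl_gens N. kpa g * int (qc g i)) = 0"
    using p q s by (cases s) (simp_all add: sum_gl_gens ijk(1) neg sum_negf case_prod_unfold del: kpa.simps(1,2))
qed

text \<open>By the theorem on symplectic coordinates the form factors through the coordinates.\<close>

lemma in_radicalI:
  assumes "\<And>i. i \<in> planes N \<Longrightarrow> (\<Sum>g\<in>gl_gens N. \<delta> g * int (pc g i)) = 0"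
    and "\<And>i. i \<in> planes N \<Longrightarrow> (\<Sum>g\<in>gl_gens N. \<delta> g * int (qc g i)) = 0"
  shows "in_radical N \<delta>"
  unfolding in_radical_def
proof
  fix h assume h: "h \<in> gl_gens N"
  have "(\<Sum>g\<in>gl_gens N. \<delta> g * om_gl g h) = (\<Sum>g\<in>gl_gens N. \<Sum>i\<in>planes N. \<delta> g * (int (pc g i) * int (qc h i) - int (qc g i) * int (pc h i)))"
    using h by (intro sum.cong refl) (simp only: symplectic_coordinates[symmetric] sum_distrib_left)
  also have "\<dots> = (\<Sum>i\<in>planes N. (\<Sum>g\<in>gl_gens N. \<delta> g * int (pc g i)) * int (qc h i) - (\<Sum>g\<in>gl_gens N. \<delta> g * int (qc g i)) * int (pc h i))"
    by (subst sum.swap) (simp add: sum_subtractf sum_distrib_left sum_distrib_right right_diff_distrib mult_ac)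
  also have "\<dots> = 0" by (rule sum.neutral) (simp add: assms)
  finally show "(\<Sum>g\<in>gl_gens N. \<delta> g * om_gl g h) = 0" .
qed

text \<open>For odd \<open>N\<close> the reflections exchange the parities, which leaves the alternating vector \<open>kpa\<close>.\<close>

theorem radical_odd:
  assumes r: "in_radical N \<delta>" and c: "gauss_lattice N \<delta> c" and N: "odd N" "2 \<le> N" and x: "x \<in> gl_gens N"
  shows "\<delta> x = c 1 * kpa x"
proof -
  have "c 1 = - c (N - 1)" by (rule radical_symmetry(1)[OF r c]) (use N in auto)
  then have c2: "c 2 = - c 1" using radical_parity[OF r c, of "N - 1"] N by simp
  have k: "in_radical N kpa" by (intro in_radicalI kpa_coordinates N)
  have "in_radical N (\<lambda>x. \<delta> x - c 1 * kpa x)"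
    using r k unfolding in_radical_def by (simp add: left_diff_distrib sum_subtractf mult.assoc sum_distrib_left[symmetric])
  moreover have "gauss_lattice N (\<lambda>x. \<delta> x - c 1 * kpa x) (\<lambda>j. c j + c 1 * (-1) ^ j)"
    using c by (simp add: gauss_lattice_def)
  moreover have "c k + c 1 * (-1) ^ k = 0" if "k \<in> {1..N}" for k
    using radical_parity[OF r c, of k] that c2 by (cases "odd k") simp_all
  ultimately have "\<delta> x - c 1 * kpa x = 0" using radical_trivial_if_c_trivial x by blast
  then show ?thesis by simp
qed

section \<open>Row determinants\<close>

lemma prod_list_upt_split3: "1 \<le> j \<Longrightarrow> j < n \<Longrightarrow> prod_list (map f [1..<n]) = prod_list (map f [1..<j]) * f j * (prod_list (map f [Suc j..<n]) :: 'a::monoid_mult)"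
proof -
  assume j: "1 \<le> j" "j < n"
  then have "[1..<n] = [1..<j] @ j # [Suc j..<n]" using upt_add_eq_append[of 1 j "n - j"] upt_conv_Cons[of j n] by simp
  then show ?thesis by (simp add: mult.assoc)
qed

lemma prod_list_zero: "0 \<in> set xs \<Longrightarrow> prod_list xs = (0 :: 'a::semiring_1)"
  by (induction xs) auto

lemma quantum_det_cong:
  assumes "\<And>r s. 1 \<le> r \<Longrightarrow> r \<le> k \<Longrightarrow> 1 \<le> s \<Longrightarrow> s \<le> k \<Longrightarrow> w r s = w' r s"
  shows "quantum_det k w = quantum_det k w'"
  unfolding quantum_det_def
proof (intro sum.cong refl)
  fix \<sigma> assume "\<sigma> \<in> {\<sigma>. \<sigma> permutes {1..k}}"
  then have p: "\<And>r. r \<in> {1..k} \<Longrightarrow> \<sigma> r \<in> {1..k}" using permutes_in_image[of \<sigma> "{1..k}"] by blast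
  have "map (\<lambda>r. w r (\<sigma> r)) [1..<k + 1] = map (\<lambda>r. w' r (\<sigma> r)) [1..<k + 1]"
  proof (rule map_cong[OF refl])
    fix r assume "r \<in> set [1..<k + 1]"
    then have "r \<in> {1..k}" by auto
    with p[OF this] show "w r (\<sigma> r) = w' r (\<sigma> r)" by (intro assms) auto
  qed
  then show "of_int (sign \<sigma>) * prod_list (map (\<lambda>r. w r (\<sigma> r)) [1..<k + 1]) = of_int (sign \<sigma>) * prod_list (map (\<lambda>r. w' r (\<sigma> r)) [1..<k + 1])"
    by (rule arg_cong[where f = "\<lambda>l. of_int (sign \<sigma>) * prod_list l"])
qed

lemma quantum_det_row_add:
  assumes j: "1 \<le> j" "j \<le> k"
  shows "quantum_det k (w(j := (\<lambda>s. p s + t s))) = quantum_det k (w(j := p)) + quantum_det k (w(j := t))"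
proof -
  have l: "prod_list (map (\<lambda>r. (w(j := v)) r (\<sigma> r)) [1..<k + 1]) = prod_list (map (\<lambda>r. w r (\<sigma> r)) [1..<j]) * v (\<sigma> j) * prod_list (map (\<lambda>r. w r (\<sigma> r)) [Suc j..<k + 1])" for v and \<sigma> :: "nat \<Rightarrow> nat"
  proof -
    have "prod_list (map (\<lambda>r. (w(j := v)) r (\<sigma> r)) [1..<k + 1]) = prod_list (map (\<lambda>r. (w(j := v)) r (\<sigma> r)) [1..<j]) * (w(j := v)) j (\<sigma> j) * prod_list (map (\<lambda>r. (w(j := v)) r (\<sigma> r)) [Suc j..<k + 1])"
      by (rule prod_list_upt_split3) (use j in auto)
    moreover have "map (\<lambda>r. (w(j := v)) r (\<sigma> r)) [1..<j] = map (\<lambda>r. w r (\<sigma> r)) [1..<j]" "map (\<lambda>r. (w(j := v)) r (\<sigma> r)) [Suc j..<k + 1] = map (\<lambda>r. w r (\<sigma> r)) [Suc j..<k + 1]"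
      by auto
    ultimately show ?thesis by (simp only: fun_upd_same)
  qed
  show ?thesis unfolding quantum_det_def l sum.distrib[symmetric] by (intro sum.cong refl) (simp only: distrib_left distrib_right)
qed

text \<open>Exchanging the values of a permutation at the two rows preserves the product and changes the sign.\<close>

lemma quantum_det_adjacent_zero:
  fixes w :: "nat \<Rightarrow> nat \<Rightarrow> 'a::ring_1"
  assumes two: "\<And>x :: 'a. x = - x \<Longrightarrow> x = 0" and j: "1 \<le> j" "j < k"
    and sy: "\<And>s t. 1 \<le> s \<Longrightarrow> s \<le> k \<Longrightarrow> 1 \<le> t \<Longrightarrow> t \<le> k \<Longrightarrow> w j s * w (Suc j) t = w j t * w (Suc j) s"
  shows "quantum_det k w = 0"
proof (rule two)
  let ?\<tau> = "Transposition.transpose j (Suc j)" and ?S = "{1..k}"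
  let ?P = "\<lambda>\<sigma>. prod_list (map (\<lambda>r. w r (\<sigma> r)) [1..<k + 1])"
  have tau: "?\<tau> permutes ?S" using j by (intro permutes_swap_id) auto
  have split: "?P \<sigma> = prod_list (map (\<lambda>r. w r (\<sigma> r)) [1..<j]) * (w j (\<sigma> j) * w (Suc j) (\<sigma> (Suc j))) * prod_list (map (\<lambda>r. w r (\<sigma> r)) [Suc (Suc j)..<k + 1])" for \<sigma>
  proof -
    have "[Suc j..<k + 1] = Suc j # [Suc (Suc j)..<k + 1]" using j by (intro upt_conv_Cons) auto
    moreover have "?P \<sigma> = prod_list (map (\<lambda>r. w r (\<sigma> r)) [1..<j]) * w j (\<sigma> j) * prod_list (map (\<lambda>r. w r (\<sigma> r)) [Suc j..<k + 1])"
      by (rule prod_list_upt_split3) (use j in auto)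
    ultimately show ?thesis by (simp only: list.map prod_list.Cons mult.assoc)
  qed
  have P: "?P (\<sigma> \<circ> ?\<tau>) = ?P \<sigma>" if s: "\<sigma> permutes ?S" for \<sigma>
  proof -
    have m1: "map (\<lambda>r. w r ((\<sigma> \<circ> ?\<tau>) r)) [1..<j] = map (\<lambda>r. w r (\<sigma> r)) [1..<j]"
      by (rule map_cong[OF refl]) (auto simp: transpose_def)
    have m2: "map (\<lambda>r. w r ((\<sigma> \<circ> ?\<tau>) r)) [Suc (Suc j)..<k + 1] = map (\<lambda>r. w r (\<sigma> r)) [Suc (Suc j)..<k + 1]"
      by (rule map_cong[OF refl]) (auto simp: transpose_def)
    have c: "(\<sigma> \<circ> ?\<tau>) j = \<sigma> (Suc j)" "(\<sigma> \<circ> ?\<tau>) (Suc j) = \<sigma> j" by simp_all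
    have "\<sigma> j \<in> ?S" "\<sigma> (Suc j) \<in> ?S" using permutes_in_image[OF s, of j] permutes_in_image[OF s, of "Suc j"] j by auto
    then have eq: "w j (\<sigma> (Suc j)) * w (Suc j) (\<sigma> j) = w j (\<sigma> j) * w (Suc j) (\<sigma> (Suc j))" by (intro sy) auto
    show ?thesis by (simp only: split[of "\<sigma> \<circ> ?\<tau>"] split[of \<sigma>] m1 m2 c eq)
  qed
  have "quantum_det k w = (\<Sum>\<sigma> | \<sigma> permutes ?S. of_int (sign (\<sigma> \<circ> ?\<tau>)) * ?P (\<sigma> \<circ> ?\<tau>))"
    unfolding quantum_det_def by (rule sum_permutations_compose_right[OF tau])
  also have "\<dots> = (\<Sum>\<sigma> | \<sigma> permutes ?S. - (of_int (sign \<sigma>) * ?P \<sigma>))"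
  proof (intro sum.cong refl)
    fix \<sigma> assume "\<sigma> \<in> {\<sigma>. \<sigma> permutes ?S}"
    then have s: "\<sigma> permutes ?S" by simp
    have "sign (\<sigma> \<circ> ?\<tau>) = - sign \<sigma>"
      using sign_compose[of \<sigma> ?\<tau>] permutes_imp_permutation[OF _ s] permutes_imp_permutation[OF _ tau] by (simp add: sign_swap_id)
    then show "of_int (sign (\<sigma> \<circ> ?\<tau>)) * ?P (\<sigma> \<circ> ?\<tau>) = - (of_int (sign \<sigma>) * ?P \<sigma>)" by (simp only: P[OF s] of_int_minus minus_mult_left)
  qed
  also have "\<dots> = - quantum_det k w" by (simp only: sum_negf quantum_det_def)
  finally show "quantum_det k w = - quantum_det k w" .
qed

text \<open>From top to bottom, the summand \<open>Q r\<close> of a row contributes nothing since it is proportional to the row \<open>P (r - 1)\<close> that already stands above it.\<close>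

lemma quantum_det_peel:
  fixes w :: "nat \<Rightarrow> nat \<Rightarrow> 'a::ring_1"
  assumes two: "\<And>x :: 'a. x = - x \<Longrightarrow> x = 0"
    and w: "\<And>r s. 1 \<le> r \<Longrightarrow> r \<le> k \<Longrightarrow> 1 \<le> s \<Longrightarrow> s \<le> k \<Longrightarrow> w r s = P r s + Q r s"
    and Q1: "\<And>s. 1 \<le> s \<Longrightarrow> s \<le> k \<Longrightarrow> Q 1 s = 0"
    and sy: "\<And>r s t. 1 \<le> r \<Longrightarrow> r < k \<Longrightarrow> 1 \<le> s \<Longrightarrow> s \<le> k \<Longrightarrow> 1 \<le> t \<Longrightarrow> t \<le> k \<Longrightarrow> P r s * Q (Suc r) t = P r t * Q (Suc r) s"
  shows "quantum_det k w = quantum_det k P"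
proof -
  have "quantum_det k w = quantum_det k (\<lambda>r s. if r \<le> j then P r s else P r s + Q r s)" if "j \<le> k" for j
    using that
  proof (induction j)
    case 0
    show ?case by (rule quantum_det_cong) (use w in auto)
  next
    case (Suc j)
    let ?v = "\<lambda>r s. if r \<le> j then P r s else P r s + Q r s"
    let ?v' = "\<lambda>r s. if r \<le> Suc j then P r s else P r s + Q r s"
    have v: "?v = ?v(Suc j := (\<lambda>s. P (Suc j) s + Q (Suc j) s))" "?v' = ?v(Suc j := P (Suc j))" by (auto simp: fun_eq_iff)
    have "quantum_det k w = quantum_det k ?v" by (rule Suc.IH) (use Suc.prems in simp)
    also have "\<dots> = quantum_det k (?v(Suc j := P (Suc j))) + quantum_det k (?v(Suc j := Q (Suc j)))"
      by (subst v(1)) (rule quantum_det_row_add, use Suc.prems in auto)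
    also have "quantum_det k (?v(Suc j := Q (Suc j))) = 0"
    proof (cases "j = 0")
      case True
      have "quantum_det k (?v(Suc j := Q (Suc j))) = quantum_det k (?v(Suc j := (\<lambda>s. 0)))"
        by (rule quantum_det_cong) (use Q1 True in auto)
      also have "\<dots> = 0" using quantum_det_row_add[of "Suc j" k ?v "\<lambda>s. 0" "\<lambda>s. 0"] Suc.prems by simp
      finally show ?thesis .
    next
      case False
      show ?thesis by (rule quantum_det_adjacent_zero[of j, OF two]) (use False Suc.prems sy in auto)
    qed
    also have "quantum_det k (?v(Suc j := P (Suc j))) + 0 = quantum_det k ?v'"
      by (simp only: add_0_right) (rule arg_cong[OF v(2)[symmetric]])
    finally show ?case .
  qed
  from this[of k] have "quantum_det k w = quantum_det k (\<lambda>r s. if r \<le> k then P r s else P r s + Q r s)" by simp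
  also have "\<dots> = quantum_det k P" by (rule quantum_det_cong) auto
  finally show ?thesis .
qed

text \<open>Every permutation except the identity moves some row to a column on its left.\<close>

lemma quantum_det_triangular:
  assumes z: "\<And>r s. 1 \<le> s \<Longrightarrow> s < r \<Longrightarrow> r \<le> k \<Longrightarrow> w r s = 0"
  shows "quantum_det k w = prod_list (map (\<lambda>r. w r r) [1..<k + 1])"
proof -
  have "of_int (sign \<sigma>) * prod_list (map (\<lambda>r. w r (\<sigma> r)) [1..<k + 1]) = 0" if s: "\<sigma> permutes {1..k}" "\<sigma> \<noteq> id" for \<sigma>
  proof -
    have "\<exists>r\<in>{1..k}. \<not> r \<le> \<sigma> r" using permutes_natset_ge[OF s(1)] s(2) by blast
    then obtain r where r: "r \<in> {1..k}" "\<sigma> r < r" by auto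
    moreover have "\<sigma> r \<in> {1..k}" using permutes_in_image[OF s(1)] r by blast
    ultimately have "w r (\<sigma> r) = 0" by (intro z) auto
    then have "0 \<in> set (map (\<lambda>r. w r (\<sigma> r)) [1..<k + 1])" using r by (force simp: image_iff)
    then show ?thesis by (simp only: prod_list_zero mult_zero_right)
  qed
  then have "quantum_det k w = (\<Sum>\<sigma>\<in>{id}. of_int (sign \<sigma>) * prod_list (map (\<lambda>r. w r (\<sigma> r)) [1..<k + 1]))"
    unfolding quantum_det_def by (intro sum.mono_neutral_right) (auto simp: permutes_id finite_permutations)
  then show ?thesis by (simp add: sign_id)
qed

section \<open>Rows of the Gauss--Lusztig product\<close>

definition vm :: "nat \<Rightarrow> (nat \<Rightarrow> 'a::semiring_1) \<Rightarrow> 'a matrix \<Rightarrow> nat \<Rightarrow> 'a" where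
  "vm N v M = (\<lambda>c. \<Sum>k=1..N. v k * M k c)"

lemma vm_cong: "(\<And>k. 1 \<le> k \<Longrightarrow> k \<le> N \<Longrightarrow> v k = v' k) \<Longrightarrow> vm N v M = vm N v' M"
  unfolding vm_def by (intro ext sum.cong) auto

lemma sum_unit: "1 \<le> (r :: nat) \<Longrightarrow> r \<le> N \<Longrightarrow> (\<Sum>k=1..N. of_bool (k = r) * f k) = (f r :: 'a::semiring_1)"
  by (subst sum.mono_neutral_right[of "{1..N}" "{r}"]) auto

lemma vm_mat_prod: "1 \<le> c \<Longrightarrow> c \<le> N \<Longrightarrow> (\<Sum>k=1..N. v k * mat_prod N Ms k c) = foldl (vm N) v Ms c"
proof (induction Ms arbitrary: v)
  case Nil
  have "(\<Sum>k=1..N. v k * mat_one k c) = (\<Sum>k\<in>{c}. v k * mat_one k c)"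
    by (rule sum.mono_neutral_right) (use Nil in \<open>auto simp: mat_one_def\<close>)
  then show ?case by (simp add: mat_prod_def mat_one_def)
next
  case (Cons M Ms)
  have e: "mat_prod N (M # Ms) k c = (\<Sum>l=1..N. M k l * mat_prod N Ms l c)" for k
    by (simp add: mat_prod_def mat_mult_def)
  have "(\<Sum>k=1..N. v k * mat_prod N (M # Ms) k c) = (\<Sum>k=1..N. \<Sum>l=1..N. v k * M k l * mat_prod N Ms l c)"
    by (simp only: e sum_distrib_left mult.assoc)
  also have "\<dots> = (\<Sum>l=1..N. \<Sum>k=1..N. v k * M k l * mat_prod N Ms l c)" by (rule sum.swap)
  also have "\<dots> = (\<Sum>l=1..N. vm N v M l * mat_prod N Ms l c)" by (simp only: vm_def sum_distrib_right)
  also have "\<dots> = foldl (vm N) (vm N v M) Ms c" by (rule Cons.IH[OF Cons.prems])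
  finally show ?case by (simp only: foldl_Cons)
qed

lemma mat_prod_row: "1 \<le> r \<Longrightarrow> r \<le> N \<Longrightarrow> 1 \<le> c \<Longrightarrow> c \<le> N \<Longrightarrow> mat_prod N Ms r c = foldl (vm N) (\<lambda>k. of_bool (k = r)) Ms c"
proof -
  assume a: "1 \<le> r" "r \<le> N" "1 \<le> c" "c \<le> N"
  have "mat_prod N Ms r c = (\<Sum>k=1..N. of_bool (k = r) * mat_prod N Ms k c)" by (rule sum_unit[OF a(1,2), symmetric])
  also have "\<dots> = foldl (vm N) (\<lambda>k. of_bool (k = r)) Ms c" by (rule vm_mat_prod[OF a(3,4)])
  finally show ?thesis .
qed

locale q_ring =
  fixes Q :: "int \<Rightarrow> 'f::ring_1" and e :: "gl_gen \<Rightarrow> 'f" and N :: nat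
  assumes Q_add: "Q (i + j) = Q i * Q j" and Q_0: "Q 0 = 1" and Q_central: "x * Q i = Q i * x"
    and e_comm: "g \<in> gl_gens N \<Longrightarrow> h \<in> gl_gens N \<Longrightarrow> e g * e h = Q (2 * om_gl g h) * (e h * e g)"
    and two: "\<And>x :: 'f. x = - x \<Longrightarrow> x = 0" and N2: "2 \<le> N"
begin

definition qx :: "int \<Rightarrow> 'f \<Rightarrow> 'f \<Rightarrow> bool" where "qx k x y \<longleftrightarrow> x * y = Q (2 * k) * (y * x)"

lemma qx_gen: "x \<in> gl_gens N \<Longrightarrow> y \<in> gl_gens N \<Longrightarrow> k = om_gl x y \<Longrightarrow> qx k (e x) (e y)"
  unfolding qx_def by (simp only:) (rule e_comm)

lemma qx_zero: "qx k 0 x" "qx k x 0" by (simp_all add: qx_def)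
lemma qx_one: "qx 0 1 x" "qx 0 x 1" by (simp_all add: qx_def Q_0)

lemma qx_self: "qx 0 x x" by (simp add: qx_def Q_0)

lemma qx_add_right: "qx k x y \<Longrightarrow> qx k x y' \<Longrightarrow> qx k x (y + y')" by (simp add: qx_def distrib_left distrib_right)
lemma qx_add_left: "qx k x y \<Longrightarrow> qx k x' y \<Longrightarrow> qx k (x + x') y" by (simp add: qx_def distrib_left distrib_right)

lemma qx_mult_right: assumes "qx i x y" "qx j x z" "k = i + j" shows "qx k x (y * z)"
proof -
  have "x * (y * z) = (x * y) * z" by (simp only: mult.assoc)
  also have "\<dots> = (Q (2 * i) * (y * x)) * z" by (simp only: assms(1)[unfolded qx_def])
  also have "\<dots> = Q (2 * i) * (y * (x * z))" by (simp only: mult.assoc)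
  also have "\<dots> = Q (2 * i) * (y * (Q (2 * j) * (z * x)))" by (simp only: assms(2)[unfolded qx_def])
  also have "\<dots> = Q (2 * i) * ((y * Q (2 * j)) * (z * x))" by (simp only: mult.assoc)
  also have "\<dots> = Q (2 * i) * ((Q (2 * j) * y) * (z * x))" by (simp only: Q_central[of y])
  also have "\<dots> = (Q (2 * i) * Q (2 * j)) * ((y * z) * x)" by (simp only: mult.assoc)
  finally show ?thesis by (simp only: qx_def assms(3) Q_add[symmetric] distrib_left)
qed

lemma qx_sym: assumes "qx i x y" "k = - i" shows "qx k y x"
proof -
  have "Q (2 * k) * (x * y) = (Q (2 * k) * Q (2 * i)) * (y * x)" using assms(1) by (simp add: qx_def mult.assoc)
  also have "\<dots> = y * x" by (simp add: assms(2) Q_add[symmetric] Q_0)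
  finally show ?thesis by (simp add: qx_def)
qed

lemma qx_mult_left: assumes "qx i x z" "qx j y z" "k = i + j" shows "qx k (x * y) z"
  by (rule qx_sym[of "- k"], rule qx_mult_right[OF qx_sym[OF assms(1) refl] qx_sym[OF assms(2) refl]]) (simp_all add: assms(3))

definition EA :: "nat \<Rightarrow> 'f matrix" where
  "EA s i j = of_bool (i = j) + (if j = i + 1 \<and> s \<le> i \<and> i \<le> N - 1 then e (Ga i s) else 0)"

definition EB :: "nat \<Rightarrow> 'f matrix" where
  "EB s i j = of_bool (i = j) + (if i = j + 1 \<and> N - s \<le> j \<and> j \<le> N - 1 then e (Gb j (j + s - (N - 1))) else 0)"

definition U :: "nat \<Rightarrow> 'f" where "U k = (if k = N then 1 else e (Gu k))"
definition V :: "nat \<Rightarrow> 'f" where "V k = (if k - 1 = 0 then 1 else e (Gv (k - 1)))"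
definition ETm :: "'f matrix" where "ETm i j = (if i = j then U i else 0)"
definition ETp :: "'f matrix" where "ETp i j = (if i = j then V i else 0)"

lemma sum_two:
  fixes f :: "nat \<Rightarrow> 'f"
  assumes "c \<in> {1..N}"
  shows "(\<Sum>k=1..N. v k * (of_bool (k = c) + (if k = d \<and> C then f k else 0))) = v c + (if d \<in> {1..N} \<and> C then v d * f d else 0)"
proof -
  have "(\<Sum>k=1..N. v k * (of_bool (k = c) + (if k = d \<and> C then f k else 0))) = (\<Sum>k=1..N. if k = c then v k else 0) + (\<Sum>k=1..N. if k = d then (if C then v k * f k else 0) else 0)"
    unfolding sum.distrib[symmetric] by (intro sum.cong) (auto simp: distrib_left)
  also have "\<dots> = v c + (if d \<in> {1..N} \<and> C then v d * f d else 0)" using assms by (simp add: sum.delta)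
  finally show ?thesis .
qed

lemma vm_EA:
  assumes "1 \<le> c" "c \<le> N" "1 \<le> s"
  shows "vm N v (EA s) c = v c + (if s < c then v (c - 1) * e (Ga (c - 1) s) else 0)"
proof -
  have "vm N v (EA s) c = (\<Sum>k=1..N. v k * (of_bool (k = c) + (if k = c - 1 \<and> s < c then e (Ga k s) else 0)))"
    unfolding vm_def EA_def by (intro sum.cong refl arg_cong2[where f = "(*)"] arg_cong2[where f = "(+)"]) (use assms in auto)
  also have "\<dots> = v c + (if c - 1 \<in> {1..N} \<and> s < c then v (c - 1) * e (Ga (c - 1) s) else 0)" by (rule sum_two) (use assms in auto)
  finally show ?thesis using assms by auto
qed

lemma vm_EB:
  assumes "1 \<le> c" "c \<le> N" "s < N"
  shows "vm N v (EB s) c = v c + (if c < N \<and> N - s \<le> c then v (c + 1) * e (Gb c (c + s - (N - 1))) else 0)"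
proof -
  have "vm N v (EB s) c = (\<Sum>k=1..N. v k * (of_bool (k = c) + (if k = c + 1 \<and> (c < N \<and> N - s \<le> c) then (\<lambda>_. e (Gb c (c + s - (N - 1)))) k else 0)))"
    unfolding vm_def EB_def by (intro sum.cong refl arg_cong2[where f = "(*)"] arg_cong2[where f = "(+)"]) (use assms in auto)
  also have "\<dots> = v c + (if c + 1 \<in> {1..N} \<and> (c < N \<and> N - s \<le> c) then v (c + 1) * e (Gb c (c + s - (N - 1))) else 0)" by (rule sum_two) (use assms in auto)
  finally show ?thesis using assms by auto
qed

lemma vm_T: assumes "1 \<le> c" "c \<le> N" shows "vm N v ETm c = v c * U c" "vm N v ETp c = v c * V c"
proof -
  have "(\<Sum>k=1..N. v k * (if k = c then F k else 0)) = v c * F c" for F :: "nat \<Rightarrow> 'f"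
    by (subst sum.mono_neutral_right[of "{1..N}" "{c}"]) (use assms in auto)
  then show "vm N v ETm c = v c * U c" "vm N v ETp c = v c * V c" by (simp_all add: vm_def ETm_def ETp_def)
qed

lemma gens_iff: "Ga m n \<in> gl_gens N \<longleftrightarrow> 1 \<le> n \<and> n \<le> m \<and> m \<le> N - 1" "Gb m n \<in> gl_gens N \<longleftrightarrow> 1 \<le> n \<and> n \<le> m \<and> m \<le> N - 1"
    "Gu m \<in> gl_gens N \<longleftrightarrow> 1 \<le> m \<and> m \<le> N - 1" "Gv m \<in> gl_gens N \<longleftrightarrow> 1 \<le> m \<and> m \<le> N - 1" for m n
  by (auto simp: gl_gens_def)

text \<open>Multiplying a row by \<open>A\<^sub>t \<cdots> A\<^bsub>t'-1\<^esub>\<close>.\<close>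

definition Arow_ok :: "nat \<Rightarrow> nat \<Rightarrow> (nat \<Rightarrow> 'f) \<Rightarrow> bool" where
  "Arow_ok r t Z \<longleftrightarrow> (\<forall>c\<in>{1..N}. c < r \<longrightarrow> Z c = 0) \<and>
     (\<forall>s m c. t \<le> s \<and> s \<le> m \<and> m \<le> N - 1 \<and> c \<in> {1..N} \<longrightarrow> qx (of_bool (m + 1 = c) - of_bool (m + 1 = r)) (e (Ga m s)) (Z c)) \<and>
     (\<forall>c\<in>{1..N}. \<forall>c'\<in>{1..N}. qx 0 (Z c) (Z c'))"

text \<open>An entry is a sum of monomials in which exactly one \<open>a\<^bsub>m,*\<^esub>\<close> occurs for each level between the row and the column. Hence its exchange exponent with a variable of a later factor depends on the column only, and the exponents of two entries cancel.\<close>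

lemma Arow_step:
  assumes Z: "Arow_ok r t Z" and t: "1 \<le> t"
  shows "Arow_ok r (Suc t) (vm N Z (EA t))"
proof -
  let ?Y = "vm N Z (EA t)"
  have z: "Z c = 0" if "c \<in> {1..N}" "c < r" for c using Z that unfolding Arow_ok_def by blast
  have h: "qx (of_bool (m + 1 = c) - of_bool (m + 1 = r)) (e (Ga m s)) (Z c)" if "t \<le> s" "s \<le> m" "m \<le> N - 1" "c \<in> {1..N}" for s m c
    using Z that unfolding Arow_ok_def by blast
  have cm: "qx 0 (Z c) (Z c')" if "c \<in> {1..N}" "c' \<in> {1..N}" for c c' using Z that unfolding Arow_ok_def by blast
  have Y: "?Y c = Z c + (if t < c then Z (c - 1) * e (Ga (c - 1) t) else 0)" if "c \<in> {1..N}" for c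
    using that t by (intro vm_EA) auto
  have Y': "?Y c = 0" if "c \<in> {1..N}" "c < r" for c
  proof -
    have "Z (c - 1) = 0" if "t < c" by (rule z) (use that \<open>c \<in> {1..N}\<close> \<open>c < r\<close> t in auto)
    then show ?thesis using z[OF that] unfolding Y[OF that(1)] by auto
  qed
  have H: "qx (of_bool (m + 1 = c) - of_bool (m + 1 = r)) (e (Ga m s)) (?Y c)" if a: "Suc t \<le> s" "s \<le> m" "m \<le> N - 1" "c \<in> {1..N}" for s m c
    unfolding Y[OF a(4)]
  proof (intro qx_add_right)
    show "qx (of_bool (m + 1 = c) - of_bool (m + 1 = r)) (e (Ga m s)) (Z c)" by (rule h) (use a in auto)
    show "qx (of_bool (m + 1 = c) - of_bool (m + 1 = r)) (e (Ga m s)) (if t < c then Z (c - 1) * e (Ga (c - 1) t) else 0)"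
    proof (cases "t < c")
      case True
      have "qx (of_bool (m + 1 = c) - of_bool (m + 1 = r)) (e (Ga m s)) (Z (c - 1) * e (Ga (c - 1) t))"
      proof (rule qx_mult_right)
        show "qx (of_bool (m + 1 = c - 1) - of_bool (m + 1 = r)) (e (Ga m s)) (Z (c - 1))" by (rule h) (use a True t in auto)
        show "qx (of_bool (m + 1 = c) - of_bool (m + 1 = c - 1)) (e (Ga m s)) (e (Ga (c - 1) t))"
          by (rule qx_gen) (use a True t in \<open>auto simp: gens_iff om_gl_def\<close>)
      qed simp
      then show ?thesis using True by simp
    qed (simp add: qx_zero)
  qed
  have C: "qx 0 (?Y c) (?Y c')" if a: "c \<in> {1..N}" "c' \<in> {1..N}" "c < c'" for c c'
  proof (cases "c < r")
    case True
    then show ?thesis using Y' a by (simp add: qx_zero)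
  next
    case cr: False
    let ?t = "if t < c then Z (c - 1) * e (Ga (c - 1) t) else 0" and ?t' = "if t < c' then Z (c' - 1) * e (Ga (c' - 1) t) else 0"
    have 1: "qx 0 (Z c) ?t'"
    proof (cases "t < c'")
      case True
      have "qx 0 (Z c) (Z (c' - 1) * e (Ga (c' - 1) t))"
      proof (rule qx_mult_right)
        show "qx 0 (Z c) (Z (c' - 1))" by (rule cm) (use a in auto)
        show "qx 0 (Z c) (e (Ga (c' - 1) t))" by (rule qx_sym[OF h]) (use a True cr in auto)
      qed simp
      then show ?thesis using True by simp
    qed (simp add: qx_zero)
    have 2: "qx 0 ?t (?Y c')" if tc: "t < c"
    proof (cases "c = r")
      case True
      then have "Z (c - 1) = 0" using tc a t by (intro z) auto
      then show ?thesis by (simp add: qx_zero)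
    next
      case False
      have c1: "c - 1 \<in> {1..N}" using tc a t by auto
      have "qx 0 (Z (c - 1) * e (Ga (c - 1) t)) (Z c')"
      proof (rule qx_mult_left)
        show "qx 0 (Z (c - 1)) (Z c')" by (rule cm[OF c1 a(2)])
        show "qx (of_bool (c - 1 + 1 = c') - of_bool (c - 1 + 1 = r)) (e (Ga (c - 1) t)) (Z c')" by (rule h) (use a tc in auto)
      qed (use a tc False in auto)
      moreover have "qx 0 (Z (c - 1) * e (Ga (c - 1) t)) (Z (c' - 1) * e (Ga (c' - 1) t))"
      proof (rule qx_mult_left)
        show "qx 0 (Z (c - 1)) (Z (c' - 1) * e (Ga (c' - 1) t))"
        proof (rule qx_mult_right)
          show "qx 0 (Z (c - 1)) (Z (c' - 1))" by (rule cm) (use c1 a in auto)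
          show "qx 0 (Z (c - 1)) (e (Ga (c' - 1) t))" by (rule qx_sym[OF h]) (use a tc c1 cr in auto)
        qed simp
        show "qx 0 (e (Ga (c - 1) t)) (Z (c' - 1) * e (Ga (c' - 1) t))"
        proof (rule qx_mult_right)
          show "qx (of_bool (c - 1 + 1 = c' - 1) - of_bool (c - 1 + 1 = r)) (e (Ga (c - 1) t)) (Z (c' - 1))" by (rule h) (use a tc in auto)
          show "qx (- of_bool (c + 1 = c')) (e (Ga (c - 1) t)) (e (Ga (c' - 1) t))"
            by (rule qx_gen) (use a tc t in \<open>auto simp: gens_iff om_gl_def\<close>)
        qed (use tc False a in auto)
      qed simp
      ultimately show ?thesis unfolding Y[OF a(2)] using tc a(3) by (simp add: qx_add_right)
    qed
    have 3: "qx 0 (Z c) (?Y c')" unfolding Y[OF a(2)] by (rule qx_add_right[OF cm[OF a(1,2)] 1])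
    show ?thesis unfolding Y[OF a(1)] by (rule qx_add_left[OF 3]) (use 2 in \<open>cases "t < c"; simp add: qx_zero\<close>)
  qed
  have C': "qx 0 (?Y c) (?Y c')" if "c \<in> {1..N}" "c' \<in> {1..N}" for c c'
    using C[of c c'] qx_sym[OF C[of c' c], of 0] qx_self that by (cases c c' rule: linorder_cases) auto
  show ?thesis unfolding Arow_ok_def using Y' H C' by blast
qed

lemma Arow_foldl:
  assumes "Arow_ok r t Z" "1 \<le> t" "t \<le> t'"
  shows "Arow_ok r t' (foldl (vm N) Z (map EA [t..<t']))"
  using assms(3)
proof (induction t' rule: dec_induct)
  case base then show ?case using assms by simp
next
  case (step n)
  then show ?case using Arow_step[of r n] assms(2) by simp
qed

text \<open>Rows of \<open>A\<^sub>t \<cdots> A\<^bsub>t'-1\<^esub>\<close> only involve variables of level at least the index of the row.\<close>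

lemma A_foldl_uniform:
  assumes x: "\<And>c. c \<in> {1..N} \<Longrightarrow> qx k x (Z c)" and z: "\<And>c. c \<in> {1..N} \<Longrightarrow> c < r \<Longrightarrow> Z c = 0"
    and a: "\<And>m s. t \<le> s \<Longrightarrow> s \<le> m \<Longrightarrow> m \<le> N - 1 \<Longrightarrow> r \<le> m \<Longrightarrow> qx 0 x (e (Ga m s))" and t: "1 \<le> t" "t \<le> t'"
  shows "\<forall>c\<in>{1..N}. qx k x (foldl (vm N) Z (map EA [t..<t']) c) \<and> (c < r \<longrightarrow> foldl (vm N) Z (map EA [t..<t']) c = 0)"
  using t(2)
proof (induction t' rule: dec_induct)
  case base then show ?case using x z by simp
next
  case (step n)
  let ?Y = "foldl (vm N) Z (map EA [t..<n])"
  show ?case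
  proof
    fix c assume c: "c \<in> {1..N}"
    have Y: "vm N ?Y (EA n) c = ?Y c + (if n < c then ?Y (c - 1) * e (Ga (c - 1) n) else 0)" using c step t by (intro vm_EA) auto
    have "qx k x (?Y (c - 1) * e (Ga (c - 1) n))" if "n < c"
    proof (cases "c - 1 < r")
      case True
      have "c - 1 \<in> {1..N}" using that c t step.hyps by auto
      then have "?Y (c - 1) = 0" using step.IH True by blast
      then show ?thesis by (simp add: qx_zero)
    next
      case False
      have c1: "c - 1 \<in> {1..N}" using that c t step.hyps by auto
      show ?thesis
      proof (rule qx_mult_right[of k _ _ 0])
        show "qx k x (?Y (c - 1))" using step.IH c1 by blast
        show "qx 0 x (e (Ga (c - 1) n))" by (rule a) (use that c False t step.hyps in auto)
      qed simp
    qed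
    then have "qx k x (vm N ?Y (EA n) c)" unfolding Y using step.IH c by (auto intro!: qx_add_right qx_zero)
    moreover have "vm N ?Y (EA n) c = 0" if "c < r"
    proof -
      have "?Y c = 0" using step.IH c that by blast
      moreover have "?Y (c - 1) = 0" if "n < c"
      proof -
        have "c - 1 \<in> {1..N}" "c - 1 < r" using that c t step.hyps \<open>c < r\<close> by auto
        then show ?thesis using step.IH by blast
      qed
      ultimately show ?thesis unfolding Y by auto
    qed
    ultimately show "qx k x (foldl (vm N) Z (map EA [t..<Suc n]) c) \<and> (c < r \<longrightarrow> foldl (vm N) Z (map EA [t..<Suc n]) c = 0)"
      using step.hyps by simp
  qed
qed

end

lemma om_b_shift:
  fixes x y :: nat
  assumes 1: "c = m \<or> m = c + 1 \<Longrightarrow> y < x" and 2: "c = m + 1 \<Longrightarrow> y \<le> x"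
  shows "om_gl (Gb m x) (Gb c y) = of_bool (c = m + 1) - of_bool (c = m)"
proof -
  consider "c = m" | "c = m + 1" | "m = c + 1" | "c \<noteq> m" "c \<noteq> m + 1" "m \<noteq> c + 1" by blast
  then show ?thesis
  proof cases
    case 1 with assms(1) show ?thesis by (simp add: om_gl_def)
  next
    case 2 with assms(2) show ?thesis by (simp add: om_gl_def)
  next
    case 3 with assms(1) show ?thesis by (simp add: om_gl_def)
  next
    case 4 then show ?thesis by (simp add: om_gl_def)
  qed
qed

lemma om_b1:
  assumes "s' < s''" "s'' < N" "N - s'' \<le> m" "N - s' \<le> c"
  shows "om_gl (Gb m (m + s'' - (N - 1))) (Gb c (c + s' - (N - 1))) = of_bool (c = m + 1) - of_bool (c = m)"
proof (rule om_b_shift)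
  have ge: "N \<le> c + s'" using assms(4) by (simp only: le_diff_conv)
  then have "N - 1 \<le> c + s'" by linarith
  moreover have "c + s' < m + s''" if "c = m \<or> m = c + 1" using that assms(1) by linarith
  ultimately show "c + s' - (N - 1) < m + s'' - (N - 1)" if "c = m \<or> m = c + 1"
    using that diff_less_mono by blast
  show "c + s' - (N - 1) \<le> m + s'' - (N - 1)" if "c = m + 1"
    by (rule diff_le_mono) (use that assms(1) in linarith)
qed

lemma om_b2:
  assumes "s < N" "N - s \<le> c'" "c' < c"
  shows "om_gl (Gb c (c + s - (N - 1))) (Gb c' (c' + s - (N - 1))) = 0"
proof -
  have z: "om_gl (Gb c x) (Gb c' y) = 0" if "y < x" for x y :: nat using that assms(3) by (auto simp: om_gl_def)
  have "N \<le> c' + s" using assms(2) by (simp only: le_diff_conv)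
  then have "N - 1 \<le> c' + s" by linarith
  moreover have "c' + s < c + s" using assms(3) by linarith
  ultimately show ?thesis by (intro z diff_less_mono)
qed

context q_ring begin

abbreviation "gb m s \<equiv> Gb m (m + s - (N - 1))"

lemma gb_gens:
  assumes "s < N" "N - s \<le> m" "m < N" shows "gb m s \<in> gl_gens N"
proof -
  have N: "N \<le> m + s" using assms(2) by (simp only: le_diff_conv)
  obtain x where x: "m + s = x + (N - 1)" "1 \<le> x"
    by (rule that[of "m + s + 1 - N"]) (use N assms(1) in linarith)+
  have "m + s - (N - 1) = x" using x(1) by simp
  moreover have "x \<le> m" "m \<le> N - 1" using x(1) assms by linarith+
  ultimately show ?thesis using x(2) by (simp only: gens_iff simp_thms)
qed

lemma qx_gen_gb: "g \<in> gl_gens N \<Longrightarrow> s < N \<Longrightarrow> N - s \<le> m \<Longrightarrow> m < N \<Longrightarrow> k = om_gl g (gb m s) \<Longrightarrow> qx k (e g) (e (gb m s))"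
  by (rule qx_gen[OF _ gb_gens])

definition Brow_ok :: "nat \<Rightarrow> nat \<Rightarrow> (nat \<Rightarrow> 'f) \<Rightarrow> bool" where
  "Brow_ok r t Y \<longleftrightarrow> (\<forall>c\<in>{1..N}. r < c \<longrightarrow> Y c = 0) \<and>
     (\<forall>s m c. t \<le> s \<and> s < N \<and> N - s \<le> m \<and> m < N \<and> c \<in> {1..N} \<longrightarrow> qx (of_bool (m + 1 = c) - of_bool (m + 1 = r)) (e (gb m s)) (Y c)) \<and>
     (\<forall>k c. 1 \<le> k \<and> k < N \<and> c \<in> {1..N} \<longrightarrow> qx (of_bool (c \<le> k \<and> k < r)) (e (Gu k)) (Y c)) \<and>
     (\<forall>g c. (g \<in> range Gv \<or> (\<exists>m n. g = Ga m n)) \<and> g \<in> gl_gens N \<and> c \<in> {1..N} \<longrightarrow> qx 0 (e g) (Y c)) \<and>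
     (\<forall>c\<in>{1..N}. \<forall>c'\<in>{1..N}. c' < c \<longrightarrow> qx (- of_bool (c < r)) (Y c) (Y c'))"

lemma Brow_okD:
  assumes B: "Brow_ok r t Z"
  shows "c \<in> {1..N} \<Longrightarrow> r < c \<Longrightarrow> Z c = 0"
    and "t \<le> s \<Longrightarrow> s < N \<Longrightarrow> N - s \<le> m \<Longrightarrow> m < N \<Longrightarrow> c \<in> {1..N} \<Longrightarrow> qx (of_bool (m + 1 = c) - of_bool (m + 1 = r)) (e (gb m s)) (Z c)"
    and "1 \<le> k \<Longrightarrow> k < N \<Longrightarrow> c \<in> {1..N} \<Longrightarrow> qx (of_bool (c \<le> k \<and> k < r)) (e (Gu k)) (Z c)"
    and "g \<in> range Gv \<or> (\<exists>m n. g = Ga m n) \<Longrightarrow> g \<in> gl_gens N \<Longrightarrow> c \<in> {1..N} \<Longrightarrow> qx 0 (e g) (Z c)"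
    and "c \<in> {1..N} \<Longrightarrow> c' \<in> {1..N} \<Longrightarrow> c' < c \<Longrightarrow> qx (- of_bool (c < r)) (Z c) (Z c')"
proof -
  note B1 = B[unfolded Brow_ok_def, THEN conjunct1]
  note B2 = B[unfolded Brow_ok_def, THEN conjunct2, THEN conjunct1]
  note B3 = B[unfolded Brow_ok_def, THEN conjunct2, THEN conjunct2, THEN conjunct1]
  note B4 = B[unfolded Brow_ok_def, THEN conjunct2, THEN conjunct2, THEN conjunct2, THEN conjunct1]
  note B5 = B[unfolded Brow_ok_def, THEN conjunct2, THEN conjunct2, THEN conjunct2, THEN conjunct2]
  show "c \<in> {1..N} \<Longrightarrow> r < c \<Longrightarrow> Z c = 0" by (rule B1[rule_format])
  show "t \<le> s \<Longrightarrow> s < N \<Longrightarrow> N - s \<le> m \<Longrightarrow> m < N \<Longrightarrow> c \<in> {1..N} \<Longrightarrow> qx (of_bool (m + 1 = c) - of_bool (m + 1 = r)) (e (gb m s)) (Z c)"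
    by (rule B2[rule_format]) (intro conjI)
  show "1 \<le> k \<Longrightarrow> k < N \<Longrightarrow> c \<in> {1..N} \<Longrightarrow> qx (of_bool (c \<le> k \<and> k < r)) (e (Gu k)) (Z c)"
    by (rule B3[rule_format]) (intro conjI)
  show "g \<in> range Gv \<or> (\<exists>m n. g = Ga m n) \<Longrightarrow> g \<in> gl_gens N \<Longrightarrow> c \<in> {1..N} \<Longrightarrow> qx 0 (e g) (Z c)"
    by (rule B4[rule_format]) (intro conjI)
  show "c \<in> {1..N} \<Longrightarrow> c' \<in> {1..N} \<Longrightarrow> c' < c \<Longrightarrow> qx (- of_bool (c < r)) (Z c) (Z c')"
    by (rule B5[rule_format])
qed

text \<open>As for the \<open>a\<close>, except that entries left of the diagonal do not commute with each other; the exponent \<open>-1\<close> that remains is compensated by the factors \<open>\<u>\<^sub>c\<close> of \<open>T\<close>.\<close>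

lemma Brow_step:
  assumes B: "Brow_ok r t Z" and t: "t < N" and r: "1 \<le> r" "r \<le> N"
  shows "Brow_ok r (Suc t) (vm N Z (EB t))"
proof -
  let ?Y = "vm N Z (EB t)"
  note z = Brow_okD(1)[OF B] and h = Brow_okD(2)[OF B] and u = Brow_okD(3)[OF B] and va = Brow_okD(4)[OF B] and cm = Brow_okD(5)[OF B]
  define T where "T c = (if c < N \<and> N - t \<le> c then Z (c + 1) * e (gb c t) else 0)" for c
  have Y: "?Y c = Z c + T c" if "c \<in> {1..N}" for c
    unfolding T_def using that t by (intro vm_EB) auto
  have T0: "qx k x (T c)" if "c < N \<Longrightarrow> N - t \<le> c \<Longrightarrow> qx k x (Z (c + 1) * e (gb c t))" for k x c
    unfolding T_def using that by (simp add: qx_zero)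
  have T0': "qx k (T c) x" if "c < N \<Longrightarrow> N - t \<le> c \<Longrightarrow> qx k (Z (c + 1) * e (gb c t)) x" for k x c
    unfolding T_def using that by (simp add: qx_zero)
  have 1: "?Y c = 0" if "c \<in> {1..N}" "r < c" for c
    using that z[of c] z[of "c + 1"] by (auto simp: Y T_def)
  have 2: "qx (of_bool (m + 1 = c) - of_bool (m + 1 = r)) (e (gb m s)) (?Y c)" if a: "Suc t \<le> s" "s < N" "N - s \<le> m" "m < N" "c \<in> {1..N}" for s m c
    unfolding Y[OF a(5)]
  proof (rule qx_add_right[OF h T0])
    assume c: "c < N" "N - t \<le> c"
    show "qx (of_bool (m + 1 = c) - of_bool (m + 1 = r)) (e (gb m s)) (Z (c + 1) * e (gb c t))"
    proof (rule qx_mult_right)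
      show "qx (of_bool (m + 1 = c + 1) - of_bool (m + 1 = r)) (e (gb m s)) (Z (c + 1))" by (rule h) (use a c in auto)
      show "qx (of_bool (c = m + 1) - of_bool (c = m)) (e (gb m s)) (e (gb c t))"
        by (rule qx_gen) (use a c t in \<open>simp_all only: gb_gens om_b1 Suc_le_eq\<close>)
    qed auto
  qed (use a in auto)
  have 3: "qx (of_bool (c \<le> k \<and> k < r)) (e (Gu k)) (?Y c)" if a: "1 \<le> k" "k < N" "c \<in> {1..N}" for k c
    unfolding Y[OF a(3)]
  proof (rule qx_add_right[OF u T0])
    assume c: "c < N" "N - t \<le> c"
    show "qx (of_bool (c \<le> k \<and> k < r)) (e (Gu k)) (Z (c + 1) * e (gb c t))"
    proof (cases "c < r")
      case True
      show ?thesis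
      proof (rule qx_mult_right)
        show "qx (of_bool (c + 1 \<le> k \<and> k < r)) (e (Gu k)) (Z (c + 1))" by (rule u) (use a c in auto)
        show "qx (of_bool (k = c)) (e (Gu k)) (e (gb c t))" by (rule qx_gen_gb) (use a c t in \<open>auto simp: gens_iff om_gl_def\<close>)
      qed (use True in auto)
    next
      case False
      then have "Z (c + 1) = 0" using z[of "c + 1"] c by auto
      then show ?thesis by (simp add: qx_zero)
    qed
  qed (use a in auto)
  have 4: "qx 0 (e g) (?Y c)" if a: "g \<in> range Gv \<or> (\<exists>m n. g = Ga m n)" "g \<in> gl_gens N" "c \<in> {1..N}" for g c
    unfolding Y[OF a(3)]
  proof (rule qx_add_right[OF va T0])
    assume c: "c < N" "N - t \<le> c"
    show "qx 0 (e g) (Z (c + 1) * e (gb c t))"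
    proof (rule qx_mult_right)
      show "qx 0 (e g) (Z (c + 1))" by (rule va) (use a c in auto)
      show "qx 0 (e g) (e (gb c t))" by (rule qx_gen_gb) (use a c t in \<open>auto simp: om_gl_def\<close>)
    qed simp
  qed (use a in auto)
  have 5: "qx (- of_bool (c < r)) (?Y c) (?Y c')" if a: "c \<in> {1..N}" "c' \<in> {1..N}" "c' < c" for c c'
  proof (cases "r < c")
    case True
    then show ?thesis using 1 a by (simp add: qx_zero)
  next
    case cr: False
    have A: "qx (- of_bool (c < r)) (Z c) (T c')"
    proof (rule T0)
      assume c': "c' < N" "N - t \<le> c'"
      show "qx (- of_bool (c < r)) (Z c) (Z (c' + 1) * e (gb c' t))"
      proof (rule qx_mult_right)
        show "qx (if c' + 1 = c then 0 else - of_bool (c < r)) (Z c) (Z (c' + 1))" using a cm[of c "c' + 1"] qx_self by auto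
        show "qx (- (of_bool (c' + 1 = c) - of_bool (c' + 1 = r))) (Z c) (e (gb c' t))" by (rule qx_sym[OF h]) (use a c' t in auto)
      qed (use a cr in auto)
    qed
    have Bq: "qx (- of_bool (c < r)) (T c) (?Y c')"
    proof (rule T0')
      assume c: "c < N" "N - t \<le> c"
      show "qx (- of_bool (c < r)) (Z (c + 1) * e (gb c t)) (?Y c')"
      proof (cases "c < r")
        case False
        then have "Z (c + 1) = 0" using z[of "c + 1"] c by auto
        then show ?thesis by (simp add: qx_zero)
      next
        case True
        show ?thesis unfolding Y[OF a(2)]
        proof (rule qx_add_right[OF _ T0])
          show "qx (- of_bool (c < r)) (Z (c + 1) * e (gb c t)) (Z c')"
          proof (rule qx_mult_left)
            show "qx (- of_bool (c + 1 < r)) (Z (c + 1)) (Z c')" by (rule cm) (use a c in auto)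
            show "qx (of_bool (c + 1 = c') - of_bool (c + 1 = r)) (e (gb c t)) (Z c')" by (rule h) (use a c t in auto)
          qed (use True a in auto)
        next
          assume c': "c' < N" "N - t \<le> c'"
          show "qx (- of_bool (c < r)) (Z (c + 1) * e (gb c t)) (Z (c' + 1) * e (gb c' t))"
          proof (rule qx_mult_right)
            show "qx (- of_bool (c < r)) (Z (c + 1) * e (gb c t)) (Z (c' + 1))"
            proof (rule qx_mult_left)
              show "qx (- of_bool (c + 1 < r)) (Z (c + 1)) (Z (c' + 1))" by (rule cm) (use a c in auto)
              show "qx (of_bool (c + 1 = c' + 1) - of_bool (c + 1 = r)) (e (gb c t)) (Z (c' + 1))" by (rule h) (use a c c' t in auto)
            qed (use True a in auto)
            show "qx 0 (Z (c + 1) * e (gb c t)) (e (gb c' t))"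
            proof (rule qx_mult_left)
              show "qx 0 (Z (c + 1)) (e (gb c' t))" by (rule qx_sym[OF h]) (use a c c' t True in auto)
              show "qx 0 (e (gb c t)) (e (gb c' t))" by (rule qx_gen) (use a c c' t in \<open>simp_all only: gb_gens om_b2\<close>)
            qed simp
          qed simp
        qed
      qed
    qed
    show ?thesis unfolding Y[OF a(1)]
    proof (rule qx_add_left[OF _ Bq])
      show "qx (- of_bool (c < r)) (Z c) (?Y c')" unfolding Y[OF a(2)] by (rule qx_add_right[OF cm[OF a] A])
    qed
  qed
  show ?thesis unfolding Brow_ok_def
  proof (intro conjI)
    show "\<forall>c\<in>{1..N}. r < c \<longrightarrow> ?Y c = 0" using 1 by blast
    show "\<forall>s m c. Suc t \<le> s \<and> s < N \<and> N - s \<le> m \<and> m < N \<and> c \<in> {1..N} \<longrightarrow> qx (of_bool (m + 1 = c) - of_bool (m + 1 = r)) (e (gb m s)) (?Y c)"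
      by (intro allI impI, elim conjE) (rule 2)
    show "\<forall>k c. 1 \<le> k \<and> k < N \<and> c \<in> {1..N} \<longrightarrow> qx (of_bool (c \<le> k \<and> k < r)) (e (Gu k)) (?Y c)"
      by (intro allI impI, elim conjE) (rule 3)
    show "\<forall>g c. (g \<in> range Gv \<or> (\<exists>m n. g = Ga m n)) \<and> g \<in> gl_gens N \<and> c \<in> {1..N} \<longrightarrow> qx 0 (e g) (?Y c)"
      by (intro allI impI, elim conjE) (rule 4)
    show "\<forall>c\<in>{1..N}. \<forall>c'\<in>{1..N}. c' < c \<longrightarrow> qx (- of_bool (c < r)) (?Y c) (?Y c')"
      by (intro ballI impI) (rule 5)
  qed
qed

definition Brow :: "nat \<Rightarrow> nat \<Rightarrow> nat \<Rightarrow> nat \<Rightarrow> 'f" where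
  "Brow r s t = foldl (vm N) (\<lambda>k. of_bool (k = r)) (map EB [s..<t])"

lemma Brow_Suc: "s \<le> t \<Longrightarrow> Brow r s (Suc t) = vm N (Brow r s t) (EB t)" by (simp add: Brow_def)

lemma Brow_ok_Brow:
  assumes r: "1 \<le> r" "r \<le> N" and s: "s \<le> t" "t \<le> N"
  shows "Brow_ok r t (Brow r s t)"
  using s(1,2)
proof (induction t rule: dec_induct)
  case base
  have "qx k x (of_bool (c = r))" if "c = r \<Longrightarrow> k = 0" for k x c using that by (cases "c = r") (simp_all add: qx_one qx_zero)
  moreover have "qx k (of_bool (c = r)) (of_bool (c' = r))" if "c = r \<Longrightarrow> k = 0" for k and c c' :: nat
    using that by (cases "c = r") (simp_all add: qx_one qx_zero)
  ultimately show ?case unfolding Brow_ok_def Brow_def by simp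
next
  case (step n)
  then show ?case using Brow_step[of r n "Brow r s n"] r by (simp add: Brow_Suc)
qed

lemma Brow_left:
  assumes r: "1 \<le> \<rho>" "\<rho> < N" "N - s \<le> \<rho>" "s < t" "t \<le> N" and c: "c \<in> {1..N}"
  shows "qx (- of_bool (c < \<rho>)) (e (gb \<rho> s)) (Brow \<rho> (Suc s) t c)"
proof -
  have "Suc s \<le> t" using r(4) by simp
  from this r(5) c show ?thesis
proof (induction t arbitrary: c rule: dec_induct)
  case base
  then show ?case by (cases "c = \<rho>") (simp_all add: Brow_def qx_one qx_zero)
next
  case (step n)
  then have sn: "s < n" "n < N" by auto
  have z: "Brow \<rho> (Suc s) n (c + 1) = 0" if "\<rho> < c + 1" "c + 1 \<le> N"
    by (rule Brow_okD(1)[OF Brow_ok_Brow]) (use that r step.hyps step.prems sn in auto)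
  have Y: "Brow \<rho> (Suc s) (Suc n) c = Brow \<rho> (Suc s) n c + (if c < N \<and> N - n \<le> c then Brow \<rho> (Suc s) n (c + 1) * e (gb c n) else 0)"
    using step sn by (simp only: Brow_Suc) (intro vm_EB, auto)
  have "qx (- of_bool (c < \<rho>)) (e (gb \<rho> s)) (Brow \<rho> (Suc s) n (c + 1) * e (gb c n))" if cc: "c < N" "N - n \<le> c"
  proof (cases "c < \<rho>")
    case False
    then show ?thesis using z cc by (simp add: qx_zero)
  next
    case True
    show ?thesis
    proof (rule qx_mult_right)
      show "qx (- of_bool (c + 1 < \<rho>)) (e (gb \<rho> s)) (Brow \<rho> (Suc s) n (c + 1))" by (rule step.IH) (use step cc in auto)
      have "om_gl (gb \<rho> s) (gb c n) = - om_gl (gb c n) (gb \<rho> s)" by (simp only: om_gl_def minus_diff_eq)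
      also have "om_gl (gb c n) (gb \<rho> s) = of_bool (\<rho> = c + 1) - of_bool (\<rho> = c)"
        by (rule om_b1) (use sn r cc in auto)
      finally have om: "om_gl (gb \<rho> s) (gb c n) = - of_bool (\<rho> = c + 1)" using True by simp
      show "qx (- of_bool (\<rho> = c + 1)) (e (gb \<rho> s)) (e (gb c n))"
        by (rule qx_gen_gb[OF gb_gens _ _ _ om[symmetric]]) (use r cc sn in auto)
    qed (use True in auto)
  qed
  moreover have "qx (- of_bool (c < \<rho>)) (e (gb \<rho> s)) (Brow \<rho> (Suc s) n c)" by (rule step.IH) (use step in auto)
  ultimately show ?case unfolding Y by (auto intro!: qx_add_right qx_zero)
qed
qed

definition W :: "nat \<Rightarrow> 'f matrix" where
  "W s = mat_prod N (map EB [s..<N] @ [ETm, ETp] @ map EA [1..<N])"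

definition XA :: "nat \<Rightarrow> 'f matrix" where "XA t = mat_prod N (map EA [t..<N])"

lemma W_row:
  assumes "1 \<le> r" "r \<le> N" "c \<in> {1..N}"
  shows "W s r c = foldl (vm N) (\<lambda>c. Brow r s N c * U c * V c) (map EA [1..<N]) c"
proof -
  have c: "vm N v A = vm N v' A" if "\<And>k. 1 \<le> k \<Longrightarrow> k \<le> N \<Longrightarrow> v k = v' k" for v v' :: "nat \<Rightarrow> 'f" and A by (rule vm_cong[OF that])
  have f: "foldl (vm N) v Ms c = foldl (vm N) v' Ms c" if "\<And>k. 1 \<le> k \<Longrightarrow> k \<le> N \<Longrightarrow> v k = v' k" for v v' :: "nat \<Rightarrow> 'f" and Ms
  proof (cases Ms)
    case Nil then show ?thesis using that assms(3) by simp
  next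
    case (Cons A As)
    have "vm N v A = vm N v' A" by (rule vm_cong[OF that])
    then show ?thesis using Cons by simp
  qed
  have "W s r c = foldl (vm N) (\<lambda>k. of_bool (k = r)) (map EB [s..<N] @ [ETm, ETp] @ map EA [1..<N]) c"
    unfolding W_def by (rule mat_prod_row) (use assms in auto)
  also have "\<dots> = foldl (vm N) (vm N (vm N (Brow r s N) ETm) ETp) (map EA [1..<N]) c"
    by (simp only: foldl_append foldl_Cons foldl_Nil Brow_def)
  also have "\<dots> = foldl (vm N) (\<lambda>c. Brow r s N c * U c * V c) (map EA [1..<N]) c"
    by (rule f) (simp add: vm_T)
  finally show ?thesis .
qed

lemma qx_U: "1 \<le> c \<Longrightarrow> c \<le> N \<Longrightarrow> x \<in> gl_gens N \<Longrightarrow> (c \<noteq> N \<Longrightarrow> om_gl x (Gu c) = k) \<Longrightarrow> (c = N \<Longrightarrow> k = 0) \<Longrightarrow> qx k (e x) (U c)"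
  by (cases "c = N") (auto simp: U_def qx_one gens_iff intro!: qx_gen)

lemma qx_V: "1 \<le> c \<Longrightarrow> c \<le> N \<Longrightarrow> x \<in> gl_gens N \<Longrightarrow> (c \<noteq> 1 \<Longrightarrow> om_gl x (Gv (c - 1)) = k) \<Longrightarrow> (c = 1 \<Longrightarrow> k = 0) \<Longrightarrow> qx k (e x) (V c)"
  by (cases "c = 1") (auto simp: V_def qx_one gens_iff intro!: qx_gen)

lemma qx_V_left: "1 \<le> c \<Longrightarrow> c \<le> N \<Longrightarrow> (c \<noteq> 1 \<Longrightarrow> qx 0 (e (Gv (c - 1))) y) \<Longrightarrow> qx 0 (V c) y"
  by (cases "c = 1") (auto simp: V_def qx_one)

lemma qx_U_left: "(c \<noteq> N \<Longrightarrow> qx k (e (Gu c)) y) \<Longrightarrow> (c = N \<Longrightarrow> k = 0) \<Longrightarrow> qx k (U c) y"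
  by (cases "c = N") (auto simp: U_def qx_one)

lemma Z_Arow_ok:
  assumes r: "1 \<le> r" "r \<le> N" and s: "s \<le> N"
  shows "Arow_ok 0 1 (\<lambda>c. Brow r s N c * U c * V c)"
proof -
  let ?B = "Brow r s N"
  note B = Brow_ok_Brow[OF r s order_refl]
  note u = Brow_okD(3)[OF B] and va = Brow_okD(4)[OF B] and cm = Brow_okD(5)[OF B]
  have UU: "qx 0 (U c) (U c')" if "c \<in> {1..N}" "c' \<in> {1..N}" for c c'
    by (rule qx_U_left, rule qx_U) (use that in \<open>auto simp: gens_iff om_gl_def\<close>)
  have UV: "qx 0 (U c) (V c')" if "c \<in> {1..N}" "c' \<in> {1..N}" for c c'
    by (rule qx_U_left, rule qx_V) (use that in \<open>auto simp: gens_iff om_gl_def\<close>)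
  have VV: "qx 0 (V c) (V c')" if "c \<in> {1..N}" "c' \<in> {1..N}" for c c'
    by (rule qx_V_left, use that in simp, use that in simp, rule qx_V) (use that in \<open>auto simp: gens_iff om_gl_def\<close>)
  have VB: "qx 0 (V c) (?B c')" if "c \<in> {1..N}" "c' \<in> {1..N}" for c c'
    by (rule qx_V_left, use that in simp, use that in simp, rule va) (use that in \<open>auto simp: gens_iff\<close>)
  have UB: "qx (of_bool (c' \<le> c \<and> c < r)) (U c) (?B c')" if "c \<in> {1..N}" "c' \<in> {1..N}" for c c'
    by (rule qx_U_left, rule u) (use that r in auto)
  have lt: "qx 0 (?B c * U c * V c) (?B c' * U c' * V c')" if a: "c \<in> {1..N}" "c' \<in> {1..N}" "c' < c" for c c'
  proof -
    have "qx 0 (V c) (?B c' * U c')"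
      by (rule qx_mult_right[OF VB[OF a(1,2)] qx_sym[OF UV[OF a(2,1)], of 0]]) simp_all
    then have v': "qx 0 (V c) (?B c' * U c' * V c')" by (rule qx_mult_right[OF _ VV[OF a(1,2)]]) simp
    have "qx (of_bool (c' \<le> c \<and> c < r)) (U c) (?B c' * U c')"
      by (rule qx_mult_right[OF UB[OF a(1,2)] UU[OF a(1,2)]]) simp
    then have u': "qx (of_bool (c' \<le> c \<and> c < r)) (U c) (?B c' * U c' * V c')"
      by (rule qx_mult_right[OF _ UV[OF a(1,2)]]) simp
    have bu: "qx 0 (?B c) (U c')" by (rule qx_sym[OF UB[OF a(2,1)]]) (use a in auto)
    have bv: "qx 0 (?B c) (V c')" by (rule qx_sym[OF VB[OF a(2,1)]]) simp
    have "qx (- of_bool (c < r)) (?B c) (?B c' * U c')" by (rule qx_mult_right[OF cm[OF a] bu]) simp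
    then have b': "qx (- of_bool (c < r)) (?B c) (?B c' * U c' * V c')" by (rule qx_mult_right[OF _ bv]) simp
    have "qx 0 (?B c * U c) (?B c' * U c' * V c')" by (rule qx_mult_left[OF b' u']) (use a in auto)
    then show ?thesis by (rule qx_mult_left[OF _ v']) simp
  qed
  have C: "qx 0 (?B c * U c * V c) (?B c' * U c' * V c')" if "c \<in> {1..N}" "c' \<in> {1..N}" for c c'
    using lt[of c c'] qx_sym[OF lt[of c' c], of 0] qx_self that by (cases c c' rule: linorder_cases) auto
  have H: "qx (of_bool (m + 1 = c) - of_bool (m + 1 = 0)) (e (Ga m t)) (?B c * U c * V c)" if a: "1 \<le> t" "t \<le> m" "m \<le> N - 1" "c \<in> {1..N}" for t m c
  proof (rule qx_mult_right[of 0])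
    show "qx (of_bool (m + 1 = c)) (e (Ga m t)) (V c)" by (rule qx_V) (use a in \<open>auto simp: gens_iff om_gl_def\<close>)
    show "qx 0 (e (Ga m t)) (?B c * U c)"
    proof (rule qx_mult_right[of 0 _ _ 0])
      show "qx 0 (e (Ga m t)) (?B c)" by (rule va) (use a in \<open>auto simp: gens_iff\<close>)
      show "qx 0 (e (Ga m t)) (U c)" by (rule qx_U) (use a in \<open>auto simp: gens_iff om_gl_def\<close>)
    qed simp
  qed simp
  show ?thesis unfolding Arow_ok_def using C H by simp
qed

lemma W_row_comm:
  assumes r: "1 \<le> r" "r \<le> N" "s \<le> N" "c \<in> {1..N}" "c' \<in> {1..N}"
  shows "qx 0 (W s r c) (W s r c')"
  using Arow_foldl[OF Z_Arow_ok[OF r(1-3)], of N] N2 r unfolding Arow_ok_def by (auto simp: W_row)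

text \<open>Every monomial in this row contains either \<open>b\<^bsub>\<rho>-1,*\<^esub>\<close> or \<open>\<u>\<^sub>\<rho>\<close>, each of which contributes the same exponent; therefore the exponent is independent of the column.\<close>

lemma W_left:
  assumes r: "1 \<le> \<rho>" "\<rho> < N" "N - s \<le> \<rho>" "s < N" and c: "c \<in> {1..N}"
  shows "qx (- 1) (e (gb \<rho> s)) (W (Suc s) \<rho> c)"
proof -
  let ?Z = "\<lambda>c. Brow \<rho> (Suc s) N c * U c * V c"
  have g: "gb \<rho> s \<in> gl_gens N" by (rule gb_gens) (use r in auto)
  have z: "?Z c = 0" if "\<rho> < c" "c \<in> {1..N}" for c
    using Brow_okD(1)[OF Brow_ok_Brow[of \<rho> "Suc s" N]] that r by simp
  have Z: "qx (- 1) (e (gb \<rho> s)) (?Z c)" if c: "c \<in> {1..N}" for c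
  proof (cases "\<rho> < c")
    case True then show ?thesis using z c by (simp add: qx_zero)
  next
    case False
    show ?thesis
    proof (rule qx_mult_right[of "-1" _ _ 0])
      show "qx 0 (e (gb \<rho> s)) (V c)" by (rule qx_V) (use c r g in \<open>auto simp: om_gl_def\<close>)
      show "qx (- 1) (e (gb \<rho> s)) (Brow \<rho> (Suc s) N c * U c)"
      proof (rule qx_mult_right)
        show "qx (- of_bool (c < \<rho>)) (e (gb \<rho> s)) (Brow \<rho> (Suc s) N c)" by (rule Brow_left) (use r c in auto)
        show "qx (- of_bool (c = \<rho>)) (e (gb \<rho> s)) (U c)" by (rule qx_U) (use c r g in \<open>auto simp: om_gl_def\<close>)
      qed (use False in auto)
    qed simp
  qed
  have "\<forall>c\<in>{1..N}. qx (- 1) (e (gb \<rho> s)) (foldl (vm N) ?Z (map EA [1..<N]) c) \<and> (c < 0 \<longrightarrow> foldl (vm N) ?Z (map EA [1..<N]) c = 0)"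
  proof (rule A_foldl_uniform)
    show "qx 0 (e (gb \<rho> s)) (e (Ga m t))" if "1 \<le> t" "t \<le> m" "m \<le> N - 1" "0 \<le> m" for m t
      by (rule qx_gen[OF g]) (use that in \<open>auto simp: gens_iff om_gl_def\<close>)
  qed (use Z N2 in auto)
  then show ?thesis using c r by (simp add: W_row)
qed

lemma sum_two_left:
  fixes f :: "nat \<Rightarrow> 'f"
  assumes "i \<in> {1..N}"
  shows "(\<Sum>k=1..N. (of_bool (i = k) + (if k = d \<and> C then f k else 0)) * v k) = v i + (if d \<in> {1..N} \<and> C then f d * v d else 0)"
proof -
  have "(\<Sum>k=1..N. (of_bool (i = k) + (if k = d \<and> C then f k else 0)) * v k) = (\<Sum>k=1..N. if k = i then v k else 0) + (\<Sum>k=1..N. if k = d then (if C then f k * v k else 0) else 0)"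
    unfolding sum.distrib[symmetric] by (intro sum.cong) (auto simp: distrib_right)
  also have "\<dots> = v i + (if d \<in> {1..N} \<and> C then f d * v d else 0)" using assms by (simp add: sum.delta)
  finally show ?thesis .
qed

lemma W_rec:
  assumes "s < N" "i \<in> {1..N}"
  shows "W s i c = W (Suc s) i c + (if 2 \<le> i \<and> N - s \<le> i - 1 then e (gb (i - 1) s) * W (Suc s) (i - 1) c else 0)"
proof -
  have "W s = mat_mult N (EB s) (W (Suc s))" unfolding W_def using assms by (simp add: upt_conv_Cons mat_prod_def)
  then have "W s i c = (\<Sum>k=1..N. EB s i k * W (Suc s) k c)" by (simp add: mat_mult_def)
  also have "\<dots> = (\<Sum>k=1..N. (of_bool (i = k) + (if k = i - 1 \<and> (2 \<le> i \<and> N - s \<le> i - 1) then (\<lambda>_. e (gb (i - 1) s)) k else 0)) * W (Suc s) k c)"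
    unfolding EB_def by (intro sum.cong refl arg_cong2[where f = "(*)"] arg_cong2[where f = "(+)"]) (use assms in auto)
  also have "\<dots> = W (Suc s) i c + (if i - 1 \<in> {1..N} \<and> (2 \<le> i \<and> N - s \<le> i - 1) then e (gb (i - 1) s) * W (Suc s) (i - 1) c else 0)"
    by (rule sum_two_left[OF assms(2)])
  finally show ?thesis using assms by auto
qed

lemma XA_rec:
  assumes "t < N" "i \<in> {1..N}"
  shows "XA t i c = XA (Suc t) i c + (if t \<le> i \<and> i < N then e (Ga i t) * XA (Suc t) (i + 1) c else 0)"
proof -
  have "XA t = mat_mult N (EA t) (XA (Suc t))" unfolding XA_def using assms by (simp add: upt_conv_Cons mat_prod_def)
  then have "XA t i c = (\<Sum>k=1..N. EA t i k * XA (Suc t) k c)" by (simp add: mat_mult_def)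
  also have "\<dots> = (\<Sum>k=1..N. (of_bool (i = k) + (if k = i + 1 \<and> (t \<le> i \<and> i < N) then (\<lambda>_. e (Ga i t)) k else 0)) * XA (Suc t) k c)"
    unfolding EA_def by (intro sum.cong refl arg_cong2[where f = "(*)"] arg_cong2[where f = "(+)"]) (use assms in auto)
  also have "\<dots> = XA (Suc t) i c + (if i + 1 \<in> {1..N} \<and> (t \<le> i \<and> i < N) then e (Ga i t) * XA (Suc t) (i + 1) c else 0)"
    by (rule sum_two_left[OF assms(2)])
  finally show ?thesis using assms by auto
qed

lemma XA_N: "XA N i c = of_bool (i = c)" by (simp add: XA_def mat_prod_def mat_one_def)

lemma XA_upper: "t \<le> N \<Longrightarrow> i \<in> {1..N} \<Longrightarrow> c \<le> i \<Longrightarrow> XA t i c = of_bool (i = c)"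
proof (induction t arbitrary: i rule: inc_induct)
  case base then show ?case by (simp add: XA_N)
next
  case (step t) then show ?case by (auto simp: XA_rec)
qed

lemma XA_unit: "t \<le> N \<Longrightarrow> i \<in> {1..N} \<Longrightarrow> i < t \<Longrightarrow> XA t i c = of_bool (i = c)"
proof (induction t rule: inc_induct)
  case base then show ?case by (simp add: XA_N)
next
  case (step t) then show ?case by (auto simp: XA_rec)
qed

lemma W_N: "i \<in> {1..N} \<Longrightarrow> W N i c = U i * V i * XA 1 i c"
proof -
  assume i: "i \<in> {1..N}"
  have d: "(\<Sum>k=1..N. (if i = k then F i else 0) * v k) = F i * v i" for F v :: "nat \<Rightarrow> 'f"
    by (subst sum.mono_neutral_right[of "{1..N}" "{i}"]) (use i in auto)
  have 1: "mat_mult N ETm M i c = U i * M i c" for M unfolding mat_mult_def ETm_def by (rule d)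
  have 2: "mat_mult N ETp M i c = V i * M i c" for M unfolding mat_mult_def ETp_def by (rule d)
  have "W N i c = mat_mult N ETm (mat_mult N ETp (XA 1)) i c" by (simp add: W_def XA_def mat_prod_def)
  then show ?thesis by (simp only: 1 2 mult.assoc)
qed

text \<open>This is what makes the determinant blind to adding a multiple of the row above.\<close>

lemma sym_pair:
  assumes "qx k b x" "qx k b y" "qx 0 x y"
  shows "x * (b * y) = y * (b * x)"
proof -
  have xy: "x * y = y * x" using assms(3) by (simp add: qx_def Q_0)
  have "x * (b * y) = x * (Q (2 * k) * (y * b))" by (simp only: assms(2)[unfolded qx_def])
  also have "\<dots> = (x * Q (2 * k)) * (y * b)" by (simp only: mult.assoc)
  also have "\<dots> = (Q (2 * k) * x) * (y * b)" by (simp only: Q_central[of x])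
  also have "\<dots> = Q (2 * k) * ((x * y) * b)" by (simp only: mult.assoc)
  also have "\<dots> = (Q (2 * k) * y) * (x * b)" by (simp only: xy mult.assoc)
  also have "\<dots> = (y * Q (2 * k)) * (x * b)" by (simp only: Q_central[of y])
  also have "\<dots> = y * (Q (2 * k) * (x * b))" by (simp only: mult.assoc)
  also have "\<dots> = y * (b * x)" by (simp only: assms(1)[unfolded qx_def])
  finally show ?thesis .
qed

text \<open>Multiplication by \<open>B\<^sub>s\<close> adds to a row a multiple of the row above it. The rows below \<open>d + 1\<close> see their upper neighbour inside the minor, and row \<open>d + 1\<close> is unchanged as \<open>s < N - d\<close>.\<close>

lemma det_peel_B:
  assumes "1 \<le> s" "s \<le> N - d" "d + k \<le> N" "f + k \<le> N" "d < N"
  shows "quantum_det k (\<lambda>r c. W s (d + r) (f + c)) = quantum_det k (\<lambda>r c. W (N - d) (d + r) (f + c))"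
  using assms(2)
proof (induction s rule: inc_induct)
  case (step s)
  have "quantum_det k (\<lambda>r c. W s (d + r) (f + c)) = quantum_det k (\<lambda>r c. W (Suc s) (d + r) (f + c))"
  proof (rule quantum_det_peel[OF two, where Q = "\<lambda>r c. if 2 \<le> d + r \<and> N - s \<le> d + r - 1 then e (gb (d + r - 1) s) * W (Suc s) (d + r - 1) (f + c) else 0"])
    show "W s (d + r) (f + c) = W (Suc s) (d + r) (f + c) + (if 2 \<le> d + r \<and> N - s \<le> d + r - 1 then e (gb (d + r - 1) s) * W (Suc s) (d + r - 1) (f + c) else 0)"
      if "1 \<le> r" "r \<le> k" for r c by (rule W_rec) (use that step assms in auto)
    show "(if 2 \<le> d + 1 \<and> N - s \<le> d + 1 - 1 then e (gb (d + 1 - 1) s) * W (Suc s) (d + 1 - 1) (f + c) else 0) = 0" for c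
      using step.hyps assms by auto
    fix r c c' assume a: "1 \<le> r" "r < k" "1 \<le> c" "c \<le> k" "1 \<le> c'" "c' \<le> k"
    have "W (Suc s) (d + r) (f + c) * (e (gb (d + r) s) * W (Suc s) (d + r) (f + c')) = W (Suc s) (d + r) (f + c') * (e (gb (d + r) s) * W (Suc s) (d + r) (f + c))" if "N - s \<le> d + r"
      by (rule sym_pair[of "-1"]; (intro W_left W_row_comm)?) (use a that step.hyps assms in auto)
    then show "W (Suc s) (d + r) (f + c) * (if 2 \<le> d + Suc r \<and> N - s \<le> d + Suc r - 1 then e (gb (d + Suc r - 1) s) * W (Suc s) (d + Suc r - 1) (f + c') else 0)
      = W (Suc s) (d + r) (f + c') * (if 2 \<le> d + Suc r \<and> N - s \<le> d + Suc r - 1 then e (gb (d + Suc r - 1) s) * W (Suc s) (d + Suc r - 1) (f + c) else 0)"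
      by simp
  qed
  then show ?case using step.IH by simp
qed simp

fun D :: "nat \<Rightarrow> nat \<Rightarrow> 'f" where
  "D 0 i = U i * V i"
| "D (Suc n) i = e (Gb (i - 1) (i - Suc n)) * D n (i - 1)"

text \<open>Each of the remaining \<open>n\<close> factors \<open>B\<close> lowers the row index by at most one, so the entry at distance \<open>n\<close> from the diagonal arises in one way only.\<close>

lemma W_lower:
  assumes "n < i" "i \<le> N"
  shows "W (N - n) i (i - n) = D n i \<and> (\<forall>c\<ge>1. c < i - n \<longrightarrow> W (N - n) i c = 0)"
  using assms
proof (induction n arbitrary: i)
  case 0
  then show ?case by (auto simp: W_N XA_upper)
next
  case (Suc n)
  have s: "Suc (N - Suc n) = N - n" "N - Suc n < N" using Suc.prems by auto
  have rec: "W (N - Suc n) i c = W (N - n) i c + e (Gb (i - 1) (i - Suc n)) * W (N - n) (i - 1) c" for c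
  proof -
    have "i - 1 + (N - Suc n) - (N - 1) = i - Suc n" using Suc.prems by auto
    then show ?thesis using W_rec[of "N - Suc n" i c] Suc.prems s by auto
  qed
  have 1: "W (N - n) i c = 0" if "1 \<le> c" "c < i - n" for c using Suc.IH[of i] Suc.prems that by auto
  have 2: "W (N - n) (i - 1) (i - 1 - n) = D n (i - 1)" "\<forall>c\<ge>1. c < i - 1 - n \<longrightarrow> W (N - n) (i - 1) c = 0"
    using Suc.IH[of "i - 1"] Suc.prems by auto
  have "i - Suc n = i - 1 - n" by simp
  then show ?case unfolding rec using 1 2 Suc.prems by auto
qed

theorem det_lower:
  assumes "1 \<le> k" "d + k \<le> N"
  shows "quantum_det k (\<lambda>r c. W 1 (d + r) c) = prod_list (map (\<lambda>r. D d (d + r)) [1..<k + 1])"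
proof -
  have "quantum_det k (\<lambda>r c. W 1 (d + r) (0 + c)) = quantum_det k (\<lambda>r c. W (N - d) (d + r) (0 + c))"
    by (rule det_peel_B) (use assms in auto)
  also have "\<dots> = prod_list (map (\<lambda>r. W (N - d) (d + r) (0 + r)) [1..<k + 1])"
    by (rule quantum_det_triangular) (use W_lower[of d] assms in auto)
  also have "map (\<lambda>r. W (N - d) (d + r) (0 + r)) [1..<k + 1] = map (\<lambda>r. D d (d + r)) [1..<k + 1]"
    by (rule map_cong[OF refl]) (use W_lower[of d "d + _"] assms in auto)
  finally show ?thesis by simp
qed

fun Pf :: "nat \<Rightarrow> nat \<Rightarrow> 'f" where
  "Pf 0 r = U r * V r"
| "Pf (Suc t) r = Pf t r * e (Ga (r + t) (Suc t))"

lemma Pf_commute: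
  assumes "1 \<le> r" "r + t \<le> m" "t + 2 \<le> s" "s \<le> m" "m \<le> N - 1" "t' \<le> t"
  shows "qx 0 (e (Ga m s)) (Pf t' r)"
  using assms(6)
proof (induction t')
  case 0
  show ?case unfolding Pf.simps
  proof (rule qx_mult_right[of 0 _ _ 0])
    show "qx 0 (e (Ga m s)) (U r)" by (rule qx_U) (use assms in \<open>auto simp: gens_iff om_gl_def\<close>)
    show "qx 0 (e (Ga m s)) (V r)" by (rule qx_V) (use assms in \<open>auto simp: gens_iff om_gl_def\<close>)
  qed simp
next
  case (Suc t')
  show ?case unfolding Pf.simps
  proof (rule qx_mult_right[of 0 _ _ 0])
    show "qx 0 (e (Ga m s)) (Pf t' r)" using Suc by simp
    show "qx 0 (e (Ga m s)) (e (Ga (r + t') (Suc t')))" by (rule qx_gen) (use assms Suc.prems in \<open>auto simp: gens_iff om_gl_def\<close>)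
  qed simp
qed

lemma XA_row:
  assumes "i \<in> {1..N}" "c \<in> {1..N}"
  shows "XA t i c = foldl (vm N) (\<lambda>k. of_bool (k = i)) (map EA [t..<N]) c"
  unfolding XA_def using assms by (intro mat_prod_row) auto

lemma XA_row_comm:
  assumes "i \<in> {1..N}" "c \<in> {1..N}" "c' \<in> {1..N}" "1 \<le> t" "t \<le> N"
  shows "qx 0 (XA t i c) (XA t i c')"
proof -
  have "qx k x (of_bool (c = i))" if "c = i \<Longrightarrow> k = 0" for k x c using that by (cases "c = i") (simp_all add: qx_one qx_zero)
  then have "Arow_ok i t (\<lambda>k. of_bool (k = i))" unfolding Arow_ok_def by simp
  from Arow_foldl[OF this assms(4,5)] show ?thesis using assms unfolding Arow_ok_def by (simp add: XA_row)
qed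

lemma Pf_XA:
  assumes "1 \<le> r" "r + t \<in> {1..N}" "c \<in> {1..N}" "t + 2 \<le> N"
  shows "qx 0 (Pf t r) (XA (t + 2) (r + t) c)"
proof -
  have "\<forall>c\<in>{1..N}. qx 0 (Pf t r) (foldl (vm N) (\<lambda>k. of_bool (k = r + t)) (map EA [t + 2..<N]) c) \<and> (c < r + t \<longrightarrow> foldl (vm N) (\<lambda>k. of_bool (k = r + t)) (map EA [t + 2..<N]) c = 0)"
  proof (rule A_foldl_uniform)
    show "qx 0 (Pf t r) (of_bool (c = r + t))" for c by (cases "c = r + t") (simp_all add: qx_one qx_zero)
    show "qx 0 (Pf t r) (e (Ga m s))" if "t + 2 \<le> s" "s \<le> m" "m \<le> N - 1" "r + t \<le> m" for m s
      by (rule qx_sym[OF Pf_commute[of r t]]) (use that assms in auto)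
  qed (use assms in auto)
  then show ?thesis using assms by (simp add: XA_row)
qed

text \<open>Here the roles are reversed: the entry of \<open>A\<^sub>t\<close> off the diagonal survives, as the diagonal one repeats the row above or, in the first row, is a unit vector outside of the minor.\<close>

lemma det_peel_A:
  assumes "t \<le> d" "d + k \<le> N" "1 \<le> k"
  shows "quantum_det k (\<lambda>r c. Pf 0 r * XA 1 (r + 0) (d + c)) = quantum_det k (\<lambda>r c. Pf t r * XA (Suc t) (r + t) (d + c))"
  using assms(1)
proof (induction t)
  case (Suc t)
  have "quantum_det k (\<lambda>r c. Pf t r * XA (Suc t) (r + t) (d + c)) = quantum_det k (\<lambda>r c. Pf (Suc t) r * XA (Suc (Suc t)) (r + Suc t) (d + c))"
  proof (rule quantum_det_peel[OF two, where Q = "\<lambda>r c. Pf t r * XA (Suc (Suc t)) (r + t) (d + c)"])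
    fix r c assume a: "1 \<le> r" "r \<le> k" "1 \<le> c" "c \<le> k"
    have "XA (Suc t) (r + t) (d + c) = XA (Suc (Suc t)) (r + t) (d + c) + e (Ga (r + t) (Suc t)) * XA (Suc (Suc t)) (r + t + 1) (d + c)"
      using XA_rec[of "Suc t" "r + t" "d + c"] a assms Suc.prems by simp
    then show "Pf t r * XA (Suc t) (r + t) (d + c) = Pf (Suc t) r * XA (Suc (Suc t)) (r + Suc t) (d + c) + Pf t r * XA (Suc (Suc t)) (r + t) (d + c)"
      by (simp add: distrib_left mult.assoc add.commute)
  next
    fix c assume "1 \<le> c" "c \<le> k"
    then show "Pf t 1 * XA (Suc (Suc t)) (1 + t) (d + c) = 0" using XA_unit[of "Suc (Suc t)" "1 + t" "d + c"] Suc.prems assms by simp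
  next
    fix r c c' assume a: "1 \<le> r" "r < k" "1 \<le> c" "c \<le> k" "1 \<le> c'" "c' \<le> k"
    let ?X = "XA (t + 2) (Suc r + t)"
    have "?X (d + c) * (Pf t (Suc r) * ?X (d + c')) = ?X (d + c') * (Pf t (Suc r) * ?X (d + c))"
      by (rule sym_pair[of 0]; (intro Pf_XA XA_row_comm)?) (use a assms Suc.prems in auto)
    then show "Pf (Suc t) r * XA (Suc (Suc t)) (r + Suc t) (d + c) * (Pf t (Suc r) * XA (Suc (Suc t)) (Suc r + t) (d + c'))
      = Pf (Suc t) r * XA (Suc (Suc t)) (r + Suc t) (d + c') * (Pf t (Suc r) * XA (Suc (Suc t)) (Suc r + t) (d + c))"
      by (simp add: mult.assoc)
  qed
  then show ?case using Suc by simp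
qed simp

theorem det_upper:
  assumes "1 \<le> k" "d + k \<le> N"
  shows "quantum_det k (\<lambda>r c. W 1 r (d + c)) = prod_list (map (Pf d) [1..<k + 1])"
proof -
  have "quantum_det k (\<lambda>r c. W 1 (0 + r) (d + c)) = quantum_det k (\<lambda>r c. W (N - 0) (0 + r) (d + c))"
    by (rule det_peel_B) (use assms in auto)
  also have "\<dots> = quantum_det k (\<lambda>r c. Pf 0 r * XA 1 (r + 0) (d + c))"
    by (rule quantum_det_cong) (use assms in \<open>auto simp: W_N\<close>)
  also have "\<dots> = quantum_det k (\<lambda>r c. Pf d r * XA (Suc d) (r + d) (d + c))" by (rule det_peel_A) (use assms in auto)
  also have "\<dots> = prod_list (map (\<lambda>r. Pf d r * XA (Suc d) (r + d) (d + r)) [1..<k + 1])"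
    by (rule quantum_det_triangular) (use assms in \<open>auto simp: XA_upper\<close>)
  also have "map (\<lambda>r. Pf d r * XA (Suc d) (r + d) (d + r)) [1..<k + 1] = map (Pf d) [1..<k + 1]"
    by (rule map_cong[OF refl]) (use assms in \<open>auto simp: XA_upper add.commute\<close>)
  finally show ?thesis by simp
qed

end

section \<open>The homomorphism to the torus algebra\<close>

fun om_t :: "'n torus_gen \<Rightarrow> 'n torus_gen \<Rightarrow> int" where
  "om_t (Tu i) (Tv j) = of_bool (i = j)"
| "om_t (Tv i) (Tu j) = - of_bool (i = j)"
| "om_t _ _ = 0"

lemma om_t_skew: "om_t x y = - om_t y x"
  by (cases x; cases y) auto

lemma om_gl_skew: "om_gl x y = - om_gl y x" by (simp add: om_gl_def)

lemma gen_mult: "gen x * gen y = Poly_Mapping.single (Word [x, y]) 1"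
  by (simp add: gen_def single_mult_single)

text \<open>A Weyl ordered monomial of the tori: its exponents are the symplectic coordinates of \<open>g\<close>.\<close>

definition tw :: "('n \<Rightarrow> plane) \<Rightarrow> 'n list \<Rightarrow> gl_gen \<Rightarrow> 'n torus_gen list" where
  "tw \<iota> us g = concat (map (\<lambda>i. replicate (pc g (\<iota> i)) (Tu i) @ replicate (qc g (\<iota> i)) (Tv i)) us)"

lemma tw_sum_list:
  fixes F :: "'n torus_gen \<Rightarrow> 'a::real_vector"
  shows "(\<Sum>x\<leftarrow>tw \<iota> us g. F x) = (\<Sum>i\<leftarrow>us. real (pc g (\<iota> i)) *\<^sub>R F (Tu i) + real (qc g (\<iota> i)) *\<^sub>R F (Tv i))"
proof -
  have r: "sum_list (replicate n x) = real n *\<^sub>R x" for n and x :: 'a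
    by (induction n) (simp_all add: scaleR_add_left)
  show ?thesis by (induction us) (simp_all add: tw_def map_replicate r[unfolded map_replicate])
qed

lemma tw_sum:
  fixes F :: "'n::finite torus_gen \<Rightarrow> 'a::real_vector"
  assumes "distinct us" "set us = UNIV"
  shows "(\<Sum>x\<leftarrow>tw \<iota> us g. F x) = (\<Sum>i\<in>UNIV. real (pc g (\<iota> i)) *\<^sub>R F (Tu i) + real (qc g (\<iota> i)) *\<^sub>R F (Tv i))"
  unfolding tw_sum_list using assms by (subst sum_list_distinct_conv_sum_set) simp_all

lemma tw_sum_int:
  fixes F :: "'n::finite torus_gen \<Rightarrow> int"
  assumes "distinct us" "set us = UNIV"
  shows "(\<Sum>x\<leftarrow>tw \<iota> us g. F x) = (\<Sum>i\<in>UNIV. int (pc g (\<iota> i)) * F (Tu i) + int (qc g (\<iota> i)) * F (Tv i))"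
proof -
  have s: "real_of_int (sum_list xs) = (\<Sum>x\<leftarrow>xs. real_of_int x)" for xs by (induction xs) simp_all
  have "real_of_int (\<Sum>x\<leftarrow>tw \<iota> us g. F x) = (\<Sum>x\<leftarrow>tw \<iota> us g. real_of_int (F x))" by (simp add: s o_def)
  also have "\<dots> = real_of_int (\<Sum>i\<in>UNIV. int (pc g (\<iota> i)) * F (Tu i) + int (qc g (\<iota> i)) * F (Tv i))"
    by (subst tw_sum[OF assms]) simp
  finally show ?thesis by (simp only: of_int_eq_iff)
qed

lemma of_bool_sum: "(\<Sum>k\<in>(UNIV :: 'n::finite set). int (f k) * of_bool (i = k)) = int (f i)"
  by (subst sum.mono_neutral_right[of UNIV "{i}"]) auto

locale torus_embedding =
  fixes \<iota> :: "'n::finite \<Rightarrow> plane" and us :: "'n list" and N :: nat and q :: complex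
  assumes us: "distinct us" "set us = UNIV" and bij: "bij_betw \<iota> UNIV (planes N)" and q0: "q \<noteq> 0" and N2: "2 \<le> N"
begin

abbreviation "t \<equiv> tw \<iota> us"

text \<open>The two forms agree since the exponents of the monomials are the symplectic coordinates.\<close>

lemma cross_tw:
  assumes "g \<in> gl_gens N" "h \<in> gl_gens N"
  shows "cross om_t (t g) (t h) = om_gl g h"
proof -
  have u: "(\<Sum>y\<leftarrow>t h. om_t (Tu i) y) = int (qc h (\<iota> i))" for i
    by (simp add: tw_sum_int[OF us] of_bool_sum)
  have v: "(\<Sum>y\<leftarrow>t h. om_t (Tv i) y) = - int (pc h (\<iota> i))" for i
    by (simp add: tw_sum_int[OF us] of_bool_sum sum_negf)
  have "cross om_t (t g) (t h) = (\<Sum>i\<in>UNIV. int (pc g (\<iota> i)) * int (qc h (\<iota> i)) + int (qc g (\<iota> i)) * - int (pc h (\<iota> i)))"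
    unfolding cross_def tw_sum_int[OF us, of "\<lambda>x. \<Sum>y\<leftarrow>t h. om_t x y"] u v ..
  also have "\<dots> = (\<Sum>i\<in>planes N. int (pc g i) * int (qc h i) + int (qc g i) * - int (pc h i))"
    by (rule sum.reindex_bij_betw[OF bij])
  also have "\<dots> = om_gl g h" using symplectic_coordinates[OF assms] by simp
  finally show ?thesis .
qed

definition \<phi> :: "gl_gen \<Rightarrow> 'n torus_gen free_algebra" where
  "\<phi> g = Poly_Mapping.single (Word (t g)) (q powi (- ph om_t (t g)))"

definition Phi :: "gl_gen multiset \<Rightarrow> 'n torus_gen multiset" where
  "Phi M = (\<Sum>g\<in>#M. mset (t g))"

lemma prod_phi:
  assumes "set w \<subseteq> gl_gens N"
  shows "prod_list (map \<phi> w) = Poly_Mapping.single (Word (concat (map t w))) (q powi (ph om_gl w - ph om_t (concat (map t w))))"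
  using assms
proof (induction w)
  case Nil show ?case by (simp add: zero_word_def[symmetric])
next
  case (Cons g w)
  have c: "cross om_t (t g) (concat (map t w)) = (\<Sum>h\<leftarrow>w. om_gl g h)"
    using Cons.prems by (induction w) (simp_all add: cross_simps cross_tw)
  have "ph om_gl (g # w) - ph om_t (concat (map t (g # w))) = - ph om_t (t g) + (ph om_gl w - ph om_t (concat (map t w)))"
    by (simp add: ph_append c)
  then have "q powi (ph om_gl (g # w) - ph om_t (concat (map t (g # w)))) = q powi (- ph om_t (t g)) * q powi (ph om_gl w - ph om_t (concat (map t w)))"
    using q0 by (simp only: power_int_add simp_thms)
  then show ?case using Cons by (simp add: \<phi>_def single_mult_single)
qed

lemma mset_concat_tw: "mset (concat (map t w)) = Phi (mset w)"
  by (induction w) (simp_all add: Phi_def)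

lemma nf_sum: "nf q om (\<Sum>i\<in>A. f i) M = (\<Sum>i\<in>A. nf q om (f i) M)"
  by (induction A rule: infinite_finite_induct) (simp_all add: nf_zero nf_add)

text \<open>The phase of the product of the monomials differs from the sum of the phases by the form, so \<open>\<phi>\<close> sends normal ordered monomials to normal ordered monomials.\<close>

lemma nf_lift_phi:
  assumes "\<And>w. w \<in> Poly_Mapping.keys x \<Longrightarrow> set (letters w) \<subseteq> gl_gens N"
  shows "nf q om_t (lift \<phi> x) E = (\<Sum>w\<in>Poly_Mapping.keys x. if Phi (mset (letters w)) = E then Poly_Mapping.lookup x w * q powi ph om_gl (letters w) else 0)"
  unfolding lift_def nf_sum
proof (intro sum.cong refl)
  fix w assume w: "w \<in> Poly_Mapping.keys x"
  show "nf q om_t (const (Poly_Mapping.lookup x w) * prod_list (map \<phi> (letters w))) E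
      = (if Phi (mset (letters w)) = E then Poly_Mapping.lookup x w * q powi ph om_gl (letters w) else 0)"
    using q0 by (simp add: prod_phi[OF assms[OF w]] const_mult_single nf_single mset_concat_tw power_int_add[symmetric])
qed

lemma nf_exchange:
  assumes "\<And>x y. om x y = - om y x"
  shows "nf q om (Poly_Mapping.single v c * (gen x * gen y - const (q powi (2 * om x y)) * (gen y * gen x)) * Poly_Mapping.single w d) M = 0"
proof (cases v, cases w)
  fix v' w' assume [simp]: "v = Word v'" "w = Word w'"
  have p: "ph om (v' @ [x, y] @ w') = ph om (v' @ [y, x] @ w') + 2 * om x y"
    using assms[of y x] by (simp add: ph_append cross_simps)
  have q: "q powi (ph om (v' @ [x, y] @ w')) = q powi (2 * om x y) * q powi (ph om (v' @ [y, x] @ w'))"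
    unfolding p using q0 by (simp add: power_int_add)
  have "Poly_Mapping.single v c * (gen x * gen y - const (q powi (2 * om x y)) * (gen y * gen x)) * Poly_Mapping.single w d
     = Poly_Mapping.single (Word (v' @ [x, y] @ w')) (c * d) - Poly_Mapping.single (Word (v' @ [y, x] @ w')) (q powi (2 * om x y) * (c * d))"
    by (simp add: gen_mult right_diff_distrib left_diff_distrib const_mult_single single_mult_single mult_ac)
  then show ?thesis using q by (simp add: nf_diff nf_single add_mset_commute mult_ac)
qed

lemma torus_rels_exchange:
  fixes l r :: "'n torus_gen free_algebra"
  assumes "(l, r) \<in> torus_rels q"
  shows "\<exists>x y. l = gen x * gen y \<and> r = const (q powi (2 * om_t x y)) * (gen y * gen x)"
  using assms unfolding torus_rels_def
proof (elim UnE CollectE exE conjE)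
  fix i :: 'n assume e: "(l, r) = (gen (Tu i) * gen (Tv i), const (q\<^sup>2) * gen (Tv i) * gen (Tu i))"
  then show ?thesis by (intro exI[of _ "Tu i"] exI[of _ "Tv i"]) (simp add: mult.assoc)
next
  fix x y and i j :: 'n assume e: "(l, r) = (gen x * gen y, gen y * gen x)" "i \<noteq> j" "x \<in> {Tu i, Tv i}" "y \<in> {Tu j, Tv j}"
  then have "om_t x y = 0" by auto
  then show ?thesis using e by (intro exI[of _ x] exI[of _ y]) (simp add: const_one)
qed

lemma torus_nf:
  fixes x y :: "'n torus_gen free_algebra"
  assumes "alg_eq (torus_rels q) x y"
  shows "nf q om_t x M = nf q om_t y M"
proof -
  have "nf q om_t (1 * (x - y) * 1) M = 0"
  proof (rule nf_ideal[of "{l - r | l r. (l, r) \<in> torus_rels q}"])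
    show "x - y \<in> two_sided_ideal {l - r | l r. (l, r) \<in> torus_rels q}" using assms by (simp add: alg_eq_def)
    fix s :: "'n torus_gen free_algebra" and v w :: "'n torus_gen word" and c d M
    assume "s \<in> {l - r | l r. (l, r) \<in> torus_rels q}"
    then obtain l r where "s = l - r" "(l, r) \<in> torus_rels q" by blast
    with torus_rels_exchange obtain a b where s: "s = gen a * gen b - const (q powi (2 * om_t a b)) * (gen b * gen a)" by metis
    show "nf q om_t (Poly_Mapping.single v c * s * Poly_Mapping.single w d) M = 0"
      unfolding s by (rule nf_exchange) (rule om_t_skew)
  qed
  then show ?thesis by (simp add: nf_diff)
qed

lemma exchange_sym:
  assumes "alg_eq R (gen x * gen y) (const (q powi k) * (gen y * gen x))"
  shows "alg_eq R (gen y * gen x) (const (q powi (- k)) * (gen x * gen y))"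
proof -
  have "alg_eq R (const (q powi (- k)) * (gen x * gen y)) (const (q powi (- k)) * (const (q powi k) * (gen y * gen x)))"
    by (rule alg_eq_scale[OF assms])
  also have "const (q powi (- k)) * (const (q powi k) * (gen y * gen x)) = gen y * gen x"
    using q0 by (simp add: mult.assoc[symmetric] const_mult[symmetric] power_int_add[symmetric] const_one)
  finally show ?thesis by (rule alg_eq_sym)
qed

lemma quasi_torus: "quasi_commuting q (om_t :: 'n torus_gen \<Rightarrow> _) UNIV (torus_rels q)"
proof
  show "q \<noteq> 0" by (rule q0)
  show "om_t x y = - om_t y x" for x y :: "'n torus_gen" by (rule om_t_skew)
  fix x y :: "'n torus_gen"
  show "alg_eq (torus_rels q) (gen x * gen y) (const (q powi (2 * om_t x y)) * (gen y * gen x))"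
  proof -
    obtain i where i: "x \<in> {Tu i, Tv i}" by (cases x) auto
    obtain j where j: "y \<in> {Tu j, Tv j}" by (cases y) auto
    have "(x = Tu i \<and> y = Tv i) \<or> (x = Tv i \<and> y = Tu i) \<or> x = y \<or> i \<noteq> j" using i j by auto
    then consider (uv) "x = Tu i" "y = Tv i" | (vu) "x = Tv i" "y = Tu i" | (eq) "x = y" | (ne) "i \<noteq> j" by blast
    then show ?thesis
    proof cases
      case uv
      then have "(gen x * gen y, const (q\<^sup>2) * gen y * gen x) \<in> torus_rels q" by (auto simp: torus_rels_def)
      then show ?thesis using uv by (simp add: alg_eq_rel mult.assoc)
    next
      case vu
      then have "(gen y * gen x, const (q\<^sup>2) * gen x * gen y) \<in> torus_rels q" by (auto simp: torus_rels_def)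
      then have "alg_eq (torus_rels q) (gen y * gen x) (const (q powi 2) * (gen x * gen y))" by (simp add: alg_eq_rel mult.assoc)
      then show ?thesis using vu exchange_sym by fastforce
    next
      case eq
      then show ?thesis using om_t_skew[of x x] by (simp add: const_one alg_eq_refl)
    next
      case ne
      then have "(gen x * gen y, gen y * gen x) \<in> torus_rels q" using i j unfolding torus_rels_def by blast
      moreover have "om_t x y = 0" using ne i j by auto
      ultimately show ?thesis by (simp add: const_one alg_eq_rel)
    qed
  qed
qed

lemma q2_rel_excl: "\<not> (q2_rel x y \<and> q2_rel y x)"
  by (cases x; cases y) auto

lemma quasi_gl:
  assumes "gl_rels q N \<subseteq> R"
  shows "quasi_commuting q om_gl (gl_gens N) R"
proof
  show "q \<noteq> 0" by (rule q0)
  show "om_gl x y = - om_gl y x" for x y by (rule om_gl_skew)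
  fix x y assume xy: "x \<in> gl_gens N" "y \<in> gl_gens N"
  consider "q2_rel x y" "\<not> q2_rel y x" | "q2_rel y x" "\<not> q2_rel x y" | "\<not> q2_rel x y" "\<not> q2_rel y x" using q2_rel_excl by blast
  then show "alg_eq R (gen x * gen y) (const (q powi (2 * om_gl x y)) * (gen y * gen x))"
  proof cases
    case 1
    then have "(gen x * gen y, const (q\<^sup>2) * gen y * gen x) \<in> R" using assms xy by (auto simp: gl_rels_def)
    then show ?thesis using 1 by (simp add: alg_eq_rel mult.assoc om_gl_def)
  next
    case 2
    then have "(gen y * gen x, const (q\<^sup>2) * gen x * gen y) \<in> R" using assms xy by (auto simp: gl_rels_def)
    then have "alg_eq R (gen y * gen x) (const (q powi 2) * (gen x * gen y))" by (simp add: alg_eq_rel mult.assoc)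
    then show ?thesis using 2 exchange_sym by (fastforce simp: om_gl_def)
  next
    case 3
    then have "(gen x * gen y, gen y * gen x) \<in> R" using assms xy unfolding gl_rels_def by blast
    then show ?thesis using 3 by (simp add: alg_eq_rel om_gl_def const_one)
  qed
qed

lemma lift_monom: "set w \<subseteq> gl_gens N \<Longrightarrow> lift \<phi> (monom w) = Poly_Mapping.single (Word (concat (map t w))) (q powi (ph om_gl w - ph om_t (concat (map t w))))"
  by (simp add: monom_def lift_single prod_phi const_one)

lemma lift_monom_eq:
  assumes "set v \<subseteq> gl_gens N" "set w \<subseteq> gl_gens N" "Phi (mset v) = Phi (mset w)"
  shows "alg_eq (torus_rels q) (lift \<phi> (monom v)) (const (q powi (ph om_gl v - ph om_gl w)) * lift \<phi> (monom w))"
proof -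
  have "alg_eq (torus_rels q) (lift \<phi> (monom v) - const (q powi (ph om_gl v - ph om_gl w)) * lift \<phi> (monom w)) 0"
    by (rule quasi_commuting.nf_zero_imp[OF quasi_torus])
      (use q0 in \<open>simp_all add: nf_diff lift_monom assms const_mult_single nf_single mset_concat_tw power_int_add[symmetric]\<close>)
  then show ?thesis by (simp add: alg_eq_diff_zero[symmetric])
qed

lemma gl_rels_lift:
  assumes "(l, r) \<in> gl_rels q N"
  shows "alg_eq (torus_rels q) (lift \<phi> l) (lift \<phi> r)"
proof -
  have m: "gen x * gen y = monom [x, y]" for x y :: gl_gen by (simp add: monom_def gen_mult)
  have "\<exists>x y. x \<in> gl_gens N \<and> y \<in> gl_gens N \<and> l = gen x * gen y \<and> r = const (q powi (2 * om_gl x y)) * (gen y * gen x)"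
    using assms unfolding gl_rels_def
  proof (elim UnE CollectE exE conjE)
    fix x y assume "(l, r) = (gen x * gen y, const (q\<^sup>2) * gen y * gen x)" "x \<in> gl_gens N" "y \<in> gl_gens N" "q2_rel x y"
    moreover then have "\<not> q2_rel y x" using q2_rel_excl by blast
    ultimately show ?thesis by (intro exI[of _ x] exI[of _ y]) (simp add: om_gl_def mult.assoc)
  next
    fix x y assume "(l, r) = (gen x * gen y, gen y * gen x)" "x \<in> gl_gens N" "y \<in> gl_gens N" "\<not> q2_rel x y" "\<not> q2_rel y x"
    then show ?thesis by (intro exI[of _ x] exI[of _ y]) (simp add: om_gl_def const_one)
  qed
  then obtain x y where xy: "x \<in> gl_gens N" "y \<in> gl_gens N" "l = gen x * gen y" "r = const (q powi (2 * om_gl x y)) * (gen y * gen x)" by blast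
  have "alg_eq (torus_rels q) (lift \<phi> (monom [x, y])) (const (q powi (ph om_gl [x, y] - ph om_gl [y, x])) * lift \<phi> (monom [y, x]))"
    by (rule lift_monom_eq) (use xy in \<open>simp_all add: add_mset_commute\<close>)
  moreover have "ph om_gl [x, y] - ph om_gl [y, x] = 2 * om_gl x y" using om_gl_skew[of y x] by simp
  ultimately show ?thesis by (simp only: xy m lift_mult[of \<phi> "const _"] lift_const)
qed

lemma sum_mset_gens:
  fixes f :: "gl_gen \<Rightarrow> int"
  assumes "set_mset M \<subseteq> gl_gens N"
  shows "(\<Sum>g\<in>#M. f g) = (\<Sum>g\<in>gl_gens N. int (count M g) * f g)"
  using assms
proof (induction M)
  case (add x M)
  have "(\<Sum>g\<in>gl_gens N. int (count (add_mset x M) g) * f g) = (\<Sum>g\<in>gl_gens N. int (count M g) * f g) + (\<Sum>g\<in>gl_gens N. f g * of_bool (g = x))"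
    unfolding sum.distrib[symmetric] by (intro sum.cong) (auto simp: distrib_right)
  also have "(\<Sum>g\<in>gl_gens N. f g * of_bool (g = x)) = f x"
    using add.prems by (subst sum.mono_neutral_right[of _ "{x}"]) (auto simp: finite_gl_gens)
  finally show ?case using add by simp
qed simp

lemma Phi_coords:
  assumes M: "set_mset M \<subseteq> gl_gens N" and i: "i \<in> planes N"
  shows "(\<Sum>g\<in>gl_gens N. int (count M g) * int (pc g i)) = int (count (Phi M) (Tu (inv_into UNIV \<iota> i)))"
    "(\<Sum>g\<in>gl_gens N. int (count M g) * int (qc g i)) = int (count (Phi M) (Tv (inv_into UNIV \<iota> i)))"
proof -
  let ?k = "inv_into UNIV \<iota> i"
  have ik: "\<iota> ?k = i" using bij i by (metis bij_betw_imp_surj_on f_inv_into_f)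
  have c: "int (count (mset xs) x) = (\<Sum>y\<leftarrow>xs. of_bool (y = x))" for xs and x :: "'n torus_gen" by (induction xs) auto
  have u: "int (count (mset (t g)) (Tu ?k)) = int (pc g i)" and v: "int (count (mset (t g)) (Tv ?k)) = int (qc g i)" for g
    using of_bool_sum[of "\<lambda>i. pc g (\<iota> i)" ?k] of_bool_sum[of "\<lambda>i. qc g (\<iota> i)" ?k]
    by (simp_all only: c tw_sum_int[OF us]) (simp_all add: ik eq_commute[of _ ?k])
  have "int (count (Phi M) x) = (\<Sum>g\<in>#M. int (count (mset (t g)) x))" for x by (induction M) (simp_all add: Phi_def)
  then show "(\<Sum>g\<in>gl_gens N. int (count M g) * int (pc g i)) = int (count (Phi M) (Tu ?k))"
    "(\<Sum>g\<in>gl_gens N. int (count M g) * int (qc g i)) = int (count (Phi M) (Tv ?k))"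
    by (simp_all only: u v sum_mset_gens[OF M])
qed

lemma Phi_eq_radical:
  assumes "set_mset M \<subseteq> gl_gens N" "set_mset M' \<subseteq> gl_gens N" "Phi M = Phi M'"
  shows "in_radical N (\<lambda>g. int (count M g) - int (count M' g))"
  by (rule in_radicalI) (simp_all add: left_diff_distrib sum_subtractf Phi_coords assms)

lemma Phi_eqI:
  assumes M: "set_mset M \<subseteq> gl_gens N" "set_mset M' \<subseteq> gl_gens N"
    and "\<And>i. i \<in> planes N \<Longrightarrow> (\<Sum>g\<in>gl_gens N. (int (count M g) - int (count M' g)) * int (pc g i)) = 0"
    and "\<And>i. i \<in> planes N \<Longrightarrow> (\<Sum>g\<in>gl_gens N. (int (count M g) - int (count M' g)) * int (qc g i)) = 0"
  shows "Phi M = Phi M'"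
proof (rule multiset_eqI)
  fix x :: "'n torus_gen"
  obtain k where k: "x = Tu k \<or> x = Tv k" by (cases x) auto
  have i: "\<iota> k \<in> planes N" using bij by (auto simp: bij_betw_def)
  have "inv_into UNIV \<iota> (\<iota> k) = k" using bij by (simp add: bij_betw_def)
  then show "count (Phi M) x = count (Phi M') x"
    using k assms(3,4)[OF i] Phi_coords[OF M(1) i] Phi_coords[OF M(2) i] by (auto simp: left_diff_distrib sum_subtractf)
qed

subsection \<open>Words in the Gauss variables\<close>

definition Uw :: "nat \<Rightarrow> gl_gen list" where
  "Uw k = (if k = N then [] else [Gu k]) @ (if k = 1 then [] else [Gv (k - 1)])"

definition gauss_words :: "gl_gen list set" where
  "gauss_words = {[Gb m n] | m n. 1 \<le> n \<and> n \<le> m \<and> m \<le> N - 1} \<union> {Uw k | k. 1 \<le> k \<and> k \<le> N} \<union> {[Ga m n] | m n. 1 \<le> n \<and> n \<le> m \<and> m \<le> N - 1}"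

lemma U_var_monom: "1 \<le> k \<Longrightarrow> U_var N k = monom (Uw k)"
  unfolding U_var_def u_var_def v_var_def Uw_def monom_append
  by (simp add: monom_Nil monom_single)

lemma gauss_vars_monom: "gauss_vars N = monom ` gauss_words"
proof -
  have "{U_var N k | k. 1 \<le> k \<and> k \<le> N} = monom ` {Uw k | k. 1 \<le> k \<and> k \<le> N}" 
    unfolding setcompr_eq_image image_image by (rule image_cong) (simp_all add: U_var_monom)
  moreover have "{gen (Gb m n) | m n. 1 \<le> n \<and> n \<le> m \<and> m \<le> N - 1} = monom ` {[Gb m n] | m n. 1 \<le> n \<and> n \<le> m \<and> m \<le> N - 1}"
    "{gen (Ga m n) | m n. 1 \<le> n \<and> n \<le> m \<and> m \<le> N - 1} = monom ` {[Ga m n] | m n. 1 \<le> n \<and> n \<le> m \<and> m \<le> N - 1}"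
    by (auto simp: monom_single[symmetric])
  ultimately show ?thesis unfolding gauss_vars_def gauss_words_def image_Un by simp
qed

fun word_of :: "gl_gen \<Rightarrow> gl_gen list" where
  "word_of (Ga m n) = [Ga m n]"
| "word_of (Gb m n) = [Gb m n]"
| "word_of (Gu k) = Uw k"
| "word_of (Gv k) = Uw (k + 1)"

lemma Uw_inj: "1 \<le> k \<Longrightarrow> k \<le> N \<Longrightarrow> 1 \<le> l \<Longrightarrow> l \<le> N \<Longrightarrow> Uw k = Uw l \<Longrightarrow> k = l"
  using N2 by (auto simp: Uw_def split: if_splits)

lemma Uw_neq: "1 \<le> k \<Longrightarrow> k \<le> N \<Longrightarrow> Uw k \<noteq> [Ga m n]" "1 \<le> k \<Longrightarrow> k \<le> N \<Longrightarrow> Uw k \<noteq> [Gb m n]"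
  by (auto simp: Uw_def)

lemma gl_gens_iff: "Ga m n \<in> gl_gens N \<longleftrightarrow> 1 \<le> n \<and> n \<le> m \<and> m \<le> N - 1" "Gb m n \<in> gl_gens N \<longleftrightarrow> 1 \<le> n \<and> n \<le> m \<and> m \<le> N - 1"
    "Gu m \<in> gl_gens N \<longleftrightarrow> 1 \<le> m \<and> m \<le> N - 1" "Gv m \<in> gl_gens N \<longleftrightarrow> 1 \<le> m \<and> m \<le> N - 1" for m n
  by (auto simp: gl_gens_def)

lemma count_gauss_word:
  assumes w: "w \<in> gauss_words" and g: "g \<in> gl_gens N"
  shows "count (mset w) g = of_bool (w = word_of g)"
proof -
  consider m n where "w = [Gb m n]" | k where "w = Uw k" "1 \<le> k" "k \<le> N" | m n where "w = [Ga m n]"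
    using w by (auto simp: gauss_words_def)
  then show ?thesis
  proof cases
    case (2 k)
    show ?thesis
    proof (cases g)
      case (Gu j)
      then have j: "1 \<le> j" "j \<le> N" "j \<noteq> N" using g N2 by (auto simp: gl_gens_iff)
      have "(Uw k = Uw j) = (k = j)" using Uw_inj 2 j by blast
      then show ?thesis using 2 j Gu by (auto simp: Uw_def)
    next
      case (Gv j)
      then have j: "1 \<le> j + 1" "j + 1 \<le> N" "j + 1 \<noteq> 1" using g N2 by (auto simp: gl_gens_iff)
      have "(Uw k = Uw (j + 1)) = (k = j + 1)" using Uw_inj[OF 2(2,3) j(1,2)] by blast
      moreover have "count (mset (Uw k)) (Gv j) = of_bool (k = j + 1)" using j 2 by (auto simp: Uw_def)
      ultimately show ?thesis unfolding 2(1) Gv word_of.simps by simp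
    qed (use 2 Uw_neq in \<open>auto simp: Uw_def\<close>)
  next
    case (1 m n)
    have uw: "w \<noteq> Uw k" if "1 \<le> k" "k \<le> N" for k using Uw_neq(2)[OF that, of m n] 1 by simp
    show ?thesis
    proof (cases g)
      case (Gu k)
      then have "w \<noteq> Uw k" using g by (intro uw) (auto simp: gl_gens_iff)
      then show ?thesis using 1 Gu by simp
    next
      case (Gv k)
      then have "w \<noteq> Uw (k + 1)" using g N2 by (intro uw) (auto simp: gl_gens_iff)
      then show ?thesis using 1 Gv by simp
    qed (use 1 in auto)
  next
    case (3 m n)
    have uw: "w \<noteq> Uw k" if "1 \<le> k" "k \<le> N" for k using Uw_neq(1)[OF that, of m n] 3 by simp
    show ?thesis
    proof (cases g)
      case (Gu k)
      then have "w \<noteq> Uw k" using g by (intro uw) (auto simp: gl_gens_iff)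
      then show ?thesis using 3 Gu by simp
    next
      case (Gv k)
      then have "w \<noteq> Uw (k + 1)" using g N2 by (intro uw) (auto simp: gl_gens_iff)
      then show ?thesis using 3 Gv by simp
    qed (use 3 in auto)
  qed
qed

lemma count_gauss_concat: "set ws \<subseteq> gauss_words \<Longrightarrow> g \<in> gl_gens N \<Longrightarrow> count (mset (concat ws)) g = count_list ws (word_of g)"
  by (induction ws) (auto simp: count_gauss_word)

lemma gauss_words_gens: "w \<in> gauss_words \<Longrightarrow> set w \<subseteq> gl_gens N"
  using N2 by (auto simp: gauss_words_def gl_gens_iff Uw_def split: if_splits; arith)

definition gauss_monoid :: "gl_gen list set" where
  "gauss_monoid = {concat ws | ws. set ws \<subseteq> gauss_words}"

lemma gauss_monoid_gens: "w \<in> gauss_monoid \<Longrightarrow> set w \<subseteq> gl_gens N"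
  unfolding gauss_monoid_def using gauss_words_gens by fastforce

lemma gauss_monoid_append: "v \<in> gauss_monoid \<Longrightarrow> w \<in> gauss_monoid \<Longrightarrow> v @ w \<in> gauss_monoid"
proof -
  assume "v \<in> gauss_monoid" "w \<in> gauss_monoid"
  then obtain vs ws where "v = concat vs" "set vs \<subseteq> gauss_words" "w = concat ws" "set ws \<subseteq> gauss_words"
    unfolding gauss_monoid_def by blast
  then have "v @ w = concat (vs @ ws) \<and> set (vs @ ws) \<subseteq> gauss_words" by simp
  then show ?thesis unfolding gauss_monoid_def by blast
qed

lemma generated_keys:
  assumes "x \<in> generated_subalgebra (gauss_vars N)" "w \<in> Poly_Mapping.keys x"
  shows "letters w \<in> gauss_monoid"
  using assms
proof (induction arbitrary: w)
  case (const c)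
  have "Poly_Mapping.keys (const c :: gl_gen free_algebra) \<subseteq> {0}" unfolding const_def by simp
  with const have "w = 0" by blast
  then show ?case unfolding gauss_monoid_def zero_word_def by (auto intro!: exI[of _ "[]"])
next
  case (base x)
  then obtain v where "v \<in> gauss_words" "w = Word v" unfolding gauss_vars_monom monom_def by (auto split: if_splits)
  then show ?case unfolding gauss_monoid_def by (auto intro!: exI[of _ "[v]"])
next
  case (add x y)
  then show ?case using Poly_Mapping.keys_add[of x y] by blast
next
  case (mult x y)
  then obtain a b where "a \<in> Poly_Mapping.keys x" "b \<in> Poly_Mapping.keys y" "w = a + b" using keys_mult[of x y] by blast
  then show ?case using mult.IH gauss_monoid_append by (simp add: plus_word_def)
qed

lemma gauss_lattice_diff:
  assumes "v \<in> gauss_monoid" "w \<in> gauss_monoid"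
  shows "\<exists>c. gauss_lattice N (\<lambda>g. int (count (mset v) g) - int (count (mset w) g)) c"
proof -
  from assms obtain vs ws where vw: "v = concat vs" "set vs \<subseteq> gauss_words" "w = concat ws" "set ws \<subseteq> gauss_words"
    unfolding gauss_monoid_def by blast
  show ?thesis unfolding gauss_lattice_def
    by (rule exI[of _ "\<lambda>k. int (count_list vs (Uw k)) - int (count_list ws (Uw k))"])
      (auto simp: vw count_gauss_concat gl_gens_iff)
qed

lemma keys_diff_gauss:
  assumes "x \<in> generated_subalgebra (gauss_vars N)" "y \<in> generated_subalgebra (gauss_vars N)" "w \<in> Poly_Mapping.keys (x - y)"
  shows "letters w \<in> gauss_monoid"
  using assms generated_keys Poly_Mapping.keys_diff[of x y] by blast

text \<open>The image is spanned by normal ordered monomials, which are independent in the torus algebra; so only monomials with the same exponents have to be identified.\<close>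

lemma faithful_criterion:
  assumes R: "gl_rels q N \<subseteq> R" and Rl: "\<And>l r. (l, r) \<in> R \<Longrightarrow> alg_eq (torus_rels q) (lift \<phi> l) (lift \<phi> r)"
    and eq: "\<And>v w. v \<in> gauss_monoid \<Longrightarrow> w \<in> gauss_monoid \<Longrightarrow> Phi (mset v) = Phi (mset w)
      \<Longrightarrow> alg_eq R (quasi_commuting.N q om_gl (mset v)) (quasi_commuting.N q om_gl (mset w))"
    and xy: "x \<in> generated_subalgebra (gauss_vars N)" "y \<in> generated_subalgebra (gauss_vars N)"
  shows "alg_eq (torus_rels q) (lift \<phi> x) (lift \<phi> y) \<longleftrightarrow> alg_eq R x y"
proof
  assume "alg_eq R x y"
  then show "alg_eq (torus_rels q) (lift \<phi> x) (lift \<phi> y)" using alg_eq_lift[of R "torus_rels q" \<phi> x y] Rl by blast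
next
  assume "alg_eq (torus_rels q) (lift \<phi> x) (lift \<phi> y)"
  then have "nf q om_t (lift \<phi> (x - y)) E = 0" for E using torus_nf by (simp add: lift_diff nf_diff)
  moreover have k: "letters w \<in> gauss_monoid" if "w \<in> Poly_Mapping.keys (x - y)" for w by (rule keys_diff_gauss[OF xy that])
  moreover have kg: "set (letters w) \<subseteq> gl_gens N" if "w \<in> Poly_Mapping.keys (x - y)" for w by (rule gauss_monoid_gens[OF k[OF that]])
  ultimately have "alg_eq R (x - y) 0"
    by (intro quasi_commuting.vanish_criterion[OF quasi_gl[OF R], where \<Phi> = Phi] kg eq k) (auto simp: nf_lift_phi kg)
  then show "alg_eq R x y" by (simp add: alg_eq_diff_zero[symmetric])
qed

theorem faithful_even:
  assumes "even N" "x \<in> generated_subalgebra (gauss_vars N)" "y \<in> generated_subalgebra (gauss_vars N)"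
  shows "alg_eq (torus_rels q) (lift \<phi> x) (lift \<phi> y) \<longleftrightarrow> alg_eq (gl_rels q N) x y"
proof (rule faithful_criterion[OF subset_refl gl_rels_lift _ assms(2,3)])
  fix v w assume vw: "v \<in> gauss_monoid" "w \<in> gauss_monoid" "Phi (mset v) = Phi (mset w)"
  have g: "set v \<subseteq> gl_gens N" "set w \<subseteq> gl_gens N" using gauss_monoid_gens vw by blast+
  obtain c where c: "gauss_lattice N (\<lambda>g. int (count (mset v) g) - int (count (mset w) g)) c" using gauss_lattice_diff vw by blast
  have r: "in_radical N (\<lambda>g. int (count (mset v) g) - int (count (mset w) g))" using Phi_eq_radical[of "mset v" "mset w"] g vw by simp
  have "count (mset v) x = count (mset w) x" for x
  proof (cases "x \<in> gl_gens N")
    case True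
    then show ?thesis using radical_even[OF r c \<open>even N\<close> N2 True] by simp
  next
    case False
    then have "x \<notin># mset v" "x \<notin># mset w" using g by auto
    then show ?thesis by (simp only: not_in_iff)
  qed
  then have "mset v = mset w" by (rule multiset_eqI)
  then show "alg_eq (gl_rels q N) (quasi_commuting.N q om_gl (mset v)) (quasi_commuting.N q om_gl (mset w))" by (simp add: alg_eq_refl)
qed


subsection \<open>The relation that holds in the image for odd \<open>N\<close>\<close>

lemma word_of_gauss: "g \<in> gl_gens N \<Longrightarrow> word_of g \<in> gauss_words"
  using N2 by (cases g) (auto simp: gauss_words_def gl_gens_iff)

lemma gauss_words_word_of: "w \<in> gauss_words \<Longrightarrow> w \<in> word_of ` gl_gens N"
proof -
  assume "w \<in> gauss_words"
  then consider m n where "w = word_of (Gb m n)" "Gb m n \<in> gl_gens N" | k where "w = Uw k" "1 \<le> k" "k \<le> N"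
    | m n where "w = word_of (Ga m n)" "Ga m n \<in> gl_gens N"
    by (auto simp: gauss_words_def gl_gens_iff)
  then show ?thesis
  proof cases
    case (2 k)
    show ?thesis
    proof (cases "k = N")
      case True
      then have "w = word_of (Gv (N - 1))" "Gv (N - 1) \<in> gl_gens N" using 2 N2 by (simp_all add: gl_gens_iff)
      then show ?thesis by blast
    next
      case False
      then have "w = word_of (Gu k)" "Gu k \<in> gl_gens N" using 2 by (simp_all add: gl_gens_iff)
      then show ?thesis by blast
    qed
  qed blast+
qed

lemma finite_gauss_words: "finite gauss_words"
  by (rule finite_subset[of _ "word_of ` gl_gens N"]) (use gauss_words_word_of finite_gl_gens in auto)

lemma kpa_hd: "g \<in> gl_gens N \<Longrightarrow> kpa (hd (word_of g)) = kpa g"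
  by (cases g) (auto simp: Uw_def gl_gens_iff)

lemma kpa_values: "kpa g = 0 \<or> kpa g = 1 \<or> kpa g = -1"
  by (cases g) (auto simp: minus_one_power_iff)

lemma count_list_distinct: "distinct xs \<Longrightarrow> count_list xs a = of_bool (a \<in> set xs)"
  by (induction xs) auto

lemma kpa_words:
  "\<exists>ps. set ps \<subseteq> gauss_words \<and> (\<forall>g\<in>gl_gens N. count (mset (concat ps)) g = of_bool (kpa g = s))"
proof -
  obtain ps where ps: "set ps = {w \<in> gauss_words. kpa (hd w) = s}" "distinct ps"
    using finite_distinct_list[of "{w \<in> gauss_words. kpa (hd w) = s}"] finite_gauss_words by auto
  show ?thesis
    by (rule exI[of _ ps]) (use ps in \<open>auto simp: count_gauss_concat count_list_distinct word_of_gauss kpa_hd\<close>)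
qed

lemma prod_list_monom: "prod_list (map monom ws) = monom (concat ws)"
  by (induction ws) (simp_all add: monom_Nil monom_append)

lemma kpa_split:
  fixes V U :: "gl_gen multiset"
  assumes V: "\<And>g. g \<in> gl_gens N \<Longrightarrow> count V g = of_bool (kpa g = 1)" and U: "\<And>g. g \<in> gl_gens N \<Longrightarrow> count U g = of_bool (kpa g = -1)"
    and s: "set_mset V \<subseteq> gl_gens N" "set_mset U \<subseteq> gl_gens N" "set_mset A \<subseteq> gl_gens N" "set_mset B \<subseteq> gl_gens N"
    and d: "\<And>g. g \<in> gl_gens N \<Longrightarrow> int (count A g) - int (count B g) = int n * kpa g"
  shows "\<exists>L. set_mset L \<subseteq> gl_gens N \<and> A = L + repeat_mset n V \<and> B = L + repeat_mset n U"
proof (intro exI conjI)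
  let ?L = "A - repeat_mset n V"
  show "set_mset ?L \<subseteq> gl_gens N" using s(3) by (auto dest!: in_diffD)
  have o: "count X g = 0" if "g \<notin> gl_gens N" "set_mset X \<subseteq> gl_gens N" for g and X :: "gl_gen multiset"
  proof -
    have "g \<notin># X" using that by blast
    then show ?thesis by (simp only: not_in_iff)
  qed
  have c: "count A g = count ?L g + n * count V g \<and> count B g = count ?L g + n * count U g" for g
  proof (cases "g \<in> gl_gens N")
    case True
    then show ?thesis using V[OF True] U[OF True] d[OF True] kpa_values[of g] by auto
  next
    case False
    then show ?thesis using o s by simp
  qed
  show "A = ?L + repeat_mset n V" "B = ?L + repeat_mset n U" by (rule multiset_eqI; use c in simp)+
qed

text \<open>Two Gauss monomials with the same image differ by a power of the quotient of the two monomials that form the positive and the negative part of \<open>kpa\<close>. As \<open>kpa\<close> is in the radical both parts exchange with the generators in the same way, so one relation between them accounts for the kernel.\<close>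

theorem faithful_odd:
  assumes N: "odd N"
  shows "\<exists>ms ns c. set ms \<subseteq> gauss_vars N \<and> set ns \<subseteq> gauss_vars N \<and> c \<noteq> 0 \<and>
     (\<forall>g\<in>gauss_vars N. \<exists>k::int.
        alg_eq (gl_rels q N) (prod_list ms * g) (const (q powi (2 * k)) * g * prod_list ms) \<and>
        alg_eq (gl_rels q N) (prod_list ns * g) (const (q powi (2 * k)) * g * prod_list ns)) \<and>
     (\<forall>x\<in>generated_subalgebra (gauss_vars N). \<forall>y\<in>generated_subalgebra (gauss_vars N).
        alg_eq (torus_rels q) (lift \<phi> x) (lift \<phi> y) \<longleftrightarrow>
        alg_eq (insert (prod_list ms, const c * prod_list ns) (gl_rels q N)) x y)"
proof -
  obtain ps where ps: "set ps \<subseteq> gauss_words" "\<And>g. g \<in> gl_gens N \<Longrightarrow> count (mset (concat ps)) g = of_bool (kpa g = 1)"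
    using kpa_words[of 1] by blast
  obtain ns where ns: "set ns \<subseteq> gauss_words" "\<And>g. g \<in> gl_gens N \<Longrightarrow> count (mset (concat ns)) g = of_bool (kpa g = -1)"
    using kpa_words[of "-1"] by blast
  define v u where "v = concat ps" and "u = concat ns"
  note cv = ps(2)[folded v_def] and cu = ns(2)[folded u_def]
  have sv: "set v \<subseteq> gl_gens N" and su: "set u \<subseteq> gl_gens N"
    using ps(1) ns(1) gauss_words_gens unfolding v_def u_def by fastforce+
  have kd: "int (count (mset v) g) - int (count (mset u) g) = kpa g" if "g \<in> gl_gens N" for g
    using cv[OF that] cu[OF that] kpa_values[of g] by auto
  have Phi_vu: "Phi (mset v) = Phi (mset u)"
    by (rule Phi_eqI) (use sv su kpa_coordinates[OF N] in \<open>simp_all add: kd\<close>)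
  have rad: "(\<Sum>g\<in>gl_gens N. kpa g * om_gl g h) = 0" if "h \<in> gl_gens N" for h
    using in_radicalI[of N kpa] kpa_coordinates[OF N] that by (simp add: in_radical_def)
  have cross1: "cross om_gl v z = cross om_gl u z" if "set z \<subseteq> gl_gens N" for z
  proof -
    have "cross om_gl v z - cross om_gl u z = (\<Sum>g\<in>gl_gens N. int (count (mset v) g) * (\<Sum>y\<leftarrow>z. om_gl g y)) - (\<Sum>g\<in>gl_gens N. int (count (mset u) g) * (\<Sum>y\<leftarrow>z. om_gl g y))"
      using sv su by (simp add: cross_def sum_mset_gens[symmetric] sum_mset_sum_list[symmetric] del: sum_mset_sum_list)
    also have "\<dots> = (\<Sum>g\<in>gl_gens N. kpa g * (\<Sum>y\<leftarrow>z. om_gl g y))"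
      unfolding sum_subtractf[symmetric] by (intro sum.cong refl) (simp add: kd[symmetric] left_diff_distrib)
    also have "\<dots> = 0" using that by (induction z) (simp_all add: distrib_left sum.distrib rad)
    finally show ?thesis by simp
  qed
  have cskew: "cross om_gl a c = - cross om_gl c a" for a c
  proof (induction a)
    case (Cons x a)
    have "(\<Sum>y\<leftarrow>c. om_gl y x) = - (\<Sum>y\<leftarrow>c. om_gl x y)" by (induction c) (use om_gl_skew[of _ x] in simp_all)
    then show ?case using Cons by (simp add: cross_simps)
  qed (simp add: cross_simps)
  define c where "c = q powi (ph om_gl v - ph om_gl u)"
  let ?R = "insert (monom v, const c * monom u) (gl_rels q N)"
  interpret G: quasi_commuting q om_gl "gl_gens N" "gl_rels q N" by (rule quasi_gl[OF subset_refl])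
  interpret Q: quasi_commuting q om_gl "gl_gens N" ?R by (rule quasi_gl) blast
  have exch: "alg_eq (gl_rels q N) (monom a * monom z) (const (q powi (2 * cross om_gl a z)) * monom z * monom a)"
    if "set a \<subseteq> gl_gens N" "set z \<subseteq> gl_gens N" for a z
  proof -
    have "alg_eq (gl_rels q N) (monom (a @ z)) (const (q powi (ph om_gl (a @ z) - ph om_gl (z @ a))) * monom (z @ a))"
      by (rule G.word_reorder) (use that in \<open>simp_all add: add.commute\<close>)
    moreover have "ph om_gl (a @ z) - ph om_gl (z @ a) = 2 * cross om_gl a z" using cskew[of z a] by (simp add: ph_append)
    ultimately show ?thesis by (simp add: monom_append mult.assoc)
  qed
  have qq: "const (q powi i) * (const (q powi j) * x) = const (q powi (i + j)) * (x :: gl_gen free_algebra)" for i j x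
    using q0 by (simp add: mult.assoc[symmetric] const_mult[symmetric] power_int_add)
  have NP: "alg_eq ?R (Q.N (mset v)) (Q.N (mset u))"
  proof -
    have "Q.N (mset v) = const (q powi (- ph om_gl v)) * (const (q powi (ph om_gl v)) * Q.N (mset v))"
      unfolding qq by (simp add: const_one)
    also have "alg_eq ?R \<dots> (const (q powi (- ph om_gl v)) * monom v)"
      by (intro alg_eq_scale alg_eq_sym[OF Q.monom_eq_N] sv)
    also have "alg_eq ?R \<dots> (const (q powi (- ph om_gl v)) * (const c * monom u))"
      by (intro alg_eq_scale alg_eq_rel) blast
    also have "alg_eq ?R \<dots> (const (q powi (- ph om_gl v)) * (const c * (const (q powi (ph om_gl u)) * Q.N (mset u))))"
      by (intro alg_eq_scale Q.monom_eq_N su)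
    also have "\<dots> = Q.N (mset u)" unfolding c_def qq by (simp add: const_one)
    finally show ?thesis .
  qed
  have mv: "set_mset (mset v) \<subseteq> gl_gens N" and mu: "set_mset (mset u) \<subseteq> gl_gens N" using sv su by simp_all
  have step: "alg_eq ?R (Q.N (L + mset v)) (Q.N (L + mset u))" if L: "set_mset L \<subseteq> gl_gens N" for L
  proof -
    let ?k = "cross om_gl (Q.cword L) (Q.cword (mset v))"
    have sL: "set (Q.cword L) \<subseteq> gl_gens N" using L by (metis Q.mset_cword set_mset_mset)
    have k: "?k = cross om_gl (Q.cword L) (Q.cword (mset u))"
      using cross1[OF sL] cskew[of "Q.cword L"] cross_cong[OF refl Q.mset_cword, of om_gl "Q.cword L"] by (simp add: Q.mset_cword cross_cong[of "Q.cword L" "Q.cword L" "Q.cword (mset _)"])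
    have "Q.N (L + mset v) = const (q powi (- ?k)) * (const (q powi ?k) * Q.N (L + mset v))" unfolding qq by (simp add: const_one)
    also have "alg_eq ?R \<dots> (const (q powi (- ?k)) * (Q.N L * Q.N (mset v)))"
      by (intro alg_eq_scale alg_eq_sym[OF Q.N_add] L mv)
    also have "alg_eq ?R \<dots> (const (q powi (- ?k)) * (Q.N L * Q.N (mset u)))"
      by (intro alg_eq_scale alg_eq_mult alg_eq_refl NP)
    also have "alg_eq ?R \<dots> (const (q powi (- ?k)) * (const (q powi ?k) * Q.N (L + mset u)))"
      unfolding k by (intro alg_eq_scale Q.N_add L mu)
    also have "\<dots> = Q.N (L + mset u)" unfolding qq by (simp add: const_one)
    finally show ?thesis .
  qed
  have iter: "alg_eq ?R (Q.N (L + repeat_mset n (mset v))) (Q.N (L + repeat_mset n (mset u)))" if "set_mset L \<subseteq> gl_gens N" for L n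
    using that
  proof (induction n arbitrary: L)
    case 0 show ?case by (simp add: alg_eq_refl)
  next
    case (Suc n)
    have r: "set_mset (repeat_mset n (mset u)) \<subseteq> gl_gens N" using su by (induction n) auto
    have "alg_eq ?R (Q.N ((L + mset v) + repeat_mset n (mset v))) (Q.N ((L + mset v) + repeat_mset n (mset u)))"
      by (rule Suc.IH) (use Suc.prems sv in auto)
    also have "(L + mset v) + repeat_mset n (mset u) = (L + repeat_mset n (mset u)) + mset v" by (simp add: ac_simps)
    also have "alg_eq ?R (Q.N \<dots>) (Q.N ((L + repeat_mset n (mset u)) + mset u))"
      by (rule step) (use Suc.prems r in auto)
    finally show ?case by (simp add: ac_simps)
  qed
  have eq: "alg_eq ?R (Q.N (mset x)) (Q.N (mset y))" if xy: "x \<in> gauss_monoid" "y \<in> gauss_monoid" "Phi (mset x) = Phi (mset y)" for x y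
  proof -
    have g: "set_mset (mset x) \<subseteq> gl_gens N" "set_mset (mset y) \<subseteq> gl_gens N" using gauss_monoid_gens xy by simp_all
    obtain d where d: "gauss_lattice N (\<lambda>g. int (count (mset x) g) - int (count (mset y) g)) d" using gauss_lattice_diff xy by blast
    have r: "in_radical N (\<lambda>g. int (count (mset x) g) - int (count (mset y) g))" by (rule Phi_eq_radical[OF g xy(3)])
    note D = radical_odd[OF r d N N2]
    show ?thesis
    proof (cases "0 \<le> d 1")
      case True
      then obtain L where "set_mset L \<subseteq> gl_gens N" "mset x = L + repeat_mset (nat (d 1)) (mset v)" "mset y = L + repeat_mset (nat (d 1)) (mset u)"
        using kpa_split[OF cv cu mv mu g, of "nat (d 1)"] D by auto
      then show ?thesis using iter by metis
    next
      case False
      have "int (count (mset y) g) - int (count (mset x) g) = int (nat (- d 1)) * kpa g" if "g \<in> gl_gens N" for g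
        using D[OF that] False by (simp add: algebra_simps)
      then obtain L where "set_mset L \<subseteq> gl_gens N" "mset y = L + repeat_mset (nat (- d 1)) (mset v)" "mset x = L + repeat_mset (nat (- d 1)) (mset u)"
        using kpa_split[OF cv cu mv mu g(2,1), of "nat (- d 1)"] by auto
      then show ?thesis using iter alg_eq_sym by metis
    qed
  qed
  have Rl: "alg_eq (torus_rels q) (lift \<phi> l) (lift \<phi> r)" if "(l, r) \<in> ?R" for l r
  proof (cases "(l, r) \<in> gl_rels q N")
    case True then show ?thesis by (rule gl_rels_lift)
  next
    case False
    then have "l = monom v" "r = const c * monom u" using that by auto
    then show ?thesis using lift_monom_eq[OF sv su Phi_vu] by (simp only: c_def lift_mult lift_const)
  qed
  show ?thesis
  proof (rule exI[of _ "map monom ps"], rule exI[of _ "map monom ns"], rule exI[of _ c], intro conjI ballI)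
    show "set (map monom ps) \<subseteq> gauss_vars N" "set (map monom ns) \<subseteq> gauss_vars N" using ps ns by (auto simp: gauss_vars_monom)
    show "c \<noteq> 0" using q0 by (simp add: c_def)
  next
    fix g assume "g \<in> gauss_vars N"
    then obtain w where w: "g = monom w" "set w \<subseteq> gl_gens N" using gauss_words_gens by (auto simp: gauss_vars_monom)
    have "alg_eq (gl_rels q N) (prod_list (map monom ps) * g) (const (q powi (2 * cross om_gl v w)) * g * prod_list (map monom ps))"
      unfolding prod_list_monom w(1) v_def[symmetric] by (rule exch[OF sv w(2)])
    moreover have "alg_eq (gl_rels q N) (prod_list (map monom ns) * g) (const (q powi (2 * cross om_gl v w)) * g * prod_list (map monom ns))"
      unfolding prod_list_monom w(1) u_def[symmetric] cross1[OF w(2)] by (rule exch[OF su w(2)])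
    ultimately show "\<exists>k::int. alg_eq (gl_rels q N) (prod_list (map monom ps) * g) (const (q powi (2 * k)) * g * prod_list (map monom ps)) \<and>
        alg_eq (gl_rels q N) (prod_list (map monom ns) * g) (const (q powi (2 * k)) * g * prod_list (map monom ns))" by blast
  next
    fix x y assume xy: "x \<in> generated_subalgebra (gauss_vars N)" "y \<in> generated_subalgebra (gauss_vars N)"
    show "alg_eq (torus_rels q) (lift \<phi> x) (lift \<phi> y) = alg_eq (insert (prod_list (map monom ps), const c * prod_list (map monom ns)) (gl_rels q N)) x y"
      unfolding prod_list_monom v_def[symmetric] u_def[symmetric]
      by (rule faithful_criterion[OF _ Rl eq xy]) blast
  qed
qed

end

section \<open>Operators\<close>

lemma lal_lbe: "lal x \<bullet> lbe y - lal y \<bullet> lbe x = real_of_int (om_t x y)"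
  by (cases x; cases y) (auto simp: inner_axis_axis)

lemma lal_wbe: "lal x \<bullet> wbe ys - wal ys \<bullet> lbe x = real_of_int (\<Sum>y\<leftarrow>ys. om_t x y)"
  by (induction ys) (simp_all add: wal_def wbe_def inner_add_left inner_add_right lal_lbe[symmetric])

lemma wal_wbe: "wal xs \<bullet> wbe ys - wal ys \<bullet> wbe xs = real_of_int (cross om_t xs ys)"
proof (induction xs)
  case Nil show ?case by (simp add: wal_def wbe_def cross_simps)
next
  case (Cons x xs)
  have "wal (x # xs) = lal x + wal xs" "wbe (x # xs) = lbe x + wbe xs" by (simp_all add: wal_def wbe_def)
  then show ?case using Cons lal_wbe[of x ys] by (simp add: inner_add_left inner_add_right cross_simps)
qed

lemma phr_eq: "phr xs = real_of_int (ph om_t xs)"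
proof (induction xs)
  case (Cons x xs) then show ?case using lal_wbe[of x xs] by simp
qed simp

lemma eph_int:
  assumes "q = exp (complex_of_real pi * \<i> * complex_of_real (b\<^sup>2))"
  shows "eph b (real_of_int k) = q powi k"
  unfolding assms eph_def exp_power_int by (simp add: mult_ac)

lemma torus_op_exchange:
  assumes "0 < b" "b < 1" "q = exp (complex_of_real pi * \<i> * complex_of_real (b\<^sup>2))" "k = 2 * real_of_int (om_t x y)"
  shows "q_exchange q k (torus_op b x) (torus_op b y)"
  unfolding torus_op_eq by (rule q_exchange_weyl_op) (use assms lal_lbe[of x y] in simp_all)

context torus_embedding begin

text \<open>Division by the phase is what turns the product of the exponentials into the exponential of the sum.\<close>

lemma realized_phi:
  assumes "q = exp (complex_of_real pi * \<i> * complex_of_real (b\<^sup>2))"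
  shows "realized b (\<phi> g) = weyl_op b (wal (t g)) (wbe (t g))"
proof -
  have "eph b (- phr (t g)) = q powi (- ph om_t (t g))" using eph_int[OF assms, of "- ph om_t (t g)"] by (simp add: phr_eq)
  then show ?thesis unfolding \<phi>_def using realized_word[of b "t g"] by simp
qed

lemma realized_phi_exchange:
  assumes "0 < b" "b < 1" "q = exp (complex_of_real pi * \<i> * complex_of_real (b\<^sup>2))"
    and "g \<in> gl_gens N" "h \<in> gl_gens N" "k = 2 * real_of_int (om_gl g h)"
  shows "q_exchange q k (realized b (\<phi> g)) (realized b (\<phi> h))"
  unfolding realized_phi[OF assms(3)]
  by (rule q_exchange_weyl_op) (use assms wal_wbe[of "t g" "t h"] cross_tw in simp_all)

end

theorem embedding_part:
  fixes b :: real and q :: complex and N :: nat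
  assumes "0 < b" and "b < 1"
    and q: "q = exp (complex_of_real pi * \<i> * complex_of_real (b\<^sup>2))"
    and N2: "N \<ge> 2" and card: "CARD('n::finite) = N\<^sup>2 div 2"
  shows "(\<forall>x :: 'n torus_gen. positive_selfadjoint (torus_op b x)) \<and>
      (\<forall>i :: 'n. q_exchange q 2 (torus_op b (Tu i)) (torus_op b (Tv i))) \<and>
      (\<forall>i j :: 'n. i \<noteq> j \<longrightarrow>
         (\<forall>x\<in>{Tu i, Tv i}. \<forall>y\<in>{Tu j, Tv j}. q_exchange q 0 (torus_op b x) (torus_op b y))) \<and>
      (\<exists>\<phi> :: gl_gen \<Rightarrow> 'n torus_gen free_algebra.
         (\<forall>(l, r)\<in>gl_rels q N. alg_eq (torus_rels q) (lift \<phi> l) (lift \<phi> r)) \<and>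
         (even N \<longrightarrow>
            (\<forall>x\<in>generated_subalgebra (gauss_vars N). \<forall>y\<in>generated_subalgebra (gauss_vars N).
               alg_eq (torus_rels q) (lift \<phi> x) (lift \<phi> y) \<longleftrightarrow> alg_eq (gl_rels q N) x y)) \<and>
         (odd N \<longrightarrow>
            (\<exists>ms ns c. set ms \<subseteq> gauss_vars N \<and> set ns \<subseteq> gauss_vars N \<and> c \<noteq> 0 \<and>
               (\<forall>g\<in>gauss_vars N. \<exists>k::int.
                  alg_eq (gl_rels q N) (prod_list ms * g) (const (q powi (2 * k)) * g * prod_list ms) \<and>
                  alg_eq (gl_rels q N) (prod_list ns * g) (const (q powi (2 * k)) * g * prod_list ns)) \<and>
               (\<forall>x\<in>generated_subalgebra (gauss_vars N). \<forall>y\<in>generated_subalgebra (gauss_vars N).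
                  alg_eq (torus_rels q) (lift \<phi> x) (lift \<phi> y) \<longleftrightarrow>
                  alg_eq (insert (prod_list ms, const c * prod_list ns) (gl_rels q N)) x y))) \<and>
         (\<forall>g\<in>gl_gens N. positive_selfadjoint (realized b (\<phi> g))) \<and>
         (\<forall>g\<in>gl_gens N. \<forall>h\<in>gl_gens N.
            (q2_rel g h \<longrightarrow> q_exchange q 2 (realized b (\<phi> g)) (realized b (\<phi> h))) \<and>
            (\<not> q2_rel g h \<and> \<not> q2_rel h g \<longrightarrow>
               q_exchange q 0 (realized b (\<phi> g)) (realized b (\<phi> h)))))"
proof -
  obtain us :: "'n list" where us: "set us = UNIV" "distinct us" using finite_distinct_list[of "UNIV :: 'n set"] by auto
  have "card (UNIV :: 'n set) = card (planes N)" using card by (simp add: card_planes)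
  then obtain \<iota> :: "'n \<Rightarrow> plane" where \<iota>: "bij_betw \<iota> UNIV (planes N)"
    using finite_same_card_bij[of "UNIV :: 'n set" "planes N"] finite_planes by auto
  have q0: "q \<noteq> 0" by (simp add: q)
  interpret E: torus_embedding \<iota> us N q by unfold_locales (use us \<iota> q0 N2 in simp_all)
  show ?thesis
  proof (intro conjI)
    show "\<forall>x :: 'n torus_gen. positive_selfadjoint (torus_op b x)" by (simp add: torus_op_eq positive_selfadjoint_weyl_op)
    show "\<forall>i :: 'n. q_exchange q 2 (torus_op b (Tu i)) (torus_op b (Tv i))"
      by (intro allI torus_op_exchange assms q) simp
    show "\<forall>i j :: 'n. i \<noteq> j \<longrightarrow> (\<forall>x\<in>{Tu i, Tv i}. \<forall>y\<in>{Tu j, Tv j}. q_exchange q 0 (torus_op b x) (torus_op b y))"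
      by (intro allI impI ballI torus_op_exchange assms q) auto
    show "\<exists>\<phi> :: gl_gen \<Rightarrow> 'n torus_gen free_algebra.
         (\<forall>(l, r)\<in>gl_rels q N. alg_eq (torus_rels q) (lift \<phi> l) (lift \<phi> r)) \<and>
         (even N \<longrightarrow>
            (\<forall>x\<in>generated_subalgebra (gauss_vars N). \<forall>y\<in>generated_subalgebra (gauss_vars N).
               alg_eq (torus_rels q) (lift \<phi> x) (lift \<phi> y) \<longleftrightarrow> alg_eq (gl_rels q N) x y)) \<and>
         (odd N \<longrightarrow>
            (\<exists>ms ns c. set ms \<subseteq> gauss_vars N \<and> set ns \<subseteq> gauss_vars N \<and> c \<noteq> 0 \<and>
               (\<forall>g\<in>gauss_vars N. \<exists>k::int.
                  alg_eq (gl_rels q N) (prod_list ms * g) (const (q powi (2 * k)) * g * prod_list ms) \<and>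
                  alg_eq (gl_rels q N) (prod_list ns * g) (const (q powi (2 * k)) * g * prod_list ns)) \<and>
               (\<forall>x\<in>generated_subalgebra (gauss_vars N). \<forall>y\<in>generated_subalgebra (gauss_vars N).
                  alg_eq (torus_rels q) (lift \<phi> x) (lift \<phi> y) \<longleftrightarrow>
                  alg_eq (insert (prod_list ms, const c * prod_list ns) (gl_rels q N)) x y))) \<and>
         (\<forall>g\<in>gl_gens N. positive_selfadjoint (realized b (\<phi> g))) \<and>
         (\<forall>g\<in>gl_gens N. \<forall>h\<in>gl_gens N.
            (q2_rel g h \<longrightarrow> q_exchange q 2 (realized b (\<phi> g)) (realized b (\<phi> h))) \<and>
            (\<not> q2_rel g h \<and> \<not> q2_rel h g \<longrightarrow>
               q_exchange q 0 (realized b (\<phi> g)) (realized b (\<phi> h))))"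
    proof (intro exI[of _ E.\<phi>] conjI ballI impI)
      fix x assume "x \<in> gl_rels q N"
      then show "case x of (l, r) \<Rightarrow> alg_eq (torus_rels q) (lift E.\<phi> l) (lift E.\<phi> r)" using E.gl_rels_lift by auto
    next
      fix x y assume "even N" "x \<in> generated_subalgebra (gauss_vars N)" "y \<in> generated_subalgebra (gauss_vars N)"
      then show "alg_eq (torus_rels q) (lift E.\<phi> x) (lift E.\<phi> y) = alg_eq (gl_rels q N) x y" by (rule E.faithful_even)
    next
      assume "odd N"
      then show "\<exists>ms ns c. set ms \<subseteq> gauss_vars N \<and> set ns \<subseteq> gauss_vars N \<and> c \<noteq> 0 \<and>
               (\<forall>g\<in>gauss_vars N. \<exists>k::int.
                  alg_eq (gl_rels q N) (prod_list ms * g) (const (q powi (2 * k)) * g * prod_list ms) \<and>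
                  alg_eq (gl_rels q N) (prod_list ns * g) (const (q powi (2 * k)) * g * prod_list ns)) \<and>
               (\<forall>x\<in>generated_subalgebra (gauss_vars N). \<forall>y\<in>generated_subalgebra (gauss_vars N).
                  alg_eq (torus_rels q) (lift E.\<phi> x) (lift E.\<phi> y) \<longleftrightarrow>
                  alg_eq (insert (prod_list ms, const c * prod_list ns) (gl_rels q N)) x y)" by (rule E.faithful_odd)
    next
      fix g show "positive_selfadjoint (realized b (E.\<phi> g))" by (simp add: E.realized_phi[OF q] positive_selfadjoint_weyl_op)
    next
      fix g h assume "g \<in> gl_gens N" "h \<in> gl_gens N" "q2_rel g h"
      then show "q_exchange q 2 (realized b (E.\<phi> g)) (realized b (E.\<phi> h))"
        using E.q2_rel_excl[of g h] by (intro E.realized_phi_exchange assms q) (simp_all add: om_gl_def)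
    next
      fix g h assume "g \<in> gl_gens N" "h \<in> gl_gens N" "\<not> q2_rel g h \<and> \<not> q2_rel h g"
      then show "q_exchange q 0 (realized b (E.\<phi> g)) (realized b (E.\<phi> h))"
        by (intro E.realized_phi_exchange assms q) (simp_all add: om_gl_def)
    qed
  qed
qed

section \<open>A ring in which the relations hold\<close>

definition cm :: "gl_gen multiset \<Rightarrow> gl_gen multiset \<Rightarrow> int" where
  "cm M M' = (\<Sum>x\<in>#M. \<Sum>y\<in>#M'. om_gl x y)"

lemma cm_add: "cm (M + M') L = cm M L + cm M' L" "cm L (M + M') = cm L M + cm L M'"
  by (simp_all add: cm_def sum_mset.distrib)

lemma cm_empty: "cm {#} L = 0" "cm L {#} = 0" by (simp_all add: cm_def)

text \<open>Exponents together with a power of \<open>q\<close> that is kept as a formal variable: a Heisenberg group without inverses. In its monoid algebra the relations hold as equations, so that determinants can be computed with ordinary rewriting.\<close>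

datatype heis = H (exponent: "gl_gen multiset") (q_power: int)

instantiation heis :: monoid_add
begin
definition "0 = H {#} 0"
fun plus_heis :: "heis \<Rightarrow> heis \<Rightarrow> heis" where
  "plus_heis (H M k) (H M' k') = H (M + M') (k + k' + cm M M')"
instance
proof
  fix a b c :: heis
  show "a + b + c = a + (b + c)" by (cases a; cases b; cases c) (simp add: cm_add ac_simps)
  show "0 + a = a" "a + 0 = a" by (cases a; simp add: zero_heis_def cm_empty)+
qed
end

type_synonym qalg = "heis \<Rightarrow>\<^sub>0 complex"

definition hQ :: "int \<Rightarrow> qalg" where "hQ k = Poly_Mapping.single (H {#} k) 1"
definition hgen :: "gl_gen \<Rightarrow> qalg" where "hgen g = Poly_Mapping.single (H {#g#} 0) 1"
definition hword :: "gl_gen list \<Rightarrow> heis" where "hword w = H (mset w) (ph om_gl w)"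

lemma cm_cross: "cm (mset v) (mset w) = cross om_gl v w"
  by (simp add: cm_def cross_def sum_mset_sum_list[symmetric] del: sum_mset_sum_list)

lemma hword_append: "hword (v @ w) = hword v + hword w"
  by (simp add: hword_def ph_append cm_cross)

lemma q_ring_hgen: "2 \<le> N \<Longrightarrow> q_ring hQ hgen N"
proof
  show "hQ (i + j) = hQ i * hQ j" for i j by (simp add: hQ_def mult_single cm_empty)
  show "hQ 0 = 1" by (simp add: hQ_def zero_heis_def[symmetric])
  show "x * hQ i = hQ i * x" for x i
  proof (induction x rule: poly_single_induct)
    case (single h v) then show ?case by (cases h) (simp add: hQ_def mult_single cm_empty add.commute)
  next
    case (sum f g) then show ?case by (simp only: distrib_left distrib_right)
  qed
  show "hgen g * hgen h = hQ (2 * om_gl g h) * (hgen h * hgen g)" for g h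
    using om_gl_skew[of h g] by (simp add: hQ_def hgen_def mult_single cm_def add_mset_commute)
  show "x = 0" if "x = - x" for x :: qalg
  proof (rule poly_mapping_eqI)
    fix h
    have "Poly_Mapping.lookup x h = Poly_Mapping.lookup (- x) h" using that by simp
    then show "Poly_Mapping.lookup x h = Poly_Mapping.lookup 0 h" by (simp add: lookup_uminus)
  qed
qed

definition ev :: "gl_gen free_algebra \<Rightarrow> qalg" where
  "ev x = (\<Sum>w\<in>Poly_Mapping.keys x. Poly_Mapping.single (hword (letters w)) (Poly_Mapping.lookup x w))"

lemma ev_single: "ev (Poly_Mapping.single w c) = Poly_Mapping.single (hword (letters w)) c"
  by (simp add: ev_def)

lemma ev_add: "ev (x + y) = ev x + ev y"
  unfolding ev_def by (rule sum_keys_add[of "\<lambda>w c. Poly_Mapping.single (hword (letters w)) c"]) (simp_all add: single_add)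

lemma ev_zero: "ev 0 = 0" by (simp add: ev_def)

lemma ev_minus: "ev (- x) = - ev x"
  using ev_add[of x "- x"] by (simp add: ev_zero minus_unique)

lemma ev_mult: "ev (x * y) = ev x * ev y"
proof (induction x rule: poly_single_induct)
  case (single v c)
  show ?case
  proof (induction y rule: poly_single_induct)
    case (single w d) show ?case by (simp only: mult_single ev_single plus_word_def word.sel hword_append)
  next
    case (sum f g) show ?case by (simp only: distrib_left ev_add sum)
  qed
next
  case (sum f g) show ?case by (simp only: distrib_right ev_add sum)
qed

lemma ev_one: "ev 1 = 1"
proof -
  have "ev (Poly_Mapping.single (Word []) 1) = Poly_Mapping.single 0 1" by (simp add: ev_single hword_def zero_heis_def)
  then show ?thesis by (simp add: zero_word_def[symmetric])
qed

lemma ev_gen: "ev (gen g) = hgen g" by (simp add: gen_def ev_single hgen_def hword_def)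

lemma ev_sum: "ev (\<Sum>i\<in>A. f i) = (\<Sum>i\<in>A. ev (f i))"
  by (induction A rule: infinite_finite_induct) (simp_all add: ev_zero ev_add)

lemma ev_prod_list: "ev (prod_list xs) = prod_list (map ev xs)"
  by (induction xs) (simp_all add: ev_one ev_mult)

lemma ev_sign: "ev (of_int (sign \<sigma>) * x) = of_int (sign \<sigma>) * ev x"
  by (simp add: sign_def ev_minus)

lemma ev_quantum_det: "ev (quantum_det k w) = quantum_det k (\<lambda>r s. ev (w r s))"
  unfolding quantum_det_def ev_sum ev_sign ev_prod_list by (simp add: o_def)

lemma ev_mat_prod: "ev (mat_prod N Ms i j) = mat_prod N (map (\<lambda>M i j. ev (M i j)) Ms) i j"
proof (induction Ms arbitrary: i j)
  case Nil show ?case by (simp add: mat_prod_def mat_one_def ev_one ev_zero)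
next
  case (Cons M Ms)
  have e: "mat_prod N (M # Ms) i j = (\<Sum>l=1..N. M i l * mat_prod N Ms l j)" for M :: "'b::semiring_1 matrix" and Ms i j
    by (simp add: mat_prod_def mat_mult_def)
  show ?case by (simp only: e list.map ev_sum ev_mult Cons.IH)
qed

subsection \<open>Equality in the ring implies equality modulo the relations\<close>

text \<open>The subalgebra generated by the generators with admissible indices.\<close>

definition over :: "nat \<Rightarrow> gl_gen free_algebra set" where
  "over N = {x. \<forall>w\<in>Poly_Mapping.keys x. set (letters w) \<subseteq> gl_gens N}"

lemma over_add: "x \<in> over N \<Longrightarrow> y \<in> over N \<Longrightarrow> x + y \<in> over N"
  unfolding over_def using Poly_Mapping.keys_add[of x y] by blast

lemma over_zero: "0 \<in> over N" by (simp add: over_def)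

lemma over_one: "1 \<in> over N"
proof -
  have "Poly_Mapping.single (Word []) 1 \<in> over N" by (simp add: over_def)
  then show ?thesis by (simp add: zero_word_def[symmetric])
qed

lemma over_uminus: "x \<in> over N \<Longrightarrow> - x \<in> over N" by (simp add: over_def)

lemma over_mult:
  assumes "x \<in> over N" "y \<in> over N" shows "x * y \<in> over N"
  unfolding over_def
proof (intro CollectI ballI)
  fix w assume "w \<in> Poly_Mapping.keys (x * y)"
  then obtain a b where "a \<in> Poly_Mapping.keys x" "b \<in> Poly_Mapping.keys y" "w = a + b" using keys_mult[of x y] by blast
  then show "set (letters w) \<subseteq> gl_gens N" using assms by (auto simp: over_def plus_word_def)
qed

lemma over_sum: "(\<And>i. i \<in> A \<Longrightarrow> f i \<in> over N) \<Longrightarrow> (\<Sum>i\<in>A. f i) \<in> over N"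
  by (induction A rule: infinite_finite_induct) (auto intro: over_zero over_add)

lemma over_prod_list: "(\<And>x. x \<in> set xs \<Longrightarrow> x \<in> over N) \<Longrightarrow> prod_list xs \<in> over N"
  by (induction xs) (auto intro: over_one over_mult)

lemma over_monom: "set w \<subseteq> gl_gens N \<Longrightarrow> monom w \<in> over N" by (simp add: over_def monom_def)

lemma over_gen: "g \<in> gl_gens N \<Longrightarrow> gen g \<in> over N" using over_monom[of "[g]" N] by (simp add: monom_single)

lemma over_quantum_det:
  assumes "\<And>r s. 1 \<le> r \<Longrightarrow> r \<le> k \<Longrightarrow> 1 \<le> s \<Longrightarrow> s \<le> k \<Longrightarrow> w r s \<in> over N" shows "quantum_det k w \<in> over N"
  unfolding quantum_det_def
proof (intro over_sum)
  fix \<sigma> assume "\<sigma> \<in> {\<sigma>. \<sigma> permutes {1..k}}"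
  then have p: "\<And>r. r \<in> {1..k} \<Longrightarrow> \<sigma> r \<in> {1..k}" using permutes_in_image[of \<sigma> "{1..k}"] by blast
  have "prod_list (map (\<lambda>r. w r (\<sigma> r)) [1..<k + 1]) \<in> over N"
  proof (rule over_prod_list)
    fix x assume "x \<in> set (map (\<lambda>r. w r (\<sigma> r)) [1..<k + 1])"
    then obtain r where r: "r \<in> set [1..<k + 1]" "x = w r (\<sigma> r)" unfolding set_map by blast
    then have "r \<in> {1..k}" by auto
    then show "x \<in> over N" using p[of r] assms[of r "\<sigma> r"] r(2) by auto
  qed
  then show "of_int (sign \<sigma>) * prod_list (map (\<lambda>r. w r (\<sigma> r)) [1..<k + 1]) \<in> over N" by (simp add: sign_def over_uminus)
qed

lemma over_mat_prod:
  assumes "\<And>M i j. M \<in> set Ms \<Longrightarrow> i \<in> {1..K} \<Longrightarrow> j \<in> {1..K} \<Longrightarrow> M i j \<in> over N" "i \<in> {1..K}" "j \<in> {1..K}"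
  shows "mat_prod K Ms i j \<in> over N"
  using assms
proof (induction Ms arbitrary: i j)
  case Nil then show ?case by (auto simp: mat_prod_def mat_one_def intro: over_one over_zero)
next
  case (Cons M Ms)
  have "mat_prod K (M # Ms) i j = (\<Sum>l=1..K. M i l * mat_prod K Ms l j)" by (simp add: mat_prod_def mat_mult_def)
  moreover have "mat_prod K Ms l j \<in> over N" if "l \<in> {1..K}" for l by (rule Cons.IH) (use Cons.prems that in auto)
  ultimately show ?case using Cons.prems by (auto intro!: over_sum over_mult)
qed

definition nf_ev :: "complex \<Rightarrow> qalg \<Rightarrow> gl_gen multiset \<Rightarrow> complex" where
  "nf_ev q f M = (\<Sum>h\<in>Poly_Mapping.keys f. if exponent h = M then Poly_Mapping.lookup f h * q powi q_power h else 0)"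

lemma nf_ev_add: "nf_ev q (f + g) M = nf_ev q f M + nf_ev q g M"
  unfolding nf_ev_def by (rule sum_keys_add[of "\<lambda>h c. if exponent h = M then c * q powi q_power h else 0"]) (simp_all add: distrib_right)

text \<open>Specializing the formal variable to \<open>q\<close> yields the normal form.\<close>

lemma nf_ev: "nf_ev q (ev x) M = nf q om_gl x M"
proof (induction x rule: poly_single_induct)
  case (single w c) show ?case by (simp add: ev_single nf_single nf_ev_def hword_def)
next
  case (sum f g) show ?case by (simp only: ev_add nf_ev_add nf_add sum)
qed

subsection \<open>The Gauss--Lusztig product in the ring\<close>

lemma A_entry: "A_mat N s i j = of_bool (i = j) + (if j = i + 1 \<and> s \<le> i \<and> i \<le> N - 1 then gen (Ga i s) else 0)"
proof -
  have "(\<Sum>m=s..N - 1. gen (Ga m s) * mat_unit m (m + 1) i j) = (\<Sum>m=s..N - 1. if m = i then (if j = i + 1 then gen (Ga i s) else 0) else 0)"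
    by (intro sum.cong) (auto simp: mat_unit_def)
  then show ?thesis unfolding A_mat_def mat_one_def by (simp add: sum.delta)
qed

lemma B_entry: "B_mat N s i j = of_bool (i = j) + (if i = j + 1 \<and> N - s \<le> j \<and> j \<le> N - 1 then gen (Gb j (j + s - (N - 1))) else 0)"
proof -
  have "(\<Sum>m=N - s..N - 1. gen (Gb m (m + s - (N - 1))) * mat_unit (m + 1) m i j) = (\<Sum>m=N - s..N - 1. if m = j then (if i = j + 1 then gen (Gb j (j + s - (N - 1))) else 0) else 0)"
    by (intro sum.cong) (auto simp: mat_unit_def)
  then show ?thesis unfolding B_mat_def mat_one_def by (simp add: sum.delta)
qed

lemma over_A: "1 \<le> s \<Longrightarrow> A_mat N s i j \<in> over N"
  unfolding A_entry by (auto intro!: over_add over_gen simp: over_zero over_one gl_gens_def)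

lemma over_B: "s < N \<Longrightarrow> B_mat N s i j \<in> over N"
  unfolding B_entry by (auto intro!: over_add over_gen simp: over_zero over_one gl_gens_def)

context torus_embedding begin

interpretation R: q_ring hQ hgen N by (rule q_ring_hgen[OF N2])

fun Dw :: "nat \<Rightarrow> nat \<Rightarrow> gl_gen list list" where
  "Dw 0 i = [Uw i]"
| "Dw (Suc n) i = [Gb (i - 1) (i - Suc n)] # Dw n (i - 1)"

fun Pw :: "nat \<Rightarrow> nat \<Rightarrow> gl_gen list list" where
  "Pw 0 r = [Uw r]"
| "Pw (Suc n) r = Pw n r @ [[Ga (r + n) (Suc n)]]"

lemma ev_monom_Uw: "1 \<le> i \<Longrightarrow> ev (monom (Uw i)) = R.U i * R.V i"
  by (auto simp: Uw_def R.U_def R.V_def monom_append monom_Nil monom_single ev_mult ev_one ev_gen)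

lemma ev_Dw: "n < i \<Longrightarrow> ev (monom (concat (Dw n i))) = R.D n i"
proof (induction n arbitrary: i)
  case (Suc n)
  then have "ev (monom (concat (Dw n (i - 1)))) = R.D n (i - 1)" by simp
  then show ?case using monom_append[of "[Gb (i - 1) (i - Suc n)]"] by (simp add: ev_mult monom_single ev_gen)
qed (simp add: ev_monom_Uw)

lemma ev_Pw: "1 \<le> r \<Longrightarrow> ev (monom (concat (Pw n r))) = R.Pf n r"
  by (induction n) (simp_all add: ev_monom_Uw monom_append ev_mult monom_single ev_gen)

lemma Uw_gauss: "1 \<le> i \<Longrightarrow> i \<le> N \<Longrightarrow> Uw i \<in> gauss_words" by (auto simp: gauss_words_def)

lemma Dw_gauss: "n < i \<Longrightarrow> i \<le> N \<Longrightarrow> set (Dw n i) \<subseteq> gauss_words"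
proof (induction n arbitrary: i)
  case (Suc n)
  then have "set (Dw n (i - 1)) \<subseteq> gauss_words" by simp
  moreover have "[Gb (i - 1) (i - Suc n)] \<in> gauss_words" using Suc.prems unfolding gauss_words_def by auto
  ultimately show ?case by simp
qed (simp add: Uw_gauss)

lemma Pw_gauss: "1 \<le> r \<Longrightarrow> r + n \<le> N \<Longrightarrow> set (Pw n r) \<subseteq> gauss_words"
proof (induction n)
  case (Suc n)
  moreover have "[Ga (r + n) (Suc n)] \<in> gauss_words" using Suc.prems unfolding gauss_words_def by auto
  ultimately show ?case by simp
qed (simp add: Uw_gauss)

lemma over_Z: "i \<in> {1..N} \<Longrightarrow> j \<in> {1..N} \<Longrightarrow> Z_mat N i j \<in> over N"
  unfolding Z_mat_def
proof (rule over_mat_prod)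
  fix M :: "gl_gen free_algebra matrix" and i j
  assume "M \<in> set (map (B_mat N) [1..<N] @ [T_minus N, T_plus] @ map (A_mat N) [1..<N])" and ij: "i \<in> {1..N}" "j \<in> {1..N}"
  then consider s where "M = B_mat N s" "s < N" | "M = T_minus N" | "M = T_plus" | s where "M = A_mat N s" "1 \<le> s" by auto
  then show "M i j \<in> over N"
  proof cases
    case 1 then show ?thesis by (simp add: over_B)
  next
    case 4 then show ?thesis by (simp add: over_A)
  next
    case 2
    then show ?thesis using ij by (auto simp: T_minus_def u_var_def over_one over_zero gl_gens_iff intro!: over_gen)
  next
    case 3
    then show ?thesis using ij by (auto simp: T_plus_def v_var_def over_one over_zero gl_gens_iff intro!: over_gen)
  qed
qed

lemma ev_Z: "ev (Z_mat N i j) = R.W 1 i j"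
proof -
  have b: "(\<lambda>i j. ev (B_mat N s i j)) = R.EB s" for s
    by (intro ext) (simp add: B_entry R.EB_def ev_add ev_one ev_zero ev_gen of_bool_def)
  have a: "(\<lambda>i j. ev (A_mat N s i j)) = R.EA s" for s
    by (intro ext) (simp add: A_entry R.EA_def ev_add ev_one ev_zero ev_gen of_bool_def)
  have tm: "(\<lambda>i j. ev (T_minus N i j)) = R.ETm"
    by (intro ext) (simp add: T_minus_def u_var_def R.ETm_def R.U_def ev_one ev_zero ev_gen)
  have tp: "(\<lambda>i j. ev (T_plus i j)) = R.ETp"
    by (intro ext) (simp add: T_plus_def v_var_def R.ETp_def R.V_def ev_one ev_zero ev_gen)
  have "map (\<lambda>M i j. ev (M i j)) (map (B_mat N) [1..<N] @ [T_minus N, T_plus] @ map (A_mat N) [1..<N]) = map R.EB [1..<N] @ [R.ETm, R.ETp] @ map R.EA [1..<N]"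
    by (simp add: o_def a b tm tp)
  then show ?thesis unfolding Z_mat_def ev_mat_prod R.W_def by (simp only:)
qed


lemma ev_eq_imp:
  assumes "x \<in> over N" "y \<in> over N" "ev x = ev y"
  shows "alg_eq (gl_rels q N) x y"
proof -
  have "x - y \<in> over N" using over_add[OF assms(1) over_uminus[OF assms(2)]] by simp
  moreover have "nf q om_gl (x - y) M = 0" for M
    using nf_ev[of q x M] nf_ev[of q y M] assms(3) by (simp add: nf_diff)
  ultimately have "alg_eq (gl_rels q N) (x - y) 0"
    by (intro quasi_commuting.nf_zero_imp[OF quasi_gl[OF subset_refl]]) (auto simp: over_def)
  then show ?thesis by (simp add: alg_eq_diff_zero[symmetric])
qed

lemma ev_monom_concat: "ev (monom (concat (concat (map f xs)))) = prod_list (map (\<lambda>x. ev (monom (concat (f x)))) xs)"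
  by (induction xs) (simp_all add: monom_Nil monom_append ev_one ev_mult)

lemma gauss_concat_gens: "set ws \<subseteq> gauss_words \<Longrightarrow> set (concat ws) \<subseteq> gl_gens N"
  using gauss_words_gens by fastforce

text \<open>Row expansion is possible as the entries of one row commute; it leaves a triangular matrix.\<close>

theorem cluster_product:
  assumes "i \<in> {1..N}" "j \<in> {1..N}"
  shows "\<exists>ws. set ws \<subseteq> gauss_words \<and> alg_eq (gl_rels q N) (cluster_var N i j) (monom (concat ws))"
proof -
  define k where "k = min i j"
  have k: "1 \<le> k" "k \<le> i" "k \<le> j" using assms by (auto simp: k_def)
  have c: "cluster_var N i j = quantum_det k (\<lambda>r s. Z_mat N (i - k + r) (j - k + s))"
    by (simp add: cluster_var_def Let_def k_def)
  have o: "cluster_var N i j \<in> over N"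
    unfolding c by (rule over_quantum_det, rule over_Z) (use assms k in auto)
  have ev: "ev (cluster_var N i j) = quantum_det k (\<lambda>r s. R.W 1 (i - k + r) (j - k + s))"
    unfolding c ev_quantum_det ev_Z ..
  have "\<exists>ws. set ws \<subseteq> gauss_words \<and> ev (cluster_var N i j) = ev (monom (concat ws))"
  proof (cases "i \<le> j")
    case True
    then have ki: "i - k = 0" "k + (j - k) = j" by (auto simp: k_def)
    let ?ws = "concat (map (Pw (j - k)) [1..<k + 1])"
    have "ev (monom (concat ?ws)) = prod_list (map (R.Pf (j - k)) [1..<k + 1])"
      unfolding ev_monom_concat by (intro arg_cong[where f = prod_list] map_cong refl ev_Pw) auto
    moreover have "quantum_det k (\<lambda>r c. R.W 1 r (j - k + c)) = prod_list (map (R.Pf (j - k)) [1..<k + 1])"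
      by (rule R.det_upper) (use k assms in auto)
    moreover have "set ?ws \<subseteq> gauss_words" using Pw_gauss[of _ "j - k"] k assms by fastforce
    ultimately show ?thesis unfolding ev ki(1) add_0 by (intro exI[of _ ?ws]) simp
  next
    case False
    then have kj: "j - k = 0" by (auto simp: k_def)
    let ?ws = "concat (map (\<lambda>r. Dw (i - k) (i - k + r)) [1..<k + 1])"
    have "ev (monom (concat ?ws)) = prod_list (map (\<lambda>r. R.D (i - k) (i - k + r)) [1..<k + 1])"
      unfolding ev_monom_concat by (intro arg_cong[where f = prod_list] map_cong refl ev_Dw) auto
    moreover have "quantum_det k (\<lambda>r c. R.W 1 (i - k + r) c) = prod_list (map (\<lambda>r. R.D (i - k) (i - k + r)) [1..<k + 1])"
      by (rule R.det_lower) (use k assms in auto)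
    moreover have "set ?ws \<subseteq> gauss_words"
    proof
      fix w assume "w \<in> set ?ws"
      then obtain r where r: "r \<in> set [1..<k + 1]" "w \<in> set (Dw (i - k) (i - k + r))" by (auto simp del: upt_Suc)
      then have "1 \<le> r" "r \<le> k" by auto
      then have "set (Dw (i - k) (i - k + r)) \<subseteq> gauss_words" using k assms by (intro Dw_gauss) auto
      then show "w \<in> gauss_words" using r(2) by blast
    qed
    ultimately show ?thesis unfolding ev kj add_0 by (intro exI[of _ ?ws]) simp
  qed
  then obtain ws where ws: "set ws \<subseteq> gauss_words" "ev (cluster_var N i j) = ev (monom (concat ws))" by blast
  have "alg_eq (gl_rels q N) (cluster_var N i j) (monom (concat ws))"
    by (rule ev_eq_imp[OF o over_monom[OF gauss_concat_gens[OF ws(1)]] ws(2)])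
  then show ?thesis using ws(1) by blast
qed

lemma cross_gl_skew: "cross om_gl a c = - cross om_gl c a"
proof (induction a)
  case (Cons x a)
  have "(\<Sum>y\<leftarrow>c. om_gl y x) = - (\<Sum>y\<leftarrow>c. om_gl x y)" by (induction c) (use om_gl_skew[of _ x] in simp_all)
  then show ?case using Cons by (simp add: cross_simps)
qed (simp add: cross_simps)

theorem cluster_quasi_commute:
  assumes "i \<in> {1..N}" "j \<in> {1..N}" "i' \<in> {1..N}" "j' \<in> {1..N}"
  shows "\<exists>k::int. alg_eq (gl_rels q N) (cluster_var N i j * cluster_var N i' j')
           (const (q powi (2 * k)) * cluster_var N i' j' * cluster_var N i j)"
proof -
  let ?R = "gl_rels q N"
  obtain vs where vs: "set vs \<subseteq> gauss_words" "alg_eq ?R (cluster_var N i j) (monom (concat vs))" using cluster_product assms by blast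
  obtain ws where ws: "set ws \<subseteq> gauss_words" "alg_eq ?R (cluster_var N i' j') (monom (concat ws))" using cluster_product assms by blast
  define v w where "v = concat vs" and "w = concat ws"
  have s: "set (v @ w) \<subseteq> gl_gens N" using gauss_concat_gens[OF vs(1)] gauss_concat_gens[OF ws(1)] by (simp add: v_def w_def)
  let ?k = "cross om_gl v w"
  have "alg_eq ?R (cluster_var N i j * cluster_var N i' j') (monom v * monom w)"
    unfolding v_def w_def by (intro alg_eq_mult vs ws)
  also have "monom v * monom w = monom (v @ w)" by (simp add: monom_append)
  also have "alg_eq ?R \<dots> (const (q powi (ph om_gl (v @ w) - ph om_gl (w @ v))) * monom (w @ v))"
    by (rule quasi_commuting.word_reorder[OF quasi_gl[OF subset_refl] s]) (simp add: add.commute)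
  also have "ph om_gl (v @ w) - ph om_gl (w @ v) = 2 * ?k" using cross_gl_skew[of w v] by (simp add: ph_append)
  also have "const (q powi (2 * ?k)) * monom (w @ v) = const (q powi (2 * ?k)) * (monom w * monom v)" by (simp add: monom_append)
  also have "alg_eq ?R \<dots> (const (q powi (2 * ?k)) * (cluster_var N i' j' * cluster_var N i j))"
    unfolding v_def w_def by (intro alg_eq_scale alg_eq_mult alg_eq_sym[OF vs(2)] alg_eq_sym[OF ws(2)])
  finally show ?thesis unfolding mult.assoc by blast
qed

end

section \<open>The theorem\<close>

theorem theorem1p2:
  fixes b :: real and q :: complex and N :: nat
  assumes "0 < b" and "b < 1" and "b\<^sup>2 \<notin> \<rat>"
    and "q = exp (complex_of_real pi * \<i> * complex_of_real (b\<^sup>2))"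
    and "N \<ge> 2"
    and "CARD('n::finite) = N\<^sup>2 div 2"
  shows
    "((\<forall>x :: 'n torus_gen. positive_selfadjoint (torus_op b x)) \<and>
      (\<forall>i :: 'n. q_exchange q 2 (torus_op b (Tu i)) (torus_op b (Tv i))) \<and>
      (\<forall>i j :: 'n. i \<noteq> j \<longrightarrow>
         (\<forall>x\<in>{Tu i, Tv i}. \<forall>y\<in>{Tu j, Tv j}. q_exchange q 0 (torus_op b x) (torus_op b y))) \<and>
      (\<exists>\<phi> :: gl_gen \<Rightarrow> 'n torus_gen free_algebra.
         (\<forall>(l, r)\<in>gl_rels q N. alg_eq (torus_rels q) (lift \<phi> l) (lift \<phi> r)) \<and>
         (even N \<longrightarrow>
            (\<forall>x\<in>generated_subalgebra (gauss_vars N). \<forall>y\<in>generated_subalgebra (gauss_vars N).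
               alg_eq (torus_rels q) (lift \<phi> x) (lift \<phi> y) \<longleftrightarrow> alg_eq (gl_rels q N) x y)) \<and>
         (odd N \<longrightarrow>
            (\<exists>ms ns c. set ms \<subseteq> gauss_vars N \<and> set ns \<subseteq> gauss_vars N \<and> c \<noteq> 0 \<and>
               (\<forall>g\<in>gauss_vars N. \<exists>k::int.
                  alg_eq (gl_rels q N) (prod_list ms * g) (const (q powi (2 * k)) * g * prod_list ms) \<and>
                  alg_eq (gl_rels q N) (prod_list ns * g) (const (q powi (2 * k)) * g * prod_list ns)) \<and>
               (\<forall>x\<in>generated_subalgebra (gauss_vars N). \<forall>y\<in>generated_subalgebra (gauss_vars N).
                  alg_eq (torus_rels q) (lift \<phi> x) (lift \<phi> y) \<longleftrightarrow>
                  alg_eq (insert (prod_list ms, const c * prod_list ns) (gl_rels q N)) x y))) \<and>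
         (\<forall>g\<in>gl_gens N. positive_selfadjoint (realized b (\<phi> g))) \<and>
         (\<forall>g\<in>gl_gens N. \<forall>h\<in>gl_gens N.
            (q2_rel g h \<longrightarrow> q_exchange q 2 (realized b (\<phi> g)) (realized b (\<phi> h))) \<and>
            (\<not> q2_rel g h \<and> \<not> q2_rel h g \<longrightarrow>
               q_exchange q 0 (realized b (\<phi> g)) (realized b (\<phi> h)))))) \<and>
     ((\<forall>i\<in>{1..N}. \<forall>j\<in>{1..N}. \<exists>ws. set ws \<subseteq> gauss_vars N \<and>
         alg_eq (gl_rels q N) (cluster_var N i j) (prod_list ws)) \<and>
      (\<forall>i\<in>{1..N}. \<forall>j\<in>{1..N}. \<forall>i'\<in>{1..N}. \<forall>j'\<in>{1..N}. \<exists>k::int.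
         alg_eq (gl_rels q N) (cluster_var N i j * cluster_var N i' j')
           (const (q powi (2 * k)) * cluster_var N i' j' * cluster_var N i j)))"
proof -
  obtain us :: "'n list" where us: "set us = UNIV" "distinct us" using finite_distinct_list[of "UNIV :: 'n set"] by auto
  have "card (UNIV :: 'n set) = card (planes N)" using assms(6) by (simp add: card_planes)
  then obtain \<iota> :: "'n \<Rightarrow> plane" where \<iota>: "bij_betw \<iota> UNIV (planes N)"
    using finite_same_card_bij[of "UNIV :: 'n set" "planes N"] finite_planes by auto
  have q0: "q \<noteq> 0" by (simp add: assms(4))
  interpret E: torus_embedding \<iota> us N q by unfold_locales (use us \<iota> q0 assms(5) in simp_all)
  have products: "\<forall>i\<in>{1..N}. \<forall>j\<in>{1..N}. \<exists>ws. set ws \<subseteq> gauss_vars N \<and> alg_eq (gl_rels q N) (cluster_var N i j) (prod_list ws)"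
  proof (intro ballI)
    fix i j assume "i \<in> {1..N}" "j \<in> {1..N}"
    then obtain ws where ws: "set ws \<subseteq> E.gauss_words" "alg_eq (gl_rels q N) (cluster_var N i j) (monom (concat ws))"
      using E.cluster_product by blast
    have "set (map monom ws) \<subseteq> gauss_vars N" using ws(1) unfolding E.gauss_vars_monom by auto
    moreover have "alg_eq (gl_rels q N) (cluster_var N i j) (prod_list (map monom ws))" unfolding E.prod_list_monom by (rule ws(2))
    ultimately show "\<exists>ws. set ws \<subseteq> gauss_vars N \<and> alg_eq (gl_rels q N) (cluster_var N i j) (prod_list ws)" by blast
  qed
  have commute: "\<forall>i\<in>{1..N}. \<forall>j\<in>{1..N}. \<forall>i'\<in>{1..N}. \<forall>j'\<in>{1..N}. \<exists>k::int.
         alg_eq (gl_rels q N) (cluster_var N i j * cluster_var N i' j')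
           (const (q powi (2 * k)) * cluster_var N i' j' * cluster_var N i j)"
    by (intro ballI E.cluster_quasi_commute)
  show ?thesis
    by (rule conjI[OF embedding_part[OF assms(1,2,4,5,6)] conjI[OF products commute]])
qed

end
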